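(* Let $G$ be a non-elementary word-hyperbolic group with finite symmetric generating set $S$, let $L\subset S^*$ be a combing of $G$ with respect to $S$, and let $\phi:G\to\mathbb{Z}$ be bicombable with respect to $S,L$. Let $\Gamma$ be a digraph parameterizing $L$ together with a function $d\phi$ from the vertices of $\Gamma$ to $\mathbb{Z}$ such that $\phi(\overline{w})=\sum_{i=0}^{|w|}d\phi(\gamma(i))$ for all $w\in L$, where $\gamma$ is the path in $\Gamma$ corresponding to $w$. Let $\overline{\phi}_n$ be the value of $\phi$ on a random element of $G_n=\{g\in G:|g|=n\}$ chosen with respect to the measure $\widehat{\nu}$ on $G_n$ (normalized to be a probability measure). Let $E$ be the mean of $d\phi$ on the vertices of $\Gamma$ with respect to the stationary probability measure $\mu$. Then there is some $\sigma\ge 0$ such that, in the sense of distribution, $$n^{-1/2}(\overline{\phi}_n-nE)\to N(0,\sigma)\quad\text{as } n\to\infty .$$ In particular, $E$ and $\sigma$ are algebraic numbers.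
   Context: $S$ generates $G$ as a semigroup; $|g|$ denotes word length with respect to $S$. A word-hyperbolic group is elementary if it contains a finite index cyclic subgroup. $N(0,\sigma)$ is the normal distribution with mean $0$ and standard deviation $\sigma$ (the Dirac measure at $0$ if $\sigma=0$). Combings. $S^*$ is the set of finite words in $S$; for $w\in S^*$, $|w|$ is its length and $\overline{w}\in G$ its evaluation. A finite digraph $\Gamma$ (finite directed graph, multiple edges allowed) with initial vertex $v_1$, whose edges are labeled by letters of $S$ with at most one outgoing edge with any given label at each vertex, parameterizes a prefix-closed language $L\subset S^*$ if $L$ is exactly the set of words read along directed paths starting at $v_1$; a prefix-closed language is regular iff it is parameterized by some such $\Gamma$. A combing of $G$ with respect to $S$ is a prefix-closed regular language $L\subset S^*$ such that evaluation $L\to G$ is a bijection and every $w\in L$ is geodesic ($|w|=|\overline{w}|$). For a path $\gamma$ in $\Gamma$ starting at $v_1$, $\gamma(i)$ is the vertex reached after $i$ edges ($\gamma(0)=v_1$). Every vertex of $\Gamma$ is assumed accessible from $v_1$, and $v_1$ has no incoming edges. Bicombable. $\phi:G\to\mathbb{Z}$ is weakly combable with respect to $S,L$ if there are a digraph $\Gamma$ parameterizing $L$ and a function $d\phi$ from its vertices to $\mathbb{Z}$ with $\phi(\overline{w})=\sum_{i=0}^{|w|}d\phi(\gamma(i))$ for all $w\in L$, $\gamma$ the corresponding path. It is bicombable if moreover there is $C$ with $|\phi(as)-\phi(a)|\le C$ and $|\phi(sa)-\phi(a)|\le C$ for all $a\in G$, $s\in S$. The measure $\widehat{\nu}$. There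 are $\lambda>1$, $K\ge1$ with $K^{-1}\lambda^n\le|G_n|\le K\lambda^n$ for all $n\geq 1$ (Coornaert). Let $\widehat{\nu}_m=\frac1m\sum_{|g|\le m}\lambda^{-|g|}\delta_g$. For $g\in G$, $\mathrm{cone}(g)$ is the set of $g'\in G$ such that the word of $L$ representing $g'$ has the word of $L$ representing $g$ as a prefix. The measure $\widehat{\nu}$ on $G_n$ is given by $\widehat{\nu}(\{g\})=\lim_{m\to\infty}\widehat{\nu}_m(\mathrm{cone}(g))$ for $g\in G_n$ (the limit exists). The measure $\mu$. Let $V$ be the real vector space with orthonormal basis the vertices $v_1,v_2,\dots$ of $\Gamma$, let $M$ be the matrix with $M_{ij}$ the number of directed edges from $v_i$ to $v_j$, and let $\mathbf{1}\in V$ be the constant function $1$. Put $\rho(v)=\lim_{n}n^{-1}\sum_{i=0}^n\lambda^{-i}M^iv$ and $\ell(v)=\lim_n n^{-1}\sum_{i=0}^n\lambda^{-i}(M^T)^iv$ (these limits exist). The stationary measure $\mu$ on the vertices of $\Gamma$ is $\mu_i=\rho(\mathbf{1})_i\,\ell(v_1)_i$, rescaled to be a probability measure. *)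

theory Defs
  imports
    "HOL-Probability.Probability"
    "HOL-Algebra.Elementary_Groups"
    "HOL-Computational_Algebra.Polynomial"
    "HOL-Library.Sublist"
    "Graph_Theory.Graph_Theory"
begin

section \<open>Words and word length\<close>

definition word_eval :: "('a, 'm) monoid_scheme \<Rightarrow> 'a list \<Rightarrow> 'a" where
  "word_eval G w = foldr (\<lambda>s g. s \<otimes>\<^bsub>G\<^esub> g) w \<one>\<^bsub>G\<^esub>"

definition finite_symmetric_generating_set :: "('a, 'm) monoid_scheme \<Rightarrow> 'a set \<Rightarrow> bool" where
  "finite_symmetric_generating_set G S \<longleftrightarrow>
     S \<subseteq> carrier G \<and> finite S \<and> (\<forall>s\<in>S. inv\<^bsub>G\<^esub> s \<in> S) \<and>
     word_eval G ` lists S = carrier G"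

definition word_length :: "('a, 'm) monoid_scheme \<Rightarrow> 'a set \<Rightarrow> 'a \<Rightarrow> nat" where
  "word_length G S g = (LEAST n. \<exists>w\<in>lists S. length w = n \<and> word_eval G w = g)"

definition word_sphere :: "('a, 'm) monoid_scheme \<Rightarrow> 'a set \<Rightarrow> nat \<Rightarrow> 'a set" where
  "word_sphere G S n = {g \<in> carrier G. word_length G S g = n}"

definition word_ball :: "('a, 'm) monoid_scheme \<Rightarrow> 'a set \<Rightarrow> nat \<Rightarrow> 'a set" where
  "word_ball G S n = {g \<in> carrier G. word_length G S g \<le> n}"

section \<open>Word-hyperbolic and elementary groups\<close>

definition word_dist :: "('a, 'm) monoid_scheme \<Rightarrow> 'a set \<Rightarrow> 'a \<Rightarrow> 'a \<Rightarrow> real" where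
  "word_dist G S g h = real (word_length G S (inv\<^bsub>G\<^esub> g \<otimes>\<^bsub>G\<^esub> h))"

definition gromov_product :: "('a, 'm) monoid_scheme \<Rightarrow> 'a set \<Rightarrow> 'a \<Rightarrow> 'a \<Rightarrow> 'a \<Rightarrow> real" where
  "gromov_product G S p x y =
     (word_dist G S x p + word_dist G S y p - word_dist G S x y) / 2"

text \<open>Gromov's definition: for some finite generating set, the word metric is
  \<open>\<delta>\<close>-hyperbolic for some \<open>\<delta>\<close>.\<close>

definition word_hyperbolic :: "('a, 'm) monoid_scheme \<Rightarrow> bool" where
  "word_hyperbolic G \<longleftrightarrow>
     (\<exists>S. finite_symmetric_generating_set G S \<and>
       (\<exists>\<delta>\<ge>0. \<forall>p\<in>carrier G. \<forall>x\<in>carrier G. \<forall>y\<in>carrier G. \<forall>z\<in>carrier G.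
          gromov_product G S p x z
            \<ge> min (gromov_product G S p x y) (gromov_product G S p y z) - \<delta>))"

definition elementary_group :: "('a, 'm) monoid_scheme \<Rightarrow> bool" where
  "elementary_group G \<longleftrightarrow>
     (\<exists>H. subgroup H G \<and> cyclic_group (G\<lparr>carrier := H\<rparr>) \<and> finite (rcosets\<^bsub>G\<^esub> H))"

section \<open>Digraphs parameterizing languages, and combings\<close>

text \<open>The arcs of \<open>\<Gamma>\<close> are labelled by \<open>lab\<close>; a directed path from \<open>v1\<close> is an
  \<open>awalk\<close>, given by its list of arcs.\<close>

definition parameterizes ::
  "('v, 'e) pre_digraph \<Rightarrow> 'v \<Rightarrow> ('e \<Rightarrow> 'a) \<Rightarrow> 'a set \<Rightarrow> 'a list set \<Rightarrow> bool" where
  "parameterizes \<Gamma> v1 lab S L \<longleftrightarrow>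
     fin_digraph \<Gamma> \<and> v1 \<in> verts \<Gamma> \<and> lab ` arcs \<Gamma> \<subseteq> S \<and>
     (\<forall>e\<in>arcs \<Gamma>. \<forall>e'\<in>arcs \<Gamma>. tail \<Gamma> e = tail \<Gamma> e' \<and> lab e = lab e' \<longrightarrow> e = e') \<and>
     L = {map lab p | p v. pre_digraph.awalk \<Gamma> v1 p v}"

definition initial_accessible :: "('v, 'e) pre_digraph \<Rightarrow> 'v \<Rightarrow> bool" where
  "initial_accessible \<Gamma> v1 \<longleftrightarrow> (\<forall>v\<in>verts \<Gamma>. v1 \<rightarrow>\<^sup>*\<^bsub>\<Gamma>\<^esub> v) \<and> in_arcs \<Gamma> v1 = {}"

definition prefix_closed :: "'a list set \<Rightarrow> bool" where
  "prefix_closed L \<longleftrightarrow> (\<forall>w\<in>L. \<forall>u. prefix u w \<longrightarrow> u \<in> L)"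

text \<open>Definitions that assert the existence of a finite digraph take its vertices and arcs
  to be natural numbers, which is no restriction up to isomorphism.\<close>

definition regular_language :: "'a set \<Rightarrow> 'a list set \<Rightarrow> bool" where
  "regular_language S L \<longleftrightarrow>
     (\<exists>(\<Gamma> :: (nat, nat) pre_digraph) v1 lab. parameterizes \<Gamma> v1 lab S L)"

definition combing :: "('a, 'm) monoid_scheme \<Rightarrow> 'a set \<Rightarrow> 'a list set \<Rightarrow> bool" where
  "combing G S L \<longleftrightarrow>
     L \<subseteq> lists S \<and> prefix_closed L \<and> regular_language S L \<and>
     bij_betw (word_eval G) L (carrier G) \<and>
     (\<forall>w\<in>L. length w = word_length G S (word_eval G w))"

section \<open>Combable functions\<close>

definition combs_function ::
  "('a, 'm) monoid_scheme \<Rightarrow> ('v, 'e) pre_digraph \<Rightarrow> 'v \<Rightarrow> ('e \<Rightarrow> 'a) \<Rightarrow> 'a list set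
     \<Rightarrow> ('a \<Rightarrow> int) \<Rightarrow> ('v \<Rightarrow> int) \<Rightarrow> bool" where
  "combs_function G \<Gamma> v1 lab L \<phi> d\<phi> \<longleftrightarrow>
     (\<forall>w\<in>L. \<forall>p v. pre_digraph.awalk \<Gamma> v1 p v \<and> map lab p = w \<longrightarrow>
        \<phi> (word_eval G w) = (\<Sum>i=0..length w. d\<phi> (pre_digraph.awalk_verts \<Gamma> v1 p ! i)))"

definition weakly_combable ::
  "('a, 'm) monoid_scheme \<Rightarrow> 'a set \<Rightarrow> 'a list set \<Rightarrow> ('a \<Rightarrow> int) \<Rightarrow> bool" where
  "weakly_combable G S L \<phi> \<longleftrightarrow>
     (\<exists>(\<Gamma> :: (nat, nat) pre_digraph) v1 lab d\<phi>.
        parameterizes \<Gamma> v1 lab S L \<and> combs_function G \<Gamma> v1 lab L \<phi> d\<phi>)"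

definition bicombable ::
  "('a, 'm) monoid_scheme \<Rightarrow> 'a set \<Rightarrow> 'a list set \<Rightarrow> ('a \<Rightarrow> int) \<Rightarrow> bool" where
  "bicombable G S L \<phi> \<longleftrightarrow>
     weakly_combable G S L \<phi> \<and>
     (\<exists>C. \<forall>a\<in>carrier G. \<forall>s\<in>S.
        \<bar>\<phi> (a \<otimes>\<^bsub>G\<^esub> s) - \<phi> a\<bar> \<le> C \<and> \<bar>\<phi> (s \<otimes>\<^bsub>G\<^esub> a) - \<phi> a\<bar> \<le> C)"

section \<open>The growth rate and the measure on spheres\<close>

text \<open>The constant \<open>\<lambda>\<close> of Coornaert's theorem; the two-sided bound determines it uniquely,
  and it exists for every non-elementary word-hyperbolic group.\<close>

definition growth_rate :: "('a, 'm) monoid_scheme \<Rightarrow> 'a set \<Rightarrow> real" where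
  "growth_rate G S =
     (THE l. l > 1 \<and> (\<exists>K\<ge>1. \<forall>n\<ge>1.
        inverse K * l ^ n \<le> real (card (word_sphere G S n)) \<and>
        real (card (word_sphere G S n)) \<le> K * l ^ n))"

definition word_cone :: "('a, 'm) monoid_scheme \<Rightarrow> 'a list set \<Rightarrow> 'a \<Rightarrow> 'a set" where
  "word_cone G L g =
     {g' \<in> carrier G. \<exists>w\<in>L. \<exists>w'\<in>L. word_eval G w = g \<and> word_eval G w' = g' \<and> prefix w w'}"

text \<open>\<open>nu_approx G S m A\<close> is the mass of \<open>A\<close> under
  \<open>1/m \<Sum>\<^bsub>|g| \<le> m\<^esub> \<lambda>\<^bsup>-|g|\<^esup> \<delta>\<^sub>g\<close>.\<close>

definition nu_approx :: "('a, 'm) monoid_scheme \<Rightarrow> 'a set \<Rightarrow> nat \<Rightarrow> 'a set \<Rightarrow> real" where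
  "nu_approx G S m A =
     (1 / real m) * (\<Sum>g\<in>A \<inter> word_ball G S m. 1 / growth_rate G S ^ word_length G S g)"

definition nu_hat :: "('a, 'm) monoid_scheme \<Rightarrow> 'a set \<Rightarrow> 'a list set \<Rightarrow> nat \<Rightarrow> 'a measure" where
  "nu_hat G S L n =
     point_measure (word_sphere G S n)
       (\<lambda>g. ennreal (lim (\<lambda>m. nu_approx G S m (word_cone G L g))))"

text \<open>Conditioning on the whole space rescales \<open>nu_hat\<close> to a probability measure.\<close>

definition nu_hat_prob :: "('a, 'm) monoid_scheme \<Rightarrow> 'a set \<Rightarrow> 'a list set \<Rightarrow> nat \<Rightarrow> 'a measure" where
  "nu_hat_prob G S L n = uniform_measure (nu_hat G S L n) (word_sphere G S n)"

section \<open>The stationary measure on the vertices\<close>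

text \<open>Vectors of \<open>V\<close> are functions on vertices, only their values on \<open>verts \<Gamma>\<close> being
  relevant; limits in \<open>V\<close> are taken coordinatewise.\<close>

definition adj_matrix :: "('v, 'e) pre_digraph \<Rightarrow> 'v \<Rightarrow> 'v \<Rightarrow> real" where
  "adj_matrix \<Gamma> u v = real (card {e \<in> arcs \<Gamma>. tail \<Gamma> e = u \<and> head \<Gamma> e = v})"

definition adj_apply :: "('v, 'e) pre_digraph \<Rightarrow> ('v \<Rightarrow> real) \<Rightarrow> 'v \<Rightarrow> real" where
  "adj_apply \<Gamma> x = (\<lambda>u. \<Sum>v\<in>verts \<Gamma>. adj_matrix \<Gamma> u v * x v)"

definition adj_transpose_apply :: "('v, 'e) pre_digraph \<Rightarrow> ('v \<Rightarrow> real) \<Rightarrow> 'v \<Rightarrow> real" where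
  "adj_transpose_apply \<Gamma> x = (\<lambda>u. \<Sum>v\<in>verts \<Gamma>. adj_matrix \<Gamma> v u * x v)"

definition cesaro_limit :: "real \<Rightarrow> (('v \<Rightarrow> real) \<Rightarrow> 'v \<Rightarrow> real) \<Rightarrow> ('v \<Rightarrow> real) \<Rightarrow> 'v \<Rightarrow> real" where
  "cesaro_limit l T x = (\<lambda>u. lim (\<lambda>n. (1 / real n) * (\<Sum>i=0..n. (1 / l ^ i) * (T ^^ i) x u)))"

definition stationary_weight :: "real \<Rightarrow> ('v, 'e) pre_digraph \<Rightarrow> 'v \<Rightarrow> 'v \<Rightarrow> real" where
  "stationary_weight l \<Gamma> v1 u =
     cesaro_limit l (adj_apply \<Gamma>) (\<lambda>_. 1) u *
     cesaro_limit l (adj_transpose_apply \<Gamma>) (\<lambda>v. if v = v1 then 1 else 0) u"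

definition stationary_measure :: "real \<Rightarrow> ('v, 'e) pre_digraph \<Rightarrow> 'v \<Rightarrow> 'v \<Rightarrow> real" where
  "stationary_measure l \<Gamma> v1 u =
     stationary_weight l \<Gamma> v1 u / (\<Sum>v\<in>verts \<Gamma>. stationary_weight l \<Gamma> v1 v)"

definition stationary_mean :: "real \<Rightarrow> ('v, 'e) pre_digraph \<Rightarrow> 'v \<Rightarrow> ('v \<Rightarrow> int) \<Rightarrow> real" where
  "stationary_mean l \<Gamma> v1 f = (\<Sum>v\<in>verts \<Gamma>. real_of_int (f v) * stationary_measure l \<Gamma> v1 v)"

section \<open>The normal distribution\<close>

definition centered_normal :: "real \<Rightarrow> real measure" where
  "centered_normal \<sigma> =
     (if \<sigma> = 0 then return borel 0 else density lborel (\<lambda>x. ennreal (normal_density 0 \<sigma> x)))"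

end

theory Submission
  imports Defs "HOL-Real_Asymp.Real_Asymp"
begin

text \<open>In a non-elementary hyperbolic group any two elements can be joined by a short one so that lengths are
  almost additive; this makes the sphere sizes both sub- and supermultiplicative up to constants and gives purely
  exponential growth with rate \<open>\<lambda>\<close>. Consequently the powers of \<open>\<lambda>\<^sup>-\<^sup>1 M\<close> are bounded, and by the mean
  ergodic theorem the \<open>\<nu>\<close>-hat mass of a cone is \<open>\<lambda>\<^sup>-\<^sup>n h(v)\<close>, where \<open>h\<close> is the projection of the constant function to the
  \<open>\<lambda>\<close>-eigenspace and \<open>v\<close> the end of the path. Hence \<open>\<nu>\<close>-hat, normalized on spheres, is the law of a Markov chain with transition
  probabilities \<open>M i j h(j) / (\<lambda> h(i))\<close>, and \<open>\<phi>\<close> is an additive functional of it.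

  If the Poisson equations for drift and variance are solvable with the same constants \<open>E\<close> and \<open>\<sigma>\<^sup>2\<close> on the
  whole state space, then an explicit perturbed eigenvector shows that the characteristic functions converge to
  the Gaussian one. The chain may have several recurrent classes, so one has to see that drift and variance
  agree on all of them. Walks staying in a recurrent class evaluate to a subset of positive density of \<open>G\<close>, and
  any two such subsets overlap, after a translation, within bounded distance at every large scale. Bicombability
  makes the increments of \<open>\<phi>\<close> along fellow travelling walks differ by a bounded amount, so the averages of any
  fixed observable over windows of length \<open>n\<close> agree in the limit; by the law of large numbers the drifts and the
  variances coincide. This replaces the ergodicity of the action on the boundary.

  The growth rate is an eigenvalue of an integer matrix; the transition probabilities and the solutions of the
  Poisson equations solve linear systems with algebraic coefficients, whence the algebraicity.\<close>


section \<open>Invariance of hyperbolicity under change of word metric\<close>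

text \<open>Hyperbolicity is given for some generating set while everything else refers to
  \<open>S\<close>; stability of quasi-geodesics moves it over. Short connecting elements exist
  because otherwise the functions \<open>len (a \<otimes> y) - len y\<close>, for a sequence of
  witnesses \<open>y\<close>, cluster at an integer quasimorphism with finite fibres, and such a
  function makes the group virtually cyclic. The obstacle in the comparison of recurrent classes is
  that overlapping walks stay at a bounded but unspecified distance, so \<open>\<phi>\<close> is
  known on windows only up to a constant. This constant does not depend on the window length
  \<open>n\<close>. Observables with Lipschitz constant \<open>1 / n\<close> (the clipped average)
  and \<open>1 / sqrt n\<close> (a cosine of the normalized sum) therefore erase it as
  \<open>n\<close> grows; the former sees the drift, the latter the variance. Transient vertices are
  then covered by the maximum principle. Algebraicity is read off from a single recurrent class,
  where linear equations determine \<open>h\<close> up to one factor that cancels in the transition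
  probabilities.\<close>

locale int_geodesic_space =
  fixes X :: "'a set" and d :: "'a \<Rightarrow> 'a \<Rightarrow> int"
  assumes d_nonneg: "x \<in> X \<Longrightarrow> y \<in> X \<Longrightarrow> 0 \<le> d x y"
    and d_self: "x \<in> X \<Longrightarrow> d x x = 0"
    and d_eq_0: "x \<in> X \<Longrightarrow> y \<in> X \<Longrightarrow> d x y = 0 \<Longrightarrow> x = y"
    and d_sym: "x \<in> X \<Longrightarrow> y \<in> X \<Longrightarrow> d x y = d y x"
    and d_tri: "x \<in> X \<Longrightarrow> y \<in> X \<Longrightarrow> z \<in> X \<Longrightarrow> d x z \<le> d x y + d y z"
    and d_between: "x \<in> X \<Longrightarrow> y \<in> X \<Longrightarrow> 0 \<le> n \<Longrightarrow> n \<le> d x y \<Longrightarrow>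
      \<exists>z\<in>X. d x z = n \<and> d z y = d x y - n"
begin

text \<open>Twice the Gromov product, which keeps everything in the integers.\<close>

definition gp :: "'a \<Rightarrow> 'a \<Rightarrow> 'a \<Rightarrow> int" where
  "gp p x y = d x p + d y p - d x y"

text \<open>Because \<open>gp\<close> is doubled, \<open>D\<close> corresponds to twice the usual
  hyperbolicity constant.\<close>

definition hyperbolic :: "int \<Rightarrow> bool" where
  "hyperbolic D \<longleftrightarrow> (\<forall>p\<in>X. \<forall>x\<in>X. \<forall>y\<in>X. \<forall>z\<in>X. min (gp p x y) (gp p y z) - D \<le> gp p x z)"

lemma hyperbolicD:
  assumes "hyperbolic D" "p \<in> X" "x \<in> X" "y \<in> X" "z \<in> X"
  shows "min (gp p x y) (gp p y z) - D \<le> gp p x z"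
  using assms unfolding hyperbolic_def by blast

lemma geodesic_path:
  assumes "x \<in> X" "y \<in> X" "d x y = int n"
  shows "\<exists>\<gamma>. \<gamma> 0 = x \<and> \<gamma> n = y \<and> (\<forall>i\<le>n. \<gamma> i \<in> X) \<and>
    (\<forall>i\<le>n. \<forall>j\<le>n. d (\<gamma> i) (\<gamma> j) = \<bar>int i - int j\<bar>)"
  using assms
proof (induction n arbitrary: y)
  case 0
  then show ?case
    using d_self[of x] d_eq_0[of x y] by (intro exI[of _ "\<lambda>_. x"]) auto
next
  case (Suc n)
  obtain z where z: "z \<in> X" "d x z = int n" "d z y = 1"
    using d_between[of x y "int n"] Suc.prems by auto
  obtain \<gamma> where \<gamma>: "\<gamma> 0 = x" "\<gamma> n = z" "\<forall>i\<le>n. \<gamma> i \<in> X"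
      "\<forall>i\<le>n. \<forall>j\<le>n. d (\<gamma> i) (\<gamma> j) = \<bar>int i - int j\<bar>"
    using Suc.IH[OF Suc.prems(1) z(1,2)] by blast
  define \<beta> where "\<beta> = \<gamma>(Suc n := y)"
  have last: "d (\<gamma> i) y = int (Suc n) - int i" if "i \<le> n" for i
  proof -
    have "d (\<gamma> i) y \<le> d (\<gamma> i) z + d z y" using that \<gamma>(3) z Suc.prems by (intro d_tri) auto
    moreover have "d (\<gamma> i) z = int n - int i" using \<gamma>(2,4) that by auto
    moreover have "d x y \<le> d x (\<gamma> i) + d (\<gamma> i) y" using that \<gamma>(3) Suc.prems by (intro d_tri) auto
    moreover have "d x (\<gamma> i) = int i" using \<gamma>(1,4) that by force
    ultimately show ?thesis using Suc.prems z by auto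
  qed
  have "\<forall>i\<le>Suc n. \<forall>j\<le>Suc n. d (\<beta> i) (\<beta> j) = \<bar>int i - int j\<bar>"
  proof (intro allI impI)
    fix i j assume ij: "i \<le> Suc n" "j \<le> Suc n"
    consider "i \<le> n" "j \<le> n" | "i \<le> n" "j = Suc n" | "i = Suc n" "j \<le> n" | "i = Suc n" "j = Suc n"
      using ij by force
    then show "d (\<beta> i) (\<beta> j) = \<bar>int i - int j\<bar>"
    proof cases
      case 3
      then have "d (\<beta> i) (\<beta> j) = d (\<gamma> j) y"
        using d_sym[of "\<gamma> j" y] \<gamma>(3) Suc.prems by (auto simp: \<beta>_def)
      then show ?thesis using 3 last by auto
    qed (use \<gamma> last Suc.prems d_self in \<open>auto simp: \<beta>_def\<close>)
  qed
  then show ?case using \<gamma> Suc.prems by (intro exI[of _ \<beta>]) (auto simp: \<beta>_def le_Suc_eq)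
qed

text \<open>Iterating the four-point condition along a dyadic subdivision loses only a logarithmic
  amount, which is why a path avoiding a ball around a geodesic point is exponentially long.\<close>

lemma gp_chain:
  assumes H: "hyperbolic D" and p: "p \<in> X"
    and "\<And>i. i \<in> {a..b} \<Longrightarrow> \<gamma> i \<in> X"
    and "\<And>i. i \<in> {a..<b} \<Longrightarrow> m \<le> gp p (\<gamma> i) (\<gamma> (Suc i))"
    and "a < b" "b - a \<le> 2 ^ k"
  shows "m - int k * D \<le> gp p (\<gamma> a) (\<gamma> b)"
  using assms(3-)
proof (induction k arbitrary: a b)
  case 0
  then have "b = Suc a" by simp
  then show ?case using 0 by auto
next
  case (Suc k)
  have D: "0 \<le> D"
    using hyperbolicD[OF H p p p p] by (auto simp: gp_def)
  show ?case
  proof (cases "b - a \<le> 2 ^ k")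
    case True
    then have "m - int k * D \<le> gp p (\<gamma> a) (\<gamma> b)" using Suc.IH[of a b] Suc.prems by auto
    then show ?thesis using D by (simp add: algebra_simps)
  next
    case False
    define c where "c = a + 2 ^ k"
    have c: "a < c" "c < b" "c - a \<le> 2 ^ k" "b - c \<le> 2 ^ k"
      using False Suc.prems by (auto simp: c_def)
    have "m - int k * D \<le> gp p (\<gamma> a) (\<gamma> c)" using Suc.IH[of a c] Suc.prems c by auto
    moreover have "m - int k * D \<le> gp p (\<gamma> c) (\<gamma> b)" using Suc.IH[of c b] Suc.prems c by auto
    ultimately show ?thesis
      using hyperbolicD[OF H p, of "\<gamma> a" "\<gamma> c" "\<gamma> b"] Suc.prems c
      by (auto simp: algebra_simps)
  qed
qed

lemma gp_commute: "x \<in> X \<Longrightarrow> y \<in> X \<Longrightarrow> gp p x y = gp p y x"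
  using d_sym by (auto simp: gp_def)

text \<open>\<open>gp p x z = 0\<close> means that \<open>p\<close> lies on a geodesic from
  \<open>x\<close> to \<open>z\<close>. The point of that geodesic as far from \<open>x\<close> as
  \<open>c\<close> is works (or \<open>z\<close>, if \<open>c\<close> is farther): since
  \<open>gp x c z + gp c x z = 2 * d x c\<close>, a small product at \<open>c\<close> makes
  \<open>gp x c z\<close> nearly maximal, and the four-point condition with base \<open>x\<close>
  through \<open>z\<close> does the rest.\<close>

lemma gp_near_geodesic:
  assumes H: "hyperbolic D" and X: "c \<in> X" "x \<in> X" "z \<in> X"
    and g: "gp c x z \<le> k" "0 \<le> k"
  shows "\<exists>p\<in>X. gp p x z = 0 \<and> d c p \<le> 2 * k + D"
proof -
  define t where "t = min (d x c) (d x z)"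
  obtain p where p: "p \<in> X" "d x p = t" "d p z = d x z - t"
    using d_between[of x z t] d_nonneg X by (auto simp: t_def)
  have "min (gp x c z) (gp x z p) - D \<le> gp x c p" using hyperbolicD[OF H] X p by auto
  moreover have "gp p x z = 0" using p X d_sym[of z p] by (auto simp: gp_def)
  moreover have "d c z \<ge> d x z - d x c" "d c z \<ge> d x c - d x z"
    using d_tri[of x c z] d_tri[of x z c] X d_sym by auto
  ultimately show ?thesis
    using X p d_sym[of c x] d_sym[of z x] d_sym[of p x] d_sym[of z p] g d_sym[of c z]
    by (intro bexI[of _ p]) (auto simp: gp_def t_def min_def split: if_splits)
qed

end

text \<open>Numerical input of the stability argument: a detour with at most
  \<open>6 * A * M\<close> steps is bisected \<open>k\<close> times, each time at the cost of
  \<open>D\<close>, and the total loss must stay below \<open>2 * M\<close>.\<close>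

lemma exp_beats_linear:
  fixes A D :: int
  assumes "1 \<le> A" "0 \<le> D"
  shows "\<exists>M0\<ge>0. \<forall>M>M0. \<exists>k. 6 * A * M + 1 \<le> 2 ^ k \<and> A + int (k + 2) * D < 2 * M"
proof -
  have "eventually (\<lambda>k. (6 * real_of_int A + 1) * (real_of_int A + (real k + 3) * real_of_int D) < 2 ^ k) at_top"
  proof (cases "D = 0")
    case True then show ?thesis by simp real_asymp
  next
    case False
    then have "real_of_int D > 0" "real_of_int A > 0" using assms by auto
    then show ?thesis by real_asymp
  qed
  then obtain k0 where k0: "\<And>k. k \<ge> k0 \<Longrightarrow>
      (6 * real_of_int A + 1) * (real_of_int A + (real k + 3) * real_of_int D) < 2 ^ k"
    unfolding eventually_at_top_linorder by blast
  define M0 :: int where "M0 = 2 ^ k0 + A + (int k0 + 3) * D"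
  have "\<exists>k. 6 * A * M + 1 \<le> 2 ^ k \<and> A + int (k + 2) * D < 2 * M" if M: "M > M0" for M
  proof -
    have "A + (int k0 + 3) * D \<ge> 0" using assms by auto
    then have Mp: "M > 2 ^ k0" using M by (auto simp: M0_def)
    have Mp1: "M \<ge> 1" using Mp one_le_power[of "2::int" k0] by linarith
    have ex: "\<exists>k. 6 * A * M + 1 \<le> 2 ^ k"
    proof -
      have "int (nat (6 * A * M + 1)) < 2 ^ nat (6 * A * M + 1)"
        by (metis less_exp of_nat_less_iff of_nat_numeral of_nat_power)
      then show ?thesis using assms Mp1 by (intro exI[of _ "nat (6 * A * M + 1)"]) auto
    qed
    \<comment> \<open>Minimality bounds \<open>2 ^ (k - 1)\<close> by a multiple of
      \<open>M\<close>, so \<open>k\<close> is logarithmic in \<open>M\<close>; it exceeds the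
      threshold \<open>k0\<close> once \<open>M\<close> exceeds \<open>M0\<close>.\<close>
    define k where "k = (LEAST k. 6 * A * M + 1 \<le> 2 ^ k)"
    have k: "6 * A * M + 1 \<le> 2 ^ k" unfolding k_def using ex by (rule LeastI_ex)
    have AM: "A * M \<ge> M" using assms Mp1 by (simp add: mult_le_cancel_right1)
    have kk0: "k0 < k"
    proof (rule ccontr)
      assume "\<not> k0 < k"
      then have "(2::int) ^ k \<le> 2 ^ k0" by (intro power_increasing) auto
      moreover have "6 * A * M \<ge> M" using AM Mp1 by linarith
      ultimately show False using k Mp by linarith
    qed
    define j where "j = k - 1"
    have j: "k = Suc j" "j \<ge> k0" using kk0 by (auto simp: j_def)
    have "\<not> 6 * A * M + 1 \<le> 2 ^ j"
      using not_less_Least[of j "\<lambda>k. 6 * A * M + 1 \<le> 2 ^ k"] j unfolding k_def by auto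
    then have "(2::int) ^ j < 6 * A * M + 1" by simp
    also have "\<dots> \<le> (6 * A + 1) * M" using Mp1 by (simp add: algebra_simps)
    finally have "real_of_int (2 ^ j) < real_of_int ((6 * A + 1) * M)" by (simp only: of_int_less_iff)
    then have "(6 * real_of_int A + 1) * (real_of_int A + (real j + 3) * real_of_int D)
        < (6 * real_of_int A + 1) * real_of_int M"
      using k0[OF j(2)] by simp
    then have "real_of_int A + (real j + 3) * real_of_int D < real_of_int M"
      using assms by (simp add: mult_less_cancel_left)
    then have "real_of_int (A + (int j + 3) * D) < real_of_int M" by simp
    then have "A + (int j + 3) * D < M" by (simp only: of_int_less_iff)
    then show ?thesis using k Mp1 by (intro exI[of _ k]) (auto simp: j algebra_simps)
  qed
  moreover have "0 \<le> M0" using assms by (auto simp: M0_def)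
  ultimately show ?thesis by blast
qed

section \<open>Stability of geodesics and transfer of hyperbolicity between bilipschitz
  metrics\<close>

locale bilipschitz_spaces =
  one: int_geodesic_space X d + two: int_geodesic_space X e
  for X :: "'a set" and d e :: "'a \<Rightarrow> 'a \<Rightarrow> int" +
  fixes A :: int
  assumes A1: "1 \<le> A"
    and e_le: "x \<in> X \<Longrightarrow> y \<in> X \<Longrightarrow> e x y \<le> A * d x y"
    and d_le: "x \<in> X \<Longrightarrow> y \<in> X \<Longrightarrow> d x y \<le> A * e x y"
begin

text \<open>The Morse lemma, with one chosen \<open>e\<close>-geodesic \<gamma>. If the point
  \<open>q\<close> farthest from \<gamma> had large distance \<open>M\<close>, the points at
  distance \<open>2 * M\<close> on both sides of \<open>q\<close> could be joined through \<gamma>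
  by a chain of length linear in \<open>M\<close> that avoids the \<open>M\<close>-ball about
  \<open>q\<close>; \<open>gp_chain\<close> then makes the product of its ends at \<open>q\<close>
  positive, although \<open>q\<close> lies between them.\<close>

lemma geodesic_near_quasigeodesic:
  assumes H: "one.hyperbolic D"
  shows "\<exists>M0\<ge>0. \<forall>x\<in>X. \<forall>y\<in>X. \<forall>p\<in>X. one.gp p x y = 0 \<longrightarrow>
    (\<exists>q\<in>X. two.gp q x y = 0 \<and> d p q \<le> M0)"
proof (cases "X = {}")
  case False
  then obtain o' where "o' \<in> X" by blast
  have D: "0 \<le> D"
    using one.hyperbolicD[OF H \<open>o' \<in> X\<close> \<open>o' \<in> X\<close> \<open>o' \<in> X\<close> \<open>o' \<in> X\<close>] by (auto simp: one.gp_def)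
  obtain M0 where M0: "M0 \<ge> 0" "\<And>M. M > M0 \<Longrightarrow> \<exists>k. 6 * A * M + 1 \<le> 2 ^ k \<and> A + int (k + 2) * D < 2 * M"
    using exp_beats_linear[OF A1 D] by blast
  have "\<exists>q\<in>X. two.gp q x y = 0 \<and> d p q \<le> M0"
    if X: "x \<in> X" "y \<in> X" and p0: "p \<in> X" "one.gp p x y = 0" for x y p
  proof -
    define n where "n = nat (e x y)"
    have n: "e x y = int n" using X two.d_nonneg by (auto simp: n_def)
    obtain \<gamma> where \<gamma>: "\<gamma> 0 = x" "\<gamma> n = y" "\<And>i. i \<le> n \<Longrightarrow> \<gamma> i \<in> X"
      "\<And>i j. i \<le> n \<Longrightarrow> j \<le> n \<Longrightarrow> e (\<gamma> i) (\<gamma> j) = \<bar>int i - int j\<bar>"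
      using two.geodesic_path[OF X n] by auto
    define r where "r p = Min ((\<lambda>i. nat (d p (\<gamma> i))) ` {..n})" for p
    \<comment> \<open>\<open>I\<close> is the union of all \<open>d\<close>-geodesics from
      \<open>x\<close> to \<open>y\<close>, so that \<open>x'\<close> and \<open>y'\<close> below
      belong to it again.\<close>
    define I where "I = {p \<in> X. one.gp p x y = 0}"
    have r_le: "r p \<le> nat (d p (\<gamma> i))" if "i \<le> n" for p i
      unfolding r_def using that by (intro Min_le) auto
    have r_ex: "\<exists>i\<le>n. nat (d p (\<gamma> i)) = r p" for p
    proof -
      have "r p \<in> (\<lambda>i. nat (d p (\<gamma> i))) ` {..n}" unfolding r_def by (intro Min_in) auto
      then show ?thesis by auto
    qed
    have bd: "r q \<le> nat (d x y)" if "q \<in> I" for q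
      using r_le[of 0 q] that \<gamma>(1) X one.d_nonneg[of q y] one.d_sym[of q y] one.d_sym[of q x]
      by (auto simp: I_def one.gp_def)
    have "p \<in> I" using p0 by (simp add: I_def)
    obtain q where q: "q \<in> I" "\<And>q'. q' \<in> I \<Longrightarrow> r q' \<le> r q"
      using ex_has_greatest_nat[of "\<lambda>q. q \<in> I" p r "nat (d x y)"] \<open>p \<in> I\<close> bd by fastforce
    define M where "M = int (r q)"
    have qX: "q \<in> X" "d x q + d q y = d x y" using q X one.d_sym[of q y] by (auto simp: I_def one.gp_def)
    have far: "M \<le> d q (\<gamma> i)" if "i \<le> n" for i
      using r_le[OF that, of q] \<gamma>(3)[OF that] one.d_nonneg[of q "\<gamma> i"] qX by (auto simp: M_def)
    have "M \<le> M0"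
    proof (rule ccontr)
      assume "\<not> M \<le> M0"
      then obtain k where k: "6 * A * M + 1 \<le> 2 ^ k" "A + int (k + 2) * D < 2 * M" using M0 by force
      have near: "\<exists>i\<le>n. d u (\<gamma> i) \<le> M" if "u \<in> I" for u
        using r_ex[of u] q(2)[OF that] by (auto simp: M_def)
      have "M \<ge> 0" by (simp add: M_def)
      \<comment> \<open>\<open>x'\<close> and \<open>y'\<close> lie \<open>2 * M\<close> away from
        \<open>q\<close>, or are the endpoints themselves when these are nearer.\<close>
      obtain x' where x': "x' \<in> X" "d x x' = d x q - min (2 * M) (d x q)" "d x' q = min (2 * M) (d x q)"
        using one.d_between[of x q "d x q - min (2 * M) (d x q)"] X qX one.d_nonneg[of x q] \<open>M \<ge> 0\<close>
        by auto
      obtain y' where y': "y' \<in> X" "d q y' = min (2 * M) (d q y)" "d y' y = d q y - min (2 * M) (d q y)"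
        using one.d_between[of q y "min (2 * M) (d q y)"] X qX one.d_nonneg[of q y] \<open>M \<ge> 0\<close>
        by auto
      have xy': "d x' y' = d x' q + d q y'"
        using one.d_tri[of x' q y'] one.d_tri[of x x' y] one.d_tri[of x' y' y] X x' y' qX by linarith
      have "x' \<in> I"
        using x' X qX one.d_tri[of x x' y] one.d_tri[of x' q y] one.d_sym[of x' y]
        by (auto simp: I_def one.gp_def)
      have "y' \<in> I"
        using y' X qX one.d_tri[of x y' y] one.d_tri[of x q y'] one.d_sym[of y' y]
        by (auto simp: I_def one.gp_def)
      \<comment> \<open>The product is at least \<open>2 * M + M - M\<close>: the distances of
        \<open>x'\<close> and of \<gamma> from \<open>q\<close>, minus their distance from each
        other. In the truncated case \<open>x'\<close> is the starting point of \<gamma> and the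
        product is twice \<open>d x q\<close>.\<close>
      have "\<exists>i\<le>n. d x' (\<gamma> i) \<le> M \<and> 2 * M \<le> one.gp q x' (\<gamma> i)"
      proof (cases "2 * M \<le> d x q")
        case True
        obtain i where "i \<le> n" "d x' (\<gamma> i) \<le> M" using near[OF \<open>x' \<in> I\<close>] by blast
        then show ?thesis using far[of i] x' True \<gamma>(3)[of i] qX one.d_sym[of "\<gamma> i" q]
          by (intro exI[of _ i]) (auto simp: one.gp_def)
      next
        case False
        then have "d x' x = 0" using x' X one.d_sym by auto
        then show ?thesis using False far[of 0] \<gamma>(1) x' X qX \<open>M \<ge> 0\<close> one.d_tri[of x x' q] one.d_sym[of x q]
            one.d_sym[of x x']
          by (intro exI[of _ 0]) (auto simp: one.gp_def)
      qed
      then obtain i where i: "i \<le> n" "d x' (\<gamma> i) \<le> M" "2 * M \<le> one.gp q x' (\<gamma> i)" by blast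
      have "\<exists>j\<le>n. d y' (\<gamma> j) \<le> M \<and> 2 * M \<le> one.gp q y' (\<gamma> j)"
      proof (cases "2 * M \<le> d q y")
        case True
        obtain i where "i \<le> n" "d y' (\<gamma> i) \<le> M" using near[OF \<open>y' \<in> I\<close>] by blast
        then show ?thesis using far[of i] y' True \<gamma>(3)[of i] qX one.d_sym[of "\<gamma> i" q] one.d_sym[of y' q]
          by (intro exI[of _ i]) (auto simp: one.gp_def)
      next
        case False
        then have "d y' y = 0" using y' X one.d_sym by auto
        then show ?thesis using False far[of n] \<gamma>(2) y' X qX \<open>M \<ge> 0\<close> one.d_tri[of q y' y] one.d_sym[of y q]
            one.d_sym[of y' q]
          by (intro exI[of _ n]) (auto simp: one.gp_def)
      qed
      then obtain j where j: "j \<le> n" "d y' (\<gamma> j) \<le> M" "2 * M \<le> one.gp q y' (\<gamma> j)" by blast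
      have \<gamma>ij: "\<gamma> i \<in> X" "\<gamma> j \<in> X" using i j \<gamma>(3) by auto
      have mid: "2 * M - A - int k * D \<le> one.gp q (\<gamma> i) (\<gamma> j)"
      proof -
        have "d (\<gamma> i) (\<gamma> j) \<le> d (\<gamma> i) x' + d x' y' + d y' (\<gamma> j)"
          using one.d_tri[of "\<gamma> i" x' "\<gamma> j"] one.d_tri[of x' y' "\<gamma> j"] \<gamma>ij x' y' by linarith
        also have "\<dots> \<le> 6 * M" using i j x' y' xy' one.d_sym[of "\<gamma> i" x'] \<gamma>ij by linarith
        finally have "A * d (\<gamma> i) (\<gamma> j) \<le> A * (6 * M)" using A1 by (intro mult_left_mono) auto
        then have "\<bar>int i - int j\<bar> \<le> 6 * A * M"
          using e_le[OF \<gamma>ij] \<gamma>(4)[OF i(1) j(1)] by (simp add: algebra_simps)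
        then have "int (max i j - min i j) \<le> int (2 ^ k)" using k by (auto simp: max_def min_def)
        then have dist: "max i j - min i j \<le> 2 ^ k" by (simp only: of_nat_le_iff)
        \<comment> \<open>Consecutive points of \<gamma> have \<open>e\<close>-distance 1, hence
          \<open>d\<close>-distance at most \<open>A\<close>, and both are at least \<open>M\<close>
          away from \<open>q\<close>.\<close>
        have step: "2 * M - A \<le> one.gp q (\<gamma> l) (\<gamma> (Suc l))" if "Suc l \<le> n" for l
        proof -
          have "d (\<gamma> l) (\<gamma> (Suc l)) \<le> A * e (\<gamma> l) (\<gamma> (Suc l))" using that \<gamma>(3) by (intro d_le) auto
          moreover have "e (\<gamma> l) (\<gamma> (Suc l)) = 1" using that \<gamma>(4)[of l "Suc l"] by auto
          ultimately show ?thesis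
            using far[of l] far[of "Suc l"] that one.d_sym[of "\<gamma> l" q] one.d_sym[of "\<gamma> (Suc l)" q] \<gamma>(3) qX
            by (auto simp: one.gp_def)
        qed
        show ?thesis
        proof (cases "i = j")
          case True
          moreover have "0 \<le> int k * D" using D by simp
          ultimately show ?thesis
            using far[OF i(1)] one.d_sym[of "\<gamma> i" q] \<gamma>ij qX one.d_self[of "\<gamma> i"] A1 \<open>M \<ge> 0\<close>
            unfolding one.gp_def by auto
        next
          case False
          then have "2 * M - A - int k * D \<le> one.gp q (\<gamma> (min i j)) (\<gamma> (max i j))"
            using i(1) j(1) dist step \<gamma>(3) by (intro one.gp_chain[OF H qX(1)]) auto
          then show ?thesis using one.gp_commute[of "\<gamma> i" "\<gamma> j" q] \<gamma>ij
            by (auto simp: min_def max_def split: if_splits)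
        qed
      qed
      have kD: "0 \<le> int k * D" using D by simp
      have "min (one.gp q x' (\<gamma> i)) (one.gp q (\<gamma> i) (\<gamma> j)) - D \<le> one.gp q x' (\<gamma> j)"
        using one.hyperbolicD[OF H] qX x' \<gamma>ij by auto
      then have a1: "2 * M - A - int k * D - D \<le> one.gp q x' (\<gamma> j)"
        using i(3) mid kD A1 by linarith
      have "min (one.gp q x' (\<gamma> j)) (one.gp q (\<gamma> j) y') - D \<le> one.gp q x' y'"
        using one.hyperbolicD[OF H] qX x' y' \<gamma>ij by auto
      moreover have "2 * M \<le> one.gp q (\<gamma> j) y'" using j(3) one.gp_commute \<gamma>ij y' by metis
      moreover have "one.gp q x' y' = 0" using xy' x' y' qX one.d_sym[of y' q] by (auto simp: one.gp_def)
      ultimately have "2 * M - A - int k * D - 2 * D \<le> 0" using a1 kD A1 D by linarith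
      then show False using k by (simp add: algebra_simps)
    qed
    moreover obtain i where i: "i \<le> n" "nat (d p (\<gamma> i)) = r p" using r_ex by blast
    ultimately have "d p (\<gamma> i) \<le> M0" using q(2)[OF \<open>p \<in> I\<close>] by (auto simp: M_def)
    moreover have "two.gp (\<gamma> i) x y = 0"
      using i \<gamma>(4)[of 0 i] \<gamma>(4)[of n i] \<gamma>(1,2) n by (auto simp: two.gp_def)
    ultimately show ?thesis using i \<gamma>(3) by blast
  qed
  then show ?thesis using M0(1) by blast
qed auto

text \<open>Choose \<open>c\<close> where the \<open>d\<close>-geodesics from \<open>x\<close> to
  \<open>z\<close> and to \<open>w\<close> separate; it is almost on all three sides of the triangle
  \<open>x z w\<close>. By \<open>transfer\<close> this persists for \<open>e\<close>, so
  \<open>two.gp w x z\<close> is nearly at least \<open>2 * e c w\<close>. On the other hand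
  \<open>c\<close> is close to a side \<open>x y\<close> or \<open>y z\<close>, which bounds one of
  the other two products at \<open>w\<close> from above by nearly the same number.\<close>

lemma hyperbolic_bilipschitz:
  assumes H: "one.hyperbolic D"
  shows "\<exists>D'. two.hyperbolic D'"
proof (cases "X = {}")
  case False
  then obtain o' where "o' \<in> X" by blast
  have D: "0 \<le> D"
    using one.hyperbolicD[OF H \<open>o' \<in> X\<close> \<open>o' \<in> X\<close> \<open>o' \<in> X\<close> \<open>o' \<in> X\<close>] by (auto simp: one.gp_def)
  obtain M0 where M0: "M0 \<ge> 0" "\<And>x y p. x \<in> X \<Longrightarrow> y \<in> X \<Longrightarrow> p \<in> X \<Longrightarrow> one.gp p x y = 0 \<Longrightarrow>
    \<exists>q\<in>X. two.gp q x y = 0 \<and> d p q \<le> M0"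
    using geodesic_near_quasigeodesic[OF H] by blast
  \<comment> \<open>\<open>3 * D + 2\<close> is \<open>2 * (D + 1) + D\<close>, the distance from
    \<open>c\<close> to a \<open>d\<close>-geodesic in \<open>gp_near_geodesic\<close>;
    \<open>M0\<close> leads on to an \<open>e\<close>-geodesic, \<open>A\<close> changes the metric
    and 2 accounts for the doubled product.\<close>
  define k where "k = 2 * A * (3 * D + 2 + M0)"
  have transfer: "two.gp c x z \<le> k"
    if X: "c \<in> X" "x \<in> X" "z \<in> X" and g: "one.gp c x z \<le> D + 1" for c x z
  proof -
    obtain p where p: "p \<in> X" "one.gp p x z = 0" "d c p \<le> 2 * (D + 1) + D"
      using one.gp_near_geodesic[OF H X g] D by auto
    obtain q where q: "q \<in> X" "two.gp q x z = 0" "d p q \<le> M0" using M0(2)[of x z p] X p by blast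
    have "d c q \<le> 3 * D + 2 + M0" using one.d_tri[of c p q] X p q by auto
    then have "A * d c q \<le> A * (3 * D + 2 + M0)" using A1 by (intro mult_left_mono) auto
    then have "2 * e c q \<le> k" using e_le[of c q] X q by (simp add: k_def)
    then show ?thesis
      using q X two.d_tri[of x q c] two.d_tri[of z q c] two.d_sym[of c q] by (auto simp: two.gp_def)
  qed
  have "min (two.gp w x y) (two.gp w y z) - 3 * k \<le> two.gp w x z"
    if X: "w \<in> X" "x \<in> X" "y \<in> X" "z \<in> X" for w x y z
  proof -
    \<comment> \<open>Half of the doubled product at \<open>x\<close>, rounded down: the distance
      from \<open>x\<close> to the separation point.\<close>
    define t where "t = one.gp x z w div 2"
    have gpx: "0 \<le> one.gp x z w" "one.gp x z w \<le> 2 * d x z"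
      using one.d_tri[of z x w] one.d_tri[of x z w] one.d_sym X by (auto simp: one.gp_def)
    then have t: "0 \<le> t" "t \<le> d x z" "2 * t \<le> one.gp x z w" "one.gp x z w \<le> 2 * t + 1" by (auto simp: t_def)
    obtain c where c: "c \<in> X" "d x c = t" "d c z = d x z - t"
      using one.d_between[of x z t] X t by auto
    have cw: "min (one.gp x c z) (one.gp x z w) - D \<le> one.gp x c w"
      using one.hyperbolicD[OF H] X c by auto
    have gcz: "one.gp x c z = 2 * t"
      using c X one.d_sym[of c x] one.d_sym[of z x] by (auto simp: one.gp_def)
    have c1: "one.gp c x z \<le> D + 1" using c X one.d_sym[of c z] D by (auto simp: one.gp_def)
    have dcw: "d c w \<le> d x w - t + D"
      using cw gcz t c X one.d_sym[of w x] one.d_sym[of c x] by (auto simp: one.gp_def)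
    have c2: "one.gp c x w \<le> D + 1" using dcw c X one.d_sym[of w c] by (auto simp: one.gp_def)
    have c3: "one.gp c z w \<le> D + 1" using dcw c t X one.d_sym[of w c] one.d_sym[of z c]
        one.d_sym[of z x] one.d_sym[of w x]
      by (auto simp: one.gp_def)
    have e2: "two.gp c x w \<le> k" and e3: "two.gp c z w \<le> k"
      using transfer c1 c2 c3 X c by auto
    have lower: "2 * e c w - 2 * k \<le> two.gp w x z"
      using e2 e3 two.d_tri[of x c z] X c two.d_sym[of w c] two.d_sym[of z c]
      by (auto simp: two.gp_def)
    have "one.gp c x z = 0" using c X one.d_sym[of z c] by (auto simp: one.gp_def)
    then have "min (one.gp c x y) (one.gp c y z) \<le> D"
      using one.hyperbolicD[OF H, of c x y z] X c by auto
    then have "two.gp c x y \<le> k \<or> two.gp c y z \<le> k"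
      using transfer X c by (auto simp: min_le_iff_disj)
    moreover have "two.gp w x y \<le> 2 * e c w + two.gp c x y"
      using two.d_tri[of x c w] two.d_tri[of y c w] X c by (auto simp: two.gp_def)
    moreover have "two.gp w y z \<le> 2 * e c w + two.gp c y z"
      using two.d_tri[of y c w] two.d_tri[of z c w] X c by (auto simp: two.gp_def)
    ultimately show ?thesis using lower by linarith
  qed
  then have "two.hyperbolic (3 * k)" by (auto simp: two.hyperbolic_def)
  then show ?thesis by blast
qed (unfold two.hyperbolic_def, auto)

end

section \<open>Word metrics\<close>

locale gen_group = group G for G (structure) +
  fixes S :: "'a set"
  assumes gen: "finite_symmetric_generating_set G S"
begin

abbreviation len :: "'a \<Rightarrow> nat" where "len \<equiv> word_length G S"
abbreviation ev :: "'a list \<Rightarrow> 'a" where "ev \<equiv> word_eval G"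

definition dist :: "'a \<Rightarrow> 'a \<Rightarrow> int" where
  "dist x y = int (len (inv x \<otimes> y))"

lemma S_carrier: "s \<in> S \<Longrightarrow> s \<in> carrier G"
  and S_finite: "finite S"
  and S_inv: "s \<in> S \<Longrightarrow> inv s \<in> S"
  and ev_image: "ev ` lists S = carrier G"
  using gen by (auto simp: finite_symmetric_generating_set_def)

lemma ev_Nil [simp]: "ev [] = \<one>" and ev_Cons [simp]: "ev (s # w) = s \<otimes> ev w"
  by (auto simp: word_eval_def)

lemma ev_closed: "w \<in> lists S \<Longrightarrow> ev w \<in> carrier G"
  using ev_image by blast

lemma ev_append: "u \<in> lists S \<Longrightarrow> w \<in> lists S \<Longrightarrow> ev (u @ w) = ev u \<otimes> ev w"
  by (induction u) (auto simp: ev_closed S_carrier m_assoc)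

lemma ev_rev: "w \<in> lists S \<Longrightarrow> ev (rev (map (\<lambda>s. inv s) w)) = inv (ev w)"
proof (induction w)
  case (Cons s w)
  then have "rev (map (\<lambda>s. inv s) w) \<in> lists S" by (auto simp: S_inv in_lists_conv_set)
  then show ?case using Cons by (auto simp: ev_append S_inv S_carrier ev_closed inv_mult_group)
qed auto

lemma len_le: "w \<in> lists S \<Longrightarrow> len (ev w) \<le> length w"
  unfolding word_length_def by (intro Least_le) auto

lemma len_word: "g \<in> carrier G \<Longrightarrow> \<exists>w\<in>lists S. length w = len g \<and> ev w = g"
proof -
  assume "g \<in> carrier G"
  then obtain w where w: "w \<in> lists S" "ev w = g" using ev_image by (metis imageE)
  show ?thesis unfolding word_length_def by (rule LeastI_ex) (use w in blast)
qed

lemma len_one [simp]: "len \<one> = 0"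
  using len_le[of "[]"] by simp

lemma len_eq_0: "g \<in> carrier G \<Longrightarrow> len g = 0 \<Longrightarrow> g = \<one>"
  using len_word[of g] by auto

lemma len_mult: "g \<in> carrier G \<Longrightarrow> h \<in> carrier G \<Longrightarrow> len (g \<otimes> h) \<le> len g + len h"
proof -
  assume g: "g \<in> carrier G" and h: "h \<in> carrier G"
  obtain u where u: "u \<in> lists S" "length u = len g" "ev u = g" using len_word[OF g] by blast
  obtain w where w: "w \<in> lists S" "length w = len h" "ev w = h" using len_word[OF h] by blast
  show ?thesis using len_le[of "u @ w"] ev_append[of u w] u w by simp
qed

lemma len_inv_le: assumes g: "g \<in> carrier G" shows "len (inv g) \<le> len g"
proof -
  obtain w where w: "w \<in> lists S" "length w = len g" "ev w = g" using len_word[OF g] by blast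
  have "rev (map (\<lambda>s. inv s) w) \<in> lists S" using w by (auto simp: S_inv in_lists_conv_set)
  from len_le[OF this] show ?thesis using ev_rev[OF w(1)] w by simp
qed

lemma len_inv [simp]: "g \<in> carrier G \<Longrightarrow> len (inv g) = len g"
  using len_inv_le[of g] len_inv_le[of "inv g"] by simp

lemma len_split:
  assumes g: "g \<in> carrier G" and n: "n \<le> len g"
  shows "\<exists>h\<in>carrier G. len h = n \<and> len (inv h \<otimes> g) = len g - n"
proof -
  obtain w where w: "w \<in> lists S" "length w = len g" "ev w = g" using len_word[OF g] by blast
  have tk: "take n w \<in> lists S" "drop n w \<in> lists S" using w
    by (metis append_in_lists_conv append_take_drop_id)+
  define h where "h = ev (take n w)"
  have h: "h \<in> carrier G" "g = h \<otimes> ev (drop n w)"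
    using ev_append[OF tk] w(3) ev_closed[OF tk(1)] unfolding h_def append_take_drop_id by simp_all
  then have e: "inv h \<otimes> g = ev (drop n w)" using ev_closed[OF tk(2)] unfolding h(2) using h(1)
    by (simp add: m_assoc[symmetric])
  have "len h \<le> n" using len_le[OF tk(1)] w n by (simp add: h_def)
  moreover have "len (inv h \<otimes> g) \<le> len g - n" using len_le[OF tk(2)] e w by simp
  moreover have "len g \<le> len h + len (inv h \<otimes> g)"
    using len_mult[OF h(1) ev_closed[OF tk(2)]] unfolding e h(2)[symmetric] .
  ultimately show ?thesis using h n by (intro bexI[of _ h]) auto
qed

lemma inv_mult_cancel_left: "g \<in> carrier G \<Longrightarrow> x \<in> carrier G \<Longrightarrow> y \<in> carrier G \<Longrightarrow>
    inv (g \<otimes> x) \<otimes> (g \<otimes> y) = inv x \<otimes> y"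
  by (simp add: inv_mult_group m_assoc) (simp add: m_assoc[symmetric])

lemma dist_left: "g \<in> carrier G \<Longrightarrow> x \<in> carrier G \<Longrightarrow> y \<in> carrier G \<Longrightarrow>
    dist (g \<otimes> x) (g \<otimes> y) = dist x y"
  by (simp add: dist_def inv_mult_cancel_left)

lemma dist_one [simp]: "x \<in> carrier G \<Longrightarrow> dist \<one> x = int (len x)"
  by (simp add: dist_def)

lemma dist_mult [simp]: "x \<in> carrier G \<Longrightarrow> y \<in> carrier G \<Longrightarrow> dist x (x \<otimes> y) = int (len y)"
  using dist_left[of x \<one> y] by simp

lemma dist_commute: "x \<in> carrier G \<Longrightarrow> y \<in> carrier G \<Longrightarrow> dist x y = dist y x"
  using len_inv[of "inv x \<otimes> y"] by (simp add: dist_def inv_mult_group)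

lemma dist_one_right [simp]: "x \<in> carrier G \<Longrightarrow> dist x \<one> = int (len x)"
  using dist_commute[of x \<one>] by simp

lemma dist_tri: "x \<in> carrier G \<Longrightarrow> y \<in> carrier G \<Longrightarrow> z \<in> carrier G \<Longrightarrow> dist x z \<le> dist x y + dist y z"
proof -
  assume a: "x \<in> carrier G" "y \<in> carrier G" "z \<in> carrier G"
  have "inv x \<otimes> z = (inv x \<otimes> y) \<otimes> (inv y \<otimes> z)"
    using a by (simp add: m_assoc) (simp add: m_assoc[symmetric])
  then show ?thesis using len_mult[of "inv x \<otimes> y" "inv y \<otimes> z"] a by (simp add: dist_def)
qed

sublocale word: int_geodesic_space "carrier G" dist
proof
  fix x y assume xy: "x \<in> carrier G" "y \<in> carrier G"
  show "0 \<le> dist x y" by (simp add: dist_def)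
  show "dist x x = 0" using xy by (simp add: dist_def)
  show "dist x y = dist y x" using dist_commute xy by blast
  show "x = y" if "dist x y = 0"
  proof -
    have "inv x \<otimes> y = \<one>" using that xy len_eq_0[of "inv x \<otimes> y"] by (simp add: dist_def)
    then have "x \<otimes> (inv x \<otimes> y) = x" using xy by simp
    then show "x = y" using xy by (simp add: m_assoc[symmetric])
  qed
  fix n assume n: "0 \<le> n" "n \<le> dist x y"
  obtain h where h: "h \<in> carrier G" "len h = nat n" "len (inv h \<otimes> (inv x \<otimes> y)) = len (inv x \<otimes> y) - nat n"
    using len_split[of "inv x \<otimes> y" "nat n"] xy n by (auto simp: dist_def nat_le_iff)
  have "dist x (x \<otimes> h) = n" using h xy n by simp
  moreover have "dist (x \<otimes> h) y = dist x y - n"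
  proof -
    have "inv (x \<otimes> h) \<otimes> y = inv h \<otimes> (inv x \<otimes> y)" using h xy by (simp add: inv_mult_group m_assoc)
    then show ?thesis using h n by (simp add: dist_def of_nat_diff nat_le_iff)
  qed
  ultimately show "\<exists>z\<in>carrier G. dist x z = n \<and> dist z y = dist x y - n" using h xy by blast
qed (use dist_tri in auto)

lemma finite_lists_length: "finite {w \<in> lists S. length w \<le> n}"
  using finite_lists_length_le[OF S_finite, of n] by (simp add: lists_eq_set conj_commute)

lemma finite_ball: "finite (word_ball G S n)"
proof -
  have "word_ball G S n \<subseteq> ev ` {w \<in> lists S. length w \<le> n}"
    using len_word by (force simp: word_ball_def)
  then show ?thesis using finite_lists_length finite_surj by blast
qed

lemma sphere_subset_ball: "word_sphere G S n \<subseteq> word_ball G S n"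
  by (auto simp: word_sphere_def word_ball_def)

lemma finite_sphere: "finite (word_sphere G S n)"
  using finite_ball sphere_subset_ball finite_subset by blast

definition ball_card :: "int \<Rightarrow> nat" where
  "ball_card r = card (word_ball G S (nat r))"

lemma dist_ball:
  assumes x: "x \<in> carrier G"
  shows "finite {y \<in> carrier G. dist x y \<le> r}" "card {y \<in> carrier G. dist x y \<le> r} \<le> ball_card r"
proof -
  have sub: "{y \<in> carrier G. dist x y \<le> r} \<subseteq> (\<otimes>) x ` word_ball G S (nat r)"
  proof
    fix y assume y: "y \<in> {y \<in> carrier G. dist x y \<le> r}"
    then have "y = x \<otimes> (inv x \<otimes> y)" using x by (simp add: m_assoc[symmetric])
    then show "y \<in> (\<otimes>) x ` word_ball G S (nat r)"
      using y x by (intro image_eqI[of _ _ "inv x \<otimes> y"]) (auto simp: word_ball_def dist_def)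
  qed
  show "finite {y \<in> carrier G. dist x y \<le> r}" using finite_subset[OF sub] finite_ball by auto
  show "card {y \<in> carrier G. dist x y \<le> r} \<le> ball_card r"
    unfolding ball_card_def using sub finite_ball by (meson card_image_le card_mono finite_imageI order_trans)
qed

lemma dist_ball':
  assumes "\<And>y. y \<in> B \<Longrightarrow> y \<in> carrier G \<and> dist x y \<le> r" and "x \<in> carrier G"
  shows "finite B" "card B \<le> ball_card r"
proof -
  have sub: "B \<subseteq> {y \<in> carrier G. dist x y \<le> r}" using assms by auto
  show "finite B" using sub dist_ball(1)[OF assms(2)] by (rule finite_subset)
  show "card B \<le> ball_card r"
    using card_mono[OF dist_ball(1)[OF assms(2)] sub] dist_ball(2)[OF assms(2), of r] by linarith
qed

lemma sphere_subset_products: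
  "word_sphere G S (m + n) \<subseteq> (\<lambda>(x, y). x \<otimes> y) ` (word_sphere G S m \<times> word_sphere G S n)"
proof
  fix g assume g: "g \<in> word_sphere G S (m + n)"
  then have gc: "g \<in> carrier G" "len g = m + n" by (auto simp: word_sphere_def)
  obtain h where h: "h \<in> carrier G" "len h = m" "len (inv h \<otimes> g) = len g - m"
    using len_split[OF gc(1), of m] gc by auto
  have "g = h \<otimes> (inv h \<otimes> g)" using h gc by (simp add: m_assoc[symmetric])
  then show "g \<in> (\<lambda>(x, y). x \<otimes> y) ` (word_sphere G S m \<times> word_sphere G S n)"
    using h gc by (intro image_eqI[of _ _ "(h, inv h \<otimes> g)"]) (auto simp: word_sphere_def)
qed

lemma card_sphere_submult:
  "card (word_sphere G S (m + n)) \<le> card (word_sphere G S m) * card (word_sphere G S n)"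
  using card_mono[OF _ sphere_subset_products[of m n]]
    card_image_le[of "word_sphere G S m \<times> word_sphere G S n" "\<lambda>(x, y). x \<otimes> y"] finite_sphere
  by (auto simp: card_cartesian_product)

lemma len_bilipschitz:
  assumes "gen_group G S'"
  shows "\<exists>A\<ge>1. \<forall>g\<in>carrier G. len g \<le> A * word_length G S' g"
proof -
  interpret o: gen_group G S' by fact
  define A where "A = Max (insert 1 (len ` S'))"
  have A: "1 \<le> A" "\<And>s. s \<in> S' \<Longrightarrow> len s \<le> A"
    unfolding A_def using o.S_finite by (auto intro: Max_ge)
  have w: "len (ev w) \<le> A * length w" if "w \<in> lists S'" for w
    using that
  proof (induction w)
    case (Cons s w)
    then have "len (s \<otimes> ev w) \<le> len s + len (ev w)"
      using o.S_carrier o.ev_closed by (intro len_mult) auto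
    then show ?case using Cons A(2)[of s] by simp
  qed auto
  have "len g \<le> A * word_length G S' g" if "g \<in> carrier G" for g
    using o.len_word[OF that] w by metis
  then show ?thesis using A(1) by blast
qed

end

text \<open>\<open>word_hyperbolic\<close> concerns some generating set \<open>S'\<close>; the two
  word metrics are bilipschitz, so the condition passes to \<open>S\<close>. Doubling \<delta> and
  rounding up yields an integer constant.\<close>

lemma hyperbolic_word_metric:
  assumes "gen_group G S" "word_hyperbolic G"
  shows "\<exists>D. int_geodesic_space.hyperbolic (carrier G) (gen_group.dist G S) D"
proof -
  interpret two: gen_group G S by fact
  obtain S' \<delta> where S': "finite_symmetric_generating_set G S'" and
    \<delta>: "\<And>p x y z. p \<in> carrier G \<Longrightarrow> x \<in> carrier G \<Longrightarrow> y \<in> carrier G \<Longrightarrow> z \<in> carrier G \<Longrightarrow>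
          gromov_product G S' p x z
            \<ge> min (gromov_product G S' p x y) (gromov_product G S' p y z) - \<delta>"
    using assms(2) unfolding word_hyperbolic_def by blast
  interpret one: gen_group G S' using S' by unfold_locales
  have gp: "gromov_product G S' p x y = real_of_int (one.word.gp p x y) / 2" for p x y
    by (simp add: gromov_product_def word_dist_def one.word.gp_def one.dist_def)
  have "one.word.hyperbolic \<lceil>2 * \<delta>\<rceil>"
    unfolding one.word.hyperbolic_def
  proof (intro ballI)
    fix p x y z assume "p \<in> carrier G" "x \<in> carrier G" "y \<in> carrier G" "z \<in> carrier G"
    from \<delta>[OF this] have "min (real_of_int (one.word.gp p x y)) (real_of_int (one.word.gp p y z)) - 2 * \<delta>
       \<le> real_of_int (one.word.gp p x z)"
      unfolding gp by (auto simp: min_def split: if_splits)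
    then have "real_of_int (min (one.word.gp p x y) (one.word.gp p y z) - one.word.gp p x z) \<le> 2 * \<delta>"
      by (auto simp: min_def)
    then show "min (one.word.gp p x y) (one.word.gp p y z) - \<lceil>2 * \<delta>\<rceil> \<le> one.word.gp p x z" by linarith
  qed
  moreover obtain A1 where A1: "A1 \<ge> 1" "\<forall>g\<in>carrier G. two.len g \<le> A1 * one.len g"
    using two.len_bilipschitz[of S'] one.gen_group_axioms by blast
  moreover obtain A2 where A2: "A2 \<ge> 1" "\<forall>g\<in>carrier G. one.len g \<le> A2 * two.len g"
    using one.len_bilipschitz[of S] assms by blast
  define A where "A = max A1 A2"
  have A: "\<forall>g\<in>carrier G. two.len g \<le> A * one.len g" "\<forall>g\<in>carrier G. one.len g \<le> A * two.len g"
    using A1 A2 unfolding A_def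
    by (meson max.cobounded1 max.cobounded2 mult_le_mono1 order_trans)+
  interpret bilipschitz_spaces "carrier G" one.dist two.dist "int A"
  proof
    show "1 \<le> int A" using A1 by (simp add: A_def)
    fix x y assume "x \<in> carrier G" "y \<in> carrier G"
    then have "inv\<^bsub>G\<^esub> x \<otimes>\<^bsub>G\<^esub> y \<in> carrier G" by auto
    then show "two.dist x y \<le> int A * one.dist x y" "one.dist x y \<le> int A * two.dist x y"
      using A unfolding one.dist_def two.dist_def by (auto simp flip: of_nat_mult)
  qed
  show ?thesis using hyperbolic_bilipschitz calculation by blast
qed

section \<open>Almost additive products in non-elementary groups\<close>

text \<open>A diagonal argument replacing a pointwise limit along a subsequence: a bounded integer
  sequence takes some value infinitely often, and the coordinates are fixed one after the other on
  nested infinite index sets.\<close>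

lemma cluster_function:
  fixes f :: "nat \<Rightarrow> 'b \<Rightarrow> int"
  assumes cnt: "countable A" and bd: "\<And>N a. a \<in> A \<Longrightarrow> \<bar>f N a\<bar> \<le> b a"
  shows "\<exists>s. \<forall>F N0. finite F \<and> F \<subseteq> A \<longrightarrow> (\<exists>N\<ge>N0. \<forall>a\<in>F. f N a = s a)"
proof -
  define t where "t = to_nat_on A"
  have step: "\<exists>v. infinite {N \<in> I. \<forall>a\<in>A. t a = k \<longrightarrow> f N a = v}" if I: "infinite I" for I :: "nat set" and k
  proof (cases "\<exists>a\<in>A. t a = k")
    case True
    then obtain a where a: "a \<in> A" "t a = k" by blast
    have uniq: "a' = a" if "a' \<in> A" "t a' = k" for a'
      using that a inj_on_to_nat_on[OF cnt] by (auto simp: t_def inj_on_def)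
    have "finite ((\<lambda>N. f N a) ` I)"
      by (rule finite_subset[of _ "{-b a..b a}"]) (use bd a in \<open>auto simp: abs_le_iff minus_le_iff\<close>)
    then obtain N0 where N0: "infinite {N \<in> I. f N a = f N0 a}"
      using pigeonhole_infinite[OF I] by blast
    define v where "v = f N0 a"
    have "{N \<in> I. f N a = v} \<subseteq> {N \<in> I. \<forall>a\<in>A. t a = k \<longrightarrow> f N a = v}" using uniq by auto
    then show ?thesis using N0 infinite_super unfolding v_def[symmetric] by blast
  next
    case False
    then have "{N \<in> I. \<forall>a\<in>A. t a = k \<longrightarrow> f N a = 0} = I" by auto
    then show ?thesis using I by (intro exI[of _ 0]) simp
  qed
  \<comment> \<open>\<open>g (Suc k)\<close> carries an infinite set of indices and the value chosen
    for the element numbered \<open>k\<close>; a number that belongs to no element leaves the index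
    set unchanged.\<close>
  have "\<exists>g. \<forall>k. (infinite (fst (g k :: nat set \<times> int))) \<and> (fst (g (Suc k)) = {N \<in> fst (g k). \<forall>a\<in>A. t a = k \<longrightarrow> f N a = snd (g (Suc k))})"
    proof (rule dependent_nat_choice)
      show "\<exists>x :: nat set \<times> int. infinite (fst x)" by (intro exI[of _ "(UNIV, 0)"]) auto
      fix x :: "nat set \<times> int" and k assume "infinite (fst x)"
      from step[OF this, of k] obtain v where "infinite {N \<in> fst x. \<forall>a\<in>A. t a = k \<longrightarrow> f N a = v}" by blast
      then show "\<exists>y. infinite (fst y) \<and> fst y = {N \<in> fst x. \<forall>a\<in>A. t a = k \<longrightarrow> f N a = snd y}"
        by (intro exI[of _ "({N \<in> fst x. \<forall>a\<in>A. t a = k \<longrightarrow> f N a = v}, v)"]) auto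
    qed
  then obtain g where g: "\<And>k. infinite (fst (g k))"
    "\<And>k. fst (g (Suc k)) = {N \<in> fst (g k). \<forall>a\<in>A. t a = k \<longrightarrow> f N a = snd (g (Suc k))}" by blast
  have agree: "f N a = snd (g (Suc (t a)))" if "a \<in> A" "N \<in> fst (g k)" "t a < k" for N a k
    using that
  proof (induction k)
    case (Suc k)
    then show ?case using g(2)[of k] by (cases "t a = k") auto
  qed auto
  show ?thesis
  proof (intro exI[of _ "\<lambda>a. snd (g (Suc (t a)))"] allI impI)
    fix F N0 assume F: "finite F \<and> F \<subseteq> A"
    obtain k where k: "\<forall>n\<in>t ` F. n < k" using F finite_nat_set_iff_bounded[of "t ` F"] by blast
    obtain N where "N \<ge> N0" "N \<in> fst (g k)" using g(1)[of k] by (meson infinite_nat_iff_unbounded_le)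
    then show "\<exists>N\<ge>N0. \<forall>a\<in>F. f N a = snd (g (Suc (t a)))" using agree k F by blast
  qed
qed

context group
begin

lemma elementary_groupI:
  assumes g: "g \<in> carrier G" and R: "finite R" "R \<subseteq> carrier G"
    and cov: "\<And>h. h \<in> carrier G \<Longrightarrow> \<exists>k::int. g [^] k \<otimes> h \<in> R"
  shows "elementary_group G"
proof -
  define H where "H = generate G {g}"
  have H: "subgroup H G" using g by (auto simp: H_def intro: generate_is_subgroup)
  have "cyclic_group (G\<lparr>carrier := H\<rparr>)"
    using cyclic_group_generated[of g] g by (simp add: subgroup_generated_def H_def)
  moreover have "rcosets\<^bsub>G\<^esub> H \<subseteq> (\<lambda>r. H #> r) ` R"
  proof
    fix C assume "C \<in> rcosets\<^bsub>G\<^esub> H"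
    then obtain h where h: "h \<in> carrier G" "C = H #> h" by (auto simp: RCOSETS_def)
    obtain k :: int where k: "g [^] k \<otimes> h \<in> R" using cov[OF h(1)] by blast
    have "g [^] k \<in> H" using g by (auto simp: H_def generate_pow)
    then have "H #> (g [^] k \<otimes> h) = C"
      using h H g coset_mult_assoc[of H "g [^] k" h] coset_join2[of "g [^] k" H]
      by (simp add: subgroup.subset)
    then show "C \<in> (\<lambda>r. H #> r) ` R" using k by blast
  qed
  ultimately show ?thesis using H R finite_subset unfolding elementary_group_def by blast
qed

lemma elementary_if_finite: "finite (carrier G) \<Longrightarrow> elementary_group G"
  by (rule elementary_groupI[of \<one> "carrier G"]) auto

text \<open>If \<open>s g\<close> exceeds the defect \<open>D\<close>, multiplication by
  \<open>g\<close> raises \<open>s\<close> by at least 1 and at most \<open>m\<close>. Every orbit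
  of the powers of \<open>g\<close> therefore visits the slab \<open>0 \<le> s \<le> m\<close>,
  which is finite, so this slab represents all cosets.\<close>

lemma elementary_if_quasimorphism:
  fixes s :: "'a \<Rightarrow> int"
  assumes q: "\<And>a b. a \<in> carrier G \<Longrightarrow> b \<in> carrier G \<Longrightarrow> \<bar>s (a \<otimes> b) - s a - s b\<bar> \<le> D"
    and fib: "\<And>j. finite {a \<in> carrier G. s a = j}"
  shows "elementary_group G"
proof (cases "finite (carrier G)")
  case False
  have slab: "finite {a \<in> carrier G. i \<le> s a \<and> s a \<le> j}" for i j
  proof -
    have "{a \<in> carrier G. i \<le> s a \<and> s a \<le> j} = (\<Union>k\<in>{i..j}. {a \<in> carrier G. s a = k})" by auto
    then show ?thesis using fib by auto
  qed
  have D: "0 \<le> D" using q[of \<one> \<one>] by auto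
  obtain g0 where g0: "g0 \<in> carrier G" "\<not> (- 3 * D - 1 \<le> s g0 \<and> s g0 \<le> 3 * D + 1)"
    using slab[of "- 3 * D - 1" "3 * D + 1"] False by (metis (mono_tags, lifting) finite_subset mem_Collect_eq subsetI)
  \<comment> \<open>Either \<open>g0\<close> or its inverse works: of the margin
    \<open>3 * D + 1\<close>, one \<open>D\<close> pays for the defect and one for
    \<open>s \<one>\<close>.\<close>
  have "\<exists>g\<in>carrier G. D + 1 \<le> s g"
  proof (cases "D + 1 \<le> s g0")
    case False
    have "\<bar>s \<one> - s g0 - s (inv g0)\<bar> \<le> D" using q[of g0 "inv g0"] g0 by simp
    moreover have "\<bar>s \<one> - s \<one> - s \<one>\<bar> \<le> D" using q[of \<one> \<one>] by simp
    ultimately show ?thesis using False g0 D by (intro bexI[of _ "inv g0"]) auto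
  qed (use g0 in blast)
  then obtain g where g: "g \<in> carrier G" "D + 1 \<le> s g" by blast
  define m where "m = s g + D"
  have "\<exists>k::int. g [^] k \<otimes> h \<in> {a \<in> carrier G. 0 \<le> s a \<and> s a \<le> m}" if h: "h \<in> carrier G" for h
  proof -
    define f where "f k = s (g [^] (k::int) \<otimes> h)" for k
    have st: "f k + 1 \<le> f (k + 1)" "f (k + 1) \<le> f k + m" for k
    proof -
      have "g [^] (k + 1) \<otimes> h = g \<otimes> (g [^] k \<otimes> h)"
        using g h int_pow_mult[of g 1 k] by (simp add: m_assoc add.commute)
      then have "\<bar>f (k + 1) - s g - f k\<bar> \<le> D" using q[of g "g [^] k \<otimes> h"] g h by (simp add: f_def)
      then show "f k + 1 \<le> f (k + 1)" "f (k + 1) \<le> f k + m" using g by (auto simp: m_def)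
    qed
    have grow: "f k + int n \<le> f (k + int n)" for k n
    proof (induction n)
      case (Suc n)
      then show ?case using st(1)[of "k + int n"] by (simp add: ac_simps)
    qed simp
    \<comment> \<open>Start where \<open>f\<close> is negative and take the first later index with a
      nonnegative value; one step raises \<open>f\<close> by at most \<open>m\<close>.\<close>
    define k0 where "k0 = - \<bar>f 0\<bar> - 1"
    have neg: "f k0 < 0" using grow[of k0 "nat (- k0)"] by (auto simp: k0_def)
    define P where "P n \<longleftrightarrow> 0 \<le> f (k0 + int n)" for n
    have "P (nat \<bar>f k0\<bar>)" using grow[of k0 "nat \<bar>f k0\<bar>"] by (auto simp: P_def)
    then have L: "P (LEAST n. P n)" by (rule LeastI)
    define n where "n = (LEAST n. P n)"
    have "n \<noteq> 0" using L neg unfolding n_def[symmetric] by (auto simp: P_def intro!: gr0I)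
    then obtain n' where n': "n = Suc n'" by (cases n) auto
    then have "\<not> P n'" unfolding n_def using not_less_Least[of n' P] by auto
    then have "f (k0 + int n) \<le> m" using st(2)[of "k0 + int n'"] by (simp add: P_def n' ac_simps)
    moreover have "0 \<le> f (k0 + int n)" using L by (simp add: P_def n_def)
    ultimately show ?thesis using g h by (intro exI[of _ "k0 + int n"]) (simp add: f_def)
  qed
  from elementary_groupI[OF g(1) slab _ this] show ?thesis by blast
qed (use elementary_if_finite in blast)

end

section \<open>A Busemann quasimorphism in the absence of short connecting elements\<close>

locale hyp_group = gen_group +
  fixes D :: int
  assumes hyp: "word.hyperbolic D"
begin

lemma D_nonneg: "0 \<le> D"
  using word.hyperbolicD[OF hyp one_closed one_closed one_closed one_closed] by (simp add: word.gp_def)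

lemma gp_one: "x \<in> carrier G \<Longrightarrow> y \<in> carrier G \<Longrightarrow> word.gp \<one> x y = int (len x) + int (len y) - dist x y"
  by (simp add: word.gp_def)

text \<open>Two uses of the four-point condition along the chain \<open>p\<close>, \<open>y\<close>,
  \<open>z\<close>, \<open>q\<close> seen from \<open>x\<close>.\<close>

lemma close_points:
  assumes "p \<in> carrier G" "q \<in> carrier G" "x \<in> carrier G" "y \<in> carrier G" "z \<in> carrier G"
  shows "dist p q \<le> dist p x + dist q x - min (word.gp x p y) (min (word.gp x y z) (word.gp x z q)) + 2 * D"
proof -
  have "min (word.gp x p y) (word.gp x y z) - D \<le> word.gp x p z"
    "min (word.gp x p z) (word.gp x z q) - D \<le> word.gp x p q"
    using word.hyperbolicD[OF hyp] assms by auto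
  moreover have "dist p q = dist p x + dist q x - word.gp x p q" by (simp add: word.gp_def)
  ultimately show ?thesis using D_nonneg by linarith
qed

text \<open>A translation \<open>a\<close> which moves the far away point \<open>y\<close> in a direction close to that of \<open>y\<close>
  shifts the geodesic from \<open>1\<close> to \<open>y\<close> along itself, by the amount \<open>len (a \<otimes> y) - len y\<close>.\<close>

lemma translate_geodesic:
  assumes a: "a \<in> carrier G" and y: "y \<in> carrier G" and u: "u \<in> carrier G" and v: "v \<in> carrier G"
    and j: "int (len (a \<otimes> y)) = int (len y) + j"
    and t: "int (len a) \<le> t" "t \<le> int (len y) + j" "t \<le> int (len y)"
    and far: "2 * t \<le> word.gp \<one> (a \<otimes> y) y"
    and uy: "int (len u) = t" "dist u y = int (len y) - t"
    and vy: "int (len v) = t - j" "dist v y = int (len y) - (t - j)"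
  shows "dist u (a \<otimes> v) \<le> 4 * D"
proof -
  have ay: "a \<otimes> y \<in> carrier G" and av: "a \<otimes> v \<in> carrier G" using a y v by auto
  \<comment> \<open>\<open>q\<close> is the point at distance \<open>t\<close> on a geodesic from 1
    to \<open>a \<otimes> y\<close>. Seen from 1 it is close to \<open>u\<close>, seen from
    \<open>a \<otimes> y\<close> it is close to \<open>a \<otimes> v\<close>, each time within
    \<open>2 * D\<close>.\<close>
  obtain q where q: "q \<in> carrier G" "dist \<one> q = t" "dist q (a \<otimes> y) = int (len y) + j - t"
    using word.d_between[of \<one> "a \<otimes> y" t] ay j t by auto
  have "dist u q \<le> dist u \<one> + dist q \<one>
      - min (word.gp \<one> u y) (min (word.gp \<one> y (a \<otimes> y)) (word.gp \<one> (a \<otimes> y) q)) + 2 * D"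
    using close_points u q y ay by blast
  moreover have "word.gp \<one> u y = 2 * t" using uy u y by (simp add: word.gp_def)
  moreover have "word.gp \<one> y (a \<otimes> y) = word.gp \<one> (a \<otimes> y) y" using y ay word.gp_commute by blast
  moreover have "word.gp \<one> (a \<otimes> y) q = 2 * t"
    using q ay j dist_commute[of q "a \<otimes> y"] by (simp add: word.gp_def)
  ultimately have uq: "dist u q \<le> 2 * D" using far u q uy by auto
  have avy: "dist (a \<otimes> v) (a \<otimes> y) = int (len y) - (t - j)" using dist_left[OF a v y] vy by simp
  have aay: "dist a (a \<otimes> y) = int (len y)" using a y by simp
  have aav: "dist a (a \<otimes> v) = t - j" using a v vy by simp
  have "dist q (a \<otimes> v) \<le> dist q (a \<otimes> y) + dist (a \<otimes> v) (a \<otimes> y)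
      - min (word.gp (a \<otimes> y) q \<one>) (min (word.gp (a \<otimes> y) \<one> a) (word.gp (a \<otimes> y) a (a \<otimes> v))) + 2 * D"
    using close_points q av ay a by blast
  moreover have "word.gp (a \<otimes> y) q \<one> = 2 * (int (len y) + j - t)"
    using q ay j dist_commute[of \<one> q] by (simp add: word.gp_def)
  moreover have "2 * (int (len y) + j - t) \<le> word.gp (a \<otimes> y) \<one> a"
  proof -
    have "int (len (a \<otimes> y)) \<ge> int (len y) - int (len a)"
      using word.d_tri[of a \<one> "a \<otimes> y"] a ay aay by simp
    moreover have "len (a \<otimes> y) \<le> len a + len y" using len_mult a y by blast
    ultimately have "j \<le> int (len a)" using j by linarith
    then show ?thesis using a y ay aay j t by (simp add: word.gp_def)
  qed
  moreover have "word.gp (a \<otimes> y) a (a \<otimes> v) = 2 * (int (len y) + j - t)"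
    using aay avy aav by (simp add: word.gp_def)
  ultimately have "dist q (a \<otimes> v) \<le> 2 * D" using q avy by auto
  then show ?thesis using uq word.d_tri[of u q "a \<otimes> v"] u q av by auto
qed

text \<open>Otherwise there are \<open>x N\<close>, \<open>y N\<close> for which every connecting
  element of length up to \<open>N\<close> fails. Then all \<open>a \<otimes> y N\<close> point in
  the direction of the inverse of \<open>x N\<close>, hence in a common direction, and
  \<open>len (a \<otimes> y N) - len (y N)\<close> behaves like a Busemann function. Its cluster
  value \<open>s\<close> is a quasimorphism. Elements with equal value send one geodesic point into
  a common small ball, so the fibres are finite and the group is elementary.\<close>

theorem almost_additive_products:
  assumes ne: "\<not> elementary_group G"
  shows "\<exists>C. \<forall>x\<in>carrier G. \<forall>y\<in>carrier G. \<exists>a\<in>carrier G.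
    len a \<le> C \<and> len x + len y \<le> len (x \<otimes> a \<otimes> y) + C"
proof (rule ccontr)
  assume "\<not> ?thesis"
  then have "\<forall>N. \<exists>x y. x \<in> carrier G \<and> y \<in> carrier G \<and> (\<forall>a\<in>carrier G. len a \<le> N \<longrightarrow>
      len (x \<otimes> a \<otimes> y) + N < len x + len y)"
    by (meson not_le)
  then obtain x y where X: "\<And>N. x N \<in> carrier G" and Y: "\<And>N. y N \<in> carrier G" and
    bad: "\<And>N a. a \<in> carrier G \<Longrightarrow> len a \<le> N \<Longrightarrow> len (x N \<otimes> a \<otimes> y N) + N < len (x N) + len (y N)"
    by metis
  have lenay: "\<bar>int (len (a \<otimes> z)) - int (len z)\<bar> \<le> int (len a)" if "a \<in> carrier G" "z \<in> carrier G" for a z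
    using word.d_tri[of a \<one> "a \<otimes> z"] word.d_tri[of \<one> a "a \<otimes> z"] that by auto
  have toward: "int N - int (len a) \<le> word.gp \<one> (inv (x N)) (a \<otimes> y N)"
    if "a \<in> carrier G" "len a \<le> N" for a N
  proof -
    have "dist (inv (x N)) (a \<otimes> y N) = int (len (x N \<otimes> a \<otimes> y N))"
      using X Y that by (simp add: dist_def m_assoc)
    then show ?thesis using bad[OF that] lenay[of a "y N"] X Y that by (simp add: gp_one)
  qed
  have close: "int N - int (max (len a) (len b)) - D \<le> word.gp \<one> (a \<otimes> y N) (b \<otimes> y N)"
    if "a \<in> carrier G" "b \<in> carrier G" "len a \<le> N" "len b \<le> N" for a b N
  proof -
    have "min (word.gp \<one> (a \<otimes> y N) (inv (x N))) (word.gp \<one> (inv (x N)) (b \<otimes> y N)) - D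
       \<le> word.gp \<one> (a \<otimes> y N) (b \<otimes> y N)"
      using word.hyperbolicD[OF hyp] X Y that by auto
    then show ?thesis
      using toward[of a N] toward[of b N] that X Y word.gp_commute[of "a \<otimes> y N" "inv (x N)"] by auto
  qed
  define f where "f N a = int (len (a \<otimes> y N)) - int (len (y N))" for N a
  have "countable (carrier G)"
  proof -
    have "countable (lists S)" using S_finite by (simp add: countable_finite countable_lists)
    then show ?thesis using ev_image by (metis countable_image)
  qed
  then obtain s where s: "\<And>F N0. finite F \<Longrightarrow> F \<subseteq> carrier G \<Longrightarrow> \<exists>N\<ge>N0. \<forall>a\<in>F. f N a = s a"
    using cluster_function[of "carrier G" f "\<lambda>a. int (len a)"] lenay Y unfolding f_def by metis
  \<comment> \<open>Points seen in nearly the same direction from 1 give Busemann differences at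
    \<open>g\<close> that agree up to \<open>D\<close>.\<close>
  have gp_diff: "\<bar>(dist g u - dist \<one> u) - (dist g v - dist \<one> v)\<bar> \<le> D"
    if "g \<in> carrier G" "u \<in> carrier G" "v \<in> carrier G" "2 * int (len g) \<le> word.gp \<one> u v" for g u v
  proof -
    have "min (word.gp \<one> g u) (word.gp \<one> u v) - D \<le> word.gp \<one> g v"
      "min (word.gp \<one> g v) (word.gp \<one> v u) - D \<le> word.gp \<one> g u"
      using word.hyperbolicD[OF hyp] that by auto
    moreover have "word.gp \<one> g w \<le> 2 * int (len g)" if "w \<in> carrier G" for w
      using word.d_tri[of \<one> g w] that \<open>g \<in> carrier G\<close> by (simp add: gp_one)
    then have "word.gp \<one> g u \<le> 2 * int (len g)" "word.gp \<one> g v \<le> 2 * int (len g)" using that by auto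
    ultimately show ?thesis
      using that word.gp_commute[of u v \<one>] by (auto simp: gp_one min_def split: if_splits)
  qed
  have quasi: "\<bar>s (a \<otimes> b) - s a - s b\<bar> \<le> D" if ab: "a \<in> carrier G" "b \<in> carrier G" for a b
  proof -
    define N0 where "N0 = 2 * len a + len b + nat D"
    obtain N where N: "N \<ge> N0" "f N a = s a" "f N b = s b" "f N (a \<otimes> b) = s (a \<otimes> b)"
      using s[of "{a, b, a \<otimes> b}" N0] ab by auto
    have "2 * int (len (inv a)) \<le> word.gp \<one> (b \<otimes> y N) (\<one> \<otimes> y N)"
      using close[of b \<one> N] N ab D_nonneg by (auto simp: N0_def)
    then have "\<bar>(dist (inv a) (b \<otimes> y N) - dist \<one> (b \<otimes> y N)) - (dist (inv a) (y N) - dist \<one> (y N))\<bar> \<le> D"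
      using gp_diff[of "inv a" "b \<otimes> y N" "y N"] ab Y by simp
    moreover have "dist (inv a) z = int (len (a \<otimes> z))" if "z \<in> carrier G" for z
      using ab that by (simp add: dist_def)
    ultimately have "\<bar>f N (a \<otimes> b) - f N a - f N b\<bar> \<le> D" using ab Y[of N] by (simp add: f_def m_assoc)
    then show ?thesis using N by simp
  qed
  have fibre: "card B \<le> ball_card (4 * D)" if B: "B \<subseteq> {a \<in> carrier G. s a = j}" "finite B" for B j
  proof -
    define t where "t = Max (insert 0 (len ` B)) + nat \<bar>j\<bar>"
    have t: "len a + nat \<bar>j\<bar> \<le> t" if "a \<in> B" for a using B(2) that by (auto simp: t_def)
    have tj: "nat \<bar>j\<bar> \<le> t" by (simp add: t_def)
    \<comment> \<open>\<open>6 * t\<close> forces \<open>len (y N) \<ge> 3 * t\<close>, leaving room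
      for geodesic points at distances \<open>t\<close> and \<open>t - j\<close>, and keeps the
      product of \<open>a \<otimes> y N\<close> and \<open>y N\<close> above
      \<open>2 * t\<close>.\<close>
    obtain N where N: "N \<ge> 6 * t + nat D" "\<And>a. a \<in> B \<Longrightarrow> f N a = j" using s[OF B(2)] B by fastforce
    have "2 * t + nat \<bar>j\<bar> \<le> len (y N)"
    proof -
      have "int N \<le> word.gp \<one> (inv (x N)) (y N)" using toward[of \<one> N] Y by simp
      also have "\<dots> \<le> 2 * int (len (y N))"
        using word.d_tri[of \<one> "y N" "inv (x N)"] X Y dist_commute[of "y N" "inv (x N)"] by (simp add: gp_one)
      finally show ?thesis using N tj by linarith
    qed
    note ly = this
    obtain u where u: "u \<in> carrier G" "dist \<one> u = int t" "dist u (y N) = int (len (y N)) - int t"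
      using word.d_between[of \<one> "y N" "int t"] Y ly by auto
    obtain v where v: "v \<in> carrier G" "dist \<one> v = int t - j" "dist v (y N) = int (len (y N)) - (int t - j)"
    proof -
      have "j \<le> int t" "int t - j \<le> int (len (y N))" using ly tj by linarith+
      then show ?thesis using that word.d_between[of \<one> "y N" "int t - j"] Y by auto
    qed
    have "dist u (a \<otimes> v) \<le> 4 * D" if a: "a \<in> B" for a
    proof (rule translate_geodesic[of a "y N" u v j "int t"])
      show "2 * int t \<le> word.gp \<one> (a \<otimes> y N) (y N)"
        using close[of a \<one> N] t[OF a] N D_nonneg a B Y by auto
      show "int (len (a \<otimes> y N)) = int (len (y N)) + j" using N(2)[OF a] by (simp add: f_def)
    qed (use a B Y u v t[OF a] ly in auto)
    then have "card ((\<lambda>a. a \<otimes> v) ` B) \<le> ball_card (4 * D)"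
      using B v u by (intro dist_ball'(2)[of _ u]) auto
    moreover have "inj_on (\<lambda>a. a \<otimes> v) B" using B v by (auto simp: inj_on_def subset_iff)
    ultimately show ?thesis by (simp add: card_image)
  qed
  have "finite {a \<in> carrier G. s a = j}" for j
    using fibre[of _ j] by (intro finite_if_finite_subsets_card_bdd[of _ "ball_card (4 * D)", THEN conjunct1]) auto
  with quasi ne show False using elementary_if_quasimorphism[of s D] by blast
qed

end

section \<open>Purely exponential growth\<close>

lemma card_le_fibres:
  assumes "finite A" "finite B" "f ` A \<subseteq> B" "\<And>b. b \<in> B \<Longrightarrow> card {a \<in> A. f a = b} \<le> K"
  shows "card A \<le> K * card B"
proof -
  have "A = (\<Union>b\<in>B. {a \<in> A. f a = b})" using assms(3) by auto
  then have "card A \<le> (\<Sum>b\<in>B. card {a \<in> A. f a = b})"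
    using card_UN_le[OF assms(2), of "\<lambda>b. {a \<in> A. f a = b}"] by simp
  also have "\<dots> \<le> (\<Sum>b\<in>B. K)" by (intro sum_mono assms)
  finally show ?thesis by (simp add: mult.commute)
qed

text \<open>Fekete's argument with \<open>l\<close> the infimum of the \<open>n\<close>-th roots,
  which gives the lower bound with constant 1. For the upper bound compare the two estimates of
  \<open>a (m * n)\<close>: they give \<open>(a m / K) ^ n \<le> a n ^ m\<close>, so the
  \<open>m\<close>-th root of \<open>a m / K\<close> is below every \<open>n\<close>-th
  root.\<close>

lemma growth_constant:
  fixes a :: "nat \<Rightarrow> real"
  assumes a1: "\<And>n. 1 \<le> a n" and K: "1 \<le> K"
    and sub: "\<And>m n. a (m + n) \<le> a m * a n" and sup: "\<And>m n. a m * a n \<le> K * a (m + n)"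
  shows "\<exists>l\<ge>1. \<forall>n. l ^ n \<le> a n \<and> a n \<le> K * l ^ n"
proof -
  define l where "l = (INF n\<in>{1..}. root n (a n))"
  have rt: "1 \<le> root n (a n)" if "n \<ge> 1" for n using a1[of n] that by simp
  have bdd: "bdd_below ((\<lambda>n. root n (a n)) ` {1..})" using rt by (intro bdd_belowI[of _ 1]) auto
  have l1: "1 \<le> l" unfolding l_def by (rule cINF_greatest) (use rt in auto)
  have a0: "0 < a n" for n using a1[of n] by linarith
  have low: "l ^ n \<le> a n" for n
  proof (cases "n = 0")
    case False
    then have "l \<le> root n (a n)" unfolding l_def by (intro cINF_lower bdd) auto
    then have "l ^ n \<le> root n (a n) ^ n" using l1 by (intro power_mono) auto
    then show ?thesis using False a0[of n] by simp
  qed (use a1 in auto)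
  have subp: "a (n * m) \<le> a n ^ m" if "m \<ge> 1" for n m
    using that
  proof (induction m rule: dec_induct)
    case (step m)
    have "a (n * Suc m) \<le> a n * a (n * m)" using sub[of n "n * m"] by simp
    also have "\<dots> \<le> a n * a n ^ m" using step a0[of n] by (intro mult_left_mono) auto
    finally show ?case by simp
  qed simp
  have supp: "a m ^ n \<le> K ^ n * a (m * n)" if "n \<ge> 1" for n m
    using that
  proof (induction n rule: dec_induct)
    case base
    have "1 * a m \<le> K * a m" using K a0[of m] by (intro mult_right_mono) auto
    then show ?case by simp
  next
    case (step n)
    have "a m ^ Suc n \<le> a m * (K ^ n * a (m * n))" using step a0[of m] by (simp add: mult_left_mono)
    also have "\<dots> = K ^ n * (a m * a (m * n))" by simp
    also have "\<dots> \<le> K ^ n * (K * a (m + m * n))" using sup K by (intro mult_left_mono) auto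
    finally show ?case by (simp add: mult.assoc mult.left_commute)
  qed
  have up: "a m \<le> K * l ^ m" for m
  proof (cases "m = 0")
    case True
    have "a 0 * a 0 \<le> K * a 0" using sup[of 0 0] by simp
    then show ?thesis using a0[of 0] True by simp
  next
    case False
    have "root m (a m / K) \<le> root n (a n)" if "n \<ge> 1" for n
    proof -
      have "a m ^ n \<le> K ^ n * a (n * m)" using supp[OF that, of m] by (simp add: mult.commute)
      also have "\<dots> \<le> K ^ n * a n ^ m" using subp[of m n] False K by (intro mult_left_mono) auto
      finally have "a m ^ n \<le> K ^ n * a n ^ m" .
      then have "(a m / K) ^ n \<le> a n ^ m" using K by (simp add: power_divide divide_le_eq mult.commute)
      then have "root (m * n) ((a m / K) ^ n) \<le> root (m * n) (a n ^ m)" using that False by simp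
      then have "root m (root n ((a m / K) ^ n)) \<le> root n (root m (a n ^ m))"
        using real_root_mult_exp[of m n] real_root_mult_exp[of n m] by (simp add: mult.commute)
      then show ?thesis
        using that False a0[of m] a0[of n] K by (simp add: real_root_power_cancel)
    qed
    then have "root m (a m / K) \<le> l" unfolding l_def by (intro cINF_greatest) auto
    then have "root m (a m / K) ^ m \<le> l ^ m" using a0[of m] K False by (intro power_mono) auto
    then have "a m / K \<le> l ^ m" using a0[of m] K False by simp
    then show ?thesis using K by (simp add: divide_le_eq mult.commute)
  qed
  show ?thesis using l1 low up by blast
qed

locale ext_group = hyp_group +
  fixes C :: nat
  assumes ext: "x \<in> carrier G \<Longrightarrow> y \<in> carrier G \<Longrightarrow>
      \<exists>a\<in>carrier G. len a \<le> C \<and> len x + len y \<le> len (x \<otimes> a \<otimes> y) + C"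
    and not_elementary: "\<not> elementary_group G"
begin

abbreviation "Sph \<equiv> word_sphere G S"

text \<open>Substitutes for words: \<open>prd\<close> plays the role of concatenation, with the
  short element \<open>mid\<close> inserted so that lengths nearly add, and \<open>pre\<close> that
  of passing to a prefix.\<close>

definition mid :: "'a \<Rightarrow> 'a \<Rightarrow> 'a" where
  "mid x y = (SOME a. a \<in> carrier G \<and> len a \<le> C \<and> len x + len y \<le> len (x \<otimes> a \<otimes> y) + C)"

definition prd :: "'a \<Rightarrow> 'a \<Rightarrow> 'a" where
  "prd x y = x \<otimes> mid x y \<otimes> y"

definition pre :: "'a \<Rightarrow> nat \<Rightarrow> 'a" where
  "pre y k = (SOME z. z \<in> carrier G \<and> len z = k \<and> dist z y = int (len y) - int k)"

lemma mid: assumes "x \<in> carrier G" "y \<in> carrier G"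
  shows "mid x y \<in> carrier G" "len (mid x y) \<le> C" "len x + len y \<le> len (prd x y) + C"
proof -
  have "mid x y \<in> carrier G \<and> len (mid x y) \<le> C \<and> len x + len y \<le> len (x \<otimes> mid x y \<otimes> y) + C"
    unfolding mid_def by (rule someI_ex) (use ext[OF assms] in blast)
  then show "mid x y \<in> carrier G" "len (mid x y) \<le> C" "len x + len y \<le> len (prd x y) + C"
    by (auto simp: prd_def)
qed

lemma prd: assumes "x \<in> carrier G" "y \<in> carrier G"
  shows prd_closed: "prd x y \<in> carrier G"
    and prd_le: "len (prd x y) \<le> len x + len y + C"
    and dist_prd: "dist x (prd x y) \<le> int C + int (len y)"
proof -
  note m = mid[OF assms]
  show "prd x y \<in> carrier G" using assms m by (simp add: prd_def)
  have e: "prd x y = x \<otimes> (mid x y \<otimes> y)" using assms m by (simp add: prd_def m_assoc)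
  have "len (mid x y \<otimes> y) \<le> C + len y" using len_mult[of "mid x y" y] m assms by linarith
  then show "dist x (prd x y) \<le> int C + int (len y)" "len (prd x y) \<le> len x + len y + C"
    using e assms m len_mult[of x "mid x y \<otimes> y"] by auto
qed

lemma pre: assumes "y \<in> carrier G" "k \<le> len y"
  shows "pre y k \<in> carrier G" "len (pre y k) = k" "dist (pre y k) y = int (len y) - int k"
proof -
  have "\<exists>z. z \<in> carrier G \<and> len z = k \<and> dist z y = int (len y) - int k"
    using word.d_between[of \<one> y "int k"] assms by auto
  then have "pre y k \<in> carrier G \<and> len (pre y k) = k \<and> dist (pre y k) y = int (len y) - int k"
    unfolding pre_def by (rule someI_ex)
  then show "pre y k \<in> carrier G" "len (pre y k) = k" "dist (pre y k) y = int (len y) - int k" by auto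
qed

text \<open>Both products with \<open>y\<close> from 1 are within \<open>R\<close> of their maximum
  \<open>2 * len z\<close>; the four-point condition carries this over to the pair.\<close>

lemma shadow_close:
  assumes "z \<in> carrier G" "z' \<in> carrier G" "y \<in> carrier G" "len z' = len z"
    and "int (len z) + dist z y \<le> int (len y) + R" "int (len z) + dist z' y \<le> int (len y) + R"
  shows "dist z z' \<le> R + D"
proof -
  have "min (word.gp \<one> z y) (word.gp \<one> y z') - D \<le> word.gp \<one> z z'"
    using word.hyperbolicD[OF hyp] assms by auto
  then show ?thesis using assms dist_commute[of y z'] by (auto simp: gp_one)
qed

definition prd_mult :: nat where
  "prd_mult = ball_card (2 * int C + D) * ball_card (int C)"

text \<open>In a pair with product \<open>z\<close> the first factor is nearly on a geodesic from 1
  to \<open>z\<close>, at the fixed distance \<open>k\<close>, so by \<open>shadow_close\<close> all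
  first factors lie in one ball of radius \<open>2 * C + D\<close>; first factor and connecting
  element determine the second.\<close>

lemma prd_fibre:
  assumes P: "P \<subseteq> Sph k \<times> carrier G"
  shows "finite {(x, y) \<in> P. prd x y = z}" "card {(x, y) \<in> P. prd x y = z} \<le> prd_mult"
proof -
  let ?F = "{(x, y) \<in> P. prd x y = z}"
  have *: "finite ?F \<and> card ?F \<le> prd_mult"
  proof (cases "?F = {}")
    case False
    then obtain x0 y0 where x0: "(x0, y0) \<in> P" "prd x0 y0 = z" by auto
    have x0': "x0 \<in> carrier G" "len x0 = k" "y0 \<in> carrier G" using P x0 by (auto simp: word_sphere_def)
    have z: "z \<in> carrier G" using prd_closed[of x0 y0] x0 x0' by auto
    have sh: "x \<in> carrier G \<and> len x = k \<and> y \<in> carrier G \<and> int k + dist x z \<le> int (len z) + 2 * int C"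
      if "(x, y) \<in> P" "prd x y = z" for x y
    proof -
      have x: "x \<in> carrier G" "len x = k" "y \<in> carrier G" using P that by (auto simp: word_sphere_def)
      show ?thesis using x mid(3)[OF x(1,3)] dist_prd[OF x(1,3)] that by auto
    qed
    let ?B = "{x \<in> carrier G. dist x0 x \<le> 2 * int C + D} \<times> {a \<in> carrier G. dist \<one> a \<le> int C}"
    have fB: "finite ?B" "card ?B \<le> prd_mult"
      using dist_ball[OF x0'(1)] dist_ball[OF one_closed]
      by (auto simp: card_cartesian_product prd_mult_def intro!: mult_le_mono)
    have inj: "inj_on (\<lambda>(x, y). (x, mid x y)) ?F"
    proof (rule inj_onI)
      fix q q' assume q: "q \<in> ?F" "q' \<in> ?F" "(\<lambda>(x, y). (x, mid x y)) q = (\<lambda>(x, y). (x, mid x y)) q'"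
      obtain x y y' where e: "q = (x, y)" "q' = (x, y')" "prd x y = prd x y'" "mid x y = mid x y'"
        using q by (cases q; cases q') auto
      then have "x \<in> carrier G" "y \<in> carrier G" "y' \<in> carrier G" using P q by (auto simp: word_sphere_def)
      then show "q = q'" using e mid(1)[of x y] by (auto simp: prd_def)
    qed
    have sub: "(\<lambda>(x, y). (x, mid x y)) ` ?F \<subseteq> ?B"
      using sh shadow_close[OF x0'(1) _ z] x0 x0' mid by auto
    show ?thesis
      using finite_imageD[OF finite_subset[OF sub fB(1)] inj] card_image[OF inj] card_mono[OF fB(1) sub] fB(2)
      by auto
  next
    case True
    then show ?thesis by (simp only: finite.emptyI card.empty le0 simp_thms)
  qed
  then show "finite ?F" "card ?F \<le> prd_mult" by auto
qed

lemma infinite_carrier: "infinite (carrier G)"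
  using elementary_if_finite not_elementary by blast

lemma sphere_nonempty: "Sph n \<noteq> {}"
proof -
  have "\<not> carrier G \<subseteq> word_ball G S n" using infinite_carrier finite_ball finite_subset by blast
  then obtain y where "y \<in> carrier G" "y \<notin> word_ball G S n" by blast
  then have "y \<in> carrier G" "n < len y" by (auto simp: word_ball_def)
  then have "pre y n \<in> Sph n" using pre[of y n] by (auto simp: word_sphere_def)
  then show ?thesis by blast
qed

lemma card_sphere_pos: "1 \<le> card (Sph n)"
  using sphere_nonempty[of n] finite_sphere[of n] by (simp add: Suc_le_eq card_gt_0_iff)

text \<open>Products may fall short by \<open>C\<close>, so second factors will be taken
  \<open>C\<close> longer; this lemma pays for it. Multiply by a fixed element of length
  \<open>2 * C\<close> and truncate at \<open>m + C\<close>: points move by at most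
  \<open>3 * C + 2 * C\<close>.\<close>

lemma card_sphere_shift: "card (Sph m) \<le> ball_card (5 * int C) * card (Sph (m + C))"
proof -
  obtain y where y: "y \<in> carrier G" "len y = 2 * C" using sphere_nonempty[of "2 * C"] by (auto simp: word_sphere_def)
  define f where "f x = pre (prd x y) (m + C)" for x
  have f: "f x \<in> Sph (m + C)" "dist (f x) x \<le> 5 * int C" if "x \<in> Sph m" for x
  proof -
    have x: "x \<in> carrier G" "len x = m" using that by (auto simp: word_sphere_def)
    have w: "prd x y \<in> carrier G" "m + C \<le> len (prd x y)" "len (prd x y) \<le> m + 3 * C"
      "dist x (prd x y) \<le> 3 * int C"
      using prd[OF x(1) y(1)] mid[OF x(1) y(1)] x y by auto
    note p = pre[OF w(1,2)]
    show "f x \<in> Sph (m + C)" using p by (simp add: f_def word_sphere_def)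
    show "dist (f x) x \<le> 5 * int C"
      using word.d_tri[of "f x" "prd x y" x] dist_commute[of "prd x y" x] p w x by (auto simp: f_def)
  qed
  show ?thesis
  proof (rule card_le_fibres[of _ _ f])
    fix b assume "b \<in> Sph (m + C)"
    then show "card {a \<in> Sph m. f a = b} \<le> ball_card (5 * int C)"
      using f(2) by (intro dist_ball'(2)[of _ b]) (auto simp: word_sphere_def)
  qed (use f finite_sphere in auto)
qed

text \<open>Truncated product: for factors of lengths \<open>m\<close> and \<open>n + C\<close> the
  product reaches length \<open>m + n\<close>, and cutting there lands exactly on that
  sphere.\<close>

definition tprd :: "nat \<Rightarrow> 'a \<times> 'a \<Rightarrow> 'a" where
  "tprd n q = pre (prd (fst q) (snd q)) n"

lemma tprd:
  assumes "x \<in> Sph m" "y \<in> Sph (n + C)"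
  shows "tprd (m + n) (x, y) \<in> Sph (m + n)"
    and "dist (tprd (m + n) (x, y)) (prd x y) \<le> 2 * int C"
    and "dist x (tprd (m + n) (x, y)) \<le> int n + 4 * int C"
proof -
  have q: "x \<in> carrier G" "y \<in> carrier G" "len x = m" "len y = n + C"
    using assms by (auto simp: word_sphere_def)
  have w: "prd x y \<in> carrier G" "m + n \<le> len (prd x y)" "len (prd x y) \<le> m + n + 2 * C"
    using prd[OF q(1,2)] mid[OF q(1,2)] q by auto
  note p = pre[OF w(1,2)]
  show "tprd (m + n) (x, y) \<in> Sph (m + n)" "dist (tprd (m + n) (x, y)) (prd x y) \<le> 2 * int C"
    using p w by (auto simp: tprd_def word_sphere_def)
  then show "dist x (tprd (m + n) (x, y)) \<le> int n + 4 * int C"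
    using word.d_tri[of x "prd x y" "tprd (m + n) (x, y)"] p w q dist_prd[OF q(1,2)]
      dist_commute[of "prd x y" "tprd (m + n) (x, y)"]
    by (auto simp: tprd_def)
qed

definition tprd_mult :: nat where
  "tprd_mult = ball_card (2 * int C) * prd_mult"

text \<open>A value of \<open>tprd\<close> is within \<open>2 * C\<close> of the untruncated
  product, so its fibre is covered by boundedly many fibres of \<open>prd\<close>.\<close>

lemma tprd_count:
  assumes P: "P \<subseteq> Sph m \<times> Sph (n + C)" and B: "tprd (m + n) ` P \<subseteq> B" "B \<subseteq> carrier G" "finite B"
  shows "card P \<le> tprd_mult * card B"
proof (rule card_le_fibres[of _ _ "tprd (m + n)"])
  fix p assume "p \<in> B"
  then have pc: "p \<in> carrier G" using B by auto
  let ?W = "{w \<in> carrier G. dist p w \<le> 2 * int C}"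
  have P': "P \<subseteq> Sph m \<times> carrier G" using P by (auto simp: word_sphere_def)
  have "{q \<in> P. tprd (m + n) q = p} \<subseteq> (\<Union>w\<in>?W. {(x, y) \<in> P. prd x y = w})"
  proof
    fix q assume q: "q \<in> {q \<in> P. tprd (m + n) q = p}"
    obtain x y where qq: "q = (x, y)" by (cases q) auto
    then have xy: "x \<in> Sph m" "y \<in> Sph (n + C)" using q P by auto
    then show "q \<in> (\<Union>w\<in>?W. {(x, y) \<in> P. prd x y = w})"
      using tprd[OF xy] q qq prd_closed[of x y] by (auto simp: word_sphere_def)
  qed
  then have "card {q \<in> P. tprd (m + n) q = p} \<le> card (\<Union>w\<in>?W. {(x, y) \<in> P. prd x y = w})"
    using prd_fibre(1)[OF P'] dist_ball(1)[OF pc] by (intro card_mono finite_UN_I) auto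
  also have "\<dots> \<le> (\<Sum>w\<in>?W. card {(x, y) \<in> P. prd x y = w})" using dist_ball(1)[OF pc] by (rule card_UN_le)
  also have "\<dots> \<le> (\<Sum>w\<in>?W. prd_mult)" by (intro sum_mono prd_fibre[OF P'])
  also have "\<dots> \<le> tprd_mult" using dist_ball(2)[OF pc] by (simp add: tprd_mult_def)
  finally show "card {q \<in> P. tprd (m + n) q = p} \<le> tprd_mult" .
qed (use B P finite_sphere in \<open>auto intro: finite_subset\<close>)

lemma card_sphere_supermult: "\<exists>K\<ge>1. \<forall>m n. card (Sph m) * card (Sph n) \<le> K * card (Sph (m + n))"
proof -
  define K where "K = tprd_mult"
  have *: "card (Sph m) * card (Sph (n + C)) \<le> K * card (Sph (m + n))" for m n
    using tprd_count[of "Sph m \<times> Sph (n + C)" m n "Sph (m + n)"] tprd(1)[of _ m _ n] finite_sphere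
    by (auto simp: K_def card_cartesian_product word_sphere_def)
  define K' where "K' = max 1 (ball_card (5 * int C) * K)"
  have "card (Sph m) * card (Sph n) \<le> K' * card (Sph (m + n))" for m n
  proof -
    have "card (Sph m) * card (Sph n) \<le> card (Sph m) * (ball_card (5 * int C) * card (Sph (n + C)))"
      using card_sphere_shift by (intro mult_le_mono) auto
    also have "\<dots> = ball_card (5 * int C) * (card (Sph m) * card (Sph (n + C)))" by simp
    also have "\<dots> \<le> ball_card (5 * int C) * (K * card (Sph (m + n)))" by (intro mult_le_mono * order_refl)
    also have "\<dots> \<le> K' * card (Sph (m + n))" unfolding K'_def
      by (metis max.cobounded2 mult.assoc mult_le_mono1)
    finally show ?thesis .
  qed
  then show ?thesis by (intro exI[of _ K']) (auto simp: K'_def)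
qed

text \<open>A bounded growth of the spheres is excluded by counting the elements \<open>w\<^sup>i h\<close>, where \<open>h\<close> runs
  over the prefixes of an element that is shortest in its coset modulo the powers of \<open>w\<close>.\<close>

lemma spheres_unbounded:
  assumes w: "w \<in> carrier G" and inj: "\<And>i j :: nat. w [^] i = w [^] j \<Longrightarrow> i = j"
  shows "\<exists>n. K < card (Sph n)"
proof (rule ccontr)
  assume "\<not> ?thesis"
  then have K: "card (Sph n) \<le> K" for n by (auto simp: not_less)
  define m where "m = len w + 1"
  have "n * n \<le> (n * m + 1) * K" for n
  proof -
    have "\<exists>h\<in>carrier G. \<forall>k::int. w [^] k \<otimes> h \<notin> word_ball G S n"
      using elementary_groupI[OF w finite_ball[of n]] not_elementary by (auto simp: word_ball_def)
    then obtain h0 where h0: "h0 \<in> carrier G" "\<And>k::int. n < len (w [^] k \<otimes> h0)"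
      using w by (auto simp: word_ball_def not_le)
    \<comment> \<open>This makes \<open>h\<close> shortest in its coset; it is longer than
      \<open>n\<close>, as no element of the coset lies in the ball of radius
      \<open>n\<close>.\<close>
    define k0 where "k0 = arg_min (\<lambda>k::int. len (w [^] k \<otimes> h0)) (\<lambda>_. True)"
    have k0: "len (w [^] k0 \<otimes> h0) \<le> len (w [^] k \<otimes> h0)" for k :: int
      unfolding k0_def using arg_min_nat_le[of "\<lambda>_. True" k "\<lambda>k. len (w [^] k \<otimes> h0)"] by simp
    define h where "h = w [^] k0 \<otimes> h0"
    have h: "h \<in> carrier G" "n < len h" using h0 w by (auto simp: h_def)
    have hmin: "len h \<le> len (w [^] k \<otimes> h)" for k :: int
    proof -
      have "w [^] k \<otimes> h = w [^] (k + k0) \<otimes> h0" using w h0 by (simp add: h_def int_pow_mult m_assoc)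
      then show ?thesis using k0 by (simp add: h_def)
    qed
    \<comment> \<open>If a power of \<open>w\<close> shortened a prefix of \<open>h\<close>, it
      would shorten \<open>h\<close> too. So \<open>pre h r\<close> is shortest in its own coset,
      and \<open>w [^] i \<otimes> pre h r\<close> determines \<open>r\<close> as the minimal length
      there.\<close>
    have premin: "r \<le> len (w [^] k \<otimes> pre h r)" if "r \<le> n" for r and k :: int
    proof -
      note p = pre[of h r]
      have p: "pre h r \<in> carrier G" "len (pre h r) = r" "dist (pre h r) h = int (len h) - int r"
        using p h that by auto
      have "dist \<one> (w [^] k \<otimes> h) \<le> dist \<one> (w [^] k \<otimes> pre h r) + dist (w [^] k \<otimes> pre h r) (w [^] k \<otimes> h)"
        using p h w by (intro word.d_tri) auto
      then show ?thesis using dist_left[of "w [^] k" "pre h r" h] p h w hmin[of k] by auto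
    qed
    define f where "f = (\<lambda>(i::nat, r). w [^] i \<otimes> pre h r)"
    have fc: "pre h r \<in> carrier G \<and> len (pre h r) = r" if "r < n" for r using pre[of h r] h that by auto
    have rr: "r \<le> r'" if "w [^] (i::nat) \<otimes> pre h r = w [^] (i'::nat) \<otimes> pre h r'" "r < n" "r' < n" for i i' r r'
    proof -
      have "w [^] (int i' - int i) \<otimes> pre h r' = inv (w [^] i) \<otimes> (w [^] i' \<otimes> pre h r')"
        using fc[OF that(2)] fc[OF that(3)] w int_pow_mult[of w "- int i" "int i'"]
        by (simp add: int_pow_neg int_pow_int m_assoc add.commute)
      also have "\<dots> = pre h r" using that fc w by (metis inv_closed inv_solve_left' nat_pow_closed m_closed)
      finally have e: "w [^] (int i' - int i) \<otimes> pre h r' = pre h r" .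
      then have "w [^] (int i - int i') \<otimes> pre h r = w [^] (int i - int i') \<otimes> (w [^] (int i' - int i) \<otimes> pre h r')"
        by simp
      also have "\<dots> = pre h r'" using fc[OF that(3)] w int_pow_mult[of w "int i - int i'" "int i' - int i"]
        by (simp add: m_assoc[symmetric])
      finally show ?thesis using premin[of r "int i - int i'"] premin[of r "0"] e that fc
        by (metis less_imp_le premin)
    qed
    have "inj_on f ({..<n} \<times> {..<n})"
    proof (rule inj_onI)
      fix q q' assume q: "q \<in> {..<n} \<times> {..<n}" "q' \<in> {..<n} \<times> {..<n}" "f q = f q'"
      obtain i r i' r' where qq: "q = (i, r)" "q' = (i', r')" by (cases q; cases q') auto
      with q have e: "w [^] i \<otimes> pre h r = w [^] i' \<otimes> pre h r'" "r < n" "r' < n" by (auto simp: f_def)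
      then have "r = r'" using rr[OF e] rr[OF e(1)[symmetric]] by auto
      moreover have "w [^] i = w [^] i'" using e fc w \<open>r = r'\<close> by simp
      ultimately show "q = q'" using inj qq by blast
    qed
    then have "n * n = card (f ` ({..<n} \<times> {..<n}))" by (simp add: card_image card_cartesian_product)
    also have "\<dots> \<le> card (\<Union>j\<in>{..n * m}. Sph j)"
    proof (intro card_mono image_subsetI)
      fix q assume "q \<in> {..<n} \<times> {..<n}"
      then obtain i r where q: "q = (i, r)" "i < n" "r < n" by auto
      have "len (w [^] i) \<le> i * len w" for i :: nat
      proof (induction i)
        case (Suc i)
        then show ?case using len_mult[of "w [^] i" w] w by auto
      qed simp
      then have "len (f q) \<le> i * len w + r"
        using len_mult[of "w [^] i" "pre h r"] fc[OF q(3)] w by (fastforce simp: f_def q intro: order_trans)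
      also have "\<dots> \<le> n * m" using q mult_le_mono1[of i n "len w"] unfolding m_def by (simp only: distrib_left) linarith
      finally show "f q \<in> (\<Union>j\<in>{..n * m}. Sph j)" using fc[OF q(3)] w by (auto simp: word_sphere_def f_def q)
    qed (use finite_sphere in auto)
    also have "\<dots> \<le> (\<Sum>j\<in>{..n * m}. card (Sph j))" by (rule card_UN_le) simp
    also have "\<dots> \<le> (\<Sum>j\<in>{..n * m}. K)" by (intro sum_mono K)
    finally show ?thesis by simp
  qed
  \<comment> \<open>Quadratically many elements in a ball of linear radius contradict
    \<open>K\<close> elements per sphere for this \<open>n\<close>.\<close>
  from this[of "(m + 1) * K + 1"] show False by (simp add: algebra_simps)
qed

text \<open>Sub- and supermultiplicativity give \<open>l\<close> by \<open>growth_constant\<close>;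
  \<open>l = 1\<close> would bound the spheres, which an element of infinite order excludes.
  \<open>growth_rate\<close> is a definite description, so \<open>cmp\<close> supplies uniqueness:
  the ratio of two candidates has bounded powers.\<close>

theorem coornaert:
  assumes w: "w \<in> carrier G" and inj: "\<And>i j :: nat. w [^] i = w [^] j \<Longrightarrow> i = j"
  shows "\<exists>K\<ge>1. 1 < growth_rate G S \<and>
    (\<forall>n. growth_rate G S ^ n \<le> real (card (Sph n)) \<and> real (card (Sph n)) \<le> K * growth_rate G S ^ n)"
proof -
  obtain K where K: "1 \<le> K" "\<And>m n. card (Sph m) * card (Sph n) \<le> K * card (Sph (m + n))"
    using card_sphere_supermult by blast
  have "\<exists>l\<ge>1. \<forall>n. l ^ n \<le> real (card (Sph n)) \<and> real (card (Sph n)) \<le> real K * l ^ n"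
  proof (rule growth_constant)
    show "1 \<le> real (card (Sph n))" for n using card_sphere_pos[of n] by simp
    show "real (card (Sph (m + n))) \<le> real (card (Sph m)) * real (card (Sph n))" for m n
      using card_sphere_submult[of m n] by (simp flip: of_nat_mult)
    show "real (card (Sph m)) * real (card (Sph n)) \<le> real K * real (card (Sph (m + n)))" for m n
      using K(2)[of m n] by (simp flip: of_nat_mult)
  qed (use K in auto)
  then obtain l where l: "1 \<le> l" "\<And>n. l ^ n \<le> real (card (Sph n))" "\<And>n. real (card (Sph n)) \<le> real K * l ^ n"
    by blast
  have l1: "1 < l"
  proof (rule ccontr)
    assume "\<not> 1 < l"
    then have "l = 1" using l by simp
    then have "card (Sph n) \<le> K" for n using l(3)[of n] by simp
    then show False using spheres_unbounded[OF w inj, of K] by (simp add: not_less[symmetric])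
  qed
  have cmp: "l1 \<le> l2" if "1 < l1" "1 < l2" "\<And>n. n \<ge> 1 \<Longrightarrow> l1 ^ n \<le> B * l2 ^ n" for l1 l2 B :: real
  proof (rule ccontr)
    assume "\<not> l1 \<le> l2"
    then have "1 < l1 / l2" using that by simp
    then obtain n where n: "B < (l1 / l2) ^ n" using real_arch_pow by blast
    also have "\<dots> \<le> (l1 / l2) ^ max 1 n" using \<open>1 < l1 / l2\<close> by (intro power_increasing) auto
    finally have "B < (l1 / l2) ^ max 1 n" .
    moreover have "(l1 / l2) ^ max 1 n \<le> B" using that(3)[of "max 1 n"] that by (simp add: power_divide divide_le_eq)
    ultimately show False by simp
  qed
  have "growth_rate G S = l"
    unfolding growth_rate_def
  proof (rule the_equality)
    have "inverse (real K) * l ^ n \<le> real (card (Sph n))" for n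
    proof -
      have "inverse (real K) * l ^ n \<le> 1 * l ^ n" using K(1) l1 by (intro mult_right_mono) (auto simp: inverse_le_1_iff)
      then show ?thesis using l(2)[of n] by simp
    qed
    then show "1 < l \<and> (\<exists>K\<ge>1. \<forall>n\<ge>1. inverse K * l ^ n \<le> real (card (Sph n)) \<and> real (card (Sph n)) \<le> K * l ^ n)"
      using l1 l(3) K(1) by (intro conjI exI[of _ "real K"]) auto
    fix l' assume "1 < l' \<and> (\<exists>K\<ge>1. \<forall>n\<ge>1. inverse K * l' ^ n \<le> real (card (Sph n)) \<and> real (card (Sph n)) \<le> K * l' ^ n)"
    then obtain K' where l': "1 < l'" "1 \<le> K'" "\<And>n. n \<ge> 1 \<Longrightarrow> inverse K' * l' ^ n \<le> real (card (Sph n))"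
      "\<And>n. n \<ge> 1 \<Longrightarrow> real (card (Sph n)) \<le> K' * l' ^ n" by blast
    have "l' ^ n \<le> K' * real K * l ^ n" if "n \<ge> 1" for n
      using order_trans[OF l'(3)[OF that] l(3)[of n]] l'(2) by (simp add: field_simps)
    moreover have "l ^ n \<le> K' * l' ^ n" if "n \<ge> 1" for n
      using order_trans[OF l(2)[of n] l'(4)[OF that]] .
    ultimately show "l' = l" using cmp[of l' l "K' * real K"] cmp[of l l' K'] l' l1 by (meson order_antisym)
  qed
  then show ?thesis using l l1 K(1) by (intro exI[of _ "real K"]) auto
qed

end

section \<open>Overlap of positive density subtrees\<close>

locale growth_group = ext_group +
  fixes l K :: real
  assumes l: "1 < l" and K: "1 \<le> K"
    and sphere_lower: "l ^ n \<le> real (card (Sph n))"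
    and sphere_upper: "real (card (Sph n)) \<le> K * l ^ n"
begin

text \<open>The slack \<open>4 * C\<close> is what \<open>tprd\<close> produces from a first factor
  \<open>z\<close>.\<close>

definition shadow :: "'a \<Rightarrow> nat \<Rightarrow> 'a set" where
  "shadow z N = {y \<in> Sph N. int (len z) + dist z y \<le> int N + 4 * int C}"

lemma finite_shadow: "finite (shadow z N)"
  using finite_sphere[of N] by (rule finite_subset[rotated]) (auto simp: shadow_def)

lemma shadow_large:
  assumes z: "z \<in> carrier G" "len z \<le> N"
  shows "l ^ (N - len z) \<le> real tprd_mult * real (card (shadow z N))"
proof -
  let ?P = "{z} \<times> Sph (N - len z + C)"
  have zz: "z \<in> Sph (len z)" using z by (simp add: word_sphere_def)
  have P: "?P \<subseteq> Sph (len z) \<times> Sph (N - len z + C)" using zz by auto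
  have N: "len z + (N - len z) = N" using z by simp
  have "tprd N ` ?P \<subseteq> shadow z N"
  proof (intro image_subsetI)
    fix q assume "q \<in> ?P"
    then obtain y where y: "q = (z, y)" "y \<in> Sph (N - len z + C)" by auto
    show "tprd N q \<in> shadow z N" using tprd[OF zz y(2)] y z by (auto simp: shadow_def N of_nat_diff)
  qed
  moreover have "shadow z N \<subseteq> carrier G" by (auto simp: shadow_def word_sphere_def)
  ultimately have "card ?P \<le> tprd_mult * card (shadow z N)"
    using tprd_count[OF P, of "shadow z N"] finite_shadow unfolding N by blast
  then have "card (Sph (N - len z + C)) \<le> tprd_mult * card (shadow z N)" by (simp add: card_cartesian_product)
  then have "real (card (Sph (N - len z + C))) \<le> real tprd_mult * real (card (shadow z N))"
    by (simp flip: of_nat_mult)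
  moreover have "l ^ (N - len z) \<le> l ^ (N - len z + C)" using l by (intro power_increasing) auto
  ultimately show ?thesis using sphere_lower[of "N - len z + C"] by linarith
qed

text \<open>Closure under some geodesic ancestor on every level from \<open>r\<close> on. Below
  \<open>r\<close> nothing is asked, since a tree of walks starts at the end of a path of length
  \<open>r\<close>.\<close>

definition rooted_tree :: "nat \<Rightarrow> 'a set \<Rightarrow> bool" where
  "rooted_tree r T \<longleftrightarrow> T \<subseteq> carrier G \<and>
     (\<forall>x\<in>T. \<forall>k\<in>{r..len x}. \<exists>x'\<in>T. len x' = k \<and> dist x' x = int (len x) - int k)"

text \<open>\<open>tree_nbhd T k N\<close> is, up to a bounded error, the set of elements of length \<open>N\<close> whose prefix of
  length \<open>k\<close> is close to \<open>T\<close>. It decreases with \<open>k\<close>.\<close>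

definition tree_nbhd :: "'a set \<Rightarrow> nat \<Rightarrow> nat \<Rightarrow> 'a set" where
  "tree_nbhd T k N = {y \<in> Sph N. \<exists>x\<in>T. len x = k \<and> int k + dist x y \<le> int N + 6 * int C}"

lemma finite_tree_nbhd: "finite (tree_nbhd T k N)"
  using finite_sphere[of N] by (rule finite_subset[rotated]) (auto simp: tree_nbhd_def)

lemma tree_nbhd_antimono:
  assumes T: "rooted_tree r T" and k: "r \<le> k" "k \<le> k'"
  shows "tree_nbhd T k' N \<subseteq> tree_nbhd T k N"
proof
  fix y assume "y \<in> tree_nbhd T k' N"
  then obtain x where x: "y \<in> Sph N" "x \<in> T" "len x = k'" "int k' + dist x y \<le> int N + 6 * int C"
    by (auto simp: tree_nbhd_def)
  obtain x' where x': "x' \<in> T" "len x' = k" "dist x' x = int k' - int k"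
    using T x k by (force simp: rooted_tree_def)
  have "dist x' y \<le> dist x' x + dist x y"
    using x x' T by (intro word.d_tri) (auto simp: rooted_tree_def word_sphere_def)
  then show "y \<in> tree_nbhd T k N" using x x' by (auto simp: tree_nbhd_def)
qed

text \<open>The cardinalities divided by \<open>l ^ N\<close> lie between 0 and \<open>K\<close> and
  decrease with the level. If no level were stable, each would be followed by one that loses another
  \<epsilon>, and more than \<open>K / \<epsilon>\<close> losses are impossible.\<close>

lemma tree_nbhd_stabilizes:
  assumes T: "rooted_tree r T" and \<epsilon>: "0 < \<epsilon>"
  shows "\<exists>k0\<ge>r. \<forall>k\<ge>k0. \<exists>N\<ge>k.
    real (card (tree_nbhd T k0 N)) - real (card (tree_nbhd T k N)) \<le> \<epsilon> * l ^ N"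
proof (rule ccontr)
  assume "\<not> ?thesis"
  then have drop: "\<exists>k\<ge>k0. \<forall>N\<ge>k. \<epsilon> * l ^ N < real (card (tree_nbhd T k0 N)) - real (card (tree_nbhd T k N))"
    if "k0 \<ge> r" for k0
    using that by (meson not_le)
  have iter: "\<exists>k\<ge>r. \<forall>N\<ge>k. real j * \<epsilon> * l ^ N \<le> real (card (tree_nbhd T r N)) - real (card (tree_nbhd T k N))" for j
  proof (induction j)
    case (Suc j)
    then obtain k where k: "k \<ge> r"
      "\<And>N. N \<ge> k \<Longrightarrow> real j * \<epsilon> * l ^ N \<le> real (card (tree_nbhd T r N)) - real (card (tree_nbhd T k N))" by blast
    obtain k' where k': "k' \<ge> k"
      "\<And>N. N \<ge> k' \<Longrightarrow> \<epsilon> * l ^ N < real (card (tree_nbhd T k N)) - real (card (tree_nbhd T k' N))"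
      using drop[OF k(1)] by blast
    have "real (Suc j) * \<epsilon> * l ^ N \<le> real (card (tree_nbhd T r N)) - real (card (tree_nbhd T k' N))"
      if "N \<ge> k'" for N
    proof -
      have "real (Suc j) * \<epsilon> * l ^ N = real j * \<epsilon> * l ^ N + \<epsilon> * l ^ N" by (simp add: algebra_simps)
      then show ?thesis using k(2)[of N] k'(2)[OF that] that k'(1) by linarith
    qed
    then show ?case using k k' by (intro exI[of _ k']) auto
  qed auto
  obtain j :: nat where j: "K < real j * \<epsilon>" using \<epsilon> ex_less_of_nat_mult by blast
  obtain k where k: "real j * \<epsilon> * l ^ k \<le> real (card (tree_nbhd T r k)) - real (card (tree_nbhd T k k))"
    using iter[of j] by blast
  have "card (tree_nbhd T r k) \<le> card (Sph k)" by (intro card_mono finite_sphere) (auto simp: tree_nbhd_def)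
  then have "real j * \<epsilon> * l ^ k \<le> K * l ^ k" using k sphere_upper[of k] by linarith
  then show False using j l by (simp add: mult_le_cancel_right)
qed

text \<open>Elements that descend from level \<open>k0\<close> of \<open>T\<close> but have strayed
  from \<open>T\<close>; \<open>6 * C + D\<close> is the distance that \<open>shadow_close\<close>
  yields for the slack of \<open>tree_nbhd\<close>.\<close>

definition bad :: "'a set \<Rightarrow> nat \<Rightarrow> nat \<Rightarrow> 'a set" where
  "bad T k0 k = {z \<in> Sph k. (\<exists>x\<in>T. len x = k0 \<and> int k0 + dist x z \<le> int k + 2 * int C) \<and>
     (\<forall>t\<in>T. 6 * int C + D < dist z t)}"

lemma finite_bad: "finite (bad T k0 k)"
  using finite_sphere[of k] by (rule finite_subset[rotated]) (auto simp: bad_def)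

text \<open>The shadow of such an element lies in \<open>tree_nbhd T k0 N\<close> and misses
  \<open>tree_nbhd T k N\<close>, because a point of \<open>T\<close> near the same geodesic would
  be too close. Shadows have size at least of order \<open>l ^ (N - k)\<close> and bounded overlap,
  so stability of the neighbourhoods leaves few bad elements.\<close>

lemma card_bad:
  assumes T: "rooted_tree r T" and k: "r \<le> k0" "k0 \<le> k" "k \<le> N"
    and st: "real (card (tree_nbhd T k0 N)) - real (card (tree_nbhd T k N)) \<le> \<epsilon> * l ^ N"
  shows "real (card (bad T k0 k)) \<le> real tprd_mult * real (ball_card (4 * int C + D)) * \<epsilon> * l ^ k"
proof -
  have Tc: "t \<in> carrier G" if "t \<in> T" for t using T that by (auto simp: rooted_tree_def)
  let ?Y = "tree_nbhd T k0 N - tree_nbhd T k N"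
  have sh: "shadow z N \<subseteq> ?Y" if z: "z \<in> bad T k0 k" for z
  proof
    fix y assume y: "y \<in> shadow z N"
    have zc: "z \<in> carrier G" "len z = k" using z by (auto simp: bad_def word_sphere_def)
    have yc: "y \<in> Sph N" "y \<in> carrier G" "len y = N" "int k + dist z y \<le> int N + 4 * int C"
      using y zc by (auto simp: shadow_def word_sphere_def)
    obtain x where x: "x \<in> T" "len x = k0" "int k0 + dist x z \<le> int k + 2 * int C"
      using z by (auto simp: bad_def)
    have "dist x y \<le> dist x z + dist z y" using x zc yc Tc by (intro word.d_tri) auto
    then have "y \<in> tree_nbhd T k0 N" using x yc by (auto simp: tree_nbhd_def intro!: bexI[of _ x])
    moreover have "y \<notin> tree_nbhd T k N"
    proof
      assume "y \<in> tree_nbhd T k N"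
      then obtain t where t: "t \<in> T" "len t = k" "int k + dist t y \<le> int N + 6 * int C"
        by (auto simp: tree_nbhd_def)
      then have "dist z t \<le> 6 * int C + D" using zc yc Tc by (intro shadow_close[of z t y]) auto
      then show False using z t by (auto simp: bad_def)
    qed
    ultimately show "y \<in> ?Y" by blast
  qed
  let ?\<Sigma> = "SIGMA z:bad T k0 k. shadow z N"
  have "card ?\<Sigma> \<le> ball_card (4 * int C + D) * card ?Y"
  proof (rule card_le_fibres[of _ _ snd])
    fix y assume "y \<in> ?Y"
    then have y: "y \<in> carrier G" "len y = N" by (auto simp: tree_nbhd_def word_sphere_def)
    let ?F = "{q \<in> ?\<Sigma>. snd q = y}"
    show "card ?F \<le> ball_card (4 * int C + D)"
    proof (cases "?F = {}")
      case False
      then obtain z0 where z0: "z0 \<in> bad T k0 k" "y \<in> shadow z0 N" by auto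
      have "card (fst ` ?F) \<le> ball_card (4 * int C + D)"
      proof (rule dist_ball'(2)[of _ z0])
        fix z assume "z \<in> fst ` ?F"
        then have "z \<in> bad T k0 k" "y \<in> shadow z N" by auto
        then show "z \<in> carrier G \<and> dist z0 z \<le> 4 * int C + D"
          using z0 y by (auto simp: bad_def shadow_def word_sphere_def intro!: shadow_close[of z0 z y])
      qed (use z0 in \<open>auto simp: bad_def word_sphere_def\<close>)
      moreover have "inj_on fst ?F" by (auto simp: inj_on_def)
      ultimately show ?thesis by (simp add: card_image)
    qed (simp only: card.empty le0)
  next
    show "snd ` ?\<Sigma> \<subseteq> ?Y" using sh by fastforce
  qed (use finite_bad finite_shadow finite_tree_nbhd in auto)
  then have "(\<Sum>z\<in>bad T k0 k. card (shadow z N)) \<le> ball_card (4 * int C + D) * card ?Y"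
    using finite_shadow finite_bad by simp
  then have *: "(\<Sum>z\<in>bad T k0 k. real (card (shadow z N))) \<le> real (ball_card (4 * int C + D)) * real (card ?Y)"
    by (simp flip: of_nat_mult of_nat_sum)
  have "real (card (bad T k0 k)) * l ^ (N - k) = (\<Sum>z\<in>bad T k0 k. l ^ (N - len z))"
    by (simp add: bad_def word_sphere_def)
  also have "\<dots> \<le> (\<Sum>z\<in>bad T k0 k. real tprd_mult * real (card (shadow z N)))"
    using k by (intro sum_mono shadow_large) (auto simp: bad_def word_sphere_def)
  also have "\<dots> \<le> real tprd_mult * (real (ball_card (4 * int C + D)) * real (card ?Y))"
    unfolding sum_distrib_left[symmetric] using * by (intro mult_left_mono) auto
  also have "\<dots> \<le> real tprd_mult * (real (ball_card (4 * int C + D)) * (\<epsilon> * l ^ N))"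
  proof -
    have "real (card ?Y) = real (card (tree_nbhd T k0 N)) - real (card (tree_nbhd T k N))"
      using tree_nbhd_antimono[OF T k(1,2), of N] finite_tree_nbhd
      by (simp add: card_Diff_subset card_mono of_nat_diff)
    then show ?thesis using st by (intro mult_left_mono) auto
  qed
  also have "\<dots> = real tprd_mult * real (ball_card (4 * int C + D)) * \<epsilon> * l ^ k * l ^ (N - k)"
    using k by (simp add: power_add[symmetric])
  finally show ?thesis using l by (simp add: mult_le_cancel_right)
qed

text \<open>Multiply level \<open>k0\<close> of \<open>T\<close> by the levels of \<open>T'\<close>.
  A product is near \<open>T\<close> unless it is \<open>bad\<close>, and for a stable
  \<open>k0\<close> the bad products account for at most half of all pairs. For the other pairs the
  element \<open>x \<otimes> mid x y\<close>, of bounded length, translates \<open>y\<close> close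
  to \<open>T\<close>.\<close>

theorem overlap:
  assumes T: "rooted_tree r T" "0 < c" "\<And>k. r \<le> k \<Longrightarrow> c * l ^ k \<le> real (card (T \<inter> Sph k))"
    and T': "0 < c'" "\<And>k. r' \<le> k \<Longrightarrow> c' * l ^ k \<le> real (card (T' \<inter> Sph k))"
  shows "\<exists>R \<delta> m0. 0 < \<delta> \<and> (\<forall>m\<ge>m0. \<delta> * l ^ m \<le>
    real (card {y \<in> T' \<inter> Sph m. \<exists>x\<in>carrier G. len x \<le> R \<and> (\<exists>t\<in>T. dist (x \<otimes> y) t \<le> int R)}))"
proof -
  \<comment> \<open>Collects the multiplicity of products, the \<open>2 * C + 1\<close> possible
    lengths, the factor of \<open>card_bad\<close> and \<open>l ^ C\<close> for the largest length;
    \<epsilon> then makes the bad pairs at most half of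
    \<open>c * c' * l ^ (k0 + m)\<close>.\<close>
  define c3 where "c3 = real prd_mult * (2 * real C + 1) * (real tprd_mult * real (ball_card (4 * int C + D))) * l ^ C + 1"
  have c3: "1 \<le> c3" using l by (auto simp: c3_def)
  define \<epsilon> where "\<epsilon> = c * c' / (2 * c3)"
  have \<epsilon>: "0 < \<epsilon>" using T T' c3 by (auto simp: \<epsilon>_def)
  obtain k0 where k0: "k0 \<ge> r" and st: "\<And>k. k \<ge> k0 \<Longrightarrow> \<exists>N\<ge>k.
    real (card (tree_nbhd T k0 N)) - real (card (tree_nbhd T k N)) \<le> \<epsilon> * l ^ N"
    using tree_nbhd_stabilizes[OF T(1) \<epsilon>] by blast
  \<comment> \<open>Bounds both the length of the translating element and the distance to
    \<open>T\<close> of a product that is not \<open>bad\<close>.\<close>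
  define R where "R = max (k0 + C) (nat (6 * int C + D))"
  define good where "good m = {y \<in> T' \<inter> Sph m. \<exists>x\<in>carrier G. len x \<le> R \<and> (\<exists>t\<in>T. dist (x \<otimes> y) t \<le> int R)}" for m
  have fgood: "finite (good m)" for m
    using finite_sphere[of m] by (rule finite_subset[rotated]) (auto simp: good_def)
  have "c * c' / (2 * K) * l ^ m \<le> real (card (good m))" if m: "m \<ge> max r' C" for m
  proof -
    define P where "P = (T \<inter> Sph k0) \<times> (T' \<inter> Sph m)"
    define Pb where "Pb = {(x, y) \<in> P. prd x y \<in> (\<Union>k\<in>{k0 + m - C..k0 + m + C}. bad T k0 k)}"
    have fP: "finite P" using finite_sphere by (simp add: P_def)
    have PbP: "Pb \<subseteq> P" by (auto simp: Pb_def)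
    have "c * l ^ k0 * (c' * l ^ m) \<le> real (card (T \<inter> Sph k0)) * real (card (T' \<inter> Sph m))"
      using T T' k0 m l by (intro mult_mono) auto
    then have P_large: "c * c' * l ^ (k0 + m) \<le> real (card P)"
      by (simp add: P_def card_cartesian_product power_add algebra_simps)
    have "card Pb \<le> prd_mult * card (\<Union>k\<in>{k0 + m - C..k0 + m + C}. bad T k0 k)"
    proof (rule card_le_fibres[of _ _ "\<lambda>(x, y). prd x y"])
      fix z
      have "Pb \<subseteq> Sph k0 \<times> carrier G" by (auto simp: Pb_def P_def word_sphere_def)
      from prd_fibre(2)[OF this, of z]
      show "card {q \<in> Pb. (\<lambda>(x, y). prd x y) q = z} \<le> prd_mult" by (simp add: case_prod_beta' Collect_conj_eq)
    qed (use fP PbP finite_bad in \<open>auto simp: Pb_def intro: finite_subset\<close>)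
    also have "\<dots> \<le> prd_mult * (\<Sum>k\<in>{k0 + m - C..k0 + m + C}. card (bad T k0 k))"
      by (intro mult_le_mono card_UN_le) auto
    finally have "real (card Pb) \<le> real prd_mult * (\<Sum>k\<in>{k0 + m - C..k0 + m + C}. real (card (bad T k0 k)))"
      by (simp flip: of_nat_mult of_nat_sum)
    also have "\<dots> \<le> real prd_mult * (\<Sum>k\<in>{k0 + m - C..k0 + m + C}.
        real tprd_mult * real (ball_card (4 * int C + D)) * \<epsilon> * l ^ (k0 + m + C))"
    proof (intro mult_left_mono sum_mono)
      fix k assume k: "k \<in> {k0 + m - C..k0 + m + C}"
      then have kk: "k0 \<le> k" using m by auto
      obtain N where "N \<ge> k" "real (card (tree_nbhd T k0 N)) - real (card (tree_nbhd T k N)) \<le> \<epsilon> * l ^ N"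
        using st[OF kk] by blast
      then have "real (card (bad T k0 k)) \<le> real tprd_mult * real (ball_card (4 * int C + D)) * \<epsilon> * l ^ k"
        using card_bad[OF T(1) k0 kk] by blast
      also have "\<dots> \<le> real tprd_mult * real (ball_card (4 * int C + D)) * \<epsilon> * l ^ (k0 + m + C)"
        using k l \<epsilon> by (intro mult_left_mono power_increasing) auto
      finally show "real (card (bad T k0 k)) \<le> real tprd_mult * real (ball_card (4 * int C + D)) * \<epsilon> * l ^ (k0 + m + C)" .
    qed auto
    also have "\<dots> = (c3 - 1) * \<epsilon> * l ^ (k0 + m)"
    proof -
      have "real (Suc (k0 + m + C) - (k0 + m - C)) = 2 * real C + 1" using m by auto
      then show ?thesis by (simp add: c3_def power_add)
    qed
    also have "\<dots> \<le> c3 * \<epsilon> * l ^ (k0 + m)" using \<epsilon> l by (intro mult_right_mono) auto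
    also have "\<dots> = c * c' / 2 * l ^ (k0 + m)" using c3 by (simp add: \<epsilon>_def)
    finally have Pb_small: "real (card Pb) \<le> c * c' / 2 * l ^ (k0 + m)" .
    have "P - Pb \<subseteq> (T \<inter> Sph k0) \<times> good m"
    proof
      fix q assume "q \<in> P - Pb"
      then obtain x y where q: "q = (x, y)" "x \<in> T" "x \<in> Sph k0" "y \<in> T'" "y \<in> Sph m" "(x, y) \<in> P - Pb"
        by (cases q) (auto simp: P_def)
      have xy: "x \<in> carrier G" "y \<in> carrier G" "len x = k0" "len y = m" using q by (auto simp: word_sphere_def)
      define z where "z = prd x y"
      have z: "z \<in> carrier G" "len z \<in> {k0 + m - C..k0 + m + C}"
        using prd[OF xy(1,2)] mid(3)[OF xy(1,2)] xy by (auto simp: z_def)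
      then have "z \<notin> bad T k0 (len z)" using q by (auto simp: Pb_def z_def)
      moreover have "int k0 + dist x z \<le> int (len z) + 2 * int C"
        using dist_prd[OF xy(1,2)] xy z by (auto simp: z_def)
      ultimately obtain t where t: "t \<in> T" "dist z t \<le> 6 * int C + D"
        using z q xy by (fastforce simp: bad_def word_sphere_def)
      have "z = (x \<otimes> mid x y) \<otimes> y" by (simp add: z_def prd_def)
      moreover have "len (x \<otimes> mid x y) \<le> R" "x \<otimes> mid x y \<in> carrier G"
        using len_mult[of x "mid x y"] mid[OF xy(1,2)] xy by (auto simp: R_def)
      moreover have "dist z t \<le> int R" using t by (auto simp: R_def)
      ultimately have "y \<in> good m" using q t by (auto simp: good_def)
      then show "q \<in> (T \<inter> Sph k0) \<times> good m" using q by auto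
    qed
    then have "card (P - Pb) \<le> card (T \<inter> Sph k0) * card (good m)"
      unfolding card_cartesian_product[symmetric]
      by (intro card_mono finite_cartesian_product finite_Int disjI2 finite_sphere fgood)
    also have "\<dots> \<le> card (Sph k0) * card (good m)" by (intro mult_le_mono1 card_mono finite_sphere) auto
    finally have "real (card P) - real (card Pb) \<le> real (card (Sph k0)) * real (card (good m))"
      using PbP fP by (simp add: card_Diff_subset finite_subset card_mono of_nat_diff flip: of_nat_mult)
    also have "\<dots> \<le> K * l ^ k0 * real (card (good m))" using sphere_upper by (intro mult_right_mono) auto
    finally have "real (card P) - real (card Pb) \<le> K * l ^ k0 * real (card (good m))" .
    moreover have "c * c' * l ^ (k0 + m) = c * c' / 2 * l ^ (k0 + m) + c * c' / 2 * l ^ (k0 + m)" by simp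
    ultimately have "c * c' / 2 * l ^ (k0 + m) \<le> K * l ^ k0 * real (card (good m))"
      using P_large Pb_small by linarith
    then have "l ^ k0 * (c * c' / 2 * l ^ m) \<le> l ^ k0 * (K * real (card (good m)))"
      by (simp add: power_add algebra_simps)
    then have "c * c' / 2 * l ^ m \<le> K * real (card (good m))" using l by (simp add: mult_le_cancel_left)
    then show ?thesis using K by (simp add: field_simps)
  qed
  then show ?thesis
    using T T' K unfolding good_def
    by (intro exI[of _ R] exI[of _ "c * c' / (2 * K)"] exI[of _ "max r' C"]) auto
qed

end

section \<open>The mean ergodic theorem in finite dimension\<close>

text \<open>Gaussian elimination: the pivot \<open>p\<close> removes the coordinate \<open>v\<close>
  from the other vectors, and induction handles the rest. Vectors are functions of which only the
  restriction to \<open>V\<close> counts.\<close>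

lemma linear_dependence:
  fixes w :: "'i \<Rightarrow> 'v \<Rightarrow> 'k::field"
  assumes "finite V" "finite I" "card V < card I"
  shows "\<exists>c. (\<exists>i\<in>I. c i \<noteq> 0) \<and> (\<forall>v\<in>V. (\<Sum>i\<in>I. c i * w i v) = 0)"
  using assms
proof (induction V arbitrary: I w rule: finite_induct)
  case empty
  then have "I \<noteq> {}" by auto
  then show ?case by (intro exI[of _ "\<lambda>_. 1"]) auto
next
  case (insert v V)
  show ?case
  proof (cases "\<exists>p\<in>I. w p v \<noteq> 0")
    case False
    have "card V < card I" using insert by simp
    from insert.IH[OF insert.prems(1) this, of w] show ?thesis using False by auto
  next
    case True
    then obtain p where p: "p \<in> I" "w p v \<noteq> 0" by blast
    define J where "J = I - {p}"
    have J: "finite J" "card V < card J" "I = insert p J" "p \<notin> J" using insert p by (auto simp: J_def)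
    define w' where "w' i u = w i u - w i v / w p v * w p u" for i u
    obtain c where c: "\<exists>i\<in>J. c i \<noteq> 0" "\<forall>u\<in>V. (\<Sum>i\<in>J. c i * w' i u) = 0"
      using insert.IH[OF J(1,2), of w'] by blast
    define d where "d = c(p := - (\<Sum>i\<in>J. c i * (w i v / w p v)))"
    have s: "(\<Sum>i\<in>I. d i * w i u) = (\<Sum>i\<in>J. c i * w' i u)" for u
    proof -
      have "(\<Sum>i\<in>J. d i * w i u) = (\<Sum>i\<in>J. c i * w i u)" using J by (intro sum.cong) (auto simp: d_def)
      then have "(\<Sum>i\<in>I. d i * w i u) = - (\<Sum>i\<in>J. c i * (w i v / w p v)) * w p u + (\<Sum>i\<in>J. c i * w i u)"
        using J by (simp add: d_def)
      also have "\<dots> = (\<Sum>i\<in>J. c i * w' i u)"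
        by (simp add: w'_def right_diff_distrib sum_subtractf sum_distrib_right mult.assoc)
      finally show ?thesis .
    qed
    have "(\<Sum>i\<in>J. c i * w' i v) = 0" using p by (simp add: w'_def)
    then have "\<forall>u\<in>insert v V. (\<Sum>i\<in>I. d i * w i u) = 0" using c s by auto
    moreover have "\<exists>i\<in>I. d i \<noteq> 0" using c(1) J by (auto simp: d_def)
    ultimately show ?thesis by blast
  qed
qed

definition mat_op :: "'v set \<Rightarrow> ('v \<Rightarrow> 'v \<Rightarrow> real) \<Rightarrow> ('v \<Rightarrow> real) \<Rightarrow> 'v \<Rightarrow> real" where
  "mat_op V a x = (\<lambda>u. \<Sum>v\<in>V. a u v * x v)"

lemma mat_op_cong: "(\<And>v. v \<in> V \<Longrightarrow> x v = y v) \<Longrightarrow> mat_op V a x u = mat_op V a y u"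
  by (auto simp: mat_op_def intro: sum.cong)

lemma mat_op_pow_cong:
  assumes "\<And>v. v \<in> V \<Longrightarrow> x v = y v" "u \<in> V"
  shows "(mat_op V a ^^ n) x u = (mat_op V a ^^ n) y u"
  using assms(2)
proof (induction n arbitrary: u)
  case (Suc n)
  then show ?case by (auto intro: mat_op_cong)
qed (use assms in auto)

lemma mat_op_add: "mat_op V a (\<lambda>v. x v + y v) u = mat_op V a x u + mat_op V a y u"
  and mat_op_diff: "mat_op V a (\<lambda>v. x v - y v) u = mat_op V a x u - mat_op V a y u"
  and mat_op_scale: "mat_op V a (\<lambda>v. c * x v) u = c * mat_op V a x u"
  by (auto simp: mat_op_def algebra_simps sum.distrib sum_subtractf sum_distrib_left)

lemma mat_op_sum: "mat_op V a (\<lambda>v. \<Sum>i\<in>I. x i v) u = (\<Sum>i\<in>I. mat_op V a (x i) u)"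
  unfolding mat_op_def by (simp add: sum_distrib_left) (rule sum.swap)

lemma mat_op_pow_add:
  "(mat_op V a ^^ n) (\<lambda>v. x v + y v) u = (mat_op V a ^^ n) x u + (mat_op V a ^^ n) y u"
proof (induction n arbitrary: u)
  case (Suc n)
  then have "(mat_op V a ^^ n) (\<lambda>v. x v + y v) = (\<lambda>u. (mat_op V a ^^ n) x u + (mat_op V a ^^ n) y u)" by blast
  then show ?case by (simp add: mat_op_add)
qed simp

lemma mat_op_pow_scale: "(mat_op V a ^^ n) (\<lambda>v. c * x v) u = c * (mat_op V a ^^ n) x u"
proof (induction n arbitrary: u)
  case (Suc n)
  then have "(mat_op V a ^^ n) (\<lambda>v. c * x v) = (\<lambda>u. c * (mat_op V a ^^ n) x u)" by blast
  then show ?case by (simp add: mat_op_scale)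
qed simp

lemma mat_op_pow_fixed:
  assumes "\<And>v. v \<in> V \<Longrightarrow> mat_op V a z v = z v" "u \<in> V"
  shows "(mat_op V a ^^ n) z u = z u"
  using assms(2)
proof (induction n arbitrary: u)
  case (Suc n)
  have "mat_op V a ((mat_op V a ^^ n) z) u = mat_op V a z u" by (rule mat_op_cong) (use Suc in auto)
  then show ?case using assms Suc by simp
qed auto

locale power_bounded =
  fixes V :: "'v set" and a :: "'v \<Rightarrow> 'v \<Rightarrow> real"
  assumes finite_V: "finite V"
    and bounded: "\<exists>B. \<forall>n. \<forall>u\<in>V. \<bar>(mat_op V a ^^ n) x u\<bar> \<le> B"
begin

abbreviation "T \<equiv> mat_op V a"

definition coboundary :: "('v \<Rightarrow> real) \<Rightarrow> 'v \<Rightarrow> real" where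
  "coboundary x = (\<lambda>u. x u - T x u)"

lemma coboundary_cong: "(\<And>v. v \<in> V \<Longrightarrow> x v = y v) \<Longrightarrow> u \<in> V \<Longrightarrow> coboundary x u = coboundary y u"
  using mat_op_cong[of V x y a u] by (simp add: coboundary_def)

lemma coboundary_zero: "(\<And>v. v \<in> V \<Longrightarrow> x v = 0) \<Longrightarrow> u \<in> V \<Longrightarrow> coboundary x u = 0"
  by (simp add: coboundary_def mat_op_def)

text \<open>There is no Jordan block at eigenvalue 1: for such a \<open>w\<close> the iterates are
  \<open>w - n * (w - T w)\<close>, unbounded unless the coboundary vanishes.\<close>

lemma fixed_coboundary_zero:
  assumes "\<And>u. u \<in> V \<Longrightarrow> coboundary (coboundary w) u = 0" "u \<in> V"
  shows "coboundary w u = 0"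
proof -
  define z where "z = coboundary w"
  have z: "T z v = z v" if "v \<in> V" for v using assms(1)[OF that] by (simp add: z_def coboundary_def)
  have Tw: "(T ^^ n) w v = w v - real n * z v" if "v \<in> V" for n v
    using that
  proof (induction n arbitrary: v)
    case (Suc n)
    have "(T ^^ Suc n) w v = T (\<lambda>v. w v - real n * z v) v" using Suc by (auto intro: mat_op_cong)
    also have "\<dots> = T w v - real n * z v" using z Suc by (simp add: mat_op_diff mat_op_scale)
    also have "T w v = w v - z v" by (simp add: z_def coboundary_def)
    finally show ?case by (simp add: algebra_simps)
  qed simp
  obtain B where B: "\<And>n v. v \<in> V \<Longrightarrow> \<bar>(T ^^ n) w v\<bar> \<le> B" using bounded by blast
  have "z u = 0"
  proof (rule ccontr)
    assume "z u \<noteq> 0"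
    then obtain n :: nat where n: "B + \<bar>w u\<bar> < real n * \<bar>z u\<bar>"
      using ex_less_of_nat_mult[of "\<bar>z u\<bar>"] by auto
    have "\<bar>real n * z u\<bar> \<le> \<bar>w u - real n * z u\<bar> + \<bar>w u\<bar>" by linarith
    then show False using B[OF assms(2), of n] Tw[OF assms(2), of n] n by (simp add: abs_mult)
  qed
  then show ?thesis by (simp add: z_def)
qed

text \<open>A polynomial in \<open>1 - T\<close> kills \<open>x\<close>; cancelling factors \<open>1 - T\<close> from it until its constant
  coefficient is nonzero exhibits the decomposition.\<close>

theorem mean_ergodic:
  obtains z y where "\<And>u. u \<in> V \<Longrightarrow> T z u = z u" "\<And>u. u \<in> V \<Longrightarrow> x u = z u + (y u - T y u)"
proof -
  \<comment> \<open>Horner scheme for the polynomial with coefficients \<open>c\<close> in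
    \<open>1 - T\<close>, applied to \<open>x\<close>.\<close>
  define hr where "hr = rec_nat (\<lambda>c. \<lambda>_. 0) (\<lambda>_ r c. \<lambda>u. c 0 * x u + coboundary (r (\<lambda>i. c (Suc i))) u)"
  have hr0: "hr 0 c = (\<lambda>_. 0)" and hrS: "hr (Suc n) c = (\<lambda>u. c 0 * x u + coboundary (hr n (\<lambda>i. c (Suc i))) u)"
    for c :: "nat \<Rightarrow> real" and n
    by (auto simp: hr_def)
  have cob_sum: "coboundary (\<lambda>u. \<Sum>i\<in>I. d i * X i u) u = (\<Sum>i\<in>I. d i * coboundary (X i) u)"
    for I :: "nat set" and d X u
    by (simp add: coboundary_def mat_op_sum mat_op_scale sum_subtractf right_diff_distrib)
  have hr_sum: "hr n c u = (\<Sum>i<n. c i * (coboundary ^^ i) x u)" for n c u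
  proof (induction n arbitrary: c u)
    case (Suc n)
    have "coboundary (hr n (\<lambda>i. c (Suc i))) u = (\<Sum>i<n. c (Suc i) * (coboundary ^^ Suc i) x u)"
      using cob_sum[where I = "{..<n}" and d = "\<lambda>i. c (Suc i)" and X = "\<lambda>i. (coboundary ^^ i) x" and u = u]
      unfolding Suc[of "\<lambda>i. c (Suc i)", THEN ext, symmetric] by simp
    then show ?case by (simp only: hrS sum.lessThan_Suc_shift) simp
  qed (simp add: hr0)
  \<comment> \<open>If the constant coefficient vanishes, \<open>fixed_coboundary_zero\<close>
    cancels one factor \<open>1 - T\<close>; thanks to the additional outer
    \<open>coboundary\<close> the same hypothesis then holds for the shorter polynomial.\<close>
  have key: "\<exists>d g. d \<noteq> 0 \<and> (\<forall>u\<in>V. coboundary (\<lambda>u. d * x u + coboundary g u) u = 0)"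
    if "\<exists>i<n. c i \<noteq> 0" "\<And>u. u \<in> V \<Longrightarrow> coboundary (hr n c) u = 0" for n c
    using that
  proof (induction n arbitrary: c)
    case (Suc n)
    show ?case
    proof (cases "c 0 = 0")
      case True
      then have "\<exists>i<n. c (Suc i) \<noteq> 0" using Suc.prems(1) by (metis less_Suc_eq_0_disj)
      moreover have "coboundary (hr n (\<lambda>i. c (Suc i))) u = 0" if "u \<in> V" for u
        using fixed_coboundary_zero[of "hr n (\<lambda>i. c (Suc i))" u] Suc.prems(2) True that by (simp add: hrS)
      ultimately show ?thesis by (rule Suc.IH)
    next
      case False
      then show ?thesis using Suc.prems(2) by (auto simp: hrS)
    qed
  qed auto
  \<comment> \<open>The vectors obtained from \<open>x\<close> by the first
    \<open>card V + 1\<close> powers of \<open>1 - T\<close> are dependent on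
    \<open>V\<close>.\<close>
  obtain c where c: "\<exists>i\<in>{..card V}. c i \<noteq> 0" "\<forall>v\<in>V. (\<Sum>i\<in>{..card V}. c i * (coboundary ^^ i) x v) = 0"
    using linear_dependence[OF finite_V, of "{..card V}" "\<lambda>i. (coboundary ^^ i) x"] by auto
  have "hr (Suc (card V)) c v = 0" if "v \<in> V" for v
    using c(2) that by (simp only: hr_sum lessThan_Suc_atMost)
  then have "\<exists>d g. d \<noteq> 0 \<and> (\<forall>u\<in>V. coboundary (\<lambda>u. d * x u + coboundary g u) u = 0)"
    using c(1) by (intro key[of "Suc (card V)" c] coboundary_zero) (auto simp: less_Suc_eq_le)
  then obtain d g where d: "d \<noteq> 0" and g: "\<And>u. u \<in> V \<Longrightarrow> coboundary (\<lambda>u. d * x u + coboundary g u) u = 0" by blast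
  define z where "z = (\<lambda>u. (1 / d) * (d * x u + coboundary g u))"
  have "T z u = z u" if "u \<in> V" for u
    using g[OF that] mat_op_scale[of V a "1 / d" "\<lambda>u. d * x u + coboundary g u" u]
    by (simp add: z_def coboundary_def[of "\<lambda>u. d * x u + coboundary g u"])
  moreover have "x u = z u + ((- (1 / d)) * g u - T (\<lambda>u. (- (1 / d)) * g u) u)" for u
    unfolding mat_op_scale using d by (simp add: z_def coboundary_def field_simps)
  ultimately show ?thesis by (rule that)
qed

text \<open>The coboundary part telescopes to a bounded term. The sums have \<open>n + 1\<close>
  terms but are divided by \<open>n\<close>, as in \<open>cesaro_limit\<close>; the factor
  \<open>(n + 1) / n\<close> tends to 1.\<close>

lemma cesaro_tendsto:
  assumes z: "\<And>u. u \<in> V \<Longrightarrow> T z u = z u" and x: "\<And>u. u \<in> V \<Longrightarrow> x u = z u + (y u - T y u)" and u: "u \<in> V"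
  shows "(\<lambda>n. (1 / real n) * (\<Sum>i=0..n. (T ^^ i) x u)) \<longlonglongrightarrow> z u"
proof -
  obtain B where B: "\<And>n v. v \<in> V \<Longrightarrow> \<bar>(T ^^ n) y v\<bar> \<le> B" using bounded by blast
  have Ti: "(T ^^ i) x u = z u + ((T ^^ i) y u - (T ^^ Suc i) y u)" for i
  proof -
    have "x v = z v + (y v + (- 1) * T y v)" if "v \<in> V" for v using x[OF that] by simp
    then have "(T ^^ i) x u = (T ^^ i) (\<lambda>v. z v + (y v + (- 1) * T y v)) u"
      by (rule mat_op_pow_cong) (use u in auto)
    also have "\<dots> = z u + ((T ^^ i) y u + (- 1) * (T ^^ i) (T y) u)"
      using mat_op_pow_fixed[of V a z u i] z u by (simp only: mat_op_pow_add mat_op_pow_scale)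
    finally show ?thesis by (simp add: funpow_swap1)
  qed
  have sm: "(\<Sum>i=0..n. (T ^^ i) x u) = (real n + 1) * z u + (y u - (T ^^ Suc n) y u)"
    for n
  proof (induction n)
    case 0
    then show ?case using x[OF u] by simp
  qed (auto simp: Ti algebra_simps)
  have eq: "(1 / real n) * (\<Sum>i=0..n. (T ^^ i) x u)
      = (real n + 1) / real n * z u + (y u - (T ^^ Suc n) y u) / real n" for n
    unfolding sm by (cases "n = 0") (auto simp: field_simps)
  have "(\<lambda>n. (y u - (T ^^ Suc n) y u) / real n) \<longlonglongrightarrow> 0"
  proof (rule Lim_null_comparison)
    show "\<forall>\<^sub>F n in sequentially. norm ((y u - (T ^^ Suc n) y u) / real n) \<le> 2 * B / real n"
    proof (intro always_eventually allI)
      fix n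
      have "\<bar>y u - (T ^^ Suc n) y u\<bar> \<le> 2 * B" using B[OF u, of 0] B[OF u, of "Suc n"] by simp
      then show "norm ((y u - (T ^^ Suc n) y u) / real n) \<le> 2 * B / real n"
        by (simp add: divide_right_mono)
    qed
    show "(\<lambda>n. 2 * B / real n) \<longlonglongrightarrow> 0" by real_asymp
  qed
  moreover have "(\<lambda>n. (real n + 1) / real n * z u) \<longlonglongrightarrow> 1 * z u"
    by (intro tendsto_mult tendsto_const) real_asymp
  ultimately show ?thesis unfolding eq using tendsto_add by fastforce
qed

end

section \<open>Finite Markov chains\<close>

locale markov =
  fixes H :: "'v set" and N :: "'v \<Rightarrow> 'v \<Rightarrow> real"
  assumes finite_H: "finite H" and nonempty_H: "H \<noteq> {}"
    and N_nonneg: "u \<in> H \<Longrightarrow> v \<in> H \<Longrightarrow> 0 \<le> N u v"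
    and N_sum: "u \<in> H \<Longrightarrow> (\<Sum>v\<in>H. N u v) = 1"
begin

lemma weighted_bound:
  fixes x :: "'v \<Rightarrow> 'b::real_normed_vector"
  assumes "u \<in> H" "\<And>v. v \<in> H \<Longrightarrow> norm (x v) \<le> B"
  shows "norm (\<Sum>v\<in>H. N u v *\<^sub>R x v) \<le> B"
proof -
  have "norm (\<Sum>v\<in>H. N u v *\<^sub>R x v) \<le> (\<Sum>v\<in>H. N u v * B)"
    using assms N_nonneg by (intro sum_norm_le) (auto intro: mult_left_mono)
  also have "\<dots> = B" using N_sum[OF assms(1)] by (simp flip: sum_distrib_right)
  finally show ?thesis .
qed

sublocale power_bounded H N
proof
  fix x :: "'v \<Rightarrow> real"
  define B where "B = Max ((\<lambda>u. \<bar>x u\<bar>) ` H)"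
  have "\<bar>(mat_op H N ^^ n) x u\<bar> \<le> B" if "u \<in> H" for n u
    using that
  proof (induction n arbitrary: u)
    case 0
    then show ?case using finite_H by (auto simp: B_def)
  next
    case (Suc n)
    then show ?case using weighted_bound[of u "(mat_op H N ^^ n) x" B] by (simp add: mat_op_def[of H N "(mat_op H N ^^ n) x"])
  qed
  then show "\<exists>B. \<forall>n. \<forall>u\<in>H. \<bar>(mat_op H N ^^ n) x u\<bar> \<le> B" by blast
qed (rule finite_H)

definition closed_class :: "'v set \<Rightarrow> bool" where
  "closed_class C \<longleftrightarrow> C \<subseteq> H \<and> C \<noteq> {} \<and> (\<forall>u\<in>C. \<forall>v\<in>H - C. N u v = 0)"

text \<open>These are the recurrent classes of the chain.\<close>

definition minimal_class :: "'v set \<Rightarrow> bool" where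
  "minimal_class C \<longleftrightarrow> closed_class C \<and> (\<forall>C'\<subseteq>C. closed_class C' \<longrightarrow> C' = C)"

lemma minimal_class_exists:
  assumes "closed_class C"
  shows "\<exists>C'\<subseteq>C. minimal_class C'"
proof -
  have "finite C" using assms finite_H finite_subset by (auto simp: closed_class_def)
  then show ?thesis using assms
  proof (induction C rule: finite_psubset_induct)
    case (psubset C)
    show ?case
    proof (cases "minimal_class C")
      case False
      then obtain C' where "C' \<subset> C" "closed_class C'" using psubset.prems by (auto simp: minimal_class_def)
      then show ?thesis using psubset.IH[of C'] by (meson order_trans psubset_imp_subset)
    qed blast
  qed
qed

lemma closed_sum:
  fixes x :: "'v \<Rightarrow> 'b::real_vector"
  shows "closed_class C \<Longrightarrow> u \<in> C \<Longrightarrow> (\<Sum>v\<in>C. N u v *\<^sub>R x v) = (\<Sum>v\<in>H. N u v *\<^sub>R x v)"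
  using finite_H by (intro sum.mono_neutral_left) (auto simp: closed_class_def)

lemma closed_mat_op: "closed_class C \<Longrightarrow> u \<in> C \<Longrightarrow> mat_op C N x u = mat_op H N x u"
  using closed_sum[of C u x] by (simp add: mat_op_def)

lemma markov_closed: "closed_class C \<Longrightarrow> markov C N"
  using closed_sum[of C _ "\<lambda>_. 1 :: real"] finite_H N_nonneg N_sum
  by unfold_locales (auto simp: closed_class_def finite_subset subset_iff)

text \<open>Maximum principle: at a maximum of a harmonic function the weighted mean of the
  nonnegative deficits \<open>m - z w\<close> is zero.\<close>

lemma max_set_closed:
  assumes h: "\<And>u. u \<in> H \<Longrightarrow> T z u = z u" and m: "m = Max (z ` H)"
  shows "closed_class {u \<in> H. z u = m}"
proof -
  have le: "z v \<le> m" if "v \<in> H" for v using that finite_H by (simp add: m)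
  have "m \<in> z ` H" unfolding m using finite_H nonempty_H by (intro Max_in) auto
  then have ne: "{u \<in> H. z u = m} \<noteq> {}" by auto
  have "N u v = 0" if u: "u \<in> H" "z u = m" and v: "v \<in> H" "z v \<noteq> m" for u v
  proof -
    have "(\<Sum>w\<in>H. N u w * (m - z w)) = m * (\<Sum>w\<in>H. N u w) - T z u"
      by (simp add: mat_op_def sum_distrib_left right_diff_distrib sum_subtractf mult.commute)
    then have "(\<Sum>w\<in>H. N u w * (m - z w)) = 0" using h u N_sum by simp
    then have "N u v * (m - z v) = 0"
      using sum_nonneg_eq_0_iff[of H "\<lambda>w. N u w * (m - z w)"] finite_H N_nonneg u v le by auto
    then show ?thesis using v by simp
  qed
  then show ?thesis using ne by (auto simp: closed_class_def)
qed

text \<open>The set where a harmonic function is maximal is closed and so contains a minimal class;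
  hence the maximum is \<open>e\<close>. The same holds for the negative.\<close>

lemma harmonic_bounded_by_classes:
  assumes h: "\<And>u. u \<in> H \<Longrightarrow> T z u = z u"
    and c: "\<And>C u. minimal_class C \<Longrightarrow> u \<in> C \<Longrightarrow> z u = e" and u: "u \<in> H"
  shows "z u = e"
proof -
  have le: "z' u \<le> e'" if h': "\<And>u. u \<in> H \<Longrightarrow> T z' u = z' u"
    and c': "\<And>C u. minimal_class C \<Longrightarrow> u \<in> C \<Longrightarrow> z' u = e'" for z' e'
  proof -
    obtain C where C: "C \<subseteq> {u \<in> H. z' u = Max (z' ` H)}" "minimal_class C"
      using minimal_class_exists[OF max_set_closed[OF h']] by blast
    then obtain v where "v \<in> C" by (auto simp: minimal_class_def closed_class_def)
    then have "Max (z' ` H) = e'" using C c' by force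
    moreover have "z' u \<le> Max (z' ` H)" using u finite_H by auto
    ultimately show ?thesis by simp
  qed
  have "T (\<lambda>v. (-1) * z v) v = (-1) * z v" if "v \<in> H" for v unfolding mat_op_scale using h that by simp
  from le[of "\<lambda>v. (-1) * z v" "- e", OF this] le[of z e] h c show ?thesis by force
qed

lemma minimal_class_irreducible:
  assumes C: "minimal_class C"
    and h: "\<And>u. u \<in> C \<Longrightarrow> mat_op C N z u = z u" and uv: "u \<in> C" "v \<in> C"
  shows "z u = z v"
proof -
  have cl: "closed_class C" using C by (simp add: minimal_class_def)
  interpret c: markov C N by (rule markov_closed[OF cl])
  have "c.closed_class {u \<in> C. z u = Max (z ` C)}" using c.max_set_closed h by blast
  then have "closed_class {u \<in> C. z u = Max (z ` C)}"
    using cl unfolding c.closed_class_def closed_class_def by blast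
  then have "{u \<in> C. z u = Max (z ` C)} = C" using C by (auto simp: minimal_class_def)
  then have "z w = Max (z ` C)" if "w \<in> C" for w using that by blast
  then show ?thesis using uv by simp
qed

text \<open>Expectation of a functional of the first \<open>n\<close> steps from \<open>v\<close>,
  by recursion over lists of \<open>n + 1\<close> states. No measure on trajectories is constructed,
  and real and complex values are treated alike.\<close>

primrec Ex :: "nat \<Rightarrow> 'v \<Rightarrow> ('v list \<Rightarrow> 'b::real_vector) \<Rightarrow> 'b" where
  "Ex 0 v F = F [v]"
| "Ex (Suc n) v F = (\<Sum>w\<in>H. N v w *\<^sub>R Ex n w (\<lambda>p. F (v # p)))"

lemma Ex_cong:
  assumes "v \<in> H" "\<And>p. length p = Suc n \<Longrightarrow> hd p = v \<Longrightarrow> set p \<subseteq> H \<Longrightarrow> F p = F' p"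
  shows "Ex n v F = Ex n v F'"
  using assms
proof (induction n arbitrary: v F F')
  case (Suc n)
  have "Ex n w (\<lambda>p. F (v # p)) = Ex n w (\<lambda>p. F' (v # p))" if "w \<in> H" for w
    using Suc that by (intro Suc.IH) auto
  then show ?case by simp
qed auto

lemma Ex_add: "Ex n v (\<lambda>p. F p + F' p) = Ex n v F + Ex n v F'"
  by (induction n arbitrary: v F F') (auto simp: scaleR_add_right sum.distrib)

lemma Ex_scaleR: "Ex n v (\<lambda>p. c *\<^sub>R F p) = c *\<^sub>R Ex n v F"
  by (induction n arbitrary: v F) (auto simp: scaleR_sum_right mult.commute)

lemma Ex_mult: "Ex n v (\<lambda>p. c * F p :: real) = c * Ex n v F"
  using Ex_scaleR[of n v c F] by simp

lemma Ex_cmult: "Ex n v (\<lambda>p. c * F p :: complex) = c * Ex n v F"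
  by (induction n arbitrary: v F) (auto simp: sum_distrib_left)

lemma Ex_const: "v \<in> H \<Longrightarrow> Ex n v (\<lambda>_. c) = c"
proof (induction n arbitrary: v)
  case (Suc n)
  then show ?case using N_sum[of v] by (simp flip: scaleR_sum_left)
qed simp

lemma Ex_mono:
  fixes F :: "'v list \<Rightarrow> real"
  assumes "v \<in> H" "\<And>p. length p = Suc n \<Longrightarrow> hd p = v \<Longrightarrow> set p \<subseteq> H \<Longrightarrow> F p \<le> F' p"
  shows "Ex n v F \<le> Ex n v F'"
  using assms
proof (induction n arbitrary: v F F')
  case (Suc n)
  have "Ex n w (\<lambda>p. F (v # p)) \<le> Ex n w (\<lambda>p. F' (v # p))" if "w \<in> H" for w
    using Suc that by (intro Suc.IH) auto
  then show ?case using N_nonneg Suc.prems by (auto intro!: sum_mono mult_left_mono)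
qed auto

lemma Ex_bound:
  fixes F :: "'v list \<Rightarrow> real"
  assumes "v \<in> H" "\<And>p. length p = Suc n \<Longrightarrow> set p \<subseteq> H \<Longrightarrow> \<bar>F p\<bar> \<le> B"
  shows "\<bar>Ex n v F\<bar> \<le> B"
proof -
  have "Ex n v F \<le> Ex n v (\<lambda>_. B)" "Ex n v (\<lambda>_. - B) \<le> Ex n v F"
    using assms by (auto intro!: Ex_mono simp: abs_le_iff minus_le_iff)
  then show ?thesis using assms(1) by (simp add: Ex_const abs_le_iff)
qed

text \<open>The Markov property at time \<open>j\<close>; \<open>tl r\<close> avoids repeating the
  state \<open>last p\<close>, with which \<open>r\<close> begins.\<close>

lemma Ex_split:
  assumes "v \<in> H"
  shows "Ex (j + k) v F = Ex j v (\<lambda>p. Ex k (last p) (\<lambda>r. F (p @ tl r)))"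
  using assms
proof (induction j arbitrary: v F)
  case 0
  have "Ex k v F = Ex k v (\<lambda>r. F ([v] @ tl r))"
    by (rule Ex_cong) (use 0 in \<open>auto simp: length_Suc_conv\<close>)
  then show ?case by simp
next
  case (Suc j)
  have "Ex (j + k) w (\<lambda>p. F (v # p)) = Ex j w (\<lambda>p. Ex k (last (v # p)) (\<lambda>r. F ((v # p) @ tl r)))"
    if "w \<in> H" for w
  proof -
    have "Ex (j + k) w (\<lambda>p. F (v # p)) = Ex j w (\<lambda>p. Ex k (last p) (\<lambda>r. F (v # p @ tl r)))"
      using Suc.IH[OF that, of "\<lambda>p. F (v # p)"] by simp
    also have "\<dots> = Ex j w (\<lambda>p. Ex k (last (v # p)) (\<lambda>r. F ((v # p) @ tl r)))"
      by (rule Ex_cong[OF that]) auto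
    finally show ?thesis .
  qed
  then show ?case by simp
qed

lemma Ex_truncate:
  assumes "v \<in> H"
  shows "Ex (n + k) v (\<lambda>p. F (take (Suc n) p)) = Ex n v F"
proof -
  have "Ex (n + k) v (\<lambda>p. F (take (Suc n) p)) = Ex n v (\<lambda>p. Ex k (last p) (\<lambda>r. F (take (Suc n) (p @ tl r))))"
    by (rule Ex_split[OF assms])
  also have "\<dots> = Ex n v F"
  proof (rule Ex_cong[OF assms])
    fix p assume p: "length p = Suc n" "hd p = v" "set p \<subseteq> H"
    then have "last p \<in> H" using last_in_set[of p] by fastforce
    then show "Ex k (last p) (\<lambda>r. F (take (Suc n) (p @ tl r))) = F p" using p by (simp add: Ex_const)
  qed
  finally show ?thesis .
qed

end

section \<open>The central limit theorem and the law of large numbers for finite Markov chains\<close>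

lemma iexp_second_order:
  fixes x :: real
  shows "norm (exp (\<i> * of_real x) - (1 + \<i> * of_real x - of_real (x\<^sup>2 / 2))) \<le> \<bar>x\<bar> ^ 3"
proof -
  define z where "z = \<i> * complex_of_real x"
  have q: "(\<Sum>i\<le>2. z ^ i / fact i) = 1 + \<i> * of_real x - of_real (x\<^sup>2 / 2)"
    by (simp add: complex_eq_iff z_def numeral_2_eq_2 power2_eq_square)
  have "norm (exp z - (\<Sum>i\<le>2. z ^ i / fact i)) \<le> exp \<bar>Re z\<bar> * norm z ^ Suc 2 / fact 2"
    by (rule Taylor_exp)
  moreover have "exp \<bar>Re z\<bar> * norm z ^ Suc 2 / fact 2 = \<bar>x\<bar> ^ 3 / 2"
    by (simp add: z_def norm_mult)
  moreover have "\<bar>x\<bar> ^ 3 / 2 \<le> \<bar>x\<bar> ^ 3" by simp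
  ultimately have "norm (exp z - (1 + \<i> * of_real x - of_real (x\<^sup>2 / 2))) \<le> \<bar>x\<bar> ^ 3"
    unfolding q by linarith
  then show ?thesis by (simp only: z_def)
qed

lemma quadratic_norm_le:
  fixes t h1 h2 :: real
  assumes t: "\<bar>t\<bar> \<le> 1"
  shows "norm (1 + \<i> * complex_of_real (t * h1) - of_real (t\<^sup>2 * h2 / 2)) \<le> 1 + \<bar>h1\<bar> + \<bar>h2\<bar>"
proof -
  have "norm (1 + \<i> * complex_of_real (t * h1) - of_real (t\<^sup>2 * h2 / 2)) \<le> 1 + \<bar>t * h1\<bar> + \<bar>t\<^sup>2 * h2 / 2\<bar>"
    by (rule order_trans[OF norm_triangle_ineq4] add_mono order_trans[OF norm_triangle_ineq])+
       (simp_all add: norm_mult del: of_real_mult of_real_divide)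
  moreover have "\<bar>t * h1\<bar> \<le> \<bar>h1\<bar>" unfolding abs_mult using t by (intro mult_left_le_one_le) auto
  moreover have "\<bar>t\<^sup>2 * h2 / 2\<bar> \<le> \<bar>h2\<bar>"
  proof -
    have "t\<^sup>2 * \<bar>h2\<bar> \<le> \<bar>h2\<bar>" using t by (intro mult_left_le_one_le) (auto simp: abs_square_le_1)
    moreover have "\<bar>t\<^sup>2 * h2 / 2\<bar> = t\<^sup>2 * \<bar>h2\<bar> / 2" by (simp add: abs_mult)
    ultimately show ?thesis using abs_ge_zero[of h2] by linarith
  qed
  ultimately show ?thesis by linarith
qed

text \<open>The subtracted expression is the product of the two quadratic polynomials cut off after
  degree two; the discarded part \<open>P\<close> has degrees three and four, and \<rho> is the
  Taylor remainder of the exponential.\<close>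

lemma iexp_expansion:
  fixes F h1 h2 :: real
  shows "\<exists>c\<ge>0. \<forall>t. \<bar>t\<bar> \<le> 1 \<longrightarrow>
    norm (exp (\<i> * of_real (t * F)) * (1 + \<i> * of_real (t * h1) - of_real (t\<^sup>2 * h2 / 2))
      - (1 + \<i> * of_real (t * (F + h1)) - of_real (t\<^sup>2 * (F\<^sup>2 + 2 * F * h1 + h2) / 2))) \<le> c * \<bar>t\<bar> ^ 3"
proof -
  define c where "c = \<bar>F\<bar> ^ 3 * (1 + \<bar>h1\<bar> + \<bar>h2\<bar>) + \<bar>F * h2 + F\<^sup>2 * h1\<bar> + F\<^sup>2 * \<bar>h2\<bar>"
  have "norm (exp (\<i> * of_real (t * F)) * (1 + \<i> * of_real (t * h1) - of_real (t\<^sup>2 * h2 / 2))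
      - (1 + \<i> * of_real (t * (F + h1)) - of_real (t\<^sup>2 * (F\<^sup>2 + 2 * F * h1 + h2) / 2))) \<le> c * \<bar>t\<bar> ^ 3"
    if t: "\<bar>t\<bar> \<le> 1" for t
  proof -
    define q where "q = 1 + \<i> * of_real (t * F) - of_real (t\<^sup>2 * F\<^sup>2 / 2)"
    define a where "a = 1 + \<i> * complex_of_real (t * h1) - of_real (t\<^sup>2 * h2 / 2)"
    define \<rho> where "\<rho> = exp (\<i> * of_real (t * F)) - q"
    have "norm \<rho> \<le> \<bar>t * F\<bar> ^ 3"
      using iexp_second_order[of "t * F"] by (simp add: \<rho>_def q_def power_mult_distrib)
    then have \<rho>: "norm \<rho> \<le> \<bar>t\<bar> ^ 3 * \<bar>F\<bar> ^ 3" by (simp add: abs_mult power_mult_distrib)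
    have t2: "t\<^sup>2 \<le> 1" using t by (simp add: abs_square_le_1)
    have na: "norm a \<le> 1 + \<bar>h1\<bar> + \<bar>h2\<bar>" unfolding a_def by (rule quadratic_norm_le[OF t])
    define P where "P = complex_of_real (t ^ 4 * (F\<^sup>2 * h2 / 4)) - \<i> * of_real (t ^ 3 * ((F * h2 + F\<^sup>2 * h1) / 2))"
    have id: "q * a - (1 + \<i> * of_real (t * (F + h1)) - of_real (t\<^sup>2 * (F\<^sup>2 + 2 * F * h1 + h2) / 2)) = P"
      unfolding q_def a_def P_def
      by (simp add: complex_eq_iff field_simps power2_eq_square power3_eq_cube power4_eq_xxxx)
    have "norm P \<le> \<bar>t ^ 4 * (F\<^sup>2 * h2 / 4)\<bar> + \<bar>t ^ 3 * ((F * h2 + F\<^sup>2 * h1) / 2)\<bar>"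
      unfolding P_def
      by (rule order_trans[OF norm_triangle_ineq4]) (simp add: norm_mult del: of_real_mult of_real_divide)
    also have "\<dots> \<le> \<bar>t\<bar> ^ 3 * (F\<^sup>2 * \<bar>h2\<bar>) + \<bar>t\<bar> ^ 3 * \<bar>F * h2 + F\<^sup>2 * h1\<bar>"
    proof (rule add_mono)
      have "\<bar>t\<bar> ^ 4 \<le> \<bar>t\<bar> ^ 3" using t by (intro power_decreasing) auto
      then have "\<bar>t\<bar> ^ 4 * (F\<^sup>2 * \<bar>h2\<bar> / 4) \<le> \<bar>t\<bar> ^ 3 * (F\<^sup>2 * \<bar>h2\<bar>)" by (intro mult_mono) auto
      then show "\<bar>t ^ 4 * (F\<^sup>2 * h2 / 4)\<bar> \<le> \<bar>t\<bar> ^ 3 * (F\<^sup>2 * \<bar>h2\<bar>)" by (simp add: abs_mult power_abs)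
      show "\<bar>t ^ 3 * ((F * h2 + F\<^sup>2 * h1) / 2)\<bar> \<le> \<bar>t\<bar> ^ 3 * \<bar>F * h2 + F\<^sup>2 * h1\<bar>"
        unfolding abs_mult power_abs by (intro mult_left_mono) auto
    qed
    finally have nP: "norm P \<le> \<bar>t\<bar> ^ 3 * (F\<^sup>2 * \<bar>h2\<bar> + \<bar>F * h2 + F\<^sup>2 * h1\<bar>)" by (simp add: distrib_left)
    have "exp (\<i> * of_real (t * F)) * a
      - (1 + \<i> * of_real (t * (F + h1)) - of_real (t\<^sup>2 * (F\<^sup>2 + 2 * F * h1 + h2) / 2)) = \<rho> * a + P"
      unfolding id[symmetric] \<rho>_def by (simp add: algebra_simps)
    then have "norm (exp (\<i> * of_real (t * F)) * a
      - (1 + \<i> * of_real (t * (F + h1)) - of_real (t\<^sup>2 * (F\<^sup>2 + 2 * F * h1 + h2) / 2))) \<le> norm \<rho> * norm a + norm P"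
      using norm_triangle_ineq[of "\<rho> * a" P] by (simp add: norm_mult)
    also have "\<dots> \<le> \<bar>t\<bar> ^ 3 * \<bar>F\<bar> ^ 3 * (1 + \<bar>h1\<bar> + \<bar>h2\<bar>) + \<bar>t\<bar> ^ 3 * (F\<^sup>2 * \<bar>h2\<bar> + \<bar>F * h2 + F\<^sup>2 * h1\<bar>)"
      by (intro add_mono mult_mono \<rho> na nP) auto
    also have "\<dots> = c * \<bar>t\<bar> ^ 3" by (simp add: c_def algebra_simps)
    finally show ?thesis by (simp add: a_def)
  qed
  moreover have "0 \<le> c" by (simp add: c_def)
  ultimately show ?thesis by blast
qed

lemma gauss_expansion:
  fixes s h1 h2 :: real
  shows "\<exists>c\<ge>0. \<forall>t. \<bar>t\<bar> \<le> 1 \<longrightarrow>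
    norm (of_real (exp (- s * t\<^sup>2 / 2)) * (1 + \<i> * of_real (t * h1) - of_real (t\<^sup>2 * h2 / 2))
      - (1 + \<i> * of_real (t * h1) - of_real (t\<^sup>2 * (s + h2) / 2))) \<le> c * \<bar>t\<bar> ^ 3"
proof -
  define c where "c = exp \<bar>s\<bar> * s\<^sup>2 * (1 + \<bar>h1\<bar> + \<bar>h2\<bar>) + \<bar>s * h1\<bar> + \<bar>s * h2\<bar>"
  have "norm (of_real (exp (- s * t\<^sup>2 / 2)) * (1 + \<i> * of_real (t * h1) - of_real (t\<^sup>2 * h2 / 2))
      - (1 + \<i> * of_real (t * h1) - of_real (t\<^sup>2 * (s + h2) / 2))) \<le> c * \<bar>t\<bar> ^ 3"
    if t: "\<bar>t\<bar> \<le> 1" for t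
  proof -
    define q where "q = 1 - complex_of_real (s * t\<^sup>2 / 2)"
    define a where "a = 1 + \<i> * complex_of_real (t * h1) - of_real (t\<^sup>2 * h2 / 2)"
    define \<rho> where "\<rho> = complex_of_real (exp (- s * t\<^sup>2 / 2)) - q"
    have t2: "t\<^sup>2 \<le> 1" using t by (simp add: abs_square_le_1)
    have t43: "\<bar>t\<bar> ^ 4 \<le> \<bar>t\<bar> ^ 3" using t by (intro power_decreasing) auto
    define z where "z = complex_of_real (- s * t\<^sup>2 / 2)"
    have "norm (exp z - (\<Sum>i\<le>1. z ^ i / fact i)) \<le> exp \<bar>Re z\<bar> * norm z ^ Suc 1 / fact 1" by (rule Taylor_exp)
    moreover have "exp z = complex_of_real (exp (- s * t\<^sup>2 / 2))" unfolding z_def by (rule exp_of_real)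
    moreover have "(\<Sum>i\<le>1. z ^ i / fact i) = q" by (simp add: q_def z_def)
    ultimately have "norm \<rho> \<le> exp \<bar>Re z\<bar> * (norm z)\<^sup>2" by (simp add: power2_eq_square \<rho>_def)
    also have "\<dots> \<le> exp \<bar>s\<bar> * (s\<^sup>2 * \<bar>t\<bar> ^ 4)"
    proof (rule mult_mono)
      show "exp \<bar>Re z\<bar> \<le> exp \<bar>s\<bar>"
        using t2 mult_left_mono[of "t\<^sup>2" 1 "\<bar>s\<bar>"] by (simp add: z_def abs_mult)
      have "(norm z)\<^sup>2 = s\<^sup>2 * \<bar>t\<bar> ^ 4 / 4"
        unfolding z_def norm_of_real by (simp add: power2_eq_square power4_eq_xxxx)
      moreover have "0 \<le> (norm z)\<^sup>2" by simp
      ultimately show "(norm z)\<^sup>2 \<le> s\<^sup>2 * \<bar>t\<bar> ^ 4" by linarith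
    qed auto
    also have "\<dots> \<le> exp \<bar>s\<bar> * (s\<^sup>2 * \<bar>t\<bar> ^ 3)" using t43 by (intro mult_left_mono) auto
    finally have \<rho>: "norm \<rho> \<le> exp \<bar>s\<bar> * s\<^sup>2 * \<bar>t\<bar> ^ 3" by simp
    have na: "norm a \<le> 1 + \<bar>h1\<bar> + \<bar>h2\<bar>" unfolding a_def by (rule quadratic_norm_le[OF t])
    define P where "P = complex_of_real (t ^ 4 * (s * h2 / 4)) - \<i> * of_real (t ^ 3 * (s * h1 / 2))"
    have id: "q * a - (1 + \<i> * of_real (t * h1) - of_real (t\<^sup>2 * (s + h2) / 2)) = P"
      unfolding q_def a_def P_def
      by (simp add: complex_eq_iff field_simps power2_eq_square power3_eq_cube power4_eq_xxxx)
    have "norm P \<le> \<bar>t ^ 4 * (s * h2 / 4)\<bar> + \<bar>t ^ 3 * (s * h1 / 2)\<bar>"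
      unfolding P_def
      by (rule order_trans[OF norm_triangle_ineq4]) (simp add: norm_mult del: of_real_mult of_real_divide)
    also have "\<dots> \<le> \<bar>t\<bar> ^ 3 * \<bar>s * h2\<bar> + \<bar>t\<bar> ^ 3 * \<bar>s * h1\<bar>"
    proof (rule add_mono)
      have "\<bar>t\<bar> ^ 4 * (\<bar>s * h2\<bar> / 4) \<le> \<bar>t\<bar> ^ 3 * \<bar>s * h2\<bar>" using t43 by (intro mult_mono) auto
      then show "\<bar>t ^ 4 * (s * h2 / 4)\<bar> \<le> \<bar>t\<bar> ^ 3 * \<bar>s * h2\<bar>" by (simp add: abs_mult power_abs)
      show "\<bar>t ^ 3 * (s * h1 / 2)\<bar> \<le> \<bar>t\<bar> ^ 3 * \<bar>s * h1\<bar>"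
        unfolding abs_mult[of "t ^ 3"] power_abs by (intro mult_left_mono) auto
    qed
    finally have nP: "norm P \<le> \<bar>t\<bar> ^ 3 * (\<bar>s * h2\<bar> + \<bar>s * h1\<bar>)" by (simp add: distrib_left)
    have "of_real (exp (- s * t\<^sup>2 / 2)) * a - (1 + \<i> * of_real (t * h1) - of_real (t\<^sup>2 * (s + h2) / 2)) = \<rho> * a + P"
      unfolding id[symmetric] \<rho>_def by (simp add: algebra_simps)
    then have "norm (of_real (exp (- s * t\<^sup>2 / 2)) * a
        - (1 + \<i> * of_real (t * h1) - of_real (t\<^sup>2 * (s + h2) / 2))) \<le> norm \<rho> * norm a + norm P"
      using norm_triangle_ineq[of "\<rho> * a" P] by (simp add: norm_mult)
    also have "\<dots> \<le> exp \<bar>s\<bar> * s\<^sup>2 * \<bar>t\<bar> ^ 3 * (1 + \<bar>h1\<bar> + \<bar>h2\<bar>) + \<bar>t\<bar> ^ 3 * (\<bar>s * h2\<bar> + \<bar>s * h1\<bar>)"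
      by (intro add_mono mult_mono \<rho> na nP) auto
    also have "\<dots> = c * \<bar>t\<bar> ^ 3" by (simp add: c_def algebra_simps)
    finally show ?thesis by (simp add: a_def)
  qed
  moreover have "0 \<le> c" by (simp add: c_def)
  ultimately show ?thesis by blast
qed

context markov
begin

text \<open>The operator whose powers give the characteristic function of \<open>\<Sum>i=1..n. F (X\<^sub>i)\<close>.\<close>

definition char_op :: "('v \<Rightarrow> real) \<Rightarrow> real \<Rightarrow> ('v \<Rightarrow> complex) \<Rightarrow> 'v \<Rightarrow> complex" where
  "char_op F t x = (\<lambda>u. \<Sum>v\<in>H. N u v *\<^sub>R (exp (\<i> * of_real (t * F v)) * x v))"

lemma char_op_diff: "char_op F t (\<lambda>v. x v - y v) u = char_op F t x u - char_op F t y u"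
  and char_op_add: "char_op F t (\<lambda>v. x v + y v) u = char_op F t x u + char_op F t y u"
  and char_op_scale: "char_op F t (\<lambda>v. k * x v) u = k * char_op F t x u"
  by (auto simp: char_op_def algebra_simps sum_subtractf sum.distrib sum_distrib_left)

lemma char_op_pow_diff:
  "(char_op F t ^^ n) (\<lambda>v. x v - y v) u = (char_op F t ^^ n) x u - (char_op F t ^^ n) y u"
proof (induction n arbitrary: u)
  case (Suc n)
  then have "(char_op F t ^^ n) (\<lambda>v. x v - y v) = (\<lambda>u. (char_op F t ^^ n) x u - (char_op F t ^^ n) y u)" by blast
  then show ?case by (simp add: char_op_diff)
qed simp

lemma char_op_bound:
  assumes "u \<in> H" "\<And>v. v \<in> H \<Longrightarrow> norm (x v) \<le> B"
  shows "norm (char_op F t x u) \<le> B"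
  unfolding char_op_def using assms by (intro weighted_bound) (auto simp: norm_mult)

lemma char_op_pow_bound:
  assumes "u \<in> H" "\<And>v. v \<in> H \<Longrightarrow> norm (x v) \<le> B"
  shows "norm ((char_op F t ^^ n) x u) \<le> B"
  using assms(1) by (induction n arbitrary: u) (auto intro: char_op_bound assms)

lemma Ex_char_op:
  assumes "u \<in> H"
  shows "(char_op F t ^^ n) (\<lambda>_. 1) u = Ex n u (\<lambda>p. exp (\<i> * of_real (t * sum_list (map F (tl p)))))"
  using assms
proof (induction n arbitrary: u)
  case (Suc n)
  have "exp (\<i> * of_real (t * F w)) * (char_op F t ^^ n) (\<lambda>_. 1) w
      = Ex n w (\<lambda>p. exp (\<i> * of_real (t * sum_list (map F (tl (u # p))))))" if w: "w \<in> H" for w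
  proof -
    have "exp (\<i> * of_real (t * F w)) * (char_op F t ^^ n) (\<lambda>_. 1) w
       = Ex n w (\<lambda>p. exp (\<i> * of_real (t * F w)) * exp (\<i> * of_real (t * sum_list (map F (tl p)))))"
      using Suc.IH[OF w] by (simp add: Ex_cmult)
    also have "\<dots> = Ex n w (\<lambda>p. exp (\<i> * of_real (t * sum_list (map F (tl (u # p))))))"
      by (rule Ex_cong[OF w]) (auto simp: length_Suc_conv exp_add[symmetric] algebra_simps)
    finally show ?thesis .
  qed
  then show ?case unfolding funpow.simps o_apply Ex.simps char_op_def[of F t "(char_op F t ^^ n) (\<lambda>_. 1)"]
    by (intro sum.cong) auto
qed simp

text \<open>The vector \<open>1 + \<i> t h1 - t\<^sup>2 h2 / 2\<close> is an eigenvector of \<open>char_op F t\<close> for the eigenvalue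
  \<open>exp (- s t\<^sup>2 / 2)\<close> up to an error of order three.\<close>

theorem clt:
  assumes F: "\<And>u. u \<in> H \<Longrightarrow> F u = y1 u - T y1 u"
    and s: "\<And>u. u \<in> H \<Longrightarrow> (F u)\<^sup>2 + 2 * F u * T y1 u = s + (y2 u - T y2 u)"
    and u: "u \<in> H"
  shows "(\<lambda>n. (char_op F (\<theta> / sqrt (real n)) ^^ n) (\<lambda>_. 1) u) \<longlonglongrightarrow> of_real (exp (- s * \<theta>\<^sup>2 / 2))"
proof -
  define h1 where "h1 = T y1"
  define h2 where "h2 = T y2"
  define a where "a t v = 1 + \<i> * complex_of_real (t * h1 v) - of_real (t\<^sup>2 * h2 v / 2)" for t v
  define \<mu> where "\<mu> t = exp (- s * t\<^sup>2 / 2)" for t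
  have "\<exists>c. \<forall>v\<in>H. 0 \<le> c v \<and> (\<forall>t. \<bar>t\<bar> \<le> 1 \<longrightarrow> norm (exp (\<i> * of_real (t * F v)) * a t v
      - (1 + \<i> * of_real (t * (F v + h1 v)) - of_real (t\<^sup>2 * ((F v)\<^sup>2 + 2 * F v * h1 v + h2 v) / 2))) \<le> c v * \<bar>t\<bar> ^ 3)"
    unfolding a_def by (intro bchoice ballI iexp_expansion)
  then obtain c1 where c1: "\<And>v. v \<in> H \<Longrightarrow> 0 \<le> c1 v" "\<And>v t. v \<in> H \<Longrightarrow> \<bar>t\<bar> \<le> 1 \<Longrightarrow>
      norm (exp (\<i> * of_real (t * F v)) * a t v
      - (1 + \<i> * of_real (t * (F v + h1 v)) - of_real (t\<^sup>2 * ((F v)\<^sup>2 + 2 * F v * h1 v + h2 v) / 2))) \<le> c1 v * \<bar>t\<bar> ^ 3"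
    by blast
  have "\<exists>c. \<forall>v\<in>H. 0 \<le> c v \<and> (\<forall>t. \<bar>t\<bar> \<le> 1 \<longrightarrow> norm (of_real (\<mu> t) * a t v
      - (1 + \<i> * of_real (t * h1 v) - of_real (t\<^sup>2 * (s + h2 v) / 2))) \<le> c v * \<bar>t\<bar> ^ 3)"
    unfolding a_def \<mu>_def by (intro bchoice ballI gauss_expansion)
  then obtain c2 where c2: "\<And>v. v \<in> H \<Longrightarrow> 0 \<le> c2 v" "\<And>v t. v \<in> H \<Longrightarrow> \<bar>t\<bar> \<le> 1 \<Longrightarrow>
      norm (of_real (\<mu> t) * a t v - (1 + \<i> * of_real (t * h1 v) - of_real (t\<^sup>2 * (s + h2 v) / 2))) \<le> c2 v * \<bar>t\<bar> ^ 3"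
    by blast
  define c where "c = (\<Sum>v\<in>H. c1 v) + (\<Sum>v\<in>H. c2 v)"
  have c12: "c1 v \<le> (\<Sum>v\<in>H. c1 v)" "c2 v \<le> (\<Sum>v\<in>H. c2 v)" if "v \<in> H" for v
    using that c1(1) c2(1) finite_H by (auto intro: member_le_sum)
  have c: "0 \<le> c" unfolding c_def using c1(1) c2(1) by (intro add_nonneg_nonneg sum_nonneg) auto
  have approx: "norm (char_op F t (a t) u - of_real (\<mu> t) * a t u) \<le> c * \<bar>t\<bar> ^ 3" if t: "\<bar>t\<bar> \<le> 1" and u: "u \<in> H" for t u
  proof -
    \<comment> \<open>\<open>b\<close> is the second-order expansion of
      \<open>exp (\<i> t F) * a t\<close>; averaging it with \<open>N\<close> and using the two
      Poisson equations gives the expansion of \<open>\<mu> t * a t\<close>.\<close>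
    define b where "b v = 1 + \<i> * complex_of_real (t * (F v + h1 v)) - of_real (t\<^sup>2 * ((F v)\<^sup>2 + 2 * F v * h1 v + h2 v) / 2)" for v
    have sum_real: "(\<Sum>v\<in>H. N u v *\<^sub>R complex_of_real (r v)) = of_real (T r u)" for r
      by (simp add: mat_op_def scaleR_conv_of_real)
    \<comment> \<open>\<open>F + T y1 = y1\<close> by the first Poisson equation, so averaging
      returns \<open>h1\<close>.\<close>
    have "T (\<lambda>v. F v + h1 v) u = h1 u"
    proof -
      have "T (\<lambda>v. F v + h1 v) u = T y1 u" using F by (intro mat_op_cong) (simp add: h1_def)
      then show ?thesis by (simp add: h1_def)
    qed
    moreover have "T (\<lambda>v. (F v)\<^sup>2 + 2 * F v * h1 v + h2 v) u = s + h2 u"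
    proof -
      have "T (\<lambda>v. (F v)\<^sup>2 + 2 * F v * h1 v + h2 v) u = T (\<lambda>v. s * 1 + y2 v) u"
        using s by (intro mat_op_cong) (simp add: h1_def h2_def)
      also have "\<dots> = s * T (\<lambda>_. 1) u + T y2 u" by (simp only: mat_op_add mat_op_scale)
      also have "T (\<lambda>_. 1) u = 1" using N_sum[OF u] by (simp add: mat_op_def)
      finally show ?thesis by (simp add: h2_def)
    qed
    moreover have "(\<Sum>v\<in>H. N u v *\<^sub>R b v) = (\<Sum>v\<in>H. N u v *\<^sub>R 1)
        + \<i> * (\<Sum>v\<in>H. N u v *\<^sub>R complex_of_real (t * (F v + h1 v)))
        - (\<Sum>v\<in>H. N u v *\<^sub>R complex_of_real ((t\<^sup>2 / 2) * ((F v)\<^sup>2 + 2 * F v * h1 v + h2 v)))"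
      unfolding b_def scaleR_diff_right scaleR_add_right sum_subtractf sum.distrib sum_distrib_left
      by (simp add: mult.commute)
    moreover have "(\<Sum>v\<in>H. N u v *\<^sub>R (1 :: complex)) = 1" using N_sum[OF u] by (simp flip: scaleR_sum_left)
    ultimately have bu: "(\<Sum>v\<in>H. N u v *\<^sub>R b v) = 1 + \<i> * of_real (t * h1 u) - of_real (t\<^sup>2 * (s + h2 u) / 2)"
      unfolding sum_real mat_op_scale by simp
    have "char_op F t (a t) u - (\<Sum>v\<in>H. N u v *\<^sub>R b v) = (\<Sum>v\<in>H. N u v *\<^sub>R (exp (\<i> * of_real (t * F v)) * a t v - b v))"
      by (simp add: char_op_def scaleR_diff_right sum_subtractf)
    then have "norm (char_op F t (a t) u - (\<Sum>v\<in>H. N u v *\<^sub>R b v)) \<le> (\<Sum>v\<in>H. c1 v) * \<bar>t\<bar> ^ 3"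
    proof (elim ssubst, intro weighted_bound[OF u])
      fix v assume v: "v \<in> H"
      have "norm (exp (\<i> * of_real (t * F v)) * a t v - b v) \<le> c1 v * \<bar>t\<bar> ^ 3" unfolding b_def by (rule c1(2)[OF v t])
      also have "\<dots> \<le> (\<Sum>v\<in>H. c1 v) * \<bar>t\<bar> ^ 3" using c12[OF v] by (intro mult_right_mono) auto
      finally show "norm (exp (\<i> * of_real (t * F v)) * a t v - b v) \<le> (\<Sum>v\<in>H. c1 v) * \<bar>t\<bar> ^ 3" .
    qed
    moreover have "norm (of_real (\<mu> t) * a t u - (\<Sum>v\<in>H. N u v *\<^sub>R b v)) \<le> (\<Sum>v\<in>H. c2 v) * \<bar>t\<bar> ^ 3"
      unfolding bu using order_trans[OF c2(2)[OF u t] mult_right_mono[OF c12(2)[OF u]]] by simp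
    ultimately have "norm (char_op F t (a t) u - of_real (\<mu> t) * a t u) \<le> (\<Sum>v\<in>H. c1 v) * \<bar>t\<bar> ^ 3 + (\<Sum>v\<in>H. c2 v) * \<bar>t\<bar> ^ 3"
      using norm_triangle_ineq4[of "char_op F t (a t) u - (\<Sum>v\<in>H. N u v *\<^sub>R b v)" "of_real (\<mu> t) * a t u - (\<Sum>v\<in>H. N u v *\<^sub>R b v)"]
      unfolding diff_diff_eq2 diff_add_cancel by linarith
    then show ?thesis by (simp add: c_def algebra_simps)
  qed
  \<comment> \<open>Each application adds an error of order \<open>\<bar>t\<bar> ^ 3\<close>, and
    \<open>char_op\<close> does not enlarge norms. For \<open>t\<close> of order
    \<open>1 / sqrt n\<close> the \<open>n\<close> errors sum to order
    \<open>1 / sqrt n\<close>.\<close>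
  have iter: "norm ((char_op F t ^^ n) (a t) u - of_real (\<mu> t ^ n) * a t u) \<le> real n * (c * \<bar>t\<bar> ^ 3 * exp (\<bar>s\<bar> * t\<^sup>2 * real M / 2))"
    if t: "\<bar>t\<bar> \<le> 1" and n: "n \<le> M" and u: "u \<in> H" for t n M u
    using n u
  proof (induction n arbitrary: u)
    case (Suc n)
    define e where "e v = (char_op F t ^^ n) (a t) v - of_real (\<mu> t ^ n) * a t v" for v
    define A where "A = c * \<bar>t\<bar> ^ 3 * exp (\<bar>s\<bar> * t\<^sup>2 * real M / 2)"
    have "(char_op F t ^^ n) (a t) = (\<lambda>v. e v + of_real (\<mu> t ^ n) * a t v)" by (simp add: e_def)
    then have "(char_op F t ^^ Suc n) (a t) u = char_op F t e u + of_real (\<mu> t ^ n) * char_op F t (a t) u"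
      by (simp add: char_op_add char_op_scale)
    then have eq: "(char_op F t ^^ Suc n) (a t) u - of_real (\<mu> t ^ Suc n) * a t u
      = char_op F t e u + of_real (\<mu> t ^ n) * (char_op F t (a t) u - of_real (\<mu> t) * a t u)"
      by (simp add: algebra_simps)
    have "norm (char_op F t e u) \<le> real n * A"
      using Suc unfolding e_def A_def by (intro char_op_bound) auto
    moreover have "norm (of_real (\<mu> t ^ n) * (char_op F t (a t) u - of_real (\<mu> t) * a t u)) \<le> A"
    proof -
      have "\<mu> t ^ n = exp (real n * (- s * t\<^sup>2 / 2))" unfolding \<mu>_def exp_of_nat_mult ..
      also have "\<dots> \<le> exp (\<bar>s\<bar> * t\<^sup>2 * real M / 2)"
      proof -
        have "real n * (- s * t\<^sup>2) \<le> real M * (\<bar>s\<bar> * t\<^sup>2)"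
          using Suc.prems by (intro order_trans[OF mult_left_mono[of "- s * t\<^sup>2" "\<bar>s\<bar> * t\<^sup>2"]] mult_right_mono) auto
        then show ?thesis by (simp add: mult.commute)
      qed
      finally have "\<bar>\<mu> t ^ n\<bar> \<le> exp (\<bar>s\<bar> * t\<^sup>2 * real M / 2)" by (simp add: \<mu>_def)
      then have "norm (of_real (\<mu> t ^ n) * (char_op F t (a t) u - of_real (\<mu> t) * a t u))
        \<le> exp (\<bar>s\<bar> * t\<^sup>2 * real M / 2) * (c * \<bar>t\<bar> ^ 3)"
        unfolding norm_mult norm_of_real using approx[OF t Suc.prems(2)] by (intro mult_mono) auto
      then show ?thesis by (simp add: A_def mult.commute)
    qed
    ultimately have "norm ((char_op F t ^^ Suc n) (a t) u - of_real (\<mu> t ^ Suc n) * a t u) \<le> real n * A + A"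
      unfolding eq using norm_triangle_ineq[of "char_op F t e u" "of_real (\<mu> t ^ n) * (char_op F t (a t) u - of_real (\<mu> t) * a t u)"]
      by linarith
    then show ?case by (simp add: A_def algebra_simps)
  qed simp
  define t where "t n = \<theta> / sqrt (real n)" for n
  have t0: "t \<longlonglongrightarrow> 0" unfolding t_def by real_asymp
  then have small: "eventually (\<lambda>n. \<bar>t n\<bar> \<le> 1) sequentially"
    using order_tendstoD(2)[OF tendsto_rabs[OF t0], of 1] by (auto elim: eventually_mono)
  have tsq: "real n * (t n)\<^sup>2 = \<theta>\<^sup>2" if "n > 0" for n using that by (simp add: t_def power_divide)
  have \<mu>n: "\<mu> (t n) ^ n = exp (- s * \<theta>\<^sup>2 / 2)" if "n > 0" for n
  proof -
    have "\<mu> (t n) ^ n = exp (real n * (- s * (t n)\<^sup>2 / 2))" unfolding \<mu>_def exp_of_nat_mult ..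
    also have "real n * (- s * (t n)\<^sup>2 / 2) = - s * (real n * (t n)\<^sup>2) / 2" by simp
    finally show ?thesis by (simp only: tsq[OF that])
  qed
  have d1: "(\<lambda>n. (char_op F (t n) ^^ n) (a (t n)) u - of_real (exp (- s * \<theta>\<^sup>2 / 2)) * a (t n) u) \<longlonglongrightarrow> 0"
  proof (rule Lim_null_comparison)
    show "eventually (\<lambda>n. norm ((char_op F (t n) ^^ n) (a (t n)) u - of_real (exp (- s * \<theta>\<^sup>2 / 2)) * a (t n) u)
      \<le> c * exp (\<bar>s\<bar> * \<theta>\<^sup>2 / 2) * (\<theta>\<^sup>2 * \<bar>t n\<bar>)) sequentially"
      using small eventually_gt_at_top[of 0]
    proof eventually_elim
      case (elim n)
      have "\<bar>s\<bar> * (t n)\<^sup>2 * real n / 2 = \<bar>s\<bar> * \<theta>\<^sup>2 / 2" using tsq[OF elim(2)] by (simp add: mult.assoc mult.commute)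
      moreover have "real n * (c * \<bar>t n\<bar> ^ 3 * e) = c * e * (\<theta>\<^sup>2 * \<bar>t n\<bar>)" for e
        unfolding tsq[OF elim(2), symmetric] by (simp add: power3_eq_cube power2_eq_square)
      ultimately show ?case using iter[OF elim(1) order_refl u, of n] by (simp only: \<mu>n[OF elim(2)])
    qed
    have "(\<lambda>n. c * exp (\<bar>s\<bar> * \<theta>\<^sup>2 / 2) * (\<theta>\<^sup>2 * \<bar>t n\<bar>)) \<longlonglongrightarrow> c * exp (\<bar>s\<bar> * \<theta>\<^sup>2 / 2) * (\<theta>\<^sup>2 * \<bar>0\<bar>)"
      by (intro tendsto_intros t0)
    then show "(\<lambda>n. c * exp (\<bar>s\<bar> * \<theta>\<^sup>2 / 2) * (\<theta>\<^sup>2 * \<bar>t n\<bar>)) \<longlonglongrightarrow> 0" by simp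
  qed
  have at: "(\<lambda>n. a (t n) v) \<longlonglongrightarrow> 1" for v
  proof -
    have "(\<lambda>n. a (t n) v) \<longlonglongrightarrow> 1 + \<i> * complex_of_real (0 * h1 v) - of_real (0\<^sup>2 * h2 v / 2)"
      unfolding a_def by (intro tendsto_intros t0) auto
    then show ?thesis by simp
  qed
  \<comment> \<open>The approximate eigenvector tends to the constant 1, so exchanging the two costs
    nothing in the limit.\<close>
  have d2: "(\<lambda>n. (char_op F (t n) ^^ n) (\<lambda>_. 1) u - (char_op F (t n) ^^ n) (a (t n)) u) \<longlonglongrightarrow> 0"
  proof (rule Lim_null_comparison)
    show "eventually (\<lambda>n. norm ((char_op F (t n) ^^ n) (\<lambda>_. 1) u - (char_op F (t n) ^^ n) (a (t n)) u)
      \<le> (\<Sum>v\<in>H. norm (1 - a (t n) v))) sequentially"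
      unfolding char_op_pow_diff[symmetric]
      using finite_H u by (intro always_eventually allI char_op_pow_bound) (auto intro: member_le_sum)
    have "(\<lambda>n. \<Sum>v\<in>H. norm (1 - a (t n) v)) \<longlonglongrightarrow> (\<Sum>v\<in>H. norm (1 - 1 :: complex))"
      by (intro tendsto_intros at)
    then show "(\<lambda>n. \<Sum>v\<in>H. norm (1 - a (t n) v)) \<longlonglongrightarrow> 0" by simp
  qed
  have "(\<lambda>n. of_real (exp (- s * \<theta>\<^sup>2 / 2)) * a (t n) u) \<longlonglongrightarrow> of_real (exp (- s * \<theta>\<^sup>2 / 2)) * 1"
    by (intro tendsto_mult tendsto_const at)
  from tendsto_add[OF tendsto_add[OF d1 d2] this] show ?thesis by (simp add: t_def)
qed

end

text \<open>The windows have \<open>n\<close> steps, that is \<open>n + 1\<close> states, and start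
  at the positions below \<open>m\<close>; a trajectory of \<open>m + n\<close> steps contains all
  of them completely.\<close>

definition window_sum :: "nat \<Rightarrow> ('v list \<Rightarrow> real) \<Rightarrow> nat \<Rightarrow> 'v list \<Rightarrow> real" where
  "window_sum n g m p = (\<Sum>i<m. g (take (Suc n) (drop i p)))"

lemma window_sum_Suc: "window_sum n g (Suc m) (v # p) = g (v # take n p) + window_sum n g m p"
  unfolding window_sum_def by (subst sum.lessThan_Suc_shift) simp

lemma window_sum_split: "n' \<le> m \<Longrightarrow> window_sum n g m p = window_sum n g n' p + window_sum n g (m - n') (drop n' p)"
proof (induction n' arbitrary: m p)
  case 0
  then show ?case by (simp add: window_sum_def)
next
  case (Suc n')
  then obtain m' where m: "m = Suc m'" by (cases m) auto
  show ?case using Suc.IH[of m' "drop 1 p"] Suc.prems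
    unfolding window_sum_def m sum.lessThan_Suc_shift by (simp add: add.commute)
qed

lemma window_sum_bound: "(\<And>p. \<bar>g p\<bar> \<le> B) \<Longrightarrow> \<bar>window_sum n g m p\<bar> \<le> real m * B"
  unfolding window_sum_def
  by (rule order_trans[OF sum_abs]) (use sum_bounded_above[of "{..<m}" "\<lambda>i. \<bar>g (take (Suc n) (drop i p))\<bar>" B] in simp)

context markov
begin

text \<open>Given its first state a window has mean \<open>b - T b\<close>, so the expectations
  telescope.\<close>

lemma Ex_window_sum:
  assumes b: "\<And>v. v \<in> H \<Longrightarrow> Ex n v g = b v - T b v" and v: "v \<in> H"
  shows "Ex (m + n) v (window_sum n g m) = b v - (T ^^ m) b v"
  using v
proof (induction m arbitrary: v)
  case 0
  then show ?case using Ex_const[OF 0, of n "0 :: real"] by (simp add: window_sum_def[abs_def])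
next
  case (Suc m)
  have "Ex (m + n) w (\<lambda>p. window_sum n g (Suc m) (v # p))
      = Ex (m + n) w (\<lambda>p. g (take (Suc n) (v # p))) + (b w - (T ^^ m) b w)" if "w \<in> H" for w
    using Suc.IH[OF that] by (simp add: window_sum_Suc Ex_add)
  then have "Ex (Suc m + n) v (window_sum n g (Suc m))
      = Ex (Suc (m + n)) v (\<lambda>p. g (take (Suc n) p)) + T (\<lambda>w. b w - (T ^^ m) b w) v"
    unfolding add_Suc Ex.simps real_scaleR_def mat_op_def[of H N "\<lambda>w. b w - (T ^^ m) b w"]
    by (simp only: sum.distrib[symmetric] distrib_left[symmetric] cong: sum.cong)
  also have "Ex (Suc (m + n)) v (\<lambda>p. g (take (Suc n) p)) = Ex n v g"
    using Ex_truncate[OF Suc.prems, of n "Suc m" g] by (simp add: add.commute)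
  finally show ?case using b[OF Suc.prems] by (simp add: mat_op_diff)
qed

text \<open>The first \<open>n\<close> windows may share states with \<open>f\<close> and are
  bounded trivially. For the later ones condition on the first \<open>n + 1\<close> states: what
  remains is a difference of iterates of \<open>b\<close>, bounded by \<open>2 * \<beta>\<close>
  whatever the number of windows.\<close>

lemma window_sum_correlation:
  assumes b: "\<And>v. v \<in> H \<Longrightarrow> Ex n v g = b v - T b v" and w: "w \<in> H"
    and g: "\<And>p. \<bar>g p\<bar> \<le> B" and f: "\<And>p. \<bar>f p\<bar> \<le> B"
    and \<beta>: "\<And>k u. u \<in> H \<Longrightarrow> \<bar>(T ^^ k) b u\<bar> \<le> \<beta>"
  shows "\<bar>Ex (m + n) w (\<lambda>p. f (take n p) * window_sum n g m p)\<bar> \<le> B * (real n * B) + B * (2 * \<beta>)"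
proof -
  have B: "0 \<le> B" using g[of "[]"] by linarith
  have \<beta>0: "0 \<le> \<beta>" using \<beta>[OF w, of 0] by linarith
  show ?thesis
  proof (cases "m \<le> n")
    case True
    have "\<bar>Ex (m + n) w (\<lambda>p. f (take n p) * window_sum n g m p)\<bar> \<le> B * (real n * B)"
    proof (rule Ex_bound[OF w])
      fix p
      have "\<bar>window_sum n g m p\<bar> \<le> real m * B" using g by (rule window_sum_bound)
      also have "\<dots> \<le> real n * B" using True B by (intro mult_right_mono) auto
      finally show "\<bar>f (take n p) * window_sum n g m p\<bar> \<le> B * (real n * B)"
        unfolding abs_mult using f B by (intro mult_mono) auto
    qed
    moreover have "0 \<le> B * (2 * \<beta>)" using B \<beta>0 by simp
    ultimately show ?thesis by linarith
  next
    case False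
    define R where "R p = f (take n p) * window_sum n g (m - n) (drop n p)" for p
    have "Ex (m + n) w (\<lambda>p. f (take n p) * window_sum n g m p)
      = Ex (m + n) w (\<lambda>p. f (take n p) * window_sum n g n p) + Ex (m + n) w R"
      using False by (simp add: window_sum_split[of n m] R_def[abs_def] Ex_add distrib_left)
    moreover have "\<bar>Ex (m + n) w (\<lambda>p. f (take n p) * window_sum n g n p)\<bar> \<le> B * (real n * B)"
      using f window_sum_bound[OF g] B unfolding abs_mult by (intro Ex_bound[OF w]) (auto simp: abs_mult intro!: mult_mono)
    moreover have "\<bar>Ex (m + n) w R\<bar> \<le> B * (2 * \<beta>)"
    proof -
      have "Ex (n + m) w R = Ex n w (\<lambda>p. Ex m (last p) (\<lambda>r. R (p @ tl r)))" by (rule Ex_split[OF w])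
      moreover have "\<bar>Ex n w (\<lambda>p. Ex m (last p) (\<lambda>r. R (p @ tl r)))\<bar> \<le> B * (2 * \<beta>)"
      proof (rule Ex_bound[OF w])
        fix p assume p: "length p = Suc n" "set p \<subseteq> H"
        then have l: "last p \<in> H" using last_in_set[of p] by fastforce
        have dr: "drop n p = [last p]" using p by (cases p rule: rev_cases) auto
        have "Ex m (last p) (\<lambda>r. R (p @ tl r)) = Ex m (last p) (\<lambda>r. f (take n p) * window_sum n g (m - n) r)"
        proof (rule Ex_cong[OF l])
          fix r assume "length r = Suc m" "hd r = last p"
          then have "last p # tl r = r" by (cases r) auto
          then show "R (p @ tl r) = f (take n p) * window_sum n g (m - n) r"
            using p dr by (simp add: R_def)
        qed
        also have "\<dots> = f (take n p) * Ex m (last p) (window_sum n g (m - n))" by (simp add: Ex_mult)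
        also have "Ex m (last p) (window_sum n g (m - n)) = b (last p) - (T ^^ (m - n)) b (last p)"
          using Ex_window_sum[OF b l, of "m - n"] False by simp
        also have "\<bar>f (take n p) * (b (last p) - (T ^^ (m - n)) b (last p))\<bar> \<le> B * (2 * \<beta>)"
          unfolding abs_mult using \<beta>[OF l, of 0] \<beta>[OF l, of "m - n"] f B by (intro mult_mono) auto
        finally show "\<bar>Ex m (last p) (\<lambda>r. R (p @ tl r))\<bar> \<le> B * (2 * \<beta>)" .
      qed
      ultimately show ?thesis by (simp add: add.commute)
    qed
    ultimately show ?thesis by linarith
  qed
qed

text \<open>A further window in front adds its square and twice a correlation that is bounded
  independently of \<open>m\<close>; growth is therefore linear instead of quadratic.\<close>

lemma window_sum_second_moment:
  assumes b: "\<And>v. v \<in> H \<Longrightarrow> Ex n v g = b v - T b v" and g: "\<And>p. \<bar>g p\<bar> \<le> B"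
  shows "\<exists>c. \<forall>m. \<forall>v\<in>H. Ex (m + n) v (\<lambda>p. (window_sum n g m p)\<^sup>2) \<le> c * real m"
proof -
  obtain \<beta> where \<beta>: "\<And>k u. u \<in> H \<Longrightarrow> \<bar>(T ^^ k) b u\<bar> \<le> \<beta>" using bounded by blast
  define \<kappa> where "\<kappa> = B * (real n * B) + B * (2 * \<beta>)"
  define c where "c = B\<^sup>2 + 2 * \<kappa>"
  have "Ex (m + n) v (\<lambda>p. (window_sum n g m p)\<^sup>2) \<le> c * real m" if "v \<in> H" for m v
    using that
  proof (induction m arbitrary: v)
    case 0
    then show ?case using Ex_const[OF 0, of n "0 :: real"] by (simp add: window_sum_def)
  next
    case (Suc m)
    have step: "Ex (m + n) w (\<lambda>p. (window_sum n g (Suc m) (v # p))\<^sup>2) \<le> c * real (Suc m)" if w: "w \<in> H" for w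
    proof -
      have "Ex (m + n) w (\<lambda>p. (window_sum n g (Suc m) (v # p))\<^sup>2)
        = Ex (m + n) w (\<lambda>p. (g (v # take n p))\<^sup>2 + 2 * (g (v # take n p) * window_sum n g m p) + (window_sum n g m p)\<^sup>2)"
        by (intro arg_cong[where f = "Ex (m + n) w"] ext) (simp add: window_sum_Suc power2_sum)
      also have "\<dots> = Ex (m + n) w (\<lambda>p. (g (v # take n p))\<^sup>2)
        + 2 * Ex (m + n) w (\<lambda>p. g (v # take n p) * window_sum n g m p) + Ex (m + n) w (\<lambda>p. (window_sum n g m p)\<^sup>2)"
        by (simp only: Ex_add Ex_mult)
      also have "\<dots> \<le> B\<^sup>2 + 2 * \<kappa> + c * real m"
      proof -
        have "\<bar>Ex (m + n) w (\<lambda>p. (g (v # take n p))\<^sup>2)\<bar> \<le> B\<^sup>2"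
          using g by (intro Ex_bound[OF w]) (simp add: abs_le_square_iff[symmetric] order_trans[OF _ abs_ge_self])
        moreover have "\<bar>Ex (m + n) w (\<lambda>p. g (v # take n p) * window_sum n g m p)\<bar> \<le> \<kappa>"
          unfolding \<kappa>_def by (rule window_sum_correlation[OF b w g _ \<beta>, where f = "\<lambda>q. g (v # q)"]) (assumption | rule g)+
        ultimately show ?thesis using Suc.IH[OF w] by (intro add_mono mult_left_mono) (auto simp: abs_le_iff)
      qed
      finally show ?thesis by (simp add: c_def algebra_simps)
    qed
    have "Ex (Suc m + n) v (\<lambda>p. (window_sum n g (Suc m) p)\<^sup>2) \<le> (\<Sum>w\<in>H. N v w * (c * real (Suc m)))"
      unfolding add_Suc Ex.simps real_scaleR_def using N_nonneg Suc.prems step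
      by (intro sum_mono mult_left_mono) auto
    also have "\<dots> = c * real (Suc m)" using N_sum[OF Suc.prems] by (simp flip: sum_distrib_right)
    finally show ?case .
  qed
  then show ?thesis by blast
qed

text \<open>Chebyshev's inequality with a second moment linear in \<open>m\<close>.\<close>

theorem window_lln:
  assumes b: "\<And>v. v \<in> H \<Longrightarrow> Ex n v g = b v - T b v" and g: "\<And>p. \<bar>g p\<bar> \<le> B" and \<epsilon>: "0 < \<epsilon>" and v: "v \<in> H"
  shows "(\<lambda>m. Ex (m + n) v (\<lambda>p. if \<epsilon> * real m \<le> \<bar>window_sum n g m p\<bar> then 1 else 0 :: real)) \<longlonglongrightarrow> 0"
proof -
  obtain c where c: "\<And>m v. v \<in> H \<Longrightarrow> Ex (m + n) v (\<lambda>p. (window_sum n g m p)\<^sup>2) \<le> c * real m"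
    using window_sum_second_moment[OF b g] by blast
  show ?thesis
  proof (rule tendsto_sandwich[of "\<lambda>_. 0" _ _ "\<lambda>m. c / \<epsilon>\<^sup>2 / real m"])
    show "eventually (\<lambda>m. 0 \<le> Ex (m + n) v (\<lambda>p. if \<epsilon> * real m \<le> \<bar>window_sum n g m p\<bar> then 1 else 0 :: real)) sequentially"
    proof (intro always_eventually allI)
      fix m
      have "Ex (m + n) v (\<lambda>_. 0) \<le> Ex (m + n) v (\<lambda>p. if \<epsilon> * real m \<le> \<bar>window_sum n g m p\<bar> then 1 else 0 :: real)"
        by (rule Ex_mono[OF v]) auto
      then show "0 \<le> Ex (m + n) v (\<lambda>p. if \<epsilon> * real m \<le> \<bar>window_sum n g m p\<bar> then 1 else 0 :: real)"
        using Ex_const[OF v, of _ "0 :: real"] by simp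
    qed
    show "eventually (\<lambda>m. Ex (m + n) v (\<lambda>p. if \<epsilon> * real m \<le> \<bar>window_sum n g m p\<bar> then 1 else 0 :: real)
        \<le> c / \<epsilon>\<^sup>2 / real m) sequentially"
      using eventually_gt_at_top[of 0]
    proof eventually_elim
      case (elim m)
      have "Ex (m + n) v (\<lambda>p. if \<epsilon> * real m \<le> \<bar>window_sum n g m p\<bar> then 1 else 0 :: real)
        \<le> Ex (m + n) v (\<lambda>p. 1 / (\<epsilon> * real m)\<^sup>2 * (window_sum n g m p)\<^sup>2)"
      proof (rule Ex_mono[OF v])
        fix p
        have "(\<epsilon> * real m)\<^sup>2 \<le> (window_sum n g m p)\<^sup>2" if "\<epsilon> * real m \<le> \<bar>window_sum n g m p\<bar>"
          using that \<epsilon> abs_le_square_iff[of "\<epsilon> * real m" "window_sum n g m p"] by simp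
        then show "(if \<epsilon> * real m \<le> \<bar>window_sum n g m p\<bar> then 1 else 0)
            \<le> 1 / (\<epsilon> * real m)\<^sup>2 * (window_sum n g m p)\<^sup>2"
          using elim \<epsilon> by (auto simp: le_divide_eq)
      qed
      also have "\<dots> = 1 / (\<epsilon> * real m)\<^sup>2 * Ex (m + n) v (\<lambda>p. (window_sum n g m p)\<^sup>2)" by (rule Ex_mult)
      also have "\<dots> \<le> 1 / (\<epsilon> * real m)\<^sup>2 * (c * real m)" using c[OF v, of m] by (intro mult_left_mono) auto
      also have "\<dots> = c / \<epsilon>\<^sup>2 / real m" using elim by (simp add: power2_eq_square)
      finally show ?case .
    qed
    show "(\<lambda>m. c / \<epsilon>\<^sup>2 / real m) \<longlonglongrightarrow> 0" by real_asymp
  qed simp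
qed

end

section \<open>Algebraic numbers\<close>

text \<open>\<open>r k\<close> is row \<open>i0\<close> of the \<open>k\<close>-th power of the
  rational matrix \<open>c\<close>, and \<open>x ^ k * b i0\<close> is its pairing with
  \<open>b\<close>. More than \<open>card I\<close> rows are dependent over the rationals, which
  yields a polynomial with root \<open>x\<close>.\<close>

lemma algebraic_eigenvalue:
  fixes x :: real and b :: "'i \<Rightarrow> real" and c :: "'i \<Rightarrow> 'i \<Rightarrow> rat"
  assumes I: "finite I" "i0 \<in> I" "b i0 \<noteq> 0"
    and e: "\<And>i. i \<in> I \<Longrightarrow> x * b i = (\<Sum>j\<in>I. of_rat (c i j) * b j)"
  shows "algebraic x"
proof -
  define r where "r = rec_nat (\<lambda>j. if j = i0 then 1 else 0) (\<lambda>_ r j. \<Sum>i\<in>I. r i * c i j)"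
  have r0: "r 0 = (\<lambda>j. if j = i0 then 1 else 0)" and rS: "r (Suc k) = (\<lambda>j. \<Sum>i\<in>I. r k i * c i j)" for k
    by (simp_all add: r_def)
  have pw: "x ^ k * b i0 = (\<Sum>j\<in>I. of_rat (r k j) * b j)" for k
  proof (induction k)
    case 0
    have "(\<Sum>j\<in>I. of_rat (r 0 j) * b j) = (\<Sum>j\<in>I. if j = i0 then b j else 0)"
      by (intro sum.cong) (auto simp: r0)
    then show ?case using I by simp
  next
    case (Suc k)
    have "x ^ Suc k * b i0 = x * (x ^ k * b i0)" by simp
    also have "\<dots> = (\<Sum>i\<in>I. of_rat (r k i) * (x * b i))"
      unfolding Suc sum_distrib_left by (intro sum.cong) auto
    also have "\<dots> = (\<Sum>i\<in>I. \<Sum>j\<in>I. of_rat (r k i) * of_rat (c i j) * b j)"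
      by (intro sum.cong refl) (simp add: e sum_distrib_left mult.assoc)
    also have "\<dots> = (\<Sum>j\<in>I. \<Sum>i\<in>I. of_rat (r k i) * of_rat (c i j) * b j)" by (rule sum.swap)
    also have "\<dots> = (\<Sum>j\<in>I. of_rat (r (Suc k) j) * b j)"
      by (simp add: rS of_rat_sum of_rat_mult sum_distrib_right)
    finally show ?case .
  qed
  obtain q where q: "\<exists>k\<in>{..card I}. q k \<noteq> 0" "\<forall>j\<in>I. (\<Sum>k\<in>{..card I}. q k * r k j) = 0"
    using linear_dependence[OF I(1), of "{..card I}" r] by auto
  define p where "p = (\<Sum>k\<le>card I. monom (of_rat (q k) :: real) k)"
  have cf: "coeff p k = (if k \<le> card I then of_rat (q k) else 0)" for k
    by (simp add: p_def coeff_sum)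
  have "poly p x * b i0 = (\<Sum>k\<le>card I. of_rat (q k) * (x ^ k * b i0))"
    by (simp add: p_def poly_sum poly_monom sum_distrib_right mult.assoc)
  also have "\<dots> = (\<Sum>k\<le>card I. \<Sum>j\<in>I. of_rat (q k) * of_rat (r k j) * b j)"
    unfolding pw by (simp add: sum_distrib_left mult.assoc)
  also have "\<dots> = (\<Sum>j\<in>I. \<Sum>k\<le>card I. of_rat (q k) * of_rat (r k j) * b j)" by (rule sum.swap)
  also have "\<dots> = (\<Sum>j\<in>I. of_rat (\<Sum>k\<le>card I. q k * r k j) * b j)"
    by (simp add: of_rat_sum of_rat_mult sum_distrib_right)
  also have "\<dots> = 0" using q(2) by simp
  finally have "poly p x = 0" using I by simp
  moreover have "p \<noteq> 0" using q(1) cf by (metis atMost_iff coeff_0 of_rat_eq_0_iff)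
  ultimately show ?thesis by (intro algebraicI'[of p]) (auto simp: cf)
qed

text \<open>\<open>A\<close> is the companion matrix of an annihilating polynomial.\<close>

lemma algebraic_power_basis:
  assumes "algebraic (x :: real)"
  obtains m :: nat and A :: "nat \<Rightarrow> nat \<Rightarrow> rat" where "0 < m"
    "\<And>i. i < m \<Longrightarrow> x * x ^ i = (\<Sum>j<m. of_rat (A i j) * x ^ j)"
proof -
  obtain p :: "int poly" where p: "p \<noteq> 0" "poly (map_poly of_int p) x = 0" using algebraicE'[OF assms] by blast
  define m where "m = degree p"
  have sum0: "(\<Sum>i\<le>m. of_int (coeff p i) * x ^ i) = 0"
    using p(2) unfolding poly_altdef by (simp add: m_def degree_map_poly coeff_map_poly)
  have lc: "coeff p m \<noteq> 0" using p by (simp add: m_def)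
  have m: "0 < m"
  proof (rule ccontr)
    assume "\<not> 0 < m"
    then show False using sum0 lc by simp
  qed
  define A where "A i j = (if Suc i < m then (if j = Suc i then 1 else 0) else - (of_int (coeff p j) / of_int (coeff p m)) :: rat)" for i j
  have "x * x ^ i = (\<Sum>j<m. of_rat (A i j) * x ^ j)" if i: "i < m" for i
  proof (cases "Suc i < m")
    case True
    then have "(\<Sum>j<m. of_rat (A i j) * x ^ j) = (\<Sum>j<m. if j = Suc i then x ^ j else 0)"
      by (intro sum.cong) (auto simp: A_def)
    then show ?thesis using True by simp
  next
    case False
    then have mi: "m = Suc i" using i by simp
    have e1: "of_int (coeff p m) * x ^ m = - (\<Sum>j<m. of_int (coeff p j) * x ^ j)"
      using sum0 unfolding lessThan_Suc_atMost[symmetric] by simp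
    have "(\<Sum>j<m. of_rat (A i j) * x ^ j) = - (\<Sum>j<m. of_int (coeff p j) * x ^ j) / of_int (coeff p m)"
      unfolding sum_negf[symmetric] sum_divide_distrib
      using False by (intro sum.cong) (auto simp: A_def of_rat_minus of_rat_divide)
    moreover have "x ^ m = - (\<Sum>j<m. of_int (coeff p j) * x ^ j) / of_int (coeff p m)"
      unfolding e1[symmetric] using lc by simp
    ultimately show ?thesis using mi by simp
  qed
  then show ?thesis using that m by blast
qed

text \<open>The products \<open>x ^ i * y ^ j\<close> form an eigenvector of the Kronecker sum and
  of the Kronecker product of the two companion matrices.\<close>

lemma algebraic_add_mult:
  assumes "algebraic (x :: real)" "algebraic y"
  shows algebraic_add: "algebraic (x + y)" and algebraic_mult: "algebraic (x * y)"
proof -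
  obtain m A where A: "0 < m" "\<And>i. i < m \<Longrightarrow> x * x ^ i = (\<Sum>j<m. of_rat (A i j) * x ^ j)"
    using algebraic_power_basis[OF assms(1)] by metis
  obtain n B where B: "0 < n" "\<And>i. i < n \<Longrightarrow> y * y ^ i = (\<Sum>j<n. of_rat (B i j) * y ^ j)"
    using algebraic_power_basis[OF assms(2)] by metis
  let ?I = "{..<m} \<times> {..<n}"
  define b where "b = (\<lambda>(i, j). x ^ i * y ^ j)"
  define c where "c = (\<lambda>(i, j) (i', j'). (if j' = j then A i i' else 0) + (if i' = i then B j j' else 0))"
  define d where "d = (\<lambda>(i, j) (i', j'). A i i' * B j j')"
  have prod_sum: "(\<Sum>i'<m. \<Sum>j'<n. F i' j') = (\<Sum>q\<in>?I. F (fst q) (snd q))" for F :: "nat \<Rightarrow> nat \<Rightarrow> real"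
    by (simp add: sum.cartesian_product case_prod_beta)
  show "algebraic (x + y)"
  proof (rule algebraic_eigenvalue[of ?I "(0, 0)" b _ c])
    fix q assume "q \<in> ?I"
    then obtain i j where q: "q = (i, j)" "i < m" "j < n" by auto
    have "(\<Sum>q'\<in>?I. of_rat (c q q') * b q')
      = (\<Sum>i'<m. \<Sum>j'<n. of_rat ((if j' = j then A i i' else 0) + (if i' = i then B j j' else 0)) * (x ^ i' * y ^ j'))"
      unfolding prod_sum by (intro sum.cong) (auto simp: c_def b_def q)
    also have "\<dots> = (\<Sum>i'<m. \<Sum>j'<n. if j' = j then of_rat (A i i') * (x ^ i' * y ^ j') else 0)
      + (\<Sum>i'<m. \<Sum>j'<n. if i' = i then of_rat (B j j') * (x ^ i' * y ^ j') else 0)"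
      unfolding sum.distrib[symmetric] by (intro sum.cong) (auto simp: of_rat_add distrib_right)
    also have "(\<Sum>i'<m. \<Sum>j'<n. if j' = j then of_rat (A i i') * (x ^ i' * y ^ j') else 0)
      = (\<Sum>i'<m. of_rat (A i i') * x ^ i') * y ^ j"
      using q by (simp add: sum_distrib_right mult.assoc)
    also have "(\<Sum>i'<m. \<Sum>j'<n. if i' = i then of_rat (B j j') * (x ^ i' * y ^ j') else 0)
      = x ^ i * (\<Sum>j'<n. of_rat (B j j') * y ^ j')"
      using q by (subst sum.swap) (simp add: sum_distrib_left mult.left_commute)
    also have "(\<Sum>i'<m. of_rat (A i i') * x ^ i') * y ^ j + x ^ i * (\<Sum>j'<n. of_rat (B j j') * y ^ j') = (x + y) * b q"
      unfolding A(2)[OF q(2), symmetric] B(2)[OF q(3), symmetric] by (simp add: b_def q algebra_simps)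
    finally show "(x + y) * b q = (\<Sum>q'\<in>?I. of_rat (c q q') * b q')" ..
  qed (use A(1) B(1) in \<open>auto simp: b_def\<close>)
  show "algebraic (x * y)"
  proof (rule algebraic_eigenvalue[of ?I "(0, 0)" b _ d])
    fix q assume "q \<in> ?I"
    then obtain i j where q: "q = (i, j)" "i < m" "j < n" by auto
    have "(\<Sum>q'\<in>?I. of_rat (d q q') * b q')
      = (\<Sum>i'<m. \<Sum>j'<n. (of_rat (A i i') * x ^ i') * (of_rat (B j j') * y ^ j'))"
      unfolding prod_sum by (intro sum.cong) (auto simp: d_def b_def q of_rat_mult)
    also have "\<dots> = (x * x ^ i) * (y * y ^ j)"
      unfolding A(2)[OF q(2)] B(2)[OF q(3)] sum_product ..
    finally show "x * y * b q = (\<Sum>q'\<in>?I. of_rat (d q q') * b q')" by (simp add: b_def q mult_ac)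
  qed (use A(1) B(1) in \<open>auto simp: b_def\<close>)
qed

lemma algebraic_diff: "algebraic (x :: real) \<Longrightarrow> algebraic y \<Longrightarrow> algebraic (x - y)"
  using algebraic_add[of x "- y"] by simp

lemma algebraic_divide: "algebraic (x :: real) \<Longrightarrow> algebraic y \<Longrightarrow> algebraic (x / y)"
  using algebraic_mult[of x "inverse y"] by (simp add: divide_inverse algebraic_inverse)

lemma algebraic_sum: "(\<And>i. i \<in> I \<Longrightarrow> algebraic (f i :: real)) \<Longrightarrow> algebraic (\<Sum>i\<in>I. f i)"
  by (induction I rule: infinite_finite_induct) (auto intro: algebraic_add)

text \<open>Elimination never leaves the field of algebraic numbers, and the real solution
  guarantees consistency at every stage.\<close>

lemma algebraic_linear_system:
  fixes E :: "(('j \<Rightarrow> real) \<times> real) set"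
  assumes "finite J" and "\<And>a b. (a, b) \<in> E \<Longrightarrow> algebraic b \<and> (\<forall>j\<in>J. algebraic (a j))"
    and "\<And>a b. (a, b) \<in> E \<Longrightarrow> (\<Sum>j\<in>J. a j * x j) = b"
  shows "\<exists>x'. (\<forall>j. algebraic (x' j)) \<and> (\<forall>(a, b)\<in>E. (\<Sum>j\<in>J. a j * x' j) = b)"
  using assms
proof (induction J arbitrary: E rule: finite_induct)
  case empty
  then show ?case by (intro exI[of _ "\<lambda>_. 0"]) auto
next
  case (insert k J)
  show ?case
  proof (cases "\<forall>(a, b)\<in>E. a k = 0")
    case True
    have "\<exists>x'. (\<forall>j. algebraic (x' j)) \<and> (\<forall>(a, b)\<in>E. (\<Sum>j\<in>J. a j * x' j) = b)"
    proof (rule insert.IH)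
      fix a b assume "(a, b) \<in> E"
      then show "algebraic b \<and> (\<forall>j\<in>J. algebraic (a j))" "(\<Sum>j\<in>J. a j * x j) = b"
        using insert.prems[of a b] True insert.hyps by auto
    qed
    then show ?thesis using True insert.hyps by (auto simp: case_prod_beta)
  next
    case False
    then obtain a0 b0 where e0: "(a0, b0) \<in> E" "a0 k \<noteq> 0" by auto
    note alg0 = insert.prems(1)[OF e0(1)]
    define red where "red = (\<lambda>(a :: 'j \<Rightarrow> real, b). (\<lambda>j. a j - a k / a0 k * a0 j, b - a k / a0 k * b0))"
    have "\<exists>x'. (\<forall>j. algebraic (x' j)) \<and> (\<forall>(a, b)\<in>red ` E. (\<Sum>j\<in>J. a j * x' j) = b)"
    proof (rule insert.IH)
      fix a' b' assume "(a', b') \<in> red ` E"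
      then obtain a b where ab: "(a, b) \<in> E" "a' = (\<lambda>j. a j - a k / a0 k * a0 j)" "b' = b - a k / a0 k * b0"
        by (auto simp: red_def)
      show "algebraic b' \<and> (\<forall>j\<in>J. algebraic (a' j))"
        using alg0 insert.prems(1)[OF ab(1)] by (auto simp: ab intro!: algebraic_diff algebraic_mult algebraic_divide)
      have "(\<Sum>j\<in>J. a' j * x j) = (\<Sum>j\<in>J. a j * x j) - a k / a0 k * (\<Sum>j\<in>J. a0 j * x j)"
        by (simp add: ab left_diff_distrib sum_subtractf sum_distrib_left mult.assoc)
      moreover have "(\<Sum>j\<in>J. a j * x j) = b - a k * x k" "(\<Sum>j\<in>J. a0 j * x j) = b0 - a0 k * x k"
        using insert.prems(2)[OF ab(1)] insert.prems(2)[OF e0(1)] insert.hyps by auto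
      ultimately show "(\<Sum>j\<in>J. a' j * x j) = b'"
        using e0(2) by (simp add: ab right_diff_distrib)
    qed
    then obtain x' where x'0: "\<And>j. algebraic (x' j)" "\<forall>(a, b)\<in>red ` E. (\<Sum>j\<in>J. a j * x' j) = b"
      by blast
    have x'1: "(\<Sum>j\<in>J. (a j - a k / a0 k * a0 j) * x' j) = b - a k / a0 k * b0" if "(a, b) \<in> E" for a b
      using bspec[OF x'0(2) imageI[OF that]] by (simp add: red_def)
    note x' = x'0(1) x'1
    define x'' where "x'' = x'(k := (b0 - (\<Sum>j\<in>J. a0 j * x' j)) / a0 k)"
    have "algebraic (x'' j)" for j
      using x'(1) alg0 by (auto simp: x''_def intro!: algebraic_divide algebraic_diff algebraic_sum algebraic_mult)
    moreover have "(\<Sum>j\<in>insert k J. a j * x'' j) = b" if ab: "(a, b) \<in> E" for a b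
    proof -
      have "(\<Sum>j\<in>J. a j * x'' j) = (\<Sum>j\<in>J. a j * x' j)"
        using insert.hyps by (intro sum.cong) (auto simp: x''_def)
      moreover have "(\<Sum>j\<in>J. (a j - a k / a0 k * a0 j) * x' j)
          = (\<Sum>j\<in>J. a j * x' j) - a k / a0 k * (\<Sum>j\<in>J. a0 j * x' j)"
        by (simp add: left_diff_distrib sum_subtractf sum_distrib_left mult.assoc)
      ultimately show ?thesis using x'(2)[OF ab] insert.hyps e0(2) by (simp add: x''_def field_simps)
    qed
    ultimately show ?thesis by blast
  qed
qed

text \<open>The unknowns are the values of \<open>y\<close> and, under the index
  \<open>None\<close>, the constant. An algebraic solution exists, and its constant is the given
  one: the difference of two solutions has a constant coboundary, which
  \<open>fixed_coboundary_zero\<close> forces to vanish.\<close>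

lemma (in markov) algebraic_poisson:
  assumes N: "\<And>u v. u \<in> H \<Longrightarrow> v \<in> H \<Longrightarrow> algebraic (N u v)" and f: "\<And>u. u \<in> H \<Longrightarrow> algebraic (f u)"
    and y: "\<And>u. u \<in> H \<Longrightarrow> f u = e + (y u - T y u)"
  shows "algebraic e \<and> (\<exists>y'. (\<forall>u. algebraic (y' u)) \<and> (\<forall>u\<in>H. f u = e + (y' u - T y' u)))"
proof -
  define J where "J = insert None (Some ` H)"
  define a where "a u = (\<lambda>j. case j of None \<Rightarrow> 1 | Some v \<Rightarrow> (if v = u then 1 else 0) - N u v)" for u
  have sumJ: "(\<Sum>j\<in>J. a u j * x j) = x None + (x (Some u) - T (\<lambda>v. x (Some v)) u)" if "u \<in> H" for u x
  proof -
    have "(\<Sum>j\<in>J. a u j * x j) = x None + (\<Sum>v\<in>H. ((if v = u then 1 else 0) - N u v) * x (Some v))"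
      using finite_H by (simp add: J_def a_def sum.reindex)
    also have "\<dots> = x None + ((\<Sum>v\<in>H. if v = u then x (Some v) else 0) - T (\<lambda>v. x (Some v)) u)"
      unfolding mat_op_def sum_subtractf[symmetric] by (intro arg_cong2[of _ _ _ _ "(+)"] sum.cong) (auto simp: algebra_simps)
    finally show ?thesis using that finite_H by simp
  qed
  have "\<exists>x'. (\<forall>j. algebraic (x' j)) \<and> (\<forall>(c, d)\<in>(\<lambda>u. (a u, f u)) ` H. (\<Sum>j\<in>J. c j * x' j) = d)"
  proof (rule algebraic_linear_system)
    show "finite J" using finite_H by (simp add: J_def)
    fix c d assume "(c, d) \<in> (\<lambda>u. (a u, f u)) ` H"
    then obtain u where u: "u \<in> H" "c = a u" "d = f u" by auto
    show "algebraic d \<and> (\<forall>j\<in>J. algebraic (c j))"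
      using u f N by (auto simp: J_def a_def intro!: algebraic_diff)
    show "(\<Sum>j\<in>J. c j * (case j of None \<Rightarrow> e | Some v \<Rightarrow> y v)) = d"
      using sumJ[OF u(1)] y[OF u(1)] u by simp
  qed
  then obtain x' where x': "\<And>j. algebraic (x' j)" "\<And>u. u \<in> H \<Longrightarrow> (\<Sum>j\<in>J. a u j * x' j) = f u" by auto
  define y' where "y' = (\<lambda>v. x' (Some v))"
  have y': "f u = x' None + (y' u - T y' u)" if "u \<in> H" for u
    using x'(2)[OF that] sumJ[OF that] by (simp add: y'_def)
  obtain u0 where u0: "u0 \<in> H" using nonempty_H by blast
  have cw: "coboundary (\<lambda>u. y' u - y u) u = (e - x' None)" if "u \<in> H" for u
    using y[OF that] y'[OF that] by (simp add: coboundary_def mat_op_diff)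
  have "coboundary (\<lambda>u. y' u - y u) u0 = 0"
  proof (rule fixed_coboundary_zero[OF _ u0])
    fix u assume u: "u \<in> H"
    have "coboundary (coboundary (\<lambda>u. y' u - y u)) u = coboundary (\<lambda>_. e - x' None) u"
      by (rule coboundary_cong) (use cw u in auto)
    also have "\<dots> = 0" using N_sum[OF u] by (simp add: coboundary_def mat_op_def flip: sum_distrib_right)
    finally show "coboundary (coboundary (\<lambda>u. y' u - y u)) u = 0" .
  qed
  then have "e = x' None" using cw[OF u0] by simp
  moreover have "algebraic (y' u)" for u using x'(1) by (simp add: y'_def)
  ultimately show ?thesis using x'(1) y' by auto
qed

section \<open>Walks in a finite digraph\<close>

context fin_digraph
begin

definition walks_in :: "'a set \<Rightarrow> nat \<Rightarrow> 'a \<Rightarrow> 'b list set" where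
  "walks_in Q n v = {p. length p = n \<and> awalk v p (awlast v p) \<and> set (awalk_verts v p) \<subseteq> Q}"

abbreviation walks :: "nat \<Rightarrow> 'a \<Rightarrow> 'b list set" where
  "walks \<equiv> walks_in (verts G)"

lemma walks_iff: "p \<in> walks n v \<longleftrightarrow> length p = n \<and> awalk v p (awlast v p)"
  using set_awalk_verts_cas awalk_verts_in_verts by (auto simp: walks_in_def awalk_def)

lemma walks_in_subset: "walks_in Q n v \<subseteq> walks n v"
  by (auto simp: walks_iff) (auto simp: walks_in_def)

lemma walks_in_0: "v \<in> Q \<Longrightarrow> Q \<subseteq> verts G \<Longrightarrow> walks_in Q 0 v = {[]}"
  by (auto simp: walks_in_def awalk_simps)

lemma walks_in_Suc:
  assumes "v \<in> Q" "Q \<subseteq> verts G"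
  shows "walks_in Q (Suc n) v = (\<Union>e\<in>{e \<in> arcs G. tail G e = v \<and> head G e \<in> Q}. (#) e ` walks_in Q n (head G e))"
proof (intro equalityI subsetI)
  fix p assume "p \<in> walks_in Q (Suc n) v"
  then obtain e q where p: "p = e # q" "length q = n" "awalk v (e # q) (awlast v (e # q))"
      "set (awalk_verts v (e # q)) \<subseteq> Q"
    by (auto simp: walks_in_def length_Suc_conv)
  have "head G e \<in> set (awalk_verts (head G e) q)" by (cases q) (use p in \<open>auto simp: awalk_Cons_iff\<close>)
  then show "p \<in> (\<Union>e\<in>{e \<in> arcs G. tail G e = v \<and> head G e \<in> Q}. (#) e ` walks_in Q n (head G e))"
    using p by (auto simp: awalk_Cons_iff walks_in_def)
qed (use assms in \<open>auto simp: awalk_Cons_iff walks_in_def\<close>)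

lemma finite_walks_in: "finite (walks_in Q n v)"
proof -
  have "walks_in Q n v \<subseteq> {p. set p \<subseteq> arcs G \<and> length p = n}" by (auto simp: walks_in_def)
  then show ?thesis using finite_lists_length_eq[OF finite_arcs] finite_subset by blast
qed

lemma sum_walks_in_Suc:
  assumes "v \<in> Q" "Q \<subseteq> verts G"
  shows "(\<Sum>p\<in>walks_in Q (Suc n) v. F p)
    = (\<Sum>e | e \<in> arcs G \<and> tail G e = v \<and> head G e \<in> Q. \<Sum>p\<in>walks_in Q n (head G e). F (e # p))"
  unfolding walks_in_Suc[OF assms]
proof (subst sum.UNION_disjoint)
  show "(\<Sum>e | e \<in> arcs G \<and> tail G e = v \<and> head G e \<in> Q. sum F ((#) e ` walks_in Q n (head G e)))
    = (\<Sum>e | e \<in> arcs G \<and> tail G e = v \<and> head G e \<in> Q. \<Sum>p\<in>walks_in Q n (head G e). F (e # p))"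
    by (rule sum.cong[OF refl]) (simp add: sum.reindex)
qed (auto simp: finite_walks_in)

lemma sum_arcs_by_head:
  fixes g :: "'a \<Rightarrow> 'c::real_vector"
  assumes "Q \<subseteq> verts G"
  shows "(\<Sum>e | e \<in> arcs G \<and> tail G e = v \<and> head G e \<in> Q. g (head G e)) = (\<Sum>w\<in>Q. adj_matrix G v w *\<^sub>R g w)"
proof -
  have fQ: "finite Q" by (rule finite_subset[OF assms finite_verts])
  have "(\<Sum>e | e \<in> arcs G \<and> tail G e = v \<and> head G e \<in> Q. g (head G e))
    = (\<Sum>w\<in>Q. \<Sum>e | e \<in> {e \<in> arcs G. tail G e = v \<and> head G e \<in> Q} \<and> head G e = w. g (head G e))"
    by (rule sum.group[symmetric]) (use fQ in auto)
  also have "\<dots> = (\<Sum>w\<in>Q. \<Sum>e | e \<in> arcs G \<and> tail G e = v \<and> head G e = w. g w)"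
    by (intro sum.cong) auto
  also have "\<dots> = (\<Sum>w\<in>Q. adj_matrix G v w *\<^sub>R g w)"
    by (simp add: adj_matrix_def sum_constant_scaleR)
  finally show ?thesis .
qed

lemma awlast_Cons: "awlast v (e # p) = awlast (head G e) p"
  by (cases p) auto

lemma adj_apply_pow:
  assumes "v \<in> verts G"
  shows "(adj_apply G ^^ n) x v = (\<Sum>p\<in>walks n v. x (awlast v p))"
  using assms
proof (induction n arbitrary: v)
  case 0
  then show ?case by (simp add: walks_in_0)
next
  case (Suc n)
  have "(adj_apply G ^^ Suc n) x v = (\<Sum>w\<in>verts G. adj_matrix G v w *\<^sub>R (\<Sum>p\<in>walks n w. x (awlast w p)))"
    using Suc.IH by (simp add: adj_apply_def[of G "(adj_apply G ^^ n) x"])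
  also have "\<dots> = (\<Sum>p\<in>walks (Suc n) v. x (awlast v p))"
    unfolding sum_walks_in_Suc[OF Suc.prems order_refl] awlast_Cons
    by (rule sum_arcs_by_head[symmetric]) simp
  finally show ?case .
qed

text \<open>A positive eigenvector \<open>h\<close> of the adjacency matrix on \<open>Q\<close> weights the walks in \<open>Q\<close> by the law of
  a Markov chain.\<close>

lemma Ex_walks:
  fixes F :: "'a list \<Rightarrow> 'c::real_vector"
  assumes Q: "Q \<subseteq> verts G" and h: "\<And>v. v \<in> Q \<Longrightarrow> 0 < h v" and l: "0 < l"
    and M: "markov Q (\<lambda>u w. adj_matrix G u w * h w / (l * h u))" and v: "v \<in> Q"
  shows "markov.Ex Q (\<lambda>u w. adj_matrix G u w * h w / (l * h u)) n v F
    = (\<Sum>p\<in>walks_in Q n v. (h (awlast v p) / (l ^ n * h v)) *\<^sub>R F (awalk_verts v p))"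
proof -
  interpret markov Q "\<lambda>u w. adj_matrix G u w * h w / (l * h u)" by (rule M)
  show ?thesis
    using v
  proof (induction n arbitrary: v F)
    case 0
    then show ?case using Q h[of v] by (simp add: walks_in_0)
  next
    case (Suc n)
    define S where "S w = (\<Sum>p\<in>walks_in Q n w. (h (awlast w p) / l ^ n) *\<^sub>R F (v # awalk_verts w p))" for w
    have "Ex (Suc n) v F = (\<Sum>w\<in>Q. adj_matrix G v w *\<^sub>R ((1 / (l * h v)) *\<^sub>R S w))"
    proof (unfold Ex.simps, intro sum.cong refl)
      fix w assume w: "w \<in> Q"
      have "Ex n w (\<lambda>p. F (v # p)) = (1 / h w) *\<^sub>R S w"
        unfolding Suc.IH[OF w] S_def scaleR_sum_right by (intro sum.cong) (auto simp: mult.commute)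
      then show "(adj_matrix G v w * h w / (l * h v)) *\<^sub>R Ex n w (\<lambda>p. F (v # p))
          = adj_matrix G v w *\<^sub>R ((1 / (l * h v)) *\<^sub>R S w)"
        using h[OF w] by simp
    qed
    also have "\<dots> = (\<Sum>e | e \<in> arcs G \<and> tail G e = v \<and> head G e \<in> Q. (1 / (l * h v)) *\<^sub>R S (head G e))"
      by (rule sum_arcs_by_head[OF Q, symmetric])
    also have "\<dots> = (\<Sum>p\<in>walks_in Q (Suc n) v. (h (awlast v p) / (l ^ Suc n * h v)) *\<^sub>R F (awalk_verts v p))"
      unfolding sum_walks_in_Suc[OF Suc.prems Q] awlast_Cons S_def scaleR_sum_right
      by (intro sum.cong refl) (auto simp: mult_ac)
    finally show ?case .
  qed
qed

end

section \<open>The Markov chain of a digraph of exponential growth\<close>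

locale growing_digraph = fin_digraph G for G :: "('v, 'e) pre_digraph" +
  fixes l :: real and v1 :: 'v
  assumes l_gt_1: "1 < l" and v1: "v1 \<in> verts G"
    and walks_upper: "v \<in> verts G \<Longrightarrow> \<exists>B. \<forall>n. real (card (walks n v)) \<le> B * l ^ n"
    and walks_lower: "l ^ n \<le> real (card (walks n v1))"
begin

abbreviation "A \<equiv> \<lambda>u w. adj_matrix G u w / l"

lemma adj_nonneg: "0 \<le> adj_matrix G u w"
  by (simp add: adj_matrix_def)

lemma A_pow: "(mat_op (verts G) A ^^ n) x u = (adj_apply G ^^ n) x u / l ^ n"
proof (induction n arbitrary: u)
  case (Suc n)
  then have "(mat_op (verts G) A ^^ n) x = (\<lambda>u. (adj_apply G ^^ n) x u / l ^ n)" by blast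
  then have "(mat_op (verts G) A ^^ Suc n) x u = mat_op (verts G) A (\<lambda>u. (adj_apply G ^^ n) x u / l ^ n) u" by simp
  also have "\<dots> = (adj_apply G ^^ Suc n) x u / l ^ Suc n"
    by (simp add: mat_op_def adj_apply_def[of G "(adj_apply G ^^ n) x"] sum_divide_distrib mult.commute)
  finally show ?case .
qed simp

sublocale pb: power_bounded "verts G" A
proof
  fix x :: "'v \<Rightarrow> real"
  define X where "X = (\<Sum>v\<in>verts G. \<bar>x v\<bar>)"
  have X: "\<bar>x v\<bar> \<le> X" if "v \<in> verts G" for v
    unfolding X_def using that by (intro member_le_sum) auto
  obtain B where B: "\<And>v n. v \<in> verts G \<Longrightarrow> real (card (walks n v)) \<le> B v * l ^ n"
    using walks_upper by metis
  have "\<bar>(mat_op (verts G) A ^^ n) x u\<bar> \<le> X * (\<Sum>v\<in>verts G. \<bar>B v\<bar>)" if u: "u \<in> verts G" for n u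
  proof -
    have "\<bar>(adj_apply G ^^ n) x u\<bar> \<le> (\<Sum>p\<in>walks n u. X)"
      unfolding adj_apply_pow[OF u]
      by (rule order_trans[OF sum_abs], intro sum_mono X) (auto simp: walks_iff awalk_last_in_verts)
    also have "\<dots> \<le> X * (B u * l ^ n)"
      using B[OF u, of n] abs_ge_zero[of "x u"] X[OF u] by (simp add: mult.commute mult_left_mono)
    also have "\<dots> \<le> X * ((\<Sum>v\<in>verts G. \<bar>B v\<bar>) * l ^ n)"
    proof (intro mult_left_mono mult_right_mono)
      show "B u \<le> (\<Sum>v\<in>verts G. \<bar>B v\<bar>)"
        using member_le_sum[of u "verts G" "\<lambda>v. \<bar>B v\<bar>"] u by auto
      show "0 \<le> X" using abs_ge_zero[of "x u"] X[OF u] by linarith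
    qed (use l_gt_1 in auto)
    finally show ?thesis unfolding A_pow using l_gt_1 by (simp add: abs_mult field_simps)
  qed
  then show "\<exists>B. \<forall>n. \<forall>u\<in>verts G. \<bar>(mat_op (verts G) A ^^ n) x u\<bar> \<le> B" by blast
qed simp

lemma cesaro_converges:
  assumes "u \<in> verts G"
  shows "\<exists>c. (\<lambda>n. (1 / real n) * (\<Sum>i=0..n. (1 / l ^ i) * (adj_apply G ^^ i) x u)) \<longlonglongrightarrow> c"
proof -
  obtain z y where "\<And>u. u \<in> verts G \<Longrightarrow> mat_op (verts G) A z u = z u"
    "\<And>u. u \<in> verts G \<Longrightarrow> x u = z u + (y u - mat_op (verts G) A y u)" using pb.mean_ergodic by blast
  from pb.cesaro_tendsto[OF this assms] show ?thesis by (auto simp: A_pow)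
qed

text \<open>This limit is also the rescaled mass of a cone, see \<open>nu_hat_limit\<close>, which
  links the two measures of the theorem.\<close>

definition h :: "'v \<Rightarrow> real" where
  "h = cesaro_limit l (adj_apply G) (\<lambda>_. 1)"

lemma h_tendsto:
  assumes "u \<in> verts G"
  shows "(\<lambda>n. (1 / real n) * (\<Sum>i=0..n. real (card (walks i u)) / l ^ i)) \<longlonglongrightarrow> h u"
proof -
  have "convergent (\<lambda>n. (1 / real n) * (\<Sum>i=0..n. (1 / l ^ i) * (adj_apply G ^^ i) (\<lambda>_. 1) u))"
    using cesaro_converges[OF assms] by (auto simp: convergent_def)
  then show ?thesis
    unfolding h_def cesaro_limit_def convergent_LIMSEQ_iff by (simp add: adj_apply_pow[OF assms])
qed

lemma h_eigen: assumes "u \<in> verts G" shows "(\<Sum>w\<in>verts G. adj_matrix G u w * h w) = l * h u"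
proof -
  obtain z y where z: "\<And>u. u \<in> verts G \<Longrightarrow> mat_op (verts G) A z u = z u"
    "\<And>u. u \<in> verts G \<Longrightarrow> 1 = z u + (y u - mat_op (verts G) A y u)" using pb.mean_ergodic[of "\<lambda>_. 1"] by blast
  have hz: "h u = z u" if "u \<in> verts G" for u
    using LIMSEQ_unique[OF h_tendsto[OF that]] pb.cesaro_tendsto[of z "\<lambda>_. 1" y, OF z that]
    by (simp add: A_pow adj_apply_pow[OF that])
  have "mat_op (verts G) A h u = h u"
    using z(1)[OF assms] hz[OF assms] mat_op_cong[of "verts G" h z A u] hz by simp
  then show ?thesis using l_gt_1 by (simp add: mat_op_def sum_divide_distrib[symmetric] field_simps)
qed

lemma h_nonneg: "u \<in> verts G \<Longrightarrow> 0 \<le> h u"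
  by (rule tendsto_lowerbound[OF h_tendsto]) (use l_gt_1 in \<open>auto intro!: always_eventually sum_nonneg divide_nonneg_nonneg mult_nonneg_nonneg\<close>)

lemma h_v1: "0 < h v1"
proof -
  have "1 \<le> h v1"
  proof (rule tendsto_lowerbound[OF h_tendsto[OF v1]])
    show "eventually (\<lambda>n. 1 \<le> (1 / real n) * (\<Sum>i=0..n. real (card (walks i v1)) / l ^ i)) sequentially"
      using eventually_gt_at_top[of 0]
    proof eventually_elim
      case (elim n)
      have "(\<Sum>i=0..n. 1) \<le> (\<Sum>i=0..n. real (card (walks i v1)) / l ^ i)"
        using walks_lower l_gt_1 by (intro sum_mono) (simp add: field_simps)
      then show ?case using elim by (simp add: field_simps)
    qed
  qed simp
  then show ?thesis by simp
qed

definition H :: "'v set" where "H = {u \<in> verts G. 0 < h u}"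

text \<open>Doob transform of the adjacency matrix by its eigenvector \<open>h\<close>. It lives on
  \<open>H\<close>, as the quotient makes no sense where \<open>h\<close> vanishes; such vertices
  carry no mass.\<close>

definition N :: "'v \<Rightarrow> 'v \<Rightarrow> real" where
  "N = (\<lambda>u w. adj_matrix G u w * h w / (l * h u))"

lemma H_subset: "H \<subseteq> verts G" by (auto simp: H_def)

lemma h_outside: "w \<in> verts G \<Longrightarrow> w \<notin> H \<Longrightarrow> h w = 0"
  using h_nonneg[of w] by (force simp: H_def)

lemma weighted_sum_H: "(\<Sum>w\<in>verts G. adj_matrix G u w * (h w * g w)) = (\<Sum>w\<in>H. adj_matrix G u w * (h w * g w))"
  by (intro sum.mono_neutral_right) (auto simp: H_def h_outside)

text \<open>Multiplication by \<open>h\<close> conjugates \<open>N\<close> into \<open>A\<close>.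
  Where \<open>h u = 0\<close> the eigenvalue equation forces \<open>h\<close> to vanish at all
  successors, so both sides are zero.\<close>

lemma A_N:
  assumes u: "u \<in> verts G"
  shows "mat_op (verts G) A (\<lambda>w. h w * g w) u = h u * mat_op H N g u"
proof (cases "u \<in> H")
  case True
  then have "0 < h u" by (simp add: H_def)
  then have "h u * mat_op H N g u = (\<Sum>w\<in>H. adj_matrix G u w * (h w * g w)) / l"
    using l_gt_1 by (simp add: mat_op_def N_def sum_distrib_left sum_divide_distrib mult.assoc)
  then show ?thesis by (simp add: mat_op_def weighted_sum_H[symmetric] sum_divide_distrib)
next
  case False
  then have hu: "h u = 0" using h_outside u by blast
  then have "(\<Sum>w\<in>verts G. adj_matrix G u w * h w) = 0" using h_eigen[OF u] by simp
  then have "\<forall>w\<in>verts G. adj_matrix G u w * h w = 0"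
    using sum_nonneg_eq_0_iff[of "verts G" "\<lambda>w. adj_matrix G u w * h w"] h_nonneg adj_nonneg by auto
  then have "\<forall>w\<in>verts G. A u w * (h w * g w) = 0" by auto
  then have "mat_op (verts G) A (\<lambda>w. h w * g w) u = 0" unfolding mat_op_def by (rule sum.neutral)
  then show ?thesis by (simp add: hu)
qed

sublocale chain: markov H N
proof
  show "finite H" using H_subset finite_verts finite_subset by blast
  show "H \<noteq> {}" using h_v1 v1 by (auto simp: H_def)
  fix u assume u: "u \<in> H"
  then have hu: "0 < h u" "u \<in> verts G" by (auto simp: H_def)
  show "0 \<le> N u v" if "v \<in> H" for v
    using that hu l_gt_1 adj_nonneg by (auto simp: N_def H_def)
  have "h u * (\<Sum>v\<in>H. N u v) = h u * mat_op H N (\<lambda>_. 1) u" by (simp add: mat_op_def)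
  also have "\<dots> = mat_op (verts G) A (\<lambda>w. h w * 1) u" using A_N[OF hu(2), of "\<lambda>_. 1"] by simp
  also have "\<dots> = h u" using h_eigen[OF hu(2)] l_gt_1 by (simp add: mat_op_def flip: sum_divide_distrib)
  finally show "(\<Sum>v\<in>H. N u v) = 1" using hu by simp
qed

lemma A_N_pow:
  assumes "u \<in> verts G"
  shows "(mat_op (verts G) A ^^ n) (\<lambda>w. h w * g w) u = h u * (mat_op H N ^^ n) g u"
  using assms
proof (induction n arbitrary: u)
  case (Suc n)
  have "(mat_op (verts G) A ^^ Suc n) (\<lambda>w. h w * g w) u
      = mat_op (verts G) A (\<lambda>w. h w * (mat_op H N ^^ n) g w) u"
    by (simp, rule mat_op_cong) (use Suc in auto)
  then show ?case using A_N[OF Suc.prems, of "(mat_op H N ^^ n) g"] by simp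
qed simp

lemma adj_duality:
  "(\<Sum>u\<in>verts G. x u * (adj_transpose_apply G ^^ n) y u) = (\<Sum>u\<in>verts G. (adj_apply G ^^ n) x u * y u)"
proof (induction n arbitrary: x)
  case (Suc n)
  have "(\<Sum>u\<in>verts G. x u * (adj_transpose_apply G ^^ Suc n) y u)
    = (\<Sum>u\<in>verts G. \<Sum>v\<in>verts G. x u * (adj_matrix G v u * (adj_transpose_apply G ^^ n) y v))"
    by (simp add: adj_transpose_apply_def[of G "(adj_transpose_apply G ^^ n) y"] sum_distrib_left)
  also have "\<dots> = (\<Sum>v\<in>verts G. \<Sum>u\<in>verts G. x u * (adj_matrix G v u * (adj_transpose_apply G ^^ n) y v))"
    by (rule sum.swap)
  also have "\<dots> = (\<Sum>v\<in>verts G. adj_apply G x v * (adj_transpose_apply G ^^ n) y v)"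
    by (simp add: adj_apply_def sum_distrib_right sum_distrib_left mult_ac)
  also have "\<dots> = (\<Sum>u\<in>verts G. (adj_apply G ^^ n) (adj_apply G x) u * y u)" by (rule Suc.IH)
  finally show ?case by (simp add: funpow_swap1)
qed simp

definition ldual :: "'v \<Rightarrow> real" where
  "ldual = cesaro_limit l (adj_transpose_apply G) (\<lambda>v. if v = v1 then 1 else 0)"

text \<open>By duality the entry at \<open>u\<close> of a power of the transpose is the value at
  \<open>v1\<close> of the same power of the matrix applied to the indicator of \<open>u\<close>;
  one convergence statement thus serves both limits.\<close>

lemma ldual_tendsto:
  assumes u: "u \<in> verts G"
  shows "(\<lambda>n. (1 / real n) * (\<Sum>i=0..n. (1 / l ^ i) * (adj_apply G ^^ i) (\<lambda>w. if w = u then 1 else 0) v1)) \<longlonglongrightarrow> ldual u"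
proof -
  have "(adj_transpose_apply G ^^ i) (\<lambda>v. if v = v1 then 1 else 0) u
      = (adj_apply G ^^ i) (\<lambda>w. if w = u then 1 else 0) v1" for i
    using adj_duality[of "\<lambda>w. if w = u then 1 else 0" i "\<lambda>v. if v = v1 then 1 else 0"] u v1
    by (simp add: if_distrib[of "\<lambda>x. x * _"] if_distrib[of "\<lambda>x. _ * x"] cong: if_cong)
  then show ?thesis
    using cesaro_converges[OF v1, of "\<lambda>w. if w = u then 1 else 0"]
    unfolding ldual_def cesaro_limit_def convergent_def[symmetric] convergent_LIMSEQ_iff by simp
qed

lemma sum_ldual_tendsto:
  "(\<lambda>n. (1 / real n) * (\<Sum>i=0..n. (1 / l ^ i) * (adj_apply G ^^ i) x v1)) \<longlonglongrightarrow> (\<Sum>u\<in>verts G. x u * ldual u)"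
proof -
  have pw: "(adj_apply G ^^ i) x v1 = (\<Sum>u\<in>verts G. x u * (adj_apply G ^^ i) (\<lambda>w. if w = u then 1 else 0) v1)" for i
  proof -
    have "x (awlast v1 p) = (\<Sum>u\<in>verts G. x u * (if awlast v1 p = u then 1 else 0))" if "p \<in> walks i v1" for p
      using that by (auto simp: walks_iff if_distrib[of "\<lambda>x. _ * x"] dest: awalk_last_in_verts cong: if_cong)
    then show ?thesis
      unfolding adj_apply_pow[OF v1] sum_distrib_left by (subst sum.swap) simp
  qed
  have "(1 / real n) * (\<Sum>i=0..n. (1 / l ^ i) * (adj_apply G ^^ i) x v1) = (\<Sum>u\<in>verts G. x u *
      ((1 / real n) * (\<Sum>i=0..n. (1 / l ^ i) * (adj_apply G ^^ i) (\<lambda>w. if w = u then 1 else 0) v1)))" for n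
    unfolding pw[of _] sum_distrib_left by (subst sum.swap) (simp add: mult_ac)
  then show ?thesis by (simp only:) (intro tendsto_sum tendsto_mult tendsto_const ldual_tendsto)
qed

lemma v1_H: "v1 \<in> H" using v1 h_v1 by (simp add: H_def)

text \<open>The sum is the Cesaro limit at \<open>v1\<close> of the powers of \<open>A\<close>
  applied to \<open>h * f\<close>, and these are \<open>h v1\<close> times the powers of
  \<open>N\<close> applied to \<open>f\<close>. So the stationary measure is the mean occupation of
  the chain started at \<open>v1\<close>.\<close>

lemma weight_mean:
  assumes f: "\<And>u. u \<in> H \<Longrightarrow> f u = e + (y u - mat_op H N y u)"
  shows "(\<Sum>u\<in>verts G. f u * (h u * ldual u)) = h v1 * e"
proof -
  have "(\<lambda>n. (1 / real n) * (\<Sum>i=0..n. (mat_op H N ^^ i) f v1)) \<longlonglongrightarrow> e"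
  proof (rule chain.cesaro_tendsto[OF _ f v1_H])
    show "mat_op H N (\<lambda>_. e) u = e" if "u \<in> H" for u
      using chain.N_sum[OF that] by (simp add: mat_op_def flip: sum_distrib_right)
  qed
  then have "(\<lambda>n. h v1 * ((1 / real n) * (\<Sum>i=0..n. (mat_op H N ^^ i) f v1))) \<longlonglongrightarrow> h v1 * e"
    by (rule tendsto_mult_left)
  moreover have "(1 / l ^ i) * (adj_apply G ^^ i) (\<lambda>u. h u * f u) v1 = h v1 * (mat_op H N ^^ i) f v1" for i
    using A_N_pow[OF v1, of i f] by (simp add: A_pow)
  ultimately have "(\<lambda>n. (1 / real n) * (\<Sum>i=0..n. (1 / l ^ i) * (adj_apply G ^^ i) (\<lambda>u. h u * f u) v1)) \<longlonglongrightarrow> h v1 * e"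
    by (simp add: sum_distrib_left mult.left_commute)
  from LIMSEQ_unique[OF sum_ldual_tendsto[of "\<lambda>u. h u * f u"] this] show ?thesis by (simp add: mult_ac)
qed

text \<open>The case \<open>f = 1\<close> of \<open>weight_mean\<close> identifies the normalizing
  factor as \<open>h v1\<close>.\<close>

lemma stationary_mean_eq:
  assumes f: "\<And>u. u \<in> H \<Longrightarrow> real_of_int (f u) = e + (y u - mat_op H N y u)"
  shows "stationary_mean l G v1 f = e"
proof -
  have w: "stationary_weight l G v1 u = h u * ldual u" for u by (simp add: stationary_weight_def h_def ldual_def)
  have "(\<Sum>u\<in>verts G. 1 * (h u * ldual u)) = h v1 * 1"
    by (rule weight_mean[where y = "\<lambda>_. 0"]) (simp add: mat_op_def)
  moreover have "(\<Sum>u\<in>verts G. real_of_int (f u) * (h u * ldual u)) = h v1 * e"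
    by (rule weight_mean[where f = "\<lambda>u. real_of_int (f u)", OF f])
  ultimately show ?thesis
    using h_v1 by (simp add: stationary_mean_def stationary_measure_def w flip: sum_divide_distrib)
qed

lemma algebraic_l: "algebraic l"
proof (rule algebraic_eigenvalue[of "verts G" v1 h])
  fix u assume "u \<in> verts G"
  then show "l * h u = (\<Sum>w\<in>verts G. of_rat (of_nat (card {e \<in> arcs G. tail G e = u \<and> head G e = w})) * h w)"
    using h_eigen[of u] by (simp add: adj_matrix_def)
qed (use v1 h_v1 in auto)

lemma Ex_walks_N:
  fixes F :: "'v list \<Rightarrow> 'c::real_vector"
  assumes C: "chain.closed_class C" and v: "v \<in> C"
  shows "markov.Ex C N n v F = (\<Sum>p\<in>walks_in C n v. (h (awlast v p) / (l ^ n * h v)) *\<^sub>R F (awalk_verts v p))"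
proof -
  have "C \<subseteq> H" using C by (simp add: chain.closed_class_def)
  then show ?thesis
    unfolding N_def
    by (intro Ex_walks) (use v l_gt_1 chain.markov_closed[OF C, unfolded N_def] in \<open>auto simp: H_def\<close>)
qed

lemma closed_H: "chain.closed_class H"
  using chain.nonempty_H by (auto simp: chain.closed_class_def)

text \<open>On a minimal class the eigenvector equation, normalized to sum 1, has an algebraic
  solution \<open>x'\<close>. The quotient \<open>x' / h\<close> is harmonic, hence constant on the
  class, and rescaling the eigenvector does not change the transition probabilities.\<close>

lemma algebraic_transitions:
  assumes C: "chain.minimal_class C" and uv: "u \<in> C" "v \<in> C"
  shows "algebraic (N u v)"
proof -
  have cl: "chain.closed_class C" using C by (simp add: chain.minimal_class_def)
  have CH: "C \<subseteq> H" "finite C" "C \<noteq> {}" using cl chain.finite_H finite_subset by (auto simp: chain.closed_class_def)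
  have hC: "0 < h u" if "u \<in> C" for u using CH that by (auto simp: H_def)
  define s where "s = (\<Sum>u\<in>C. h u)"
  have s: "0 < s" unfolding s_def using CH hC by (intro sum_pos) auto
  have eig: "(\<Sum>w\<in>C. adj_matrix G u w * h w) = l * h u" if u: "u \<in> C" for u
  proof -
    have "(\<Sum>w\<in>C. N u w) = 1" using markov.N_sum[OF chain.markov_closed[OF cl] u] .
    then have "(\<Sum>w\<in>C. adj_matrix G u w * h w) / (l * h u) = 1" by (simp add: N_def sum_divide_distrib)
    then show ?thesis using hC[OF u] l_gt_1 by (simp add: field_simps)
  qed
  define Eq :: "(('v \<Rightarrow> real) \<times> real) set" where "Eq = insert (\<lambda>_. 1, 1) ((\<lambda>u. (\<lambda>w. adj_matrix G u w - (if w = u then l else 0), 0)) ` C)"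
  have adj_alg: "algebraic (adj_matrix G u w)" for u w by (simp add: adj_matrix_def)
  have diag: "(\<Sum>w\<in>C. (adj_matrix G u w - (if w = u then l else 0)) * g w) = (\<Sum>w\<in>C. adj_matrix G u w * g w) - l * g u"
    if "u \<in> C" for u g
    using that CH by (simp add: left_diff_distrib sum_subtractf if_distrib[of "\<lambda>x. x * _"] cong: if_cong)
  have "\<exists>x'. (\<forall>j. algebraic (x' j)) \<and> (\<forall>(a, b)\<in>Eq. (\<Sum>j\<in>C. a j * x' j) = b)"
  proof (rule algebraic_linear_system[OF CH(2)])
    fix a b assume ab: "(a, b) \<in> Eq"
    then show "algebraic b \<and> (\<forall>j\<in>C. algebraic (a j))"
      using adj_alg algebraic_l by (auto simp: Eq_def intro!: algebraic_diff)
    from ab consider "a = (\<lambda>_. 1)" "b = 1" |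
        u where "u \<in> C" "a = (\<lambda>w. adj_matrix G u w - (if w = u then l else 0))" "b = 0"
      by (auto simp: Eq_def)
    then show "(\<Sum>j\<in>C. a j * (h j / s)) = b"
    proof cases
      case 1
      then show ?thesis using s by (simp add: s_def flip: sum_divide_distrib)
    next
      case 2
      have "(\<Sum>j\<in>C. a j * (h j / s)) = ((\<Sum>w\<in>C. adj_matrix G u w * h w) - l * h u) / s"
        unfolding 2 diag[OF 2(1)] by (simp add: sum_divide_distrib diff_divide_distrib)
      then show ?thesis using eig[OF 2(1)] 2 by simp
    qed
  qed
  then obtain x' where alg: "\<And>j. algebraic (x' j)" and x'1: "(\<Sum>j\<in>C. x' j) = 1"
    and x': "\<And>u. u \<in> C \<Longrightarrow> (\<Sum>w\<in>C. adj_matrix G u w * x' w) = l * x' u"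
    by (force simp: Eq_def diag)
  have harm: "mat_op C N (\<lambda>w. x' w / h w) u = x' u / h u" if u: "u \<in> C" for u
  proof -
    have "mat_op C N (\<lambda>w. x' w / h w) u = (\<Sum>w\<in>C. adj_matrix G u w * x' w) / (l * h u)"
      unfolding mat_op_def sum_divide_distrib N_def using hC by (intro sum.cong) (auto simp: less_imp_neq[symmetric])
    then show ?thesis using x'[OF u] l_gt_1 by simp
  qed
  define k where "k = x' u / h u"
  have k: "x' w = k * h w" if "w \<in> C" for w
    using chain.minimal_class_irreducible[OF C harm that uv(1)] hC[OF that] by (simp add: k_def field_simps)
  have "k \<noteq> 0" using x'1 k by auto
  have "N u v = adj_matrix G u v * x' v / (l * x' u)"
    using k[OF uv(1)] k[OF uv(2)] \<open>k \<noteq> 0\<close> by (simp add: N_def)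
  then show ?thesis using alg adj_alg algebraic_l by (simp add: algebraic_divide algebraic_mult)
qed

end

section \<open>Combings\<close>

locale combed_group = gen_group +
  fixes L :: "'a list set" and \<Gamma> :: "('v, 'e) pre_digraph" and v1 :: 'v and lab :: "'e \<Rightarrow> 'a"
  assumes comb: "combing G S L" and param: "parameterizes \<Gamma> v1 lab S L"
    and accessible: "initial_accessible \<Gamma> v1"
begin

sublocale graph: fin_digraph \<Gamma>
  using param by (simp add: parameterizes_def)

abbreviation "paths \<equiv> {p. graph.awalk v1 p (graph.awlast v1 p)}"

definition elem :: "'e list \<Rightarrow> 'a" where
  "elem p = ev (map lab p)"

lemma v1_verts: "v1 \<in> verts \<Gamma>" using param by (simp add: parameterizes_def)

lemma L_eq: "L = map lab ` paths"
proof -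
  have "L = {map lab p | p v. graph.awalk v1 p v}" using param by (simp add: parameterizes_def)
  then show ?thesis by auto
qed

lemma label_inj:
  assumes "graph.awalk u p v" "graph.awalk u q w" "map lab p = map lab q"
  shows "p = q"
  using assms
proof (induction p arbitrary: u q)
  case (Cons e p)
  then obtain e' q' where q: "q = e' # q'" "lab e = lab e'" "map lab p = map lab q'" by (cases q) auto
  have "e \<in> arcs \<Gamma>" "e' \<in> arcs \<Gamma>" "tail \<Gamma> e = tail \<Gamma> e'" using Cons.prems q by (auto simp: graph.awalk_Cons_iff)
  then have "e = e'" using param q(2) by (simp add: parameterizes_def)
  then show ?case using Cons.IH[of "head \<Gamma> e" q'] Cons.prems q by (auto simp: graph.awalk_Cons_iff)
qed simp

lemma labels_S: "graph.awalk u p v \<Longrightarrow> map lab p \<in> lists S"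
  using param by (auto simp: parameterizes_def graph.awalk_def in_lists_conv_set)

lemma elem_closed: "graph.awalk u p v \<Longrightarrow> elem p \<in> carrier G"
  unfolding elem_def by (intro ev_closed labels_S)

lemma elem_append:
  assumes "graph.awalk u (p @ q) v"
  shows "elem (p @ q) = elem p \<otimes> elem q"
  using labels_S[OF assms] by (simp add: elem_def ev_append)

lemma elem_inj: "inj_on elem paths"
proof (rule inj_onI)
  fix p q assume pq: "p \<in> paths" "q \<in> paths" "elem p = elem q"
  have "inj_on ev L" using comb by (auto simp: combing_def bij_betw_def)
  moreover have "map lab p \<in> L" "map lab q \<in> L" using pq L_eq by auto
  ultimately have "map lab p = map lab q" using pq(3) by (auto simp: elem_def inj_on_def)
  then show "p = q" using label_inj pq by blast
qed

lemma elem_image: "elem ` paths = carrier G"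
proof -
  have "ev ` L = carrier G" using comb by (auto simp: combing_def bij_betw_def)
  then show ?thesis by (simp add: L_eq elem_def image_image)
qed

lemma len_elem: "p \<in> paths \<Longrightarrow> len (elem p) = length p"
  using comb L_eq by (force simp: combing_def elem_def)

lemma walks_paths: "p \<in> graph.walks n v1 \<longleftrightarrow> p \<in> paths \<and> length p = n"
  by (auto simp: graph.walks_iff)

lemma elem_sphere: "bij_betw elem (graph.walks n v1) (word_sphere G S n)"
proof (rule bij_betw_imageI)
  show "inj_on elem (graph.walks n v1)" by (rule inj_on_subset[OF elem_inj]) (auto simp: graph.walks_iff)
  show "elem ` graph.walks n v1 = word_sphere G S n"
  proof (intro equalityI subsetI)
    fix g assume "g \<in> elem ` graph.walks n v1"
    then show "g \<in> word_sphere G S n"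
      using len_elem elem_closed by (auto simp: graph.walks_iff word_sphere_def)
  next
    fix g assume g: "g \<in> word_sphere G S n"
    then obtain p where "p \<in> paths" "g = elem p" using elem_image by (auto simp: word_sphere_def)
    then show "g \<in> elem ` graph.walks n v1" using g len_elem walks_paths by (auto simp: word_sphere_def)
  qed
qed

lemma card_walks_v1: "card (graph.walks n v1) = card (word_sphere G S n)"
  using elem_sphere by (rule bij_betw_same_card)

lemma take_path: "p \<in> paths \<Longrightarrow> take i p \<in> paths"
  using graph.awalk_append_iff[of v1 "take i p" "drop i p"] by simp

lemma take_elem:
  assumes p: "p \<in> paths" and i: "i \<le> length p"
  shows "elem (take i p) \<in> carrier G" "len (elem (take i p)) = i" "dist (elem (take i p)) (elem p) = int (length p) - int i"
proof -
  have a: "graph.awalk v1 (take i p @ drop i p) (graph.awlast v1 p)" using p by simp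
  have t: "take i p \<in> paths" using p by (rule take_path)
  show c: "elem (take i p) \<in> carrier G" and l: "len (elem (take i p)) = i"
    using t len_elem[OF t] i elem_closed by auto
  have d: "elem (drop i p) \<in> carrier G"
    using a unfolding graph.awalk_append_iff by (auto intro: elem_closed)
  have e: "elem p = elem (take i p) \<otimes> elem (drop i p)" using elem_append[OF a] by simp
  have "len (elem (drop i p)) \<le> length p - i"
  proof -
    have "graph.awalk (graph.awlast v1 (take i p)) (drop i p) (graph.awlast v1 p)"
      using a unfolding graph.awalk_append_iff by simp
    from len_le[OF labels_S[OF this]] show ?thesis by (simp add: elem_def)
  qed
  moreover have "length p \<le> i + len (elem (drop i p))" using len_mult[OF c d] e l len_elem[OF p] by simp
  ultimately show "dist (elem (take i p)) (elem p) = int (length p) - int i"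
    using dist_mult[OF c d] e i by simp
qed

text \<open>Pumping: a path longer than the number of vertices contains a loop \<open>r\<close>. All
  pumped words lie in \<open>L\<close> and have different lengths, so they evaluate to different
  elements.\<close>

lemma infinite_order_element:
  assumes "infinite (carrier G)"
  shows "\<exists>w\<in>carrier G. \<forall>i j :: nat. w [^] i = w [^] j \<longrightarrow> i = j"
proof -
  have "\<not> carrier G \<subseteq> word_ball G S (card (verts \<Gamma>))" using assms finite_ball finite_subset by blast
  then obtain g where g: "g \<in> carrier G" "g \<notin> word_ball G S (card (verts \<Gamma>))" by blast
  then obtain p where p: "p \<in> paths" "g = elem p" using elem_image by blast
  then have lp: "card (verts \<Gamma>) < length p" using g len_elem[OF p(1)] by (auto simp: word_ball_def)
  have aw: "graph.awalk v1 p (graph.awlast v1 p)" using p by simp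
  have "\<not> distinct (graph.awalk_verts v1 p)"
  proof
    assume "distinct (graph.awalk_verts v1 p)"
    then have "length (graph.awalk_verts v1 p) = card (set (graph.awalk_verts v1 p))" by (simp add: distinct_card)
    also have "\<dots> \<le> card (verts \<Gamma>)"
      using aw graph.set_awalk_verts_cas by (intro card_mono) (auto dest: graph.awalk_verts_in_verts)
    finally show False using lp by (simp add: graph.length_awalk_verts)
  qed
  then obtain q r s u where qrs: "p = q @ r @ s" "0 < length r" "graph.awalk v1 q u" "graph.awalk u r u"
    using graph.awalk_not_distinct_decomp[OF aw] by blast
  have pump: "graph.awalk v1 (q @ concat (replicate k r)) u \<and>
      elem (q @ concat (replicate k r)) = elem q \<otimes> elem r [^] k" for k
  proof (induction k)
    case 0
    then show ?case using qrs elem_closed by simp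
  next
    case (Suc k)
    have e: "q @ concat (replicate (Suc k) r) = (q @ concat (replicate k r)) @ r"
      by (simp add: replicate_append_same[symmetric] del: replicate_Suc) (metis append.assoc concat.simps concat_append append_Nil2 replicate_Suc replicate_append_same)
    have a: "graph.awalk v1 ((q @ concat (replicate k r)) @ r) u"
      using Suc qrs(4) by (meson graph.awalk_appendI)
    show ?case unfolding e using a elem_append[OF a] Suc qrs elem_closed by (auto simp: m_assoc)
  qed
  have "i = j" if "elem r [^] i = elem r [^] j" for i j :: nat
  proof -
    have e: "elem (q @ concat (replicate i r)) = elem (q @ concat (replicate j r))" using pump that by metis
    have P: "q @ concat (replicate k r) \<in> paths" for k using pump[of k] by auto
    have "q @ concat (replicate i r) = q @ concat (replicate j r)" by (rule inj_onD[OF elem_inj e P P])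
    then have "length (concat (replicate i r)) = length (concat (replicate j r))" by simp
    then show ?thesis using qrs(2) by (simp add: length_concat sum_list_replicate)
  qed
  then show ?thesis using elem_closed[OF qrs(4)] by blast
qed

text \<open>Equal labels from \<open>v1\<close> mean equal paths, so prefixes in \<open>L\<close>
  are prefixes of paths, and the cone consists of the continuations of \<open>p\<close>.\<close>

lemma word_cone_eq:
  assumes p: "p \<in> graph.walks n v1" and m: "n \<le> m"
  shows "word_cone G L (elem p) \<inter> word_ball G S m
    = elem ` (\<Union>j\<in>{0..m - n}. (@) p ` graph.walks j (graph.awlast v1 p))"
proof (intro equalityI subsetI)
  fix g' assume g': "g' \<in> word_cone G L (elem p) \<inter> word_ball G S m"
  then obtain w w' where w: "w \<in> L" "w' \<in> L" "ev w = elem p" "ev w' = g'" "prefix w w'"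
    by (auto simp: word_cone_def)
  obtain p1 p' where p': "p1 \<in> paths" "w = map lab p1" "p' \<in> paths" "w' = map lab p'" using w L_eq by auto
  have pp: "p \<in> paths" "length p = n" using p walks_paths by auto
  have "elem p1 = elem p" using p' w by (simp add: elem_def)
  then have p1: "p1 = p" using inj_onD[OF elem_inj] p' pp by blast
  have "map lab (take n p') = map lab p"
    using w(5) p' p1 pp by (metis append_eq_conv_conj length_map prefix_def take_map)
  then have "take n p' = p" using label_inj[of v1 "take n p'" _ p] take_path[OF p'(3), of n] pp by blast
  then have e: "p' = p @ drop n p'" by (metis append_take_drop_id)
  have "graph.awalk (graph.awlast v1 p) (drop n p') (graph.awlast (graph.awlast v1 p) (drop n p'))"
    using p'(3) e by (metis (mono_tags, lifting) graph.awalk_append_iff graph.awlast_append mem_Collect_eq)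
  moreover have "length p' \<le> m" using g' w p' len_elem[OF p'(3)] by (auto simp: word_ball_def elem_def)
  ultimately have "p' \<in> (\<Union>j\<in>{0..m - n}. (@) p ` graph.walks j (graph.awlast v1 p))"
    using e by (intro UN_I[of "length p' - n"]) (auto simp: graph.walks_iff)
  then show "g' \<in> elem ` (\<Union>j\<in>{0..m - n}. (@) p ` graph.walks j (graph.awlast v1 p))"
    using w p' by (auto simp: elem_def)
next
  fix g' assume "g' \<in> elem ` (\<Union>j\<in>{0..m - n}. (@) p ` graph.walks j (graph.awlast v1 p))"
  then obtain j q where q: "j \<le> m - n" "q \<in> graph.walks j (graph.awlast v1 p)" "g' = elem (p @ q)" by auto
  have pp: "p \<in> paths" "length p = n" using p walks_paths by auto
  have pq: "p @ q \<in> paths" using pp q by (auto simp: graph.walks_iff graph.awlast_append)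
  have "g' \<in> carrier G" using pq elem_closed q by blast
  moreover have "map lab p \<in> L" "map lab (p @ q) \<in> L"
    unfolding L_eq by (rule imageI[OF pp(1)], rule imageI[OF pq])
  ultimately have "g' \<in> word_cone G L (elem p)"
    unfolding word_cone_def using q(3)
    by (intro CollectI conjI, simp, intro bexI[of _ "map lab p"] bexI[where x = "map lab (p @ q)"])
       (auto simp: elem_def)
  moreover have "len g' \<le> m" using len_elem[OF pq] q pp m by (simp add: graph.walks_iff)
  ultimately show "g' \<in> word_cone G L (elem p) \<inter> word_ball G S m" using \<open>g' \<in> carrier G\<close> by (auto simp: word_ball_def)
qed

end

section \<open>Masses of cones, and walks confined to a closed class\<close>

locale combed_growth = growth_group G S D C l K + combed_group G S L \<Gamma> v1 lab
  for G (structure) and S D C l K L and \<Gamma> :: "('v, 'e) pre_digraph" and v1 lab +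
  assumes l_growth: "l = growth_rate G S"
begin

lemma walk_from_root:
  assumes "v \<in> verts \<Gamma>"
  shows "\<exists>p. graph.awalk v1 p v"
  using assms accessible by (auto simp: initial_accessible_def graph.reachable_awalk)

sublocale graph: growing_digraph \<Gamma> l v1
proof
  show "1 < l" by (rule l)
  show "v1 \<in> verts \<Gamma>" by (rule v1_verts)
  show "l ^ n \<le> real (card (graph.walks n v1))" for n using sphere_lower by (simp add: card_walks_v1)
  fix v assume "v \<in> verts \<Gamma>"
  then obtain p where p: "graph.awalk v1 p v" using walk_from_root by blast
  then have pv: "graph.awlast v1 p = v" by simp
  have "real (card (graph.walks n v)) \<le> K * l ^ length p * l ^ n" for n
  proof -
    have "(@) p ` graph.walks n v \<subseteq> graph.walks (length p + n) v1"
      using p pv by (auto simp: graph.walks_iff graph.awlast_append)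
    then have "card ((@) p ` graph.walks n v) \<le> card (graph.walks (length p + n) v1)"
      by (intro card_mono graph.finite_walks_in)
    also have "card ((@) p ` graph.walks n v) = card (graph.walks n v)" by (intro card_image) (auto simp: inj_on_def)
    finally show ?thesis using sphere_upper[of "length p + n"] by (simp add: card_walks_v1 power_add mult.assoc)
  qed
  then show "\<exists>B. \<forall>n. real (card (graph.walks n v)) \<le> B * l ^ n" by blast
qed

text \<open>A cone at level \<open>n\<close> has as many elements of length \<open>n + j\<close> as
  there are walks of length \<open>j\<close> from the end vertex; the averages are those defining
  \<open>h\<close>, up to the index shift \<open>m = k + n\<close>.\<close>

lemma nu_hat_limit:
  assumes p: "p \<in> graph.walks n v1"
  shows "(\<lambda>m. nu_approx G S m (word_cone G L (elem p))) \<longlonglongrightarrow> graph.h (graph.awlast v1 p) / l ^ n"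
proof -
  define v where "v = graph.awlast v1 p"
  have pp: "p \<in> paths" "length p = n" using p walks_paths by auto
  have v: "v \<in> verts \<Gamma>" using pp(1) graph.awalk_last_in_verts unfolding v_def by blast
  define c where "c j = real (card (graph.walks j v)) / l ^ j" for j
  have eq: "nu_approx G S (k + n) (word_cone G L (elem p)) = 1 / real (k + n) * (\<Sum>j=0..k. c j) / l ^ n" for k
  proof -
    define W where "W = (\<lambda>j. (@) p ` graph.walks j v)"
    have path: "q \<in> paths \<and> length q = n + j" if "q \<in> W j" for q j
      using that pp by (auto simp: W_def v_def graph.walks_iff graph.awlast_append)
    have disj: "W i \<inter> W j = {}" if "i \<noteq> j" for i j proof -
      have "i = j" if "q \<in> W i" "q \<in> W j" for q using path[OF that(1)] path[OF that(2)] by simp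
      then show ?thesis using that by blast
    qed
    have fin: "finite (W j)" for j by (simp add: W_def graph.finite_walks_in)
    have cardW: "card (W j) = card (graph.walks j v)" for j
      unfolding W_def by (intro card_image) (auto simp: inj_on_def)
    have "(\<Sum>g\<in>word_cone G L (elem p) \<inter> word_ball G S (k + n). 1 / growth_rate G S ^ len g)
      = (\<Sum>g\<in>elem ` (\<Union>j\<in>{0..k}. W j). 1 / l ^ len g)"
      using word_cone_eq[OF p, of "k + n"] by (simp add: W_def v_def l_growth)
    also have "\<dots> = (\<Sum>q\<in>(\<Union>j\<in>{0..k}. W j). 1 / l ^ len (elem q))"
      by (subst sum.reindex) (use path in \<open>auto intro: inj_on_subset[OF elem_inj]\<close>)
    also have "\<dots> = (\<Sum>j\<in>{0..k}. \<Sum>q\<in>W j. 1 / l ^ len (elem q))"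
      by (subst sum.UNION_disjoint) (use disj fin in auto)
    also have "\<dots> = (\<Sum>j\<in>{0..k}. c j / l ^ n)"
    proof (intro sum.cong refl)
      fix j
      have "(\<Sum>q\<in>W j. 1 / l ^ len (elem q)) = (\<Sum>q\<in>W j. 1 / l ^ (n + j))"
        using path len_elem by (intro sum.cong) auto
      then show "(\<Sum>q\<in>W j. 1 / l ^ len (elem q)) = c j / l ^ n" by (simp add: cardW c_def power_add)
    qed
    finally show ?thesis by (simp add: nu_approx_def sum_divide_distrib mult.commute)
  qed
  have "(\<lambda>k. real k / real (k + n) * (1 / real k * (\<Sum>j=0..k. c j)) / l ^ n) \<longlonglongrightarrow> 1 * graph.h v / l ^ n"
  proof (intro tendsto_divide tendsto_mult tendsto_const)
    show "(\<lambda>k. real k / real (k + n)) \<longlonglongrightarrow> 1" by real_asymp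
    show "(\<lambda>k. 1 / real k * (\<Sum>j=0..k. c j)) \<longlonglongrightarrow> graph.h v" unfolding c_def by (rule graph.h_tendsto[OF v])
  qed (use l in auto)
  moreover have "eventually (\<lambda>k. real k / real (k + n) * (1 / real k * (\<Sum>j=0..k. c j)) / l ^ n
      = nu_approx G S (k + n) (word_cone G L (elem p))) sequentially"
    using eventually_gt_at_top[of 0] by eventually_elim (simp add: eq)
  ultimately have "(\<lambda>k. nu_approx G S (k + n) (word_cone G L (elem p))) \<longlonglongrightarrow> graph.h v / l ^ n"
    using Lim_transform_eventually by fastforce
  then show ?thesis unfolding v_def by (rule LIMSEQ_offset)
qed

text \<open>In the applications \<open>p0\<close> leads from \<open>v1\<close> into
  \<open>Q\<close>; only the continuation is confined to \<open>Q\<close>.\<close>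

definition tree :: "'v set \<Rightarrow> 'e list \<Rightarrow> 'a set" where
  "tree Q p0 = {elem (p0 @ w) | w j. w \<in> graph.walks_in Q j (graph.awlast v1 p0)}"

lemma tree_path:
  assumes "p0 \<in> paths" "w \<in> graph.walks_in Q j (graph.awlast v1 p0)"
  shows "p0 @ w \<in> paths" "length w = j"
  using assms by (auto simp: graph.walks_in_def graph.awlast_append)

lemma walks_in_take:
  assumes w: "w \<in> graph.walks_in Q j v" and i: "i \<le> j"
  shows "take i w \<in> graph.walks_in Q i v"
proof -
  have aw: "graph.awalk v w (graph.awlast v w)" "length w = j" "set (graph.awalk_verts v w) \<subseteq> Q"
    using w by (auto simp: graph.walks_in_def)
  have "graph.awalk v (take i w @ drop i w) (graph.awlast v w)" using aw by simp
  then have "graph.awalk v (take i w) (graph.awlast v (take i w))" unfolding graph.awalk_append_iff by blast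
  moreover have "graph.awalk_verts v (take i w) = take (Suc i) (graph.awalk_verts v w)"
    using aw by (intro graph.awalk_verts_take_conv) (auto simp: graph.awalk_def)
  ultimately show ?thesis using aw i by (auto simp: graph.walks_in_def dest: in_set_takeD)
qed

lemma tree_sphere:
  assumes p0: "p0 \<in> paths" and k: "length p0 \<le> k"
  shows "tree Q p0 \<inter> Sph k = (\<lambda>w. elem (p0 @ w)) ` graph.walks_in Q (k - length p0) (graph.awlast v1 p0)"
proof (intro equalityI subsetI)
  fix g assume "g \<in> tree Q p0 \<inter> Sph k"
  then obtain w j where w: "w \<in> graph.walks_in Q j (graph.awlast v1 p0)" "g = elem (p0 @ w)" "len g = k"
    by (auto simp: tree_def word_sphere_def)
  then have "j = k - length p0" using tree_path[OF p0 w(1)] len_elem by fastforce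
  then show "g \<in> (\<lambda>w. elem (p0 @ w)) ` graph.walks_in Q (k - length p0) (graph.awlast v1 p0)" using w by blast
next
  fix g assume "g \<in> (\<lambda>w. elem (p0 @ w)) ` graph.walks_in Q (k - length p0) (graph.awlast v1 p0)"
  then obtain w where w: "w \<in> graph.walks_in Q (k - length p0) (graph.awlast v1 p0)" "g = elem (p0 @ w)" by blast
  have "p0 @ w \<in> paths" "length (p0 @ w) = k" using tree_path[OF p0 w(1)] k by auto
  then have "g \<in> Sph k" using w len_elem elem_closed by (auto simp: word_sphere_def)
  then show "g \<in> tree Q p0 \<inter> Sph k" using w by (auto simp: tree_def)
qed

lemma tree_inj: "p0 \<in> paths \<Longrightarrow> inj_on (\<lambda>w. elem (p0 @ w)) (graph.walks_in Q j (graph.awlast v1 p0))"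
  using tree_path(1) elem_inj unfolding inj_on_def by (metis (no_types, lifting) append_same_eq same_append_eq)

lemma rooted_tree:
  assumes p0: "p0 \<in> paths"
  shows "rooted_tree (length p0) (tree Q p0)"
  unfolding rooted_tree_def
proof (intro conjI ballI subsetI)
  fix x assume "x \<in> tree Q p0"
  then obtain w j where w: "w \<in> graph.walks_in Q j (graph.awlast v1 p0)" "x = elem (p0 @ w)" by (auto simp: tree_def)
  note tp = tree_path[OF p0 w(1)]
  then show "x \<in> carrier G" using w elem_closed by blast
  fix k assume k: "k \<in> {length p0..len x}"
  have lx: "len x = length p0 + j" using len_elem[OF tp(1)] tp(2) w by simp
  define i where "i = k - length p0"
  have i: "k = length p0 + i" "i \<le> j" using k lx by (auto simp: i_def)
  have tk: "take k (p0 @ w) = p0 @ take i w" by (simp add: i)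
  have "k \<le> length (p0 @ w)" using i tp by simp
  from take_elem[OF tp(1) this] have "len (elem (p0 @ take i w)) = k"
      "dist (elem (p0 @ take i w)) x = int (len x) - int k"
    using tk w(2) lx tp by auto
  moreover have "elem (p0 @ take i w) \<in> tree Q p0"
    using walks_in_take[OF w(1) i(2)] by (auto simp: tree_def)
  ultimately show "\<exists>x'\<in>tree Q p0. len x' = k \<and> dist x' x = int (len x) - int k" by blast
qed

text \<open>\<open>h\<close> is bounded above and away from zero on \<open>Q\<close>, so the Markov
  weight of a walk of length \<open>j\<close> in \<open>Q\<close> is comparable to
  \<open>1 / l ^ j\<close>. This converts probabilities into counts.\<close>

lemma walks_in_class:
  assumes C: "graph.chain.closed_class Q" and v: "v \<in> Q"
  shows "\<exists>c>0. (\<forall>j. c * l ^ j \<le> real (card (graph.walks_in Q j v))) \<and>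
    (\<forall>j P. c * real (card {w \<in> graph.walks_in Q j v. P (graph.awalk_verts v w)}) / l ^ j
       \<le> markov.Ex Q graph.N j v (\<lambda>xs. if P xs then 1 else 0 :: real))"
proof -
  have QH: "Q \<subseteq> graph.H" "finite Q"
    using C graph.chain.finite_H finite_subset by (auto simp: graph.chain.closed_class_def)
  have h: "0 < graph.h u" if "u \<in> Q" for u using QH that by (auto simp: graph.H_def)
  interpret Q: markov Q graph.N by (rule graph.chain.markov_closed[OF C])
  define s where "s = (\<Sum>u\<in>Q. graph.h u)"
  have hs: "graph.h u \<le> s" if "u \<in> Q" for u
    unfolding s_def using that QH(2) h by (intro member_le_sum) (auto intro: less_imp_le)
  define hm where "hm = Min (graph.h ` Q)"
  have hm: "0 < hm" "\<And>u. u \<in> Q \<Longrightarrow> hm \<le> graph.h u"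
  proof -
    have "graph.h ` Q \<noteq> {}" using v by blast
    then show "0 < hm" unfolding hm_def using QH(2) h by (subst Min_gr_iff) auto
  qed (use QH(2) in \<open>simp add: hm_def\<close>)
  have last: "graph.awlast v w \<in> Q" if "w \<in> graph.walks_in Q j v" for w j
  proof -
    have "graph.awlast v w \<in> set (graph.awalk_verts v w)" by (rule last_in_set) simp
    then show ?thesis using that by (auto simp: graph.walks_in_def)
  qed
  define c where "c = min (graph.h v / s) (hm / graph.h v)"
  have c: "0 < c" "c \<le> graph.h v / s" "c \<le> hm / graph.h v"
    using h[OF v] hs[OF v] hm by (auto simp: c_def intro!: divide_pos_pos)
  have "c * l ^ j \<le> real (card (graph.walks_in Q j v))" for j
  proof -
    have "1 = Q.Ex j v (\<lambda>_. 1 :: real)" by (simp add: Q.Ex_const v)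
    also have "\<dots> = (\<Sum>w\<in>graph.walks_in Q j v. graph.h (graph.awlast v w) / (l ^ j * graph.h v))"
      by (simp add: graph.Ex_walks_N[OF C v])
    also have "\<dots> \<le> (\<Sum>w\<in>graph.walks_in Q j v. s / (l ^ j * graph.h v))"
      using last hs l h[OF v] by (intro sum_mono divide_right_mono) auto
    finally have "l ^ j * graph.h v / s \<le> real (card (graph.walks_in Q j v))"
      using l h[OF v] hs[OF v] by (simp add: field_simps)
    moreover have "c * l ^ j \<le> graph.h v / s * l ^ j" using c(2) l by (intro mult_right_mono) auto
    ultimately show ?thesis by (simp add: mult.commute)
  qed
  moreover have "c * real (card {w \<in> graph.walks_in Q j v. P (graph.awalk_verts v w)}) / l ^ j
       \<le> Q.Ex j v (\<lambda>xs. if P xs then 1 else 0 :: real)" for j P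
  proof -
    let ?B = "{w \<in> graph.walks_in Q j v. P (graph.awalk_verts v w)}"
    have "c * real (card ?B) / l ^ j = (\<Sum>w\<in>?B. c / l ^ j)" by simp
    also have "\<dots> \<le> (\<Sum>w\<in>?B. graph.h (graph.awlast v w) / (l ^ j * graph.h v))"
    proof (intro sum_mono)
      fix w assume "w \<in> ?B"
      then have "hm / graph.h v \<le> graph.h (graph.awlast v w) / graph.h v"
        using hm(2)[OF last] h[OF v] by (intro divide_right_mono) auto
      then have "c \<le> graph.h (graph.awlast v w) / graph.h v" using c(3) by linarith
      then have "c / l ^ j \<le> graph.h (graph.awlast v w) / graph.h v / l ^ j"
        using l by (intro divide_right_mono) auto
      then show "c / l ^ j \<le> graph.h (graph.awlast v w) / (l ^ j * graph.h v)" by (simp add: mult.commute)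
    qed
    also have "\<dots> = (\<Sum>w\<in>graph.walks_in Q j v. if P (graph.awalk_verts v w)
        then graph.h (graph.awlast v w) / (l ^ j * graph.h v) else 0)"
      by (intro sum.inter_filter[OF graph.finite_walks_in])
    also have "\<dots> = Q.Ex j v (\<lambda>xs. if P xs then 1 else 0 :: real)"
      unfolding graph.Ex_walks_N[OF C v] by (intro sum.cong) auto
    finally show ?thesis .
  qed
  ultimately show ?thesis using c(1) by blast
qed

lemma tree_density:
  assumes C: "graph.chain.closed_class Q" and p0: "p0 \<in> paths" and v: "graph.awlast v1 p0 \<in> Q"
  shows "\<exists>c>0. \<forall>k\<ge>length p0. c * l ^ k \<le> real (card (tree Q p0 \<inter> Sph k))"
proof -
  obtain c where c: "0 < c" "\<And>j. c * l ^ j \<le> real (card (graph.walks_in Q j (graph.awlast v1 p0)))"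
    using walks_in_class[OF C v] by blast
  have "c / l ^ length p0 * l ^ k \<le> real (card (tree Q p0 \<inter> Sph k))" if k: "k \<ge> length p0" for k
  proof -
    have "c / l ^ length p0 * l ^ k = c * l ^ (k - length p0)" using l k by (simp add: power_diff)
    then show ?thesis
      unfolding tree_sphere[OF p0 k] card_image[OF tree_inj[OF p0]] using c(2)[of "k - length p0"] by simp
  qed
  moreover have "0 < c / l ^ length p0" using c l by simp
  ultimately show ?thesis by blast
qed

text \<open>There are at least \<open>\<delta> * l ^ m\<close> overlapping elements
  \<open>y\<close>. Few come from a walk with \<open>P'\<close>, and few are matched with a walk
  with \<open>P\<close>, since the matching is boundedly many to one and changes lengths by at most
  \<open>2 * R\<close>. Some \<open>y\<close> avoids both.\<close>

lemma good_pair: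
  assumes p0: "p0 \<in> paths" and p0': "p0' \<in> paths" and \<delta>: "0 < \<delta>"
    and ov: "\<And>m. m \<ge> m0 \<Longrightarrow> \<delta> * l ^ m \<le> real (card {y \<in> tree Q' p0' \<inter> Sph m.
        \<exists>x\<in>carrier G. len x \<le> R \<and> (\<exists>t\<in>tree Q p0. dist (x \<otimes> y) t \<le> int R)})"
    and small: "(\<lambda>j. real (card {w \<in> graph.walks_in Q j (graph.awlast v1 p0). P j w}) / l ^ j) \<longlonglongrightarrow> 0"
    and small': "(\<lambda>j. real (card {w \<in> graph.walks_in Q' j (graph.awlast v1 p0'). P' j w}) / l ^ j) \<longlonglongrightarrow> 0"
  shows "\<exists>M. \<forall>m\<ge>M. \<exists>w w' j j' x. length p0' + j' = m \<and> \<bar>int (length p0 + j) - int m\<bar> \<le> 2 * int R \<and>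
    w \<in> graph.walks_in Q j (graph.awlast v1 p0) \<and> \<not> P j w \<and>
    w' \<in> graph.walks_in Q' j' (graph.awlast v1 p0') \<and> \<not> P' j' w' \<and>
    x \<in> carrier G \<and> len x \<le> R \<and> dist (x \<otimes> elem (p0' @ w')) (elem (p0 @ w)) \<le> int R"
proof -
  define bc where "bc = ball_card (int R) * ball_card (int R)"
  \<comment> \<open>Chosen so that the elements matched with exceptional walks, over
    \<open>4 * R + 1\<close> levels and with multiplicity \<open>bc\<close>, number at most a
    quarter of \<open>\<delta> * l ^ m\<close>.\<close>
  define \<eta> where "\<eta> = \<delta> / (4 * (real bc * (4 * real R + 1) * l ^ (2 * R) + 1))"
  have l0: "0 < l" using l by simp
  have den: "0 < real bc * (4 * real R + 1) * l ^ (2 * R) + 1" using l0 by (intro add_nonneg_pos) auto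
  have \<eta>: "0 < \<eta>" using \<delta> den by (simp add: \<eta>_def)
  define B where "B j = {w \<in> graph.walks_in Q j (graph.awlast v1 p0). P j w}" for j
  define B' where "B' j = {w \<in> graph.walks_in Q' j (graph.awlast v1 p0'). P' j w}" for j
  have fB: "finite (B j)" "finite (B' j)" for j using graph.finite_walks_in by (auto simp: B_def B'_def)
  obtain j0 where j0: "\<And>j. j \<ge> j0 \<Longrightarrow> real (card (B j)) \<le> \<eta> * l ^ j"
    using order_tendstoD(2)[OF small \<eta>] l0 unfolding eventually_at_top_linorder B_def
    by (auto simp: divide_less_eq intro: less_imp_le)
  have "0 < \<delta> / 4" using \<delta> by simp
  then obtain j1 where j1: "\<And>j. j \<ge> j1 \<Longrightarrow> real (card (B' j)) \<le> \<delta> / 4 * l ^ j"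
    using order_tendstoD(2)[OF small', of "\<delta> / 4"] l0 unfolding eventually_at_top_linorder B'_def
    by (auto simp: divide_less_eq intro: less_imp_le)
  define M where "M = m0 + j0 + j1 + length p0 + length p0' + 2 * R"
  show ?thesis
  proof (intro exI[of _ M] allI impI)
    fix m assume m: "m \<ge> M"
    define Y where "Y = {y \<in> tree Q' p0' \<inter> Sph m. \<exists>x\<in>carrier G. len x \<le> R \<and> (\<exists>t\<in>tree Q p0. dist (x \<otimes> y) t \<le> int R)}"
    have fY: "finite Y" using finite_sphere[of m] by (rule finite_subset[rotated]) (auto simp: Y_def)
    define x where "x y = (SOME x. x \<in> carrier G \<and> len x \<le> R \<and> (\<exists>t\<in>tree Q p0. dist (x \<otimes> y) t \<le> int R))" for y
    define t where "t y = (SOME t. t \<in> tree Q p0 \<and> dist (x y \<otimes> y) t \<le> int R)" for y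
    have xt: "x y \<in> carrier G \<and> len (x y) \<le> R \<and> t y \<in> tree Q p0 \<and> dist (x y \<otimes> y) (t y) \<le> int R" if "y \<in> Y" for y
    proof -
      have "x y \<in> carrier G \<and> len (x y) \<le> R \<and> (\<exists>t\<in>tree Q p0. dist (x y \<otimes> y) t \<le> int R)"
        unfolding x_def by (rule someI_ex) (use that in \<open>auto simp: Y_def\<close>)
      moreover from this have "\<exists>t. t \<in> tree Q p0 \<and> dist (x y \<otimes> y) t \<le> int R" by blast
      then have "t y \<in> tree Q p0 \<and> dist (x y \<otimes> y) (t y) \<le> int R" unfolding t_def by (rule someI_ex)
      ultimately show ?thesis by blast
    qed
    have Tc: "z \<in> carrier G" if "z \<in> tree Q p0" for z
      using rooted_tree[OF p0, of Q] that by (auto simp: rooted_tree_def)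
    have yc: "y \<in> carrier G \<and> len y = m" if "y \<in> Y" for y using that by (auto simp: Y_def word_sphere_def)
    define TB where "TB = (\<Union>k\<in>{m - 2 * R..m + 2 * R}. (\<lambda>w. elem (p0 @ w)) ` B (k - length p0))"
    have cTB: "real (card TB) \<le> (4 * real R + 1) * (\<eta> * l ^ (m + 2 * R))"
    proof -
      have "card TB \<le> (\<Sum>k\<in>{m - 2 * R..m + 2 * R}. card ((\<lambda>w. elem (p0 @ w)) ` B (k - length p0)))"
        unfolding TB_def by (rule card_UN_le) simp
      also have "\<dots> \<le> (\<Sum>k\<in>{m - 2 * R..m + 2 * R}. card (B (k - length p0)))"
        by (intro sum_mono card_image_le fB)
      finally have "real (card TB) \<le> (\<Sum>k\<in>{m - 2 * R..m + 2 * R}. real (card (B (k - length p0))))"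
        by (simp flip: of_nat_sum)
      also have "\<dots> \<le> (\<Sum>k\<in>{m - 2 * R..m + 2 * R}. \<eta> * l ^ (m + 2 * R))"
      proof (intro sum_mono)
        fix k assume k: "k \<in> {m - 2 * R..m + 2 * R}"
        have "real (card (B (k - length p0))) \<le> \<eta> * l ^ (k - length p0)" using m k by (intro j0) (auto simp: M_def)
        also have "\<dots> \<le> \<eta> * l ^ (m + 2 * R)" using k l \<eta> by (intro mult_left_mono power_increasing) auto
        finally show "real (card (B (k - length p0))) \<le> \<eta> * l ^ (m + 2 * R)" .
      qed
      also have "\<dots> = real (Suc (m + 2 * R) - (m - 2 * R)) * (\<eta> * l ^ (m + 2 * R))" by simp
      also have "real (Suc (m + 2 * R) - (m - 2 * R)) = 4 * real R + 1" using m by (auto simp: M_def)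
      finally show ?thesis .
    qed
    have fTB: "finite TB" using fB by (auto simp: TB_def)
    have "card {y \<in> Y. t y \<in> TB} \<le> bc * card TB"
    proof (rule card_le_fibres[of _ _ t])
      fix z assume z: "z \<in> TB"
      let ?F = "{y \<in> {y \<in> Y. t y \<in> TB}. t y = z}"
      have "z \<in> tree Q p0" if "y \<in> ?F" for y using xt[of y] that by auto
      show "card ?F \<le> bc"
      proof (cases "?F = {}")
        case False
        then have zc: "z \<in> carrier G" using xt Tc by auto
        have sub: "?F \<subseteq> (\<lambda>(x, z'). inv x \<otimes> z') ` ({x \<in> carrier G. dist \<one> x \<le> int R} \<times> {z' \<in> carrier G. dist z z' \<le> int R})"
        proof
          fix y assume y: "y \<in> ?F"
          then have yy: "y \<in> carrier G" "x y \<in> carrier G" "len (x y) \<le> R" "dist (x y \<otimes> y) z \<le> int R"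
            using xt[of y] yc[of y] by auto
          then show "y \<in> (\<lambda>(x, z'). inv x \<otimes> z') ` ({x \<in> carrier G. dist \<one> x \<le> int R} \<times> {z' \<in> carrier G. dist z z' \<le> int R})"
            using dist_commute[of "x y \<otimes> y" z] zc
            by (intro image_eqI[of _ _ "(x y, x y \<otimes> y)"]) (auto simp: m_assoc[symmetric])
        qed
        have fin: "finite ({x \<in> carrier G. dist \<one> x \<le> int R} \<times> {z' \<in> carrier G. dist z z' \<le> int R})"
          using dist_ball(1) zc by auto
        have "card ?F \<le> card ({x \<in> carrier G. dist \<one> x \<le> int R} \<times> {z' \<in> carrier G. dist z z' \<le> int R})"
          by (rule surj_card_le[OF fin sub])
        also have "\<dots> \<le> bc" unfolding bc_def card_cartesian_product using dist_ball(2) zc by (intro mult_le_mono) auto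
        finally show ?thesis .
      qed (simp only: card.empty le0)
    qed (use fY fTB in auto)
    then have "real (card {y \<in> Y. t y \<in> TB}) \<le> real bc * real (card TB)" by (simp flip: of_nat_mult)
    also have "\<dots> \<le> real bc * ((4 * real R + 1) * (\<eta> * l ^ (m + 2 * R)))" using cTB by (intro mult_left_mono) auto
    also have "\<dots> = (real bc * (4 * real R + 1) * l ^ (2 * R)) * \<eta> * l ^ m" by (simp add: power_add mult_ac)
    also have "\<dots> \<le> (real bc * (4 * real R + 1) * l ^ (2 * R) + 1) * \<eta> * l ^ m"
      using \<eta> l0 by (intro mult_right_mono) auto
    also have "\<dots> = \<delta> / 4 * l ^ m" using den by (simp add: \<eta>_def field_simps)
    finally have c1: "real (card {y \<in> Y. t y \<in> TB}) \<le> \<delta> / 4 * l ^ m" .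
    define YB where "YB = (\<lambda>w. elem (p0' @ w)) ` B' (m - length p0')"
    have "real (card YB) \<le> real (card (B' (m - length p0')))" unfolding YB_def using card_image_le[OF fB(2)] by simp
    also have "\<dots> \<le> \<delta> / 4 * l ^ (m - length p0')" using m by (intro j1) (auto simp: M_def)
    also have "\<dots> \<le> \<delta> / 4 * l ^ m" using l \<delta> by (intro mult_left_mono power_increasing) auto
    finally have c2: "real (card YB) \<le> \<delta> / 4 * l ^ m" .
    have "\<delta> * l ^ m \<le> real (card Y)" unfolding Y_def using m by (intro ov) (auto simp: M_def)
    have "\<not> Y \<subseteq> {y \<in> Y. t y \<in> TB} \<union> YB"
    proof
      assume "Y \<subseteq> {y \<in> Y. t y \<in> TB} \<union> YB"
      then have "card Y \<le> card ({y \<in> Y. t y \<in> TB} \<union> YB)" using fY fB by (intro card_mono) (auto simp: YB_def)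
      also have "\<dots> \<le> card {y \<in> Y. t y \<in> TB} + card YB" by (rule card_Un_le)
      finally have "real (card Y) \<le> \<delta> / 4 * l ^ m + \<delta> / 4 * l ^ m" using c1 c2 by linarith
      moreover have "0 < \<delta> * l ^ m" using \<delta> l0 by simp
      ultimately show False using \<open>\<delta> * l ^ m \<le> real (card Y)\<close> by simp
    qed
    then obtain y where y: "y \<in> Y" "t y \<notin> TB" "y \<notin> YB" by blast
    have "y \<in> tree Q' p0' \<inter> Sph m" using y by (simp add: Y_def)
    then obtain w' where w': "w' \<in> graph.walks_in Q' (m - length p0') (graph.awlast v1 p0')" "y = elem (p0' @ w')"
      using tree_sphere[OF p0', of m Q'] m by (auto simp: M_def)
    have nP': "\<not> P' (m - length p0') w'" using y(3) w' by (auto simp: YB_def B'_def)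
    obtain w j where w: "w \<in> graph.walks_in Q j (graph.awlast v1 p0)" "t y = elem (p0 @ w)"
      using xt[OF y(1)] by (auto simp: tree_def)
    have lt: "len (t y) = length p0 + j" using len_elem tree_path[OF p0 w(1)] w(2) by simp
    note xty = xt[OF y(1)] and ycy = yc[OF y(1)]
    have "\<bar>int (length p0 + j) - int m\<bar> \<le> 2 * int R"
    proof -
      have tc: "t y \<in> carrier G" using xty Tc by blast
      have "int (len (t y)) \<le> int (len (x y \<otimes> y)) + dist (x y \<otimes> y) (t y)"
        using word.d_tri[of \<one> "x y \<otimes> y" "t y"] tc xty ycy by simp
      moreover have "int (len (x y \<otimes> y)) \<le> int (len (t y)) + dist (x y \<otimes> y) (t y)"
        using word.d_tri[of \<one> "t y" "x y \<otimes> y"] dist_commute[of "t y" "x y \<otimes> y"] tc xty ycy by simp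
      moreover have "len (x y \<otimes> y) \<le> len (x y) + len y" using len_mult xty ycy by blast
      moreover have "dist (x y) (x y \<otimes> y) \<le> dist (x y) \<one> + dist \<one> (x y \<otimes> y)"
        using xty ycy by (intro word.d_tri) auto
      ultimately show ?thesis using xty ycy unfolding lt[symmetric] by auto
    qed
    moreover have "\<not> P j w"
    proof
      assume "P j w"
      then have "t y \<in> TB" using w calculation lt unfolding TB_def B_def
        by (intro UN_I[of "length p0 + j"]) auto
      then show False using y by blast
    qed
    moreover have "length p0' + (m - length p0') = m" using m by (simp add: M_def)
    ultimately show "\<exists>w w' j j' x. length p0' + j' = m \<and> \<bar>int (length p0 + j) - int m\<bar> \<le> 2 * int R \<and>
      w \<in> graph.walks_in Q j (graph.awlast v1 p0) \<and> \<not> P j w \<and>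
      w' \<in> graph.walks_in Q' j' (graph.awlast v1 p0') \<and> \<not> P' j' w' \<and>
      x \<in> carrier G \<and> len x \<le> R \<and> dist (x \<otimes> elem (p0' @ w')) (elem (p0 @ w)) \<le> int R"
      using w w' nP' xty by metis
  qed
qed

end

section \<open>Drift of sums over a window, and the constant in a Poisson equation\<close>

context markov
begin

text \<open>Each further step contributes one more \<open>e\<close>; the correction \<open>b\<close>
  turns into \<open>T y + T b\<close> and so remains a coboundary. The initial state is not counted,
  in accordance with \<open>dsum\<close>.\<close>

lemma Ex_sum_drift:
  assumes f: "\<And>u. u \<in> H \<Longrightarrow> f u = e + (y u - T y u)"
  shows "\<exists>b. \<forall>u\<in>H. Ex n u (\<lambda>p. sum_list (map f (tl p))) = real n * e + (b u - T b u)"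
proof (induction n)
  case 0
  then show ?case by (intro exI[of _ "\<lambda>_. 0"]) (simp add: mat_op_def)
next
  case (Suc n)
  then obtain b where b: "\<And>u. u \<in> H \<Longrightarrow> Ex n u (\<lambda>p. sum_list (map f (tl p))) = real n * e + (b u - T b u)" by blast
  define b' where "b' = (\<lambda>u. T y u + T b u)"
  have "Ex (Suc n) u (\<lambda>p. sum_list (map f (tl p))) = real (Suc n) * e + (b' u - T b' u)" if u: "u \<in> H" for u
  proof -
    have "Ex n w (\<lambda>p. sum_list (map f p)) = real (Suc n) * e * 1 + ((y w + b w) - (T y w + T b w))" if w: "w \<in> H" for w
    proof -
      have "Ex n w (\<lambda>p. sum_list (map f p)) = Ex n w (\<lambda>p. f w + sum_list (map f (tl p)))"
        by (rule Ex_cong[OF w]) (auto simp: length_Suc_conv)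
      also have "\<dots> = f w + Ex n w (\<lambda>p. sum_list (map f (tl p)))" by (simp only: Ex_add Ex_const[OF w])
      finally show ?thesis unfolding b[OF w] f[OF w] by (simp add: algebra_simps)
    qed
    then have "Ex (Suc n) u (\<lambda>p. sum_list (map f (tl p)))
        = T (\<lambda>w. real (Suc n) * e * 1 + ((y w + b w) - (T y w + T b w))) u"
      unfolding Ex.simps mat_op_def real_scaleR_def by (intro sum.cong) auto
    also have "\<dots> = real (Suc n) * e * T (\<lambda>_. 1) u + (b' u - T b' u)"
      unfolding mat_op_add mat_op_diff mat_op_scale b'_def by simp
    finally show ?thesis using N_sum[OF u] by (simp add: mat_op_def)
  qed
  then show ?case by blast
qed

text \<open>Where \<open>b\<close> is largest its coboundary is nonnegative, where it is smallest
  nonpositive, so \<open>q\<close> lies between two values of \<open>z\<close>.\<close>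

lemma coboundary_value_between:
  assumes z: "\<And>u. u \<in> H \<Longrightarrow> z u = q + (b u - T b u)"
  shows "\<bar>q - c\<bar> \<le> (\<Sum>u\<in>H. \<bar>z u - c\<bar>)"
proof -
  have T_le: "T b u \<le> m" if "u \<in> H" "\<And>v. v \<in> H \<Longrightarrow> b v \<le> m" for b m u
  proof -
    have "T b u \<le> (\<Sum>v\<in>H. N u v * m)" unfolding mat_op_def using that N_nonneg by (intro sum_mono mult_left_mono) auto
    then show ?thesis using N_sum[OF that(1)] by (simp flip: sum_distrib_right)
  qed
  have single: "\<bar>z u - c\<bar> \<le> (\<Sum>u\<in>H. \<bar>z u - c\<bar>)" if "u \<in> H" for u
    using that finite_H by (intro member_le_sum) auto
  obtain u where u: "u \<in> H" "\<And>v. v \<in> H \<Longrightarrow> b v \<le> b u"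
    using finite_H nonempty_H obtains_MAX[of H b] by (metis Max_ge finite_imageI imageI)
  have "q \<le> z u" using z[OF u(1)] T_le[OF u] by simp
  obtain w where w: "w \<in> H" "\<And>v. v \<in> H \<Longrightarrow> - b v \<le> - b w"
    using finite_H nonempty_H obtains_MAX[of H "\<lambda>v. - b v"] by (metis Max_ge finite_imageI imageI)
  have "T (\<lambda>v. (-1) * b v) w \<le> - b w" using w by (intro T_le) auto
  then have "z w \<le> q" using z[OF w(1)] unfolding mat_op_scale by simp
  with \<open>q \<le> z u\<close> single[OF u(1)] single[OF w(1)] show ?thesis by linarith
qed

lemma Re_Ex: "Re (Ex n v F) = Ex n v (\<lambda>p. Re (F p))"
  by (induction n arbitrary: v F) auto

end

section \<open>Comparison of the recurrent classes\<close>

locale combed_bicombable = combed_growth +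
  fixes \<phi> :: "'a \<Rightarrow> int" and d\<phi> :: "'c \<Rightarrow> int" and B0 :: int
  assumes combs: "combs_function G \<Gamma> v1 lab L \<phi> d\<phi>" and B0: "0 \<le> B0"
    and lip: "a \<in> carrier G \<Longrightarrow> s \<in> S \<Longrightarrow> \<bar>\<phi> (a \<otimes> s) - \<phi> a\<bar> \<le> B0 \<and> \<bar>\<phi> (s \<otimes> a) - \<phi> a\<bar> \<le> B0"
begin

lemma phi_right: "a \<in> carrier G \<Longrightarrow> g \<in> carrier G \<Longrightarrow> \<bar>\<phi> (a \<otimes> g) - \<phi> a\<bar> \<le> B0 * int (len g)"
proof -
  assume a: "a \<in> carrier G" and g: "g \<in> carrier G"
  have "\<bar>\<phi> (a \<otimes> ev w) - \<phi> a\<bar> \<le> B0 * int (length w)" if "w \<in> lists S" "a \<in> carrier G" for w a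
    using that
  proof (induction w arbitrary: a)
    case (Cons s w)
    then have "a \<otimes> ev (s # w) = (a \<otimes> s) \<otimes> ev w" by (simp add: ev_closed S_carrier m_assoc)
    moreover have "\<bar>\<phi> ((a \<otimes> s) \<otimes> ev w) - \<phi> (a \<otimes> s)\<bar> \<le> B0 * int (length w)" using Cons by (auto simp: S_carrier)
    moreover have "\<bar>\<phi> (a \<otimes> s) - \<phi> a\<bar> \<le> B0" using lip[of a s] Cons by auto
    ultimately show ?case by (simp add: algebra_simps)
  qed simp
  then show ?thesis using len_word[OF g] a by metis
qed

lemma phi_left: "a \<in> carrier G \<Longrightarrow> g \<in> carrier G \<Longrightarrow> \<bar>\<phi> (g \<otimes> a) - \<phi> a\<bar> \<le> B0 * int (len g)"
proof -
  assume a: "a \<in> carrier G" and g: "g \<in> carrier G"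
  have "\<bar>\<phi> (ev w \<otimes> a) - \<phi> a\<bar> \<le> B0 * int (length w)" if "w \<in> lists S" for w
    using that
  proof (induction w)
    case (Cons s w)
    then have "ev (s # w) \<otimes> a = s \<otimes> (ev w \<otimes> a)" using a by (simp add: ev_closed S_carrier m_assoc)
    moreover have "\<bar>\<phi> (s \<otimes> (ev w \<otimes> a)) - \<phi> (ev w \<otimes> a)\<bar> \<le> B0" using lip[of "ev w \<otimes> a" s] Cons a by (auto simp: ev_closed)
    ultimately show ?case using Cons by (simp add: algebra_simps)
  qed (use a in simp)
  then show ?thesis using len_word[OF g] by metis
qed

lemma phi_dist: "a \<in> carrier G \<Longrightarrow> b \<in> carrier G \<Longrightarrow> \<bar>\<phi> b - \<phi> a\<bar> \<le> B0 * dist a b"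
  using phi_right[of a "inv a \<otimes> b"] by (simp add: dist_def m_assoc[symmetric])

text \<open>Both points are at distance about \<open>i\<close> from 1 and almost on a geodesic to
  \<open>elem p\<close>; the four-point condition from 1 applies, the translation by
  \<open>x\<close> costing multiples of \<open>R\<close>.\<close>

lemma fellow_travel:
  assumes p: "p \<in> paths" "p' \<in> paths" and i: "i \<le> length p" "i \<le> length p'"
    and x: "x \<in> carrier G" "len x \<le> R" "dist (x \<otimes> elem p') (elem p) \<le> int R"
  shows "dist (x \<otimes> elem (take i p')) (elem (take i p)) \<le> 5 * int R + D"
proof -
  note t = take_elem[OF p(1) i(1)] and y = take_elem[OF p(2) i(2)]
  have c: "elem p \<in> carrier G" "elem p' \<in> carrier G" using p elem_closed by auto
  let ?y = "x \<otimes> elem (take i p')" and ?t = "elem (take i p)"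
  have yc: "?y \<in> carrier G" "x \<otimes> elem p' \<in> carrier G" using x y c by auto
  have ly: "int i \<le> int R + int (len ?y)" "int (len ?y) \<le> int R + int i"
    using word.d_tri[of x \<one> ?y] x y yc len_mult[of x "elem (take i p')"] by auto
  have d: "dist ?y (elem p) \<le> int (length p') - int i + int R"
    using word.d_tri[of ?y "x \<otimes> elem p'" "elem p"] yc c x dist_left[of x "elem (take i p')" "elem p'"] y by auto
  have m: "int (length p') \<le> int (length p) + 2 * int R"
  proof -
    have "dist x (x \<otimes> elem p') \<le> dist x \<one> + dist \<one> (x \<otimes> elem p')" using x yc by (intro word.d_tri) auto
    moreover have "dist \<one> (x \<otimes> elem p') \<le> dist \<one> (elem p) + dist (elem p) (x \<otimes> elem p')"
      using c yc by (intro word.d_tri) auto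
    ultimately show ?thesis
      using x yc c len_elem[OF p(1)] len_elem[OF p(2)] dist_commute[of "elem p" "x \<otimes> elem p'"] by auto
  qed
  have "min (word.gp \<one> ?y (elem p)) (word.gp \<one> (elem p) ?t) - D \<le> word.gp \<one> ?y ?t"
    using word.hyperbolicD[OF hyp] yc c t by auto
  then show ?thesis
    using ly d m t c yc len_elem[OF p(1)] dist_commute[of "elem p" ?t] by (auto simp: gp_one)
qed

text \<open>The left Lipschitz property absorbs the translation by \<open>x\<close>, the right one
  the remaining distance: both halves of bicombability enter here. The bound is independent of
  \<open>i\<close> and of the lengths of the paths.\<close>

lemma phi_fellow:
  assumes p: "p \<in> paths" "p' \<in> paths" and i: "i \<le> length p" "i \<le> length p'"
    and x: "x \<in> carrier G" "len x \<le> R" "dist (x \<otimes> elem p') (elem p) \<le> int R"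
  shows "\<bar>\<phi> (elem (take i p)) - \<phi> (elem (take i p'))\<bar> \<le> B0 * (6 * int R + D)"
proof -
  note t = take_elem[OF p(1) i(1)] and y = take_elem[OF p(2) i(2)]
  have "\<bar>\<phi> (elem (take i p)) - \<phi> (x \<otimes> elem (take i p'))\<bar> \<le> B0 * (5 * int R + D)"
    using order_trans[OF phi_dist[of "x \<otimes> elem (take i p')" "elem (take i p)"] mult_left_mono[OF fellow_travel[OF p i x] B0]] x t y by auto
  moreover have "\<bar>\<phi> (x \<otimes> elem (take i p')) - \<phi> (elem (take i p'))\<bar> \<le> B0 * int R"
    using order_trans[OF phi_left[of "elem (take i p')" x] mult_left_mono[of "int (len x)" "int R", OF _ B0]] x y by auto
  ultimately show ?thesis by (simp add: algebra_simps)
qed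

lemma phi_path:
  assumes p: "p \<in> paths" and i: "i \<le> length p"
  shows "\<phi> (elem (take i p)) = (\<Sum>r=0..i. d\<phi> (graph.awalk_verts v1 p ! r))"
proof -
  have t: "take i p \<in> paths" by (rule take_path[OF p])
  then have "map lab (take i p) \<in> L" unfolding L_eq by (rule imageI)
  then have "\<phi> (elem (take i p)) = (\<Sum>r=0..length (map lab (take i p)). d\<phi> (graph.awalk_verts v1 (take i p) ! r))"
    using combs t unfolding combs_function_def elem_def by blast
  also have "\<dots> = (\<Sum>r=0..i. d\<phi> (graph.awalk_verts v1 p ! r))"
  proof (intro sum.cong)
    have "graph.awalk_verts v1 (take i p) = take (Suc i) (graph.awalk_verts v1 p)"
      using p by (intro graph.awalk_verts_take_conv) (auto simp: graph.awalk_def)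
    then show "d\<phi> (graph.awalk_verts v1 (take i p) ! r) = d\<phi> (graph.awalk_verts v1 p ! r)" if "r \<in> {0..i}" for r
      using that by simp
  qed (use i in simp)
  finally show ?thesis .
qed

text \<open>The first state of a window is dropped, as it already contributes to the value of
  \<open>\<phi>\<close> at the beginning of the window.\<close>

definition dsum :: "'c list \<Rightarrow> real" where
  "dsum xs = real_of_int (sum_list (map d\<phi> (tl xs)))"

lemma dsum_window:
  assumes p0: "p0 \<in> paths" and w: "w \<in> graph.walks_in Q j (graph.awlast v1 p0)" and i: "i + n \<le> j"
  shows "dsum (take (Suc n) (drop i (graph.awalk_verts (graph.awlast v1 p0) w)))
    = real_of_int (\<phi> (elem (take (length p0 + i + n) (p0 @ w))) - \<phi> (elem (take (length p0 + i) (p0 @ w))))"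
proof -
  define xs where "xs = graph.awalk_verts (graph.awlast v1 p0) w"
  define V where "V = graph.awalk_verts v1 (p0 @ w)"
  have pw: "p0 @ w \<in> paths" "length w = j" using tree_path[OF p0 w] by auto
  have lxs: "length xs = Suc j" using pw by (simp add: xs_def graph.length_awalk_verts)
  have "V = butlast (graph.awalk_verts v1 p0) @ xs"
    unfolding V_def xs_def using pw(1) by (intro graph.awalk_verts_append2[of _ _ _ "graph.awlast v1 (p0 @ w)"]) auto
  then have V: "V ! (length p0 + r) = xs ! r" for r by (simp add: nth_append graph.length_awalk_verts)
  have "sum_list (map d\<phi> (tl (take (Suc n) (drop i xs)))) = (\<Sum>r<n. d\<phi> (xs ! (i + Suc r)))"
    using lxs i by (simp add: sum_list_sum_nth nth_tl atLeast0LessThan)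
  also have "\<dots> = (\<Sum>r\<in>{length p0 + i<..length p0 + i + n}. d\<phi> (V ! r))"
    by (rule sum.reindex_bij_witness[of _ "\<lambda>r. r - Suc (length p0 + i)" "\<lambda>r. length p0 + (i + Suc r)"]) (auto simp: V[of "i + Suc _", simplified])
  also have "\<dots> = (\<Sum>r=0..length p0 + i + n. d\<phi> (V ! r)) - (\<Sum>r=0..length p0 + i. d\<phi> (V ! r))"
  proof -
    have e: "{0..length p0 + i + n} = {0..length p0 + i} \<union> {length p0 + i<..length p0 + i + n}" by auto
    have "(\<Sum>r=0..length p0 + i + n. d\<phi> (V ! r))
        = (\<Sum>r=0..length p0 + i. d\<phi> (V ! r)) + (\<Sum>r\<in>{length p0 + i<..length p0 + i + n}. d\<phi> (V ! r))"
      unfolding e by (rule sum.union_disjoint) auto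
    then show ?thesis by simp
  qed
  also have "\<dots> = \<phi> (elem (take (length p0 + i + n) (p0 @ w))) - \<phi> (elem (take (length p0 + i) (p0 @ w)))"
    using phi_path[OF pw(1), of "length p0 + i + n"] phi_path[OF pw(1), of "length p0 + i"] pw(2) i
    by (simp add: V_def)
  finally show ?thesis by (simp add: dsum_def xs_def)
qed

text \<open>\<open>window_lln\<close> speaks of probabilities; \<open>walks_in_class\<close> turns
  it into a statement on the number of walks relative to \<open>l ^ j\<close>.\<close>

lemma bad_windows_small:
  assumes C: "graph.chain.closed_class Q" and v: "v \<in> Q" and \<psi>: "\<And>x. \<bar>\<psi> x\<bar> \<le> B" and \<epsilon>: "0 < \<epsilon>"
    and q: "\<And>u. u \<in> Q \<Longrightarrow> markov.Ex Q graph.N n u (\<lambda>xs. \<psi> (dsum xs)) = q + (b u - mat_op Q graph.N b u)"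
  shows "(\<lambda>j. real (card {w \<in> graph.walks_in Q j v.
    \<epsilon> * real (j - n) \<le> \<bar>window_sum n (\<lambda>xs. \<psi> (dsum xs) - q) (j - n) (graph.awalk_verts v w)\<bar>}) / l ^ j) \<longlonglongrightarrow> 0"
proof -
  interpret Q: markov Q graph.N by (rule graph.chain.markov_closed[OF C])
  obtain c where c: "0 < c" "\<And>j P. c * real (card {w \<in> graph.walks_in Q j v. P (graph.awalk_verts v w)}) / l ^ j
       \<le> Q.Ex j v (\<lambda>xs. if P xs then 1 else 0 :: real)"
    using walks_in_class[OF C v] by blast
  define P where "P m xs \<longleftrightarrow> \<epsilon> * real m \<le> \<bar>window_sum n (\<lambda>xs. \<psi> (dsum xs) - q) m xs\<bar>" for m xs
  have "(\<lambda>m. Q.Ex (m + n) v (\<lambda>xs. if P m xs then 1 else 0 :: real)) \<longlonglongrightarrow> 0"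
    unfolding P_def
  proof (rule Q.window_lln[OF _ _ \<epsilon> v])
    fix u assume "u \<in> Q"
    then show "Q.Ex n u (\<lambda>xs. \<psi> (dsum xs) - q) = b u - mat_op Q graph.N b u"
      using Q.Ex_add[of n u "\<lambda>xs. \<psi> (dsum xs)" "\<lambda>_. - q"] q by (simp add: Q.Ex_const)
  next
    fix xs show "\<bar>\<psi> (dsum xs) - q\<bar> \<le> B + \<bar>q\<bar>" using \<psi>[of "dsum xs"] by linarith
  qed
  then have lim: "(\<lambda>m. Q.Ex (m + n) v (\<lambda>xs. if P m xs then 1 else 0 :: real) / c) \<longlonglongrightarrow> 0"
    using tendsto_divide[OF _ tendsto_const, of _ 0 sequentially c] c(1) by fastforce
  have "(\<lambda>m. real (card {w \<in> graph.walks_in Q (m + n) v. P m (graph.awalk_verts v w)}) / l ^ (m + n)) \<longlonglongrightarrow> 0"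
  proof (rule tendsto_sandwich[OF _ _ tendsto_const lim])
    show "eventually (\<lambda>m. 0 \<le> real (card {w \<in> graph.walks_in Q (m + n) v. P m (graph.awalk_verts v w)}) / l ^ (m + n)) sequentially"
      using l by (intro always_eventually) auto
    show "eventually (\<lambda>m. real (card {w \<in> graph.walks_in Q (m + n) v. P m (graph.awalk_verts v w)}) / l ^ (m + n)
        \<le> Q.Ex (m + n) v (\<lambda>xs. if P m xs then 1 else 0 :: real) / c) sequentially"
    proof (intro always_eventually allI)
      fix m
      show "real (card {w \<in> graph.walks_in Q (m + n) v. P m (graph.awalk_verts v w)}) / l ^ (m + n)
        \<le> Q.Ex (m + n) v (\<lambda>xs. if P m xs then 1 else 0 :: real) / c"
        using c(2)[of "m + n" "P m"] c(1) by (simp add: pos_le_divide_eq mult.commute)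
    qed
  qed
  note lim0 = this
  show ?thesis by (rule LIMSEQ_offset[where k = n]) (use lim0 in \<open>simp add: P_def\<close>)
qed

text \<open>The stationary mean of \<open>\<psi>\<close> over windows of length \<open>n\<close>,
  encoded by solvability of a Poisson equation on \<open>Q\<close>; this form feeds the law of large
  numbers directly.\<close>

definition window_mean :: "'c set \<Rightarrow> nat \<Rightarrow> (real \<Rightarrow> real) \<Rightarrow> real \<Rightarrow> bool" where
  "window_mean Q n \<psi> q \<longleftrightarrow> (\<exists>b. \<forall>u\<in>Q. markov.Ex Q graph.N n u (\<lambda>xs. \<psi> (dsum xs)) = q + (b u - mat_op Q graph.N b u))"

text \<open>By the law of large numbers the average of \<open>\<psi>\<close> over all windows of length \<open>n\<close> of a typical walk in a
  recurrent class is close to its stationary mean; for two overlapping walks these averages agree up to the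
  oscillation of \<open>\<psi>\<close> at a fixed scale.\<close>

theorem class_compare:
  assumes Q: "graph.chain.closed_class Q" and Q': "graph.chain.closed_class Q'"
  shows "\<exists>R. \<forall>n \<psi> \<kappa> B q q'. (\<forall>x. \<bar>\<psi> x\<bar> \<le> B) \<longrightarrow> (\<forall>x y. \<bar>\<psi> x - \<psi> y\<bar> \<le> \<kappa> * \<bar>x - y\<bar>) \<longrightarrow>
    window_mean Q n \<psi> q \<longrightarrow> window_mean Q' n \<psi> q' \<longrightarrow> \<bar>q - q'\<bar> \<le> R * \<kappa>"
proof -
  have root: "\<exists>p\<in>paths. graph.awlast v1 p \<in> Q" if "graph.chain.closed_class Q" for Q
  proof -
    have "Q \<noteq> {}" "Q \<subseteq> graph.H" using that by (simp_all add: graph.chain.closed_class_def)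
    then obtain v where v: "v \<in> Q" "v \<in> verts \<Gamma>" using graph.H_subset by blast
    obtain p where p: "graph.awalk v1 p v" using walk_from_root[OF v(2)] by blast
    then have "graph.awlast v1 p = v" by simp
    then show ?thesis using p v by (intro bexI[of _ p]) auto
  qed
  obtain p0 where p0: "p0 \<in> paths" "graph.awlast v1 p0 \<in> Q" using root[OF Q] by blast
  obtain p0' where p0': "p0' \<in> paths" "graph.awlast v1 p0' \<in> Q'" using root[OF Q'] by blast
  obtain c where c: "0 < c" "\<And>k. length p0 \<le> k \<Longrightarrow> c * l ^ k \<le> real (card (tree Q p0 \<inter> Sph k))"
    using tree_density[OF Q p0] by blast
  obtain c' where c': "0 < c'" "\<And>k. length p0' \<le> k \<Longrightarrow> c' * l ^ k \<le> real (card (tree Q' p0' \<inter> Sph k))"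
    using tree_density[OF Q' p0'] by blast
  obtain R \<delta> m0 where ov: "0 < \<delta>" "\<And>m. m \<ge> m0 \<Longrightarrow> \<delta> * l ^ m \<le> real (card {y \<in> tree Q' p0' \<inter> Sph m.
        \<exists>x\<in>carrier G. len x \<le> R \<and> (\<exists>t\<in>tree Q p0. dist (x \<otimes> y) t \<le> int R)})"
    using overlap[OF rooted_tree[OF p0(1), of Q] c c'] by blast
  define k where "k = length p0"
  define k' where "k' = length p0'"
  \<comment> \<open>\<open>Cst\<close> bounds the discrepancy of \<open>\<phi>\<close> along the two
    walks at equal times, and \<open>e\<close> the number of windows not common to both. Neither
    depends on \<open>n\<close> or \<open>\<psi>\<close>, which the later choice of observables
    relies on.\<close>
  define Cst where "Cst = B0 * (6 * int R + D)"
  define e where "e = k + k' + 2 * R"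
  have "\<bar>q - q'\<bar> \<le> 2 * real_of_int Cst * \<kappa>"
    if \<psi>: "\<And>x. \<bar>\<psi> x\<bar> \<le> B" and \<kappa>: "\<And>x y. \<bar>\<psi> x - \<psi> y\<bar> \<le> \<kappa> * \<bar>x - y\<bar>"
    and q: "\<And>u. u \<in> Q \<Longrightarrow> markov.Ex Q graph.N n u (\<lambda>xs. \<psi> (dsum xs)) = q + (b u - mat_op Q graph.N b u)"
    and q': "\<And>u. u \<in> Q' \<Longrightarrow> markov.Ex Q' graph.N n u (\<lambda>xs. \<psi> (dsum xs)) = q' + (b' u - mat_op Q' graph.N b' u)"
    for n \<psi> \<kappa> B q q' b b'
  proof (rule ccontr)
    assume "\<not> \<bar>q - q'\<bar> \<le> 2 * real_of_int Cst * \<kappa>"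
    \<comment> \<open>A quarter of the supposed excess: two deviations of size
      \<open>\<epsilon> * m\<close> still leave \<open>2 * \<epsilon> * m\<close>, which outgrows
      the boundary terms \<open>Z\<close>.\<close>
    define \<epsilon> where "\<epsilon> = (\<bar>q - q'\<bar> - 2 * real_of_int Cst * \<kappa>) / 4"
    have \<epsilon>: "0 < \<epsilon>" using \<open>\<not> _\<close> by (simp add: \<epsilon>_def field_simps)
    have qq: "\<bar>q - q'\<bar> = 4 * \<epsilon> + 2 * real_of_int Cst * \<kappa>" by (simp add: \<epsilon>_def field_simps)
    have \<kappa>0: "0 \<le> \<kappa>" using \<kappa>[of 1 0] by simp
    have B: "0 \<le> B" using \<psi>[of 0] by linarith
    define g where "g = (\<lambda>q xs. \<psi> (dsum xs) - q)"
    obtain M where M: "\<And>m. m \<ge> M \<Longrightarrow> \<exists>w w' j j' x. length p0' + j' = m \<and> \<bar>int (length p0 + j) - int m\<bar> \<le> 2 * int R \<and>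
      w \<in> graph.walks_in Q j (graph.awlast v1 p0) \<and>
      \<not> \<epsilon> * real (j - n) \<le> \<bar>window_sum n (g q) (j - n) (graph.awalk_verts (graph.awlast v1 p0) w)\<bar> \<and>
      w' \<in> graph.walks_in Q' j' (graph.awlast v1 p0') \<and>
      \<not> \<epsilon> * real (j' - n) \<le> \<bar>window_sum n (g q') (j' - n) (graph.awalk_verts (graph.awlast v1 p0') w')\<bar> \<and>
      x \<in> carrier G \<and> len x \<le> R \<and> dist (x \<otimes> elem (p0' @ w')) (elem (p0 @ w)) \<le> int R"
      using good_pair[OF p0(1) p0'(1) ov(1) ov(2) bad_windows_small[OF Q p0(2) \<psi> \<epsilon> q] bad_windows_small[OF Q' p0'(2) \<psi> \<epsilon> q']]
      unfolding g_def by blast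
    define Z where "Z = \<bar>q - q'\<bar> * (real k' + real n) + \<bar>q\<bar> * real e + \<epsilon> * real e + 2 * B * real e"
    obtain m :: nat where m: "m \<ge> M" "m \<ge> n + 2 * e" "Z < real m * (2 * \<epsilon>)"
    proof -
      obtain m1 :: nat where "Z < real m1 * (2 * \<epsilon>)" using ex_less_of_nat_mult[of "2 * \<epsilon>" Z] \<epsilon> by auto
      moreover have "real m1 * (2 * \<epsilon>) \<le> real (m1 + M + n + 2 * e) * (2 * \<epsilon>)" using \<epsilon> by (intro mult_right_mono) auto
      ultimately have "Z < real (m1 + M + n + 2 * e) * (2 * \<epsilon>)" by (rule less_le_trans)
      then show ?thesis by (intro that[of "m1 + M + n + 2 * e"]) simp_all
    qed
    obtain w w' j j' x where pair: "length p0' + j' = m" "\<bar>int (length p0 + j) - int m\<bar> \<le> 2 * int R"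
      "w \<in> graph.walks_in Q j (graph.awlast v1 p0)" "w' \<in> graph.walks_in Q' j' (graph.awlast v1 p0')"
      and good: "\<bar>window_sum n (g q) (j - n) (graph.awalk_verts (graph.awlast v1 p0) w)\<bar> < \<epsilon> * real (j - n)"
        "\<bar>window_sum n (g q') (j' - n) (graph.awalk_verts (graph.awlast v1 p0') w')\<bar> < \<epsilon> * real (j' - n)"
      and x: "x \<in> carrier G" "len x \<le> R" "dist (x \<otimes> elem (p0' @ w')) (elem (p0 @ w)) \<le> int R"
      using M[OF m(1)] unfolding not_le by blast
    define U where "U i = \<phi> (elem (take i (p0 @ w)))" for i
    define U' where "U' i = \<phi> (elem (take i (p0' @ w')))" for i
    note tp = tree_path[OF p0(1) pair(3)] and tp' = tree_path[OF p0'(1) pair(4)]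
    have close: "\<bar>U i - U' i\<bar> \<le> Cst" if "i \<le> k + j" "i \<le> m" for i
      unfolding U_def U'_def Cst_def using that pair(1) tp tp' x
      by (intro phi_fellow[of _ _ _ x]) (auto simp: k_def)
    define s where "s a = \<psi> (real_of_int (U (a + n) - U a))" for a
    define s' where "s' a = \<psi> (real_of_int (U' (a + n) - U' a))" for a
    define J where "J = {k..<k + (j - n)}"
    define J' where "J' = {k'..<k' + (j' - n)}"
    \<comment> \<open>Times, counted from \<open>v1\<close>, at which a window lies in the confined
      parts of both walks; \<open>J\<close> and \<open>J'\<close> exceed this set by at most
      \<open>e\<close> elements each.\<close>
    define I where "I = {max k k'..<min (k + j) m - n}"
    have kj: "int (k + j) \<le> int m + 2 * int R" "int m \<le> int (k + j) + 2 * int R" "k' + j' = m"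
      using pair by (auto simp: k_def k'_def)
    have jn: "n \<le> j" "n \<le> j'" using kj m by (auto simp: e_def)
    have ws: "window_sum n (g q) (j - n) (graph.awalk_verts (graph.awlast v1 p0) w) = sum s J - q * real (j - n)"
    proof -
      have "window_sum n (g q) (j - n) (graph.awalk_verts (graph.awlast v1 p0) w) = (\<Sum>i<j - n. s (k + i) - q)"
        unfolding window_sum_def using dsum_window[OF p0(1) pair(3)]
        by (intro sum.cong) (auto simp: g_def s_def U_def k_def)
      also have "(\<Sum>i<j - n. s (k + i) - q) = (\<Sum>i<j - n. s (k + i)) - q * real (j - n)" by (simp add: sum_subtractf)
      also have "(\<Sum>i<j - n. s (k + i)) = sum s J"
        unfolding J_def by (rule sum.reindex_bij_witness[of _ "\<lambda>a. a - k" "\<lambda>i. k + i"]) auto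
      finally show ?thesis .
    qed
    have ws': "window_sum n (g q') (j' - n) (graph.awalk_verts (graph.awlast v1 p0') w') = sum s' J' - q' * real (j' - n)"
    proof -
      have "window_sum n (g q') (j' - n) (graph.awalk_verts (graph.awlast v1 p0') w') = (\<Sum>i<j' - n. s' (k' + i) - q')"
        unfolding window_sum_def using dsum_window[OF p0'(1) pair(4)]
        by (intro sum.cong) (auto simp: g_def s'_def U'_def k'_def)
      also have "(\<Sum>i<j' - n. s' (k' + i) - q') = (\<Sum>i<j' - n. s' (k' + i)) - q' * real (j' - n)" by (simp add: sum_subtractf)
      also have "(\<Sum>i<j' - n. s' (k' + i)) = sum s' J'"
        unfolding J'_def by (rule sum.reindex_bij_witness[of _ "\<lambda>a. a - k'" "\<lambda>i. k' + i"]) auto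
      finally show ?thesis .
    qed
    have rest: "\<bar>sum f A - sum f I\<bar> \<le> B * real e"
      if "\<And>a. \<bar>f a\<bar> \<le> B" "I \<subseteq> A" "finite A" "card A \<le> card I + e" for f and A :: "nat set"
    proof -
      have "\<bar>sum f A - sum f I\<bar> = \<bar>sum f (A - I)\<bar>" using that sum_diff[of A I f] by simp
      also have "\<dots> \<le> (\<Sum>a\<in>A - I. \<bar>f a\<bar>)" by (rule sum_abs)
      also have "\<dots> \<le> real (card (A - I)) * B" using sum_bounded_above[of "A - I" "\<lambda>a. \<bar>f a\<bar>" B] that by simp
      also have "\<dots> \<le> real e * B"
        using that B by (intro mult_right_mono) (auto simp: card_Diff_subset finite_subset)
      finally show ?thesis by (simp add: mult.commute)
    qed
    have r1: "\<bar>sum s J - sum s I\<bar> \<le> B * real e"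
      by (rule rest) (use \<psi> kj jn m in \<open>auto simp: s_def J_def I_def e_def\<close>)
    have r2: "\<bar>sum s' J' - sum s' I\<bar> \<le> B * real e"
      by (rule rest) (use \<psi> kj jn m in \<open>auto simp: s'_def J'_def I_def e_def\<close>)
    have r3: "\<bar>sum s I - sum s' I\<bar> \<le> real m * (2 * real_of_int Cst * \<kappa>)"
    proof -
      have "\<bar>sum s I - sum s' I\<bar> \<le> (\<Sum>a\<in>I. \<bar>s a - s' a\<bar>)"
        unfolding sum_subtractf[symmetric] by (rule sum_abs)
      also have "\<dots> \<le> (\<Sum>a\<in>I. 2 * real_of_int Cst * \<kappa>)"
      proof (intro sum_mono)
        fix a assume "a \<in> I"
        then have "\<bar>U (a + n) - U' (a + n)\<bar> \<le> Cst" "\<bar>U a - U' a\<bar> \<le> Cst" by (auto intro!: close simp: I_def)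
        then have "\<bar>(U (a + n) - U a) - (U' (a + n) - U' a)\<bar> \<le> 2 * Cst" by linarith
        then have "\<bar>real_of_int (U (a + n) - U a) - real_of_int (U' (a + n) - U' a)\<bar> \<le> 2 * real_of_int Cst"
          by linarith
        then have "\<kappa> * \<bar>real_of_int (U (a + n) - U a) - real_of_int (U' (a + n) - U' a)\<bar> \<le> \<kappa> * (2 * real_of_int Cst)"
          using \<kappa>0 by (intro mult_left_mono)
        then show "\<bar>s a - s' a\<bar> \<le> 2 * real_of_int Cst * \<kappa>"
          using \<kappa>[of "real_of_int (U (a + n) - U a)" "real_of_int (U' (a + n) - U' a)"]
          by (simp add: s_def s'_def mult.commute)
      qed
      also have "\<dots> = real (card I) * (2 * real_of_int Cst * \<kappa>)" by simp
      also have "\<dots> \<le> real m * (2 * real_of_int Cst * \<kappa>)"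
        using \<kappa>0 B0 D_nonneg by (intro mult_right_mono) (auto simp: I_def Cst_def)
      finally show ?thesis .
    qed
    define a where "a = real (j - n)"
    define a' where "a' = real (j' - n)"
    have aa: "\<bar>a - a'\<bar> \<le> real e" "a \<le> real m + real e" "a' \<le> real m" "real m - (real k' + real n) = a'"
      using kj jn by (auto simp: a_def a'_def e_def of_nat_diff)
    have "\<bar>(q - q') * a'\<bar> \<le> \<bar>q * (a' - a)\<bar> + \<bar>sum s J - q * a\<bar> + \<bar>sum s J - sum s' J'\<bar> + \<bar>sum s' J' - q' * a'\<bar>"
      by (simp add: algebra_simps)
    moreover have "\<bar>q * (a' - a)\<bar> \<le> \<bar>q\<bar> * real e" unfolding abs_mult using aa(1) by (intro mult_left_mono) auto
    moreover have "\<bar>sum s J - q * a\<bar> \<le> \<epsilon> * (real m + real e)"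
      using good(1) aa(2) \<epsilon> mult_left_mono[of a "real m + real e" \<epsilon>] unfolding ws a_def by linarith
    moreover have "\<bar>sum s' J' - q' * a'\<bar> \<le> \<epsilon> * real m"
      using good(2) aa(3) \<epsilon> mult_left_mono[of a' "real m" \<epsilon>] unfolding ws' a'_def by linarith
    moreover have "\<bar>sum s J - sum s' J'\<bar> \<le> 2 * (B * real e) + real m * (2 * real_of_int Cst * \<kappa>)"
      using r1 r2 r3 by linarith
    moreover have "\<bar>(q - q') * a'\<bar> = \<bar>q - q'\<bar> * (real m - (real k' + real n))"
      unfolding aa(4) by (simp add: abs_mult a'_def)
    ultimately have "\<bar>q - q'\<bar> * (real m - (real k' + real n))
      \<le> \<bar>q\<bar> * real e + \<epsilon> * (real m + real e) + (2 * (B * real e) + real m * (2 * real_of_int Cst * \<kappa>)) + \<epsilon> * real m"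
      by linarith
    then have "\<bar>q - q'\<bar> * real m - real m * (2 * real_of_int Cst * \<kappa>) - 2 * (\<epsilon> * real m) \<le> Z"
      by (simp add: Z_def algebra_simps)
    moreover have "\<bar>q - q'\<bar> * real m - real m * (2 * real_of_int Cst * \<kappa>) - 2 * (\<epsilon> * real m) = real m * (2 * \<epsilon>)"
      unfolding qq by (simp add: algebra_simps)
    ultimately show False using m(3) by linarith
  qed
  then show ?thesis unfolding window_mean_def by (intro exI[of _ "2 * real_of_int Cst"]) blast
qed

end

section \<open>Uniqueness and algebraicity of drift and variance\<close>

lemma abs_cos_diff_le: "\<bar>cos x - cos y\<bar> \<le> \<bar>x - y :: real\<bar>"
proof -
  have "\<bar>cos x - cos y\<bar> = 2 * (\<bar>sin ((x + y) / 2)\<bar> * \<bar>sin ((y - x) / 2)\<bar>)"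
    by (simp add: cos_diff_cos abs_mult)
  also have "\<dots> \<le> 2 * (1 * \<bar>(y - x) / 2\<bar>)"
    by (intro mult_left_mono mult_mono abs_sin_x_le_abs_x) auto
  finally show ?thesis by simp
qed

lemma (in markov) char_op_cos:
  assumes "u \<in> H"
  shows "Ex n u (\<lambda>p. cos (t * sum_list (map F (tl p)))) = Re ((char_op F t ^^ n) (\<lambda>_. 1) u)"
  unfolding Ex_char_op[OF assms] Re_Ex by (simp add: Re_exp)

context combed_bicombable
begin

text \<open>The fixed part of the ergodic decomposition is harmonic, hence constant on a minimal
  class.\<close>

lemma class_poisson:
  assumes Q: "graph.chain.minimal_class Q"
  shows "\<exists>q b. \<forall>u\<in>Q. x u = q + (b u - mat_op Q graph.N b u)"
proof -
  have cl: "graph.chain.closed_class Q" using Q by (simp add: graph.chain.minimal_class_def)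
  interpret Q: markov Q graph.N by (rule graph.chain.markov_closed[OF cl])
  obtain z b where z: "\<And>u. u \<in> Q \<Longrightarrow> mat_op Q graph.N z u = z u"
    and b: "\<And>u. u \<in> Q \<Longrightarrow> x u = z u + (b u - mat_op Q graph.N b u)"
    using Q.mean_ergodic[of x] by blast
  obtain u0 where u0: "u0 \<in> Q" using Q.nonempty_H by blast
  have "z u = z u0" if "u \<in> Q" for u using graph.chain.minimal_class_irreducible[OF Q z that u0] .
  then show ?thesis using b by (intro exI[of _ "z u0"] exI[of _ b]) auto
qed

abbreviation "f \<equiv> (\<lambda>u. real_of_int (d\<phi> u))"

lemma of_int_sum_list_map: "real_of_int (sum_list (map g ys)) = sum_list (map (\<lambda>u. real_of_int (g u)) ys)"
  by (induction ys) auto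

lemma dsum_eq: "dsum xs = sum_list (map f (tl xs))"
  by (simp add: dsum_def of_int_sum_list_map)

text \<open>\<open>class_compare\<close> needs a bounded observable. The bound dominates the
  absolute value of \<open>f\<close> on \<open>graph.H\<close>, so on actual windows of length
  \<open>n\<close> clipping has no effect and the observable is the average increment.\<close>

definition clip :: "nat \<Rightarrow> real \<Rightarrow> real" where
  "clip n x = max (- (\<Sum>u\<in>graph.H. \<bar>f u\<bar>)) (min (\<Sum>u\<in>graph.H. \<bar>f u\<bar>) (x / real n))"

lemma clip_drift:
  assumes Q: "graph.chain.closed_class Q" and y: "\<And>u. u \<in> Q \<Longrightarrow> f u = e + (y u - mat_op Q graph.N y u)" and n: "0 < n"
  shows "window_mean Q n (clip n) e"
proof -
  interpret Q: markov Q graph.N by (rule graph.chain.markov_closed[OF Q])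
  have QH: "Q \<subseteq> graph.H" using Q by (simp add: graph.chain.closed_class_def)
  define F where "F = (\<Sum>u\<in>graph.H. \<bar>f u\<bar>)"
  obtain b where b: "\<And>u. u \<in> Q \<Longrightarrow> Q.Ex n u (\<lambda>p. sum_list (map f (tl p))) = real n * e + (b u - mat_op Q graph.N b u)"
    using Q.Ex_sum_drift[OF y] by blast
  have "Q.Ex n u (\<lambda>xs. clip n (dsum xs)) = e + ((1 / real n) * b u - mat_op Q graph.N (\<lambda>u. (1 / real n) * b u) u)" if u: "u \<in> Q" for u
  proof -
    have "Q.Ex n u (\<lambda>xs. clip n (dsum xs)) = Q.Ex n u (\<lambda>xs. (1 / real n) * sum_list (map f (tl xs)))"
    proof (rule Q.Ex_cong[OF u])
      fix xs assume xs: "length xs = Suc n" "set xs \<subseteq> Q"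
      have F: "\<bar>f x\<bar> \<le> F" if "x \<in> set (tl xs)" for x
      proof -
        have "x \<in> graph.H" using that xs QH by (cases xs) auto
        then show ?thesis unfolding F_def by (intro member_le_sum) (auto simp: graph.chain.finite_H)
      qed
      have "\<bar>sum_list (map f (tl xs))\<bar> \<le> sum_list (map (\<lambda>x. \<bar>f x\<bar>) (tl xs))"
        using sum_list_abs[of "map f (tl xs)"] by (simp add: o_def)
      also have "\<dots> \<le> sum_list (map (\<lambda>x. F) (tl xs))" using F by (intro sum_list_mono) auto
      also have "\<dots> = real n * F" using xs by (simp add: sum_list_triv)
      finally have "\<bar>sum_list (map f (tl xs)) / real n\<bar> \<le> F" using n by (simp add: divide_le_eq mult.commute)
      then have "sum_list (map f (tl xs)) / real n \<le> F" "- F \<le> sum_list (map f (tl xs)) / real n" by linarith+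
      then show "clip n (dsum xs) = (1 / real n) * sum_list (map f (tl xs))"
        unfolding clip_def F_def[symmetric] dsum_eq by (simp add: max_def min_def)
    qed
    then show ?thesis unfolding Q.Ex_mult b[OF u] mat_op_scale using n by (simp add: field_simps)
  qed
  then show ?thesis unfolding window_mean_def by (intro exI[of _ "\<lambda>u. (1 / real n) * b u"]) blast
qed

text \<open>\<open>clip n\<close> has Lipschitz constant \<open>1 / n\<close> and its window mean is
  the drift, so \<open>class_compare\<close> gives \<open>\<bar>e - e'\<bar> \<le> R / n\<close> for
  all positive \<open>n\<close>.\<close>

lemma drift_unique:
  assumes Q: "graph.chain.closed_class Q" "graph.chain.closed_class Q'"
    and y: "\<And>u. u \<in> Q \<Longrightarrow> f u = e + (y u - mat_op Q graph.N y u)"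
    and y': "\<And>u. u \<in> Q' \<Longrightarrow> f u = e' + (y' u - mat_op Q' graph.N y' u)"
  shows "e = e'"
proof (rule ccontr)
  assume "e \<noteq> e'"
  define F where "F = (\<Sum>u\<in>graph.H. \<bar>f u\<bar>)"
  obtain R where R: "\<forall>n \<psi> \<kappa> B q q'. (\<forall>x. \<bar>\<psi> x\<bar> \<le> B) \<longrightarrow> (\<forall>x y. \<bar>\<psi> x - \<psi> y\<bar> \<le> \<kappa> * \<bar>x - y\<bar>) \<longrightarrow>
    window_mean Q n \<psi> q \<longrightarrow> window_mean Q' n \<psi> q' \<longrightarrow> \<bar>q - q'\<bar> \<le> R * \<kappa>"
    using class_compare[OF Q] by blast
  have "\<bar>e - e'\<bar> \<le> R * (1 / real n)" if n: "0 < n" for n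
  proof -
    show ?thesis
    proof (rule R[rule_format, OF _ _ clip_drift[OF Q(1) y n] clip_drift[OF Q(2) y' n]])
      have F: "0 \<le> F" by (auto simp: F_def intro: sum_nonneg)
      show "\<bar>clip n x\<bar> \<le> F" for x using F by (auto simp: clip_def F_def[symmetric] max_def min_def)
      fix x z :: real
      have "\<bar>max (- F) (min F s) - max (- F) (min F r)\<bar> \<le> \<bar>s - r\<bar>" for s r :: real by (auto simp: max_def min_def)
      then have "\<bar>clip n x - clip n z\<bar> \<le> \<bar>x / real n - z / real n\<bar>" by (simp add: clip_def F_def)
      also have "\<dots> = 1 / real n * \<bar>x - z\<bar>" by (simp add: diff_divide_distrib[symmetric])
      finally show "\<bar>clip n x - clip n z\<bar> \<le> 1 / real n * \<bar>x - z\<bar>" .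
    qed
  qed
  moreover obtain n :: nat where "R < real n * \<bar>e - e'\<bar>" using ex_less_of_nat_mult[of "\<bar>e - e'\<bar>" R] \<open>e \<noteq> e'\<close> by auto
  then have "R < real (Suc n) * \<bar>e - e'\<bar>" by (simp add: algebra_simps)
  moreover have "real (Suc n) * \<bar>e - e'\<bar> \<le> R"
    using calculation(1)[of "Suc n"] by (simp add: field_simps del: of_nat_Suc)
  ultimately show False by linarith
qed

text \<open>The cosine of the normalized window sum has Lipschitz constant
  \<open>1 / sqrt n\<close>, and by \<open>clt\<close> on each class its expectation tends to
  \<open>exp (- s / 2)\<close>. Comparing the window means forces the two limits, hence
  \<open>s\<close> and \<open>s'\<close>, to agree.\<close>

lemma variance_unique:
  assumes Q: "graph.chain.minimal_class Q" "graph.chain.minimal_class Q'"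
    and y: "\<And>u. u \<in> Q \<Longrightarrow> f u - e = y u - mat_op Q graph.N y u"
    and y2: "\<And>u. u \<in> Q \<Longrightarrow> (f u - e)\<^sup>2 + 2 * (f u - e) * mat_op Q graph.N y u = s + (y2 u - mat_op Q graph.N y2 u)"
    and y': "\<And>u. u \<in> Q' \<Longrightarrow> f u - e = y' u - mat_op Q' graph.N y' u"
    and y2': "\<And>u. u \<in> Q' \<Longrightarrow> (f u - e)\<^sup>2 + 2 * (f u - e) * mat_op Q' graph.N y' u = s' + (y2' u - mat_op Q' graph.N y2' u)"
  shows "s = s'"
proof -
  have cl: "graph.chain.closed_class Q" "graph.chain.closed_class Q'"
    using Q by (auto simp: graph.chain.minimal_class_def)
  obtain R where R: "\<forall>n \<psi> \<kappa> B q q'. (\<forall>x. \<bar>\<psi> x\<bar> \<le> B) \<longrightarrow> (\<forall>x y. \<bar>\<psi> x - \<psi> y\<bar> \<le> \<kappa> * \<bar>x - y\<bar>) \<longrightarrow>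
    window_mean Q n \<psi> q \<longrightarrow> window_mean Q' n \<psi> q' \<longrightarrow> \<bar>q - q'\<bar> \<le> R * \<kappa>"
    using class_compare[OF cl] by blast
  define \<psi> where "\<psi> n x = cos (1 / sqrt (real n) * (x - real n * e))" for n x
  have lim: "\<exists>q. (\<forall>n. window_mean Q n (\<psi> n) (q n)) \<and> q \<longlonglongrightarrow> exp (- s / 2)"
    if Q: "graph.chain.minimal_class Q"
    and y: "\<And>u. u \<in> Q \<Longrightarrow> f u - e = y u - mat_op Q graph.N y u"
    and y2: "\<And>u. u \<in> Q \<Longrightarrow> (f u - e)\<^sup>2 + 2 * (f u - e) * mat_op Q graph.N y u = s + (y2 u - mat_op Q graph.N y2 u)"
    for Q y y2 s
  proof -
    have "graph.chain.closed_class Q" using Q by (simp add: graph.chain.minimal_class_def)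
    then interpret Q: markov Q graph.N by (rule graph.chain.markov_closed)
    define z where "z n u = Q.Ex n u (\<lambda>xs. \<psi> n (dsum xs))" for n u
    have "\<forall>n. \<exists>q b. \<forall>u\<in>Q. z n u = q + (b u - mat_op Q graph.N b u)" using class_poisson[OF Q] by blast
    then obtain q b where qb: "\<And>n u. u \<in> Q \<Longrightarrow> z n u = q n + (b n u - mat_op Q graph.N (b n) u)" by metis
    have zlim: "(\<lambda>n. z n u) \<longlonglongrightarrow> exp (- s / 2)" if u: "u \<in> Q" for u
    proof -
      have "z n u = Re ((Q.char_op (\<lambda>u. f u - e) (1 / sqrt (real n)) ^^ n) (\<lambda>_. 1) u)" for n
      proof -
        have "z n u = Q.Ex n u (\<lambda>p. cos (1 / sqrt (real n) * sum_list (map (\<lambda>u. f u - e) (tl p))))"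
          unfolding z_def \<psi>_def dsum_eq
          by (rule Q.Ex_cong[OF u]) (simp add: sum_list_subtractf sum_list_triv)
        then show ?thesis by (simp only: Q.char_op_cos[OF u])
      qed
      moreover have "(\<lambda>n. Re ((Q.char_op (\<lambda>u. f u - e) (1 / sqrt (real n)) ^^ n) (\<lambda>_. 1) u))
          \<longlonglongrightarrow> Re (complex_of_real (exp (- s * 1\<^sup>2 / 2)))"
        by (intro tendsto_Re Q.clt[OF y y2 u])
      ultimately show ?thesis by simp
    qed
    \<comment> \<open>By \<open>coboundary_value_between\<close> the window mean is as close to the
      limit as the expectations \<open>z n u\<close>, which all converge to it.\<close>
    have "(\<lambda>n. q n - exp (- s / 2)) \<longlonglongrightarrow> 0"
    proof (rule Lim_null_comparison)
      show "eventually (\<lambda>n. norm (q n - exp (- s / 2)) \<le> (\<Sum>u\<in>Q. \<bar>z n u - exp (- s / 2)\<bar>)) sequentially"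
        using Q.coboundary_value_between[OF qb] by (intro always_eventually) auto
      have "(\<lambda>n. \<Sum>u\<in>Q. \<bar>z n u - exp (- s / 2)\<bar>) \<longlonglongrightarrow> (\<Sum>u\<in>Q. \<bar>exp (- s / 2) - exp (- s / 2)\<bar>)"
        by (intro tendsto_intros zlim)
      then show "(\<lambda>n. \<Sum>u\<in>Q. \<bar>z n u - exp (- s / 2)\<bar>) \<longlonglongrightarrow> 0" by simp
    qed
    then have "q \<longlonglongrightarrow> exp (- s / 2)" by (simp add: LIM_zero_iff)
    then show ?thesis using qb unfolding z_def window_mean_def by blast
  qed
  obtain q where q: "\<And>n. window_mean Q n (\<psi> n) (q n)" "q \<longlonglongrightarrow> exp (- s / 2)"
    using lim[OF Q(1) y y2] by blast
  obtain q' where q': "\<And>n. window_mean Q' n (\<psi> n) (q' n)" "q' \<longlonglongrightarrow> exp (- s' / 2)"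
    using lim[OF Q(2) y' y2'] by blast
  have cmp: "\<bar>q n - q' n\<bar> \<le> R * (1 / sqrt (real n))" for n
  proof (rule R[rule_format, OF _ _ q(1) q'(1)])
    show "\<bar>\<psi> n x\<bar> \<le> 1" for x by (simp add: \<psi>_def)
    fix x y :: real
    have "\<bar>\<psi> n x - \<psi> n y\<bar> \<le> \<bar>1 / sqrt (real n) * (x - real n * e) - 1 / sqrt (real n) * (y - real n * e)\<bar>"
      unfolding \<psi>_def by (rule abs_cos_diff_le)
    also have "\<dots> = 1 / sqrt (real n) * \<bar>x - y\<bar>"
      unfolding right_diff_distrib[symmetric] abs_mult by simp
    finally show "\<bar>\<psi> n x - \<psi> n y\<bar> \<le> 1 / sqrt (real n) * \<bar>x - y\<bar>" .
  qed
  have "(\<lambda>n. q n - q' n) \<longlonglongrightarrow> 0"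
  proof (rule Lim_null_comparison)
    show "eventually (\<lambda>n. norm (q n - q' n) \<le> R * (1 / sqrt (real n))) sequentially"
      using cmp by (intro always_eventually) auto
    show "(\<lambda>n. R * (1 / sqrt (real n))) \<longlonglongrightarrow> 0" by real_asymp
  qed
  from LIMSEQ_unique[OF tendsto_diff[OF q(2) q'(2)] this] show "s = s'" by simp
qed

text \<open>Algebraicity is proved on one minimal class \<open>Q0\<close>, where
  \<open>algebraic_transitions\<close> applies. On \<open>graph.H\<close> the harmonic parts
  \<open>z\<close> and \<open>z2\<close> are constant on each minimal class, equal to
  \<open>e\<close> and \<open>s\<close> by the two uniqueness lemmas, and then constant everywhere
  by the maximum principle.\<close>

theorem drift_and_variance:
  "\<exists>e s y y2. algebraic e \<and> algebraic s \<and>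
    (\<forall>u\<in>graph.H. f u - e = y u - mat_op graph.H graph.N y u) \<and>
    (\<forall>u\<in>graph.H. (f u - e)\<^sup>2 + 2 * (f u - e) * mat_op graph.H graph.N y u = s + (y2 u - mat_op graph.H graph.N y2 u))"
proof -
  obtain Q0 where Q0: "graph.chain.minimal_class Q0"
    using graph.chain.minimal_class_exists[OF graph.closed_H] by blast
  have cl: "graph.chain.closed_class Q" if "graph.chain.minimal_class Q" for Q
    using that by (simp add: graph.chain.minimal_class_def)
  interpret Q0: markov Q0 graph.N by (rule graph.chain.markov_closed[OF cl[OF Q0]])
  have restrict: "mat_op graph.H graph.N x u = mat_op Q graph.N x u" if "graph.chain.minimal_class Q" "u \<in> Q" for Q x u
    using graph.chain.closed_mat_op[OF cl[OF that(1)] that(2)] by simp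
  have QH: "u \<in> graph.H" if "graph.chain.minimal_class Q" "u \<in> Q" for Q u
    using cl[OF that(1)] that(2) by (auto simp: graph.chain.closed_class_def)
  have const: "\<exists>c. \<forall>u\<in>Q. z u = c" if Q: "graph.chain.minimal_class Q"
    and z: "\<And>u. u \<in> graph.H \<Longrightarrow> mat_op graph.H graph.N z u = z u" for Q z
  proof -
    obtain u0 where "u0 \<in> Q" using cl[OF Q] by (auto simp: graph.chain.closed_class_def)
    then have "z u = z u0" if "u \<in> Q" for u
      using graph.chain.minimal_class_irreducible[OF Q _ that] z restrict[OF Q] QH[OF Q] by metis
    then show ?thesis by blast
  qed
  obtain e y0 where y0: "\<And>u. u \<in> Q0 \<Longrightarrow> f u = e + (y0 u - mat_op Q0 graph.N y0 u)"
    using class_poisson[OF Q0, of f] by blast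
  have algN: "algebraic (graph.N u v)" if "u \<in> Q0" "v \<in> Q0" for u v
    using graph.algebraic_transitions[OF Q0] that by blast
  have "algebraic e \<and> (\<exists>y'. (\<forall>u. algebraic (y' u)) \<and> (\<forall>u\<in>Q0. f u = e + (y' u - mat_op Q0 graph.N y' u)))"
    by (rule Q0.algebraic_poisson[OF algN _ y0]) auto
  \<comment> \<open>An algebraic solution replaces \<open>y0\<close>, so that the data of the
    variance equation are algebraic as well.\<close>
  then obtain y1 where e: "algebraic e" and y1: "\<And>u. algebraic (y1 u)"
    "\<And>u. u \<in> Q0 \<Longrightarrow> f u = e + (y1 u - mat_op Q0 graph.N y1 u)" by blast
  have Ty1: "algebraic (mat_op Q0 graph.N y1 u)" if "u \<in> Q0" for u
    unfolding mat_op_def using that algN y1(1) by (intro algebraic_sum algebraic_mult) auto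
  obtain s y2' where y2': "\<And>u. u \<in> Q0 \<Longrightarrow> (f u - e)\<^sup>2 + 2 * (f u - e) * mat_op Q0 graph.N y1 u = s + (y2' u - mat_op Q0 graph.N y2' u)"
    using class_poisson[OF Q0, of "\<lambda>u. (f u - e)\<^sup>2 + 2 * (f u - e) * mat_op Q0 graph.N y1 u"] by blast
  have s: "algebraic s"
    by (rule Q0.algebraic_poisson[OF algN _ y2', THEN conjunct1])
       (auto simp: power2_eq_square intro!: algebraic_add algebraic_mult algebraic_diff e Ty1)
  obtain z y where z: "\<And>u. u \<in> graph.H \<Longrightarrow> mat_op graph.H graph.N z u = z u"
    and zy: "\<And>u. u \<in> graph.H \<Longrightarrow> f u = z u + (y u - mat_op graph.H graph.N y u)"
    using graph.chain.mean_ergodic[of f] by blast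
  have "z u = e" if "u \<in> graph.H" for u
  proof (rule graph.chain.harmonic_bounded_by_classes[OF z _ that])
    fix Q u assume Q: "graph.chain.minimal_class Q" and u: "u \<in> Q"
    obtain c where c: "\<And>u. u \<in> Q \<Longrightarrow> z u = c" using const[OF Q z] by blast
    have "c = e"
      by (rule drift_unique[OF cl[OF Q] cl[OF Q0] _ y0]) (use zy QH[OF Q] restrict[OF Q] c in auto)
    then show "z u = e" using c u by simp
  qed
  then have y: "f u - e = y u - mat_op graph.H graph.N y u" if "u \<in> graph.H" for u using zy[OF that] that by simp
  obtain z2 y2 where z2: "\<And>u. u \<in> graph.H \<Longrightarrow> mat_op graph.H graph.N z2 u = z2 u"
    and zy2: "\<And>u. u \<in> graph.H \<Longrightarrow> (f u - e)\<^sup>2 + 2 * (f u - e) * mat_op graph.H graph.N y u = z2 u + (y2 u - mat_op graph.H graph.N y2 u)"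
    using graph.chain.mean_ergodic[of "\<lambda>u. (f u - e)\<^sup>2 + 2 * (f u - e) * mat_op graph.H graph.N y u"] by blast
  have "z2 u = s" if "u \<in> graph.H" for u
  proof (rule graph.chain.harmonic_bounded_by_classes[OF z2 _ that])
    fix Q u assume Q: "graph.chain.minimal_class Q" and u: "u \<in> Q"
    obtain c where c: "\<And>u. u \<in> Q \<Longrightarrow> z2 u = c" using const[OF Q z2] by blast
    have "c = s"
    proof (rule variance_unique[OF Q Q0 _ _ _ y2'])
      fix u assume u: "u \<in> Q"
      show "f u - e = y u - mat_op Q graph.N y u" using y[OF QH[OF Q u]] restrict[OF Q u] by simp
      show "(f u - e)\<^sup>2 + 2 * (f u - e) * mat_op Q graph.N y u = c + (y2 u - mat_op Q graph.N y2 u)"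
        using zy2[OF QH[OF Q u]] restrict[OF Q u] c[OF u] by simp
    qed (use y1(2) in auto)
    then show "z2 u = s" using c u by simp
  qed
  then have "\<forall>u\<in>graph.H. (f u - e)\<^sup>2 + 2 * (f u - e) * mat_op graph.H graph.N y u = s + (y2 u - mat_op graph.H graph.N y2 u)"
    using zy2 by simp
  then show ?thesis using e s y by blast
qed

end

section \<open>The central limit theorem\<close>

lemma real_distribution_centered_normal: "0 \<le> \<sigma> \<Longrightarrow> real_distribution (centered_normal \<sigma>)"
proof (cases "\<sigma> = 0")
  case True
  then show ?thesis
    by (simp add: centered_normal_def real_distribution_def real_distribution_axioms_def prob_space_return)
next
  case False
  assume "0 \<le> \<sigma>"
  then have "prob_space (density lborel (normal_density 0 \<sigma>))" using False by (intro prob_space_normal_density) auto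
  then show ?thesis using False
    by (simp add: centered_normal_def real_distribution_def real_distribution_axioms_def)
qed

lemma char_centered_normal:
  assumes "0 \<le> \<sigma>"
  shows "char (centered_normal \<sigma>) t = complex_of_real (exp (- \<sigma>\<^sup>2 * t\<^sup>2 / 2))"
proof (cases "\<sigma> = 0")
  case True
  then show ?thesis by (simp add: centered_normal_def char_def integral_return)
next
  case False
  then have \<sigma>: "0 < \<sigma>" using assms by simp
  have std: "normal_density 0 \<sigma> (\<sigma> * x) = std_normal_density x / \<sigma>" for x
    using \<sigma> by (simp add: normal_density_def power_mult_distrib real_sqrt_mult)
  have "char (centered_normal \<sigma>) t = (\<integral>x. normal_density 0 \<sigma> x *\<^sub>R iexp (t * x) \<partial>lborel)"
    using False by (simp add: centered_normal_def char_def integral_density)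
  also have "\<dots> = \<bar>\<sigma>\<bar> *\<^sub>R (\<integral>x. normal_density 0 \<sigma> (0 + \<sigma> * x) *\<^sub>R iexp (t * (0 + \<sigma> * x)) \<partial>lborel)"
    by (rule lborel_integral_real_affine) (use False in auto)
  also have "\<dots> = (\<integral>x. std_normal_density x *\<^sub>R iexp ((t * \<sigma>) * x) \<partial>lborel)"
    unfolding integral_scaleR_right[symmetric] using \<sigma> by (simp add: std mult.assoc)
  also have "\<dots> = char std_normal_distribution (t * \<sigma>)" by (simp add: char_def integral_density)
  also have "\<dots> = complex_of_real (exp (- ((t * \<sigma>)\<^sup>2) / 2))" by (simp only: char_std_normal_distribution)
  finally show ?thesis by (simp add: power_mult_distrib mult.commute)
qed

section \<open>The law of a random element of a sphere as the law of the chain\<close>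

context growing_digraph
begin

lemma h_pred:
  assumes "e \<in> arcs G" "0 < h (head G e)"
  shows "0 < h (tail G e)"
proof -
  have v: "tail G e \<in> verts G" "head G e \<in> verts G" using assms by auto
  have "e \<in> {a \<in> arcs G. tail G a = tail G e \<and> head G a = head G e}" using assms(1) by simp
  then have "0 < adj_matrix G (tail G e) (head G e)"
    unfolding adj_matrix_def of_nat_0_less_iff card_gt_0_iff using finite_arcs by auto
  then have "0 < adj_matrix G (tail G e) (head G e) * h (head G e)"
    using assms(2) by (rule mult_pos_pos)
  also have "\<dots> \<le> (\<Sum>w\<in>verts G. adj_matrix G (tail G e) w * h w)"
    using v h_nonneg adj_nonneg by (intro member_le_sum) auto
  finally show ?thesis using h_eigen[OF v(1)] l_gt_1 by (simp add: zero_less_mult_iff)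
qed

text \<open>By \<open>h_pred\<close> positivity at the end spreads back along the walk.\<close>

lemma walk_to_H: "p \<in> walks n v \<Longrightarrow> 0 < h (awlast v p) \<Longrightarrow> p \<in> walks_in H n v"
proof (induction n arbitrary: v p)
  case 0
  then show ?case by (auto simp: walks_in_def awalk_simps H_def)
next
  case (Suc n)
  obtain e q where p: "p = e # q" "e \<in> arcs G" "tail G e = v" "q \<in> walks n (head G e)"
    using Suc.prems(1) by (auto simp: walks_iff length_Suc_conv awalk_Cons_iff awlast_Cons)
  have q: "q \<in> walks_in H n (head G e)" using Suc.IH[OF p(4)] Suc.prems(2) p by (simp add: awlast_Cons)
  have "head G e \<in> set (awalk_verts (head G e) q)" by (cases q) (use p in \<open>auto simp: walks_iff awalk_Cons_iff\<close>)
  then have "head G e \<in> H" using q by (auto simp: walks_in_def)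
  then have "v \<in> H" using h_pred[OF p(2)] p by (auto simp: H_def)
  then show ?case using Suc.prems(1) q p by (auto simp: walks_in_def)
qed

text \<open>Walks that leave \<open>H\<close> end where \<open>h\<close> vanishes and contribute
  nothing, so the sum over all walks reduces to the chain on \<open>H\<close>.\<close>

lemma sum_walks_h:
  fixes F :: "'v list \<Rightarrow> 'c::real_vector"
  shows "(\<Sum>p\<in>walks n v1. (h (awlast v1 p) / l ^ n) *\<^sub>R F (awalk_verts v1 p)) = h v1 *\<^sub>R chain.Ex n v1 F"
proof -
  have "h v1 *\<^sub>R chain.Ex n v1 F = (\<Sum>p\<in>walks_in H n v1. (h (awlast v1 p) / l ^ n) *\<^sub>R F (awalk_verts v1 p))"
    unfolding Ex_walks_N[OF closed_H v1_H] scaleR_sum_right using h_v1 by (intro sum.cong) auto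
  also have "\<dots> = (\<Sum>p\<in>walks n v1. (h (awlast v1 p) / l ^ n) *\<^sub>R F (awalk_verts v1 p))"
  proof (rule sum.mono_neutral_left[OF finite_walks_in walks_in_subset], rule ballI)
    fix p assume p: "p \<in> walks n v1 - walks_in H n v1"
    then have "awlast v1 p \<in> verts G" by (auto simp: walks_iff dest: awalk_last_in_verts)
    then have "h (awlast v1 p) = 0" using p walk_to_H[of p n v1] h_nonneg[of "awlast v1 p"] by force
    then show "(h (awlast v1 p) / l ^ n) *\<^sub>R F (awalk_verts v1 p) = 0" by simp
  qed
  finally show ?thesis by simp
qed

end

context combed_growth
begin

text \<open>Every sphere has total mass \<open>h v1\<close>, whatever \<open>n\<close>; dividing the
  weight \<open>h / l ^ n\<close> of a path by it gives its probability under the chain.\<close>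

lemma nu_hat_prob_density:
  "nu_hat_prob G S L n = density (count_space (Sph n))
     (\<lambda>g. ennreal (lim (\<lambda>m. nu_approx G S m (word_cone G L g)) / graph.h v1))"
  and prob_space_nu_hat_prob: "prob_space (nu_hat_prob G S L n)"
  and nu_hat_prob_integral: "\<And>f :: 'a \<Rightarrow> complex. integral\<^sup>L (nu_hat_prob G S L n) f
    = (\<Sum>p\<in>graph.walks n v1. (graph.h (graph.awlast v1 p) / l ^ n / graph.h v1) *\<^sub>R f (elem p))"
proof -
  define \<nu> where "\<nu> g = lim (\<lambda>m. nu_approx G S m (word_cone G L g))" for g
  have \<nu>_elem: "\<nu> (elem p) = graph.h (graph.awlast v1 p) / l ^ n" if "p \<in> graph.walks n v1" for p
    unfolding \<nu>_def by (rule limI[OF nu_hat_limit[OF that]])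
  have img: "Sph n = elem ` graph.walks n v1" and inj: "inj_on elem (graph.walks n v1)"
    using elem_sphere[of n] by (auto simp: bij_betw_def)
  have hl: "0 \<le> graph.h (graph.awlast v1 p)" if "p \<in> graph.walks n v1" for p
    using that by (intro graph.h_nonneg) (auto simp: graph.walks_iff dest: graph.awalk_last_in_verts)
  have \<nu>0: "0 \<le> \<nu> g" if "g \<in> Sph n" for g
    using that \<nu>_elem hl l unfolding img by auto
  have "(\<Sum>g\<in>Sph n. \<nu> g) = (\<Sum>p\<in>graph.walks n v1. \<nu> (elem p))" unfolding img by (simp add: sum.reindex[OF inj])
  also have "\<dots> = (\<Sum>p\<in>graph.walks n v1. (graph.h (graph.awlast v1 p) / l ^ n) *\<^sub>R 1)" by (simp add: \<nu>_elem)
  also have "\<dots> = graph.h v1"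
    unfolding graph.sum_walks_h[of n "\<lambda>_. 1"] by (simp add: graph.chain.Ex_const graph.v1_H)
  finally have total: "(\<Sum>g\<in>Sph n. \<nu> g) = graph.h v1" .
  have nu: "nu_hat G S L n = point_measure (Sph n) (\<lambda>g. ennreal (\<nu> g))" by (simp add: nu_hat_def \<nu>_def)
  have em: "emeasure (nu_hat G S L n) (Sph n) = ennreal (graph.h v1)"
    unfolding nu emeasure_point_measure_finite[OF finite_sphere order_refl] using \<nu>0 by (simp add: sum_ennreal total)
  show "prob_space (nu_hat_prob G S L n)"
    unfolding nu_hat_prob_def by (rule prob_space_uniform_measure) (use em graph.h_v1 in auto)
  have "nu_hat_prob G S L n = density (count_space (Sph n)) (\<lambda>g. ennreal (\<nu> g) * (indicator (Sph n) g / ennreal (graph.h v1)))"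
    unfolding nu_hat_prob_def uniform_measure_def em unfolding nu point_measure_def
    by (rule density_density_eq) auto
  also have "\<dots> = density (count_space (Sph n)) (\<lambda>g. ennreal (\<nu> g / graph.h v1))"
    by (rule density_cong) (use \<nu>0 graph.h_v1 in \<open>auto simp: AE_count_space ennreal_times_divide divide_ennreal\<close>)
  finally have d: "nu_hat_prob G S L n = density (count_space (Sph n)) (\<lambda>g. ennreal (\<nu> g / graph.h v1))" .
  then show "nu_hat_prob G S L n = density (count_space (Sph n))
     (\<lambda>g. ennreal (lim (\<lambda>m. nu_approx G S m (word_cone G L g)) / graph.h v1))" by (simp add: \<nu>_def)
  fix f :: "'a \<Rightarrow> complex"
  have "integral\<^sup>L (nu_hat_prob G S L n) f = (\<Sum>g\<in>Sph n. (\<nu> g / graph.h v1) *\<^sub>R f g)"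
    unfolding d using \<nu>0 graph.h_v1
    by (subst integral_density) (auto simp: AE_count_space lebesgue_integral_count_space_finite finite_sphere)
  also have "\<dots> = (\<Sum>p\<in>graph.walks n v1. (\<nu> (elem p) / graph.h v1) *\<^sub>R f (elem p))"
    unfolding img by (simp add: sum.reindex[OF inj])
  finally show "integral\<^sup>L (nu_hat_prob G S L n) f
    = (\<Sum>p\<in>graph.walks n v1. (graph.h (graph.awlast v1 p) / l ^ n / graph.h v1) *\<^sub>R f (elem p))"
    by (simp add: \<nu>_elem)
qed

lemma nu_hat_prob_expectation:
  fixes f :: "'a \<Rightarrow> complex"
  assumes "\<And>p. p \<in> graph.walks n v1 \<Longrightarrow> f (elem p) = F (graph.awalk_verts v1 p)"
  shows "integral\<^sup>L (nu_hat_prob G S L n) f = graph.chain.Ex n v1 F"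
proof -
  have "integral\<^sup>L (nu_hat_prob G S L n) f
    = (1 / graph.h v1) *\<^sub>R (\<Sum>p\<in>graph.walks n v1. (graph.h (graph.awlast v1 p) / l ^ n) *\<^sub>R F (graph.awalk_verts v1 p))"
    unfolding nu_hat_prob_integral scaleR_sum_right using assms by (intro sum.cong) auto
  then show ?thesis unfolding graph.sum_walks_h using graph.h_v1 by simp
qed

end

context combed_bicombable
begin

theorem central_limit:
  "\<exists>\<sigma>\<ge>0. weak_conv_m
       (\<lambda>n. distr (nu_hat_prob G S L n) borel
               (\<lambda>g. real n powr (- 1 / 2) * (real_of_int (\<phi> g) - real n * stationary_mean l \<Gamma> v1 d\<phi>)))
       (centered_normal \<sigma>)
     \<and> algebraic (stationary_mean l \<Gamma> v1 d\<phi>) \<and> algebraic \<sigma>"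
proof -
  obtain e s y y2 where alg: "algebraic e" "algebraic s"
    and y: "\<And>u. u \<in> graph.H \<Longrightarrow> f u - e = y u - mat_op graph.H graph.N y u"
    and y2: "\<And>u. u \<in> graph.H \<Longrightarrow> (f u - e)\<^sup>2 + 2 * (f u - e) * mat_op graph.H graph.N y u = s + (y2 u - mat_op graph.H graph.N y2 u)"
    using drift_and_variance by blast
  have E: "stationary_mean l \<Gamma> v1 d\<phi> = e"
    using y by (intro graph.stationary_mean_eq[of _ _ y]) (simp add: algebra_simps)
  define F where "F = (\<lambda>u. f u - e)"
  have clt: "(\<lambda>n. (graph.chain.char_op F (\<theta> / sqrt (real n)) ^^ n) (\<lambda>_. 1) v1) \<longlonglongrightarrow> of_real (exp (- s * \<theta>\<^sup>2 / 2))" for \<theta>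
    unfolding F_def by (rule graph.chain.clt[OF y y2 graph.v1_H])
  \<comment> \<open>The iterates of \<open>char_op\<close> on 1 have norm at most 1, and so has
    their limit \<open>exp (- s / 2)\<close> at \<open>\<theta> = 1\<close>.\<close>
  have s: "0 \<le> s"
  proof -
    have "norm (complex_of_real (exp (- s * 1\<^sup>2 / 2))) \<le> 1"
      by (rule Lim_norm_ubound[OF _ clt]) (auto intro!: always_eventually graph.chain.char_op_pow_bound graph.v1_H)
    then show ?thesis by simp
  qed
  define X where "X n g = real n powr (- 1 / 2) * (real_of_int (\<phi> g) - real n * e)" for n g
  have root: "real n powr (- 1 / 2) = inverse (sqrt (real n))" if "0 < n" for n
    using that powr_minus[of "real n" "1 / 2"] powr_half_sqrt[of "real n"] by simp
  have char_n: "char (distr (nu_hat_prob G S L n) borel (X n)) t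
      = exp (\<i> * of_real (t / sqrt (real n) * f v1)) * (graph.chain.char_op F (t / sqrt (real n)) ^^ n) (\<lambda>_. 1) v1"
    if n: "0 < n" for n t
  proof -
    have sp: "sets (nu_hat_prob G S L n) = sets (count_space (Sph n))" unfolding nu_hat_prob_density by simp
    have meas: "X n \<in> borel_measurable (nu_hat_prob G S L n)"
      unfolding measurable_cong_sets[OF sp refl] by simp
    have "char (distr (nu_hat_prob G S L n) borel (X n)) t = (\<integral>g. iexp (t * X n g) \<partial>nu_hat_prob G S L n)"
      unfolding char_def by (rule integral_distr[OF meas]) simp
    also have "\<dots> = graph.chain.Ex n v1 (\<lambda>xs. iexp (t / sqrt (real n) * (sum_list (map f xs) - real n * e)))"
    proof (rule nu_hat_prob_expectation)
      fix p assume p: "p \<in> graph.walks n v1"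
      then have pp: "p \<in> paths" "length p = n" using walks_paths by auto
      have "\<phi> (elem p) = sum_list (map d\<phi> (graph.awalk_verts v1 p))"
        using phi_path[OF pp(1), of n] pp(2)
        by (simp add: sum_list_sum_nth graph.length_awalk_verts atLeast0LessThan atLeast0AtMost lessThan_Suc_atMost)
      then have "real_of_int (\<phi> (elem p)) = sum_list (map f (graph.awalk_verts v1 p))"
        by (simp add: of_int_sum_list_map)
      moreover have "t * (real n powr (- 1 / 2) * x) = t / sqrt (real n) * x" for x
        using root[OF n] by (simp only: divide_inverse mult.assoc)
      ultimately show "iexp (t * X n (elem p)) = iexp (t / sqrt (real n) * (sum_list (map f (graph.awalk_verts v1 p)) - real n * e))"
        by (simp only: X_def)
    qed
    \<comment> \<open>\<open>\<phi>\<close> sums over \<open>n + 1\<close> vertices while only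
      \<open>n * e\<close> is subtracted. The initial vertex is therefore split off without
      centring; its factor tends to 1.\<close>
    also have "\<dots> = graph.chain.Ex n v1 (\<lambda>xs. exp (\<i> * of_real (t / sqrt (real n) * f v1)) *
        exp (\<i> * of_real (t / sqrt (real n) * sum_list (map F (tl xs)))))"
    proof (rule graph.chain.Ex_cong[OF graph.v1_H])
      fix xs assume xs: "length xs = Suc n" "hd xs = v1"
      then obtain zs where zs: "xs = v1 # zs" "length zs = n" by (cases xs) auto
      have "sum_list (map F zs) = sum_list (map f zs) - real n * e"
        using zs(2) by (simp add: F_def sum_list_subtractf sum_list_triv)
      then show "iexp (t / sqrt (real n) * (sum_list (map f xs) - real n * e)) = exp (\<i> * of_real (t / sqrt (real n) * f v1)) *
        exp (\<i> * of_real (t / sqrt (real n) * sum_list (map F (tl xs))))"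
        unfolding exp_add[symmetric] distrib_left[symmetric] of_real_add[symmetric] by (simp add: zs(1) add_diff_eq)
    qed
    finally show ?thesis unfolding graph.chain.Ex_cmult graph.chain.Ex_char_op[OF graph.v1_H] .
  qed
  define \<sigma> where "\<sigma> = sqrt s"
  have \<sigma>: "0 \<le> \<sigma>" "\<sigma>\<^sup>2 = s" using s by (auto simp: \<sigma>_def)
  have "weak_conv_m (\<lambda>n. distr (nu_hat_prob G S L n) borel (X n)) (centered_normal \<sigma>)"
  proof (rule levy_continuity)
    show "real_distribution (distr (nu_hat_prob G S L n) borel (X n))" for n
    proof (rule prob_space.real_distribution_distr[OF prob_space_nu_hat_prob])
      have sp: "sets (nu_hat_prob G S L n) = sets (count_space (Sph n))" unfolding nu_hat_prob_density by simp
      show "X n \<in> borel_measurable (nu_hat_prob G S L n)" unfolding measurable_cong_sets[OF sp refl] by simp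
    qed
    show "real_distribution (centered_normal \<sigma>)" by (rule real_distribution_centered_normal[OF \<sigma>(1)])
    fix t
    have "(\<lambda>n. t / sqrt (real n) * f v1) \<longlonglongrightarrow> 0" by real_asymp
    then have "(\<lambda>n. exp (\<i> * complex_of_real (t / sqrt (real n) * f v1))) \<longlonglongrightarrow> exp (\<i> * complex_of_real 0)"
      by (intro tendsto_intros)
    from tendsto_mult[OF this clt[of t]]
    have "(\<lambda>n. exp (\<i> * complex_of_real (t / sqrt (real n) * f v1)) *
        (graph.chain.char_op F (t / sqrt (real n)) ^^ n) (\<lambda>_. 1) v1) \<longlonglongrightarrow> char (centered_normal \<sigma>) t"
      unfolding char_centered_normal[OF \<sigma>(1)] \<sigma>(2) by simp
    then show "(\<lambda>n. char (distr (nu_hat_prob G S L n) borel (X n)) t) \<longlonglongrightarrow> char (centered_normal \<sigma>) t"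
    proof (rule Lim_transform_eventually)
      show "\<forall>\<^sub>F n in sequentially. exp (\<i> * complex_of_real (t / sqrt (real n) * f v1)) *
        (graph.chain.char_op F (t / sqrt (real n)) ^^ n) (\<lambda>_. 1) v1 = char (distr (nu_hat_prob G S L n) borel (X n)) t"
        using eventually_gt_at_top[of 0] by (rule eventually_mono) (rule char_n[symmetric])
    qed
  qed
  moreover have "algebraic \<sigma>" unfolding \<sigma>_def by (rule algebraic_sqrt[OF alg(2)])
  ultimately show ?thesis unfolding E using \<sigma>(1) alg(1) by (intro exI[of _ \<sigma>]) (simp add: X_def[abs_def])
qed

end

theorem theorem4p25:
  fixes G :: "('a, 'm) monoid_scheme"
    and S :: "'a set"
    and L :: "'a list set"
    and \<phi> :: "'a \<Rightarrow> int"
    and \<Gamma> :: "('v, 'e) pre_digraph"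
    and v1 :: 'v
    and lab :: "'e \<Rightarrow> 'a"
    and d\<phi> :: "'v \<Rightarrow> int"
    and E :: real
  assumes "group G"
    and "word_hyperbolic G"
    and "\<not> elementary_group G"
    and "finite_symmetric_generating_set G S"
    and "combing G S L"
    and "bicombable G S L \<phi>"
    and "parameterizes \<Gamma> v1 lab S L"
    and "initial_accessible \<Gamma> v1"
    and "combs_function G \<Gamma> v1 lab L \<phi> d\<phi>"
  defines "E \<equiv> stationary_mean (growth_rate G S) \<Gamma> v1 d\<phi>"
  shows "\<exists>\<sigma>\<ge>0.
     weak_conv_m
       (\<lambda>n. distr (nu_hat_prob G S L n) borel
               (\<lambda>g. real n powr (- 1 / 2) * (real_of_int (\<phi> g) - real n * E)))
       (centered_normal \<sigma>)
     \<and> algebraic E \<and> algebraic \<sigma>"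
proof -
  interpret gen_group G S
    using assms(1,4) by (simp add: gen_group_def gen_group_axioms_def)
  obtain D where D: "word.hyperbolic D"
    using hyperbolic_word_metric[OF gen_group_axioms assms(2)] by blast
  interpret hyp_group G S D by unfold_locales (rule D)
  obtain C where "\<forall>x\<in>carrier G. \<forall>y\<in>carrier G. \<exists>a\<in>carrier G.
      len a \<le> C \<and> len x + len y \<le> len (x \<otimes>\<^bsub>G\<^esub> a \<otimes>\<^bsub>G\<^esub> y) + C"
    using almost_additive_products[OF assms(3)] by blast
  then interpret ext_group G S D C by unfold_locales (use assms(3) in auto)
  interpret cg: combed_group G S L \<Gamma> v1 lab by unfold_locales (use assms in auto)
  obtain w where w: "w \<in> carrier G" "\<And>i j :: nat. w [^]\<^bsub>G\<^esub> i = w [^]\<^bsub>G\<^esub> j \<Longrightarrow> i = j"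
    using cg.infinite_order_element[OF infinite_carrier] by blast
  obtain K where "1 \<le> K" "1 < growth_rate G S"
    "\<And>n. growth_rate G S ^ n \<le> real (card (Sph n))" "\<And>n. real (card (Sph n)) \<le> K * growth_rate G S ^ n"
    using coornaert[OF w] by blast
  then interpret growth_group G S D C "growth_rate G S" K by unfold_locales auto
  interpret cgr: combed_growth G S D C "growth_rate G S" K L \<Gamma> v1 lab by unfold_locales (rule refl)
  obtain B where B: "\<And>a s. a \<in> carrier G \<Longrightarrow> s \<in> S \<Longrightarrow>
      \<bar>\<phi> (a \<otimes>\<^bsub>G\<^esub> s) - \<phi> a\<bar> \<le> B \<and> \<bar>\<phi> (s \<otimes>\<^bsub>G\<^esub> a) - \<phi> a\<bar> \<le> B"
    using assms(6) by (auto simp: bicombable_def)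
  interpret combed_bicombable G S D C "growth_rate G S" K L \<Gamma> v1 lab \<phi> d\<phi> "\<bar>B\<bar>"
  proof
    show "combs_function G \<Gamma> v1 lab L \<phi> d\<phi>" by fact
    show "\<bar>\<phi> (a \<otimes>\<^bsub>G\<^esub> s) - \<phi> a\<bar> \<le> \<bar>B\<bar> \<and> \<bar>\<phi> (s \<otimes>\<^bsub>G\<^esub> a) - \<phi> a\<bar> \<le> \<bar>B\<bar>"
      if "a \<in> carrier G" "s \<in> S" for a s using B[OF that] by linarith
  qed simp
  show ?thesis unfolding E_def by (rule central_limit)
qed

end
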